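(* There exists an absolute constant $C>0$ such that the following holds. Let $u_0\in H^1\cap L^\infty$ be a divergence-free vector field on $\mathbb{R}^3$, let $\varepsilon>0$, $0<R_1<R_2$, and let $u_\varepsilon$ be the (unique, global-in-time) strong solution of the regularised equations $$\partial_tu-\Delta u+((J_\varepsilon u)\cdot\nabla)u+\nabla p=0,\qquad\operatorname{div}u=0$$ on $[0,\infty)$ with initial condition $u_\varepsilon(0)=u_0$. Then for $t\ge0$ $$\int_{|x|>R_2}|u_\varepsilon(t)|^2\,dx\le\int_{|x|>R_1}|u_0|^2\,dx+\frac{C(u_0,t)}{R_2-R_1},$$ where $C(u_0,t):=C\|u_0\|^2\sqrt t+C\|u_0\|^3t^{1/4}$.
   Context: All function spaces are over $\mathbb{R}^3$; $\int=\int_{\mathbb{R}^3}$ unless a domain is indicated; $\|\cdot\|$ is the $L^2$ norm. A vector field $v$ is weakly divergence free if $\int v\cdot\nabla g=0$ for all $g\in C_0^\infty(\mathbb{R}^3)$. $J_\varepsilon v=\eta_\varepsilon\ast v$ is the standard mollification on $\mathbb{R}^3$: $\eta_\varepsilon(x)=\varepsilon^{-3}\eta(x/\varepsilon)$, $\eta(x)=c\exp((|x|^2-1)^{-1})$ for $|x|<1$ and $\eta(x)=0$ for $|x|\ge1$, with $c$ such that $\int\eta=1$. A function $u_\varepsilon$ is a strong solution of the regularised equations on $[0,T)$ (here $T=\infty$) if for some $p_\varepsilon\in L^1_{loc}(\mathbb{R}^3\times[0,T))$ $$\int u_\varepsilon(0)\cdot f(0)+\int_0^T\!\!\int\big(u_\varepsilon\cdot(f_t+\Delta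 f)+p_\varepsilon\operatorname{div}f\big)=-\int_0^T\!\!\int u_\varepsilon\cdot\big((J_\varepsilon u_\varepsilon)\cdot\nabla\big)f$$ for all $f\in C_0^\infty(\mathbb{R}^3\times[0,T);\mathbb{R}^3)$, $u_\varepsilon(t)$ is weakly divergence free for $t\in(0,T)$, and $u_\varepsilon\in C([0,T);L^2)\cap C((0,T);L^\infty)$ with $\|u_\varepsilon(t)\|_\infty$ bounded as $t\to0^+$. For every such $u_0$ and $\varepsilon$ a unique strong solution on $[0,\infty)$ exists. *)

theory Defs
  imports "HOL-Analysis.Analysis" "HOL-Probability.Essential_Supremum"
begin

type_synonym R3 = "real ^ 3"

section \<open>Smooth functions and test functions\<close>

fun Ck :: "nat \<Rightarrow> ('a::euclidean_space \<Rightarrow> 'b::real_normed_vector) \<Rightarrow> bool" where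
  "Ck 0 f \<longleftrightarrow> continuous_on UNIV f"
| "Ck (Suc k) f \<longleftrightarrow> (\<forall>x. f differentiable (at x)) \<and>
     (\<forall>b\<in>Basis. Ck k (\<lambda>x. frechet_derivative f (at x) b))"

definition test_function :: "('a::euclidean_space \<Rightarrow> 'b::real_normed_vector) \<Rightarrow> bool" where
  "test_function f \<longleftrightarrow> (\<forall>k. Ck k f) \<and> compact (closure {x. f x \<noteq> 0})"

text \<open>The elements of \<open>C\<^sub>0\<^sup>\<infinity>(\<real>\<^sup>3 \<times> [0,\<infinity>))\<close> are the restrictions to nonnegative times of the
  elements of \<open>C\<^sub>0\<^sup>\<infinity>(\<real>\<^sup>3 \<times> \<real>)\<close>; in particular they need not vanish at time 0. They are
  represented by such an extension, and only its values at nonnegative times are used below.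
  Time is the first argument.\<close>

definition spacetime_test_function :: "(real \<Rightarrow> R3 \<Rightarrow> 'b::real_normed_vector) \<Rightarrow> bool" where
  "spacetime_test_function f \<longleftrightarrow> test_function (\<lambda>(t, x). f t x)"

section \<open>Differential operators in the space variable\<close>

definition partial_deriv :: "3 \<Rightarrow> (R3 \<Rightarrow> 'b::real_normed_vector) \<Rightarrow> R3 \<Rightarrow> 'b" where
  "partial_deriv i f x = frechet_derivative f (at x) (axis i 1)"

definition grad :: "(R3 \<Rightarrow> real) \<Rightarrow> R3 \<Rightarrow> R3" where
  "grad g x = (\<chi> i. partial_deriv i g x)"

definition divergence :: "(R3 \<Rightarrow> R3) \<Rightarrow> R3 \<Rightarrow> real" where
  "divergence v x = (\<Sum>i\<in>UNIV. partial_deriv i v x $ i)"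

definition laplacian :: "(R3 \<Rightarrow> 'b::real_normed_vector) \<Rightarrow> R3 \<Rightarrow> 'b" where
  "laplacian f x = (\<Sum>i\<in>UNIV. partial_deriv i (partial_deriv i f) x)"

text \<open>\<open>(a \<cdot> \<nabla>) f\<close>\<close>

definition advect :: "(R3 \<Rightarrow> R3) \<Rightarrow> (R3 \<Rightarrow> R3) \<Rightarrow> R3 \<Rightarrow> R3" where
  "advect a f x = (\<Sum>i\<in>UNIV. (a x $ i) *\<^sub>R partial_deriv i f x)"

section \<open>Function spaces\<close>

text \<open>Elements of Lebesgue spaces are represented by Lebesgue measurable functions on all of
  \<open>\<real>\<^sup>3\<close>; nothing below depends on the choice of representatives.\<close>

definition in_L2 :: "(R3 \<Rightarrow> R3) \<Rightarrow> bool" where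
  "in_L2 v \<longleftrightarrow> v \<in> borel_measurable lebesgue \<and> integrable lebesgue (\<lambda>x. (norm (v x))\<^sup>2)"

definition L2_norm :: "(R3 \<Rightarrow> R3) \<Rightarrow> real" where
  "L2_norm v = sqrt (LINT x|lebesgue. (norm (v x))\<^sup>2)"

definition Linf_norm :: "(R3 \<Rightarrow> R3) \<Rightarrow> ereal" where
  "Linf_norm v = esssup lebesgue (\<lambda>x. ereal (norm (v x)))"

definition in_Linf :: "(R3 \<Rightarrow> R3) \<Rightarrow> bool" where
  "in_Linf v \<longleftrightarrow> v \<in> borel_measurable lebesgue \<and> Linf_norm v < \<infinity>"

definition weak_partial_deriv :: "3 \<Rightarrow> (R3 \<Rightarrow> R3) \<Rightarrow> (R3 \<Rightarrow> R3) \<Rightarrow> bool" where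
  "weak_partial_deriv i v w \<longleftrightarrow>
     (\<forall>g::R3 \<Rightarrow> real. test_function g \<longrightarrow>
        (LINT x|lebesgue. partial_deriv i g x *\<^sub>R v x) = - (LINT x|lebesgue. g x *\<^sub>R w x))"

definition in_H1 :: "(R3 \<Rightarrow> R3) \<Rightarrow> bool" where
  "in_H1 v \<longleftrightarrow> in_L2 v \<and> (\<forall>i. \<exists>w. in_L2 w \<and> weak_partial_deriv i v w)"

definition weakly_div_free :: "(R3 \<Rightarrow> R3) \<Rightarrow> bool" where
  "weakly_div_free v \<longleftrightarrow>
     (\<forall>g. test_function g \<longrightarrow> (LINT x|lebesgue. v x \<bullet> grad g x) = 0)"

text \<open>\<open>C([0,\<infinity>);L\<^sup>2)\<close>, \<open>C((0,\<infinity>);L\<^sup>\<infinity>)\<close> and \<open>L\<^sup>1\<^sub>l\<^sub>o\<^sub>c(\<real>\<^sup>3 \<times> [0,\<infinity>))\<close>\<close>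

definition continuous_L2 :: "(real \<Rightarrow> R3 \<Rightarrow> R3) \<Rightarrow> bool" where
  "continuous_L2 u \<longleftrightarrow>
     (\<forall>t\<ge>0. in_L2 (u t) \<and>
        ((\<lambda>s. L2_norm (\<lambda>x. u s x - u t x)) \<longlongrightarrow> 0) (at t within {0..}))"

definition continuous_Linf :: "(real \<Rightarrow> R3 \<Rightarrow> R3) \<Rightarrow> bool" where
  "continuous_Linf u \<longleftrightarrow>
     (\<forall>t>0. in_Linf (u t) \<and>
        ((\<lambda>s. Linf_norm (\<lambda>x. u s x - u t x)) \<longlongrightarrow> 0) (at t within {0<..}))"

definition in_L1_loc :: "(real \<Rightarrow> R3 \<Rightarrow> real) \<Rightarrow> bool" where
  "in_L1_loc p \<longleftrightarrow>
     (\<forall>K::(real \<times> R3) set. compact K \<and> K \<subseteq> {0..} \<times> UNIV \<longrightarrow>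
        set_integrable lebesgue K (\<lambda>(t, x). p t x))"

section \<open>Mollification\<close>

definition bump :: "R3 \<Rightarrow> real" where
  "bump x = (if norm x < 1 then exp (1 / ((norm x)\<^sup>2 - 1)) else 0)"

definition mollifier :: "R3 \<Rightarrow> real" where
  "mollifier x = bump x / (LINT y|lebesgue. bump y)"

definition mollifier_eps :: "real \<Rightarrow> R3 \<Rightarrow> real" where
  "mollifier_eps \<epsilon> x = mollifier (x /\<^sub>R \<epsilon>) / \<epsilon> ^ 3"

definition mollify :: "real \<Rightarrow> (R3 \<Rightarrow> R3) \<Rightarrow> R3 \<Rightarrow> R3" where
  "mollify \<epsilon> v x = (LINT y|lebesgue. mollifier_eps \<epsilon> (x - y) *\<^sub>R v y)"

section \<open>Strong solutions of the regularised equations\<close>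

text \<open>Space-time integrals are iterated integrals. The velocity is only a curve in \<open>L\<^sup>2\<close>, so its
  representatives at different times need not be jointly measurable, but the inner integrals
  involving it are continuous in time. The pressure is jointly measurable by \<open>in_L1_loc\<close>, so that
  Fubini's theorem applies to it.\<close>

definition weak_equation ::
  "real \<Rightarrow> (real \<Rightarrow> R3 \<Rightarrow> R3) \<Rightarrow> (real \<Rightarrow> R3 \<Rightarrow> real) \<Rightarrow> (real \<Rightarrow> R3 \<Rightarrow> R3) \<Rightarrow> bool" where
  "weak_equation \<epsilon> u p f \<longleftrightarrow>
     (LINT x|lebesgue. u 0 x \<bullet> f 0 x)
     + (LINT t:{0..}|lebesgue. LINT x|lebesgue.
          u t x \<bullet> (vector_derivative (\<lambda>s. f s x) (at t) + laplacian (f t) x)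
          + p t x * divergence (f t) x)
     = - (LINT t:{0..}|lebesgue. LINT x|lebesgue.
          u t x \<bullet> advect (mollify \<epsilon> (u t)) (f t) x)"

definition strong_solution :: "real \<Rightarrow> (real \<Rightarrow> R3 \<Rightarrow> R3) \<Rightarrow> bool" where
  "strong_solution \<epsilon> u \<longleftrightarrow>
     (\<exists>p. in_L1_loc p \<and> (\<forall>f. spacetime_test_function f \<longrightarrow> weak_equation \<epsilon> u p f)) \<and>
     (\<forall>t>0. weakly_div_free (u t)) \<and>
     continuous_L2 u \<and>
     continuous_Linf u \<and>
     (\<exists>M::real. \<forall>\<^sub>F t in at_right 0. Linf_norm (u t) \<le> ereal M)"

end

theory Submission
  imports Defs "HOL-Real_Asymp.Real_Asymp"
begin

text \<open>The pressure is eliminated: testing with \<open>\<theta>(t) g(x)\<close>, where \<open>g\<close> is divergence free, gives a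
  pressure-free weak formulation. For an arbitrary test field \<open>Y\<close>, subtracting the gradient of
  \<open>K * div Y\<close>, with \<open>K\<close> a difference of two regularised Newtonian kernels, leaves a divergence-free
  field up to errors that vanish with the two scales. As \<open>\<parallel>D\<^sup>2 \<psi>\<parallel> = \<parallel>\<Delta> \<psi>\<parallel>\<close>, the defect of the
  weak formulation for \<open>Y\<close> on \<open>[s,t]\<close> is at most \<open>2 \<integral> \<parallel> |J u| |u| \<parallel> \<parallel>div Y\<parallel>\<close>.

  Inserting \<open>Y = \<eta>\<^sub>\<delta> * (\<phi> (\<eta>\<^sub>\<delta> * u))\<close> with a cutoff \<open>\<phi>\<close> of slope at most \<open>L\<close> bounds the growth of
  \<open>\<integral> \<phi> |\<eta>\<^sub>\<delta> * u|\<^sup>2\<close> by terms carrying a factor \<open>L\<close> and commutators that vanish with \<open>\<delta>\<close>. Cutoffs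
  with \<open>L\<close> tending to 0 give the energy inequality. Cutoffs with \<open>L\<close> of order
  \<open>1/(R2 - R1)\<close> that vanish for \<open>|x| \<le> R1\<close> and are 1 from \<open>R2\<close> up to a radius tending to infinity
  give the exterior estimate: by Ladyzhenskaya's inequality and the energy
  inequality, the time integrals of \<open>\<parallel>u\<parallel> \<parallel>\<nabla>u\<parallel>\<close> and of \<open>\<parallel>u\<parallel> \<parallel> |J u| |u| \<parallel>\<close> are of order
  \<open>\<parallel>u\<^sub>0\<parallel>\<^sup>2 t\<^sup>1\<^sup>/\<^sup>2\<close> and \<open>\<parallel>u\<^sub>0\<parallel>\<^sup>3 t\<^sup>1\<^sup>/\<^sup>4\<close>.\<close>

section \<open>Smooth functions and compact support\<close>

text \<open>The pressure is merely locally integrable, so no formula for it in terms of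
  \<open>u\<close> is at hand; estimating the defect replaces such a formula together with the
  singular integrals behind it. Test fields need compact support, and this is why two Newtonian
  kernels are subtracted: each has a tail, but the tails agree. The solution is only a continuous
  curve in L2, so there is no time derivative to multiply by \<open>u\<close>. The mollifier occurs
  twice in the test field in order that the quadratic form \<open>ip w (tfield w)\<close> be
  symmetric; symmetry turns an energy increment into two increments against frozen test fields, to
  which the weak formulation applies. The power \<open>t powr (1/4)\<close> arises from Young
  inequalities whose weight is \<open>p = t powr (1/4)\<close>. The constant 80 is 20 times the 4 in
  the cutoff slope \<open>4 / (R2 - R1)\<close>.\<close>

lemma frechet_derivative_eqI:
  "(f has_derivative f') (at x) \<Longrightarrow> frechet_derivative f (at x) = f'"
  by (rule frechet_derivative_at[symmetric])

lemma Ck_SucD: "Ck (Suc k) f \<Longrightarrow> Ck k f"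
proof (induction k arbitrary: f)
  case 0
  then show ?case
    by (simp add: continuous_at_imp_continuous_on differentiable_imp_continuous_within)
next
  case (Suc k)
  then show ?case
    unfolding Ck.simps(2)[of "Suc k"] Ck.simps(2)[of k] by blast
qed

lemma Ck_le: "Ck k f \<Longrightarrow> j \<le> k \<Longrightarrow> Ck j f"
  by (induction k) (use Ck_SucD le_Suc_eq in blast)+

lemma Ck_continuous: "Ck k f \<Longrightarrow> continuous_on UNIV f"
  using Ck_le[of k f 0] by simp

lemma Ck_Suc_has_derivative:
  "Ck (Suc k) f \<Longrightarrow> (f has_derivative frechet_derivative f (at x)) (at x)"
  using frechet_derivative_works by auto

lemma Ck_const: "Ck k (\<lambda>x. c)"
  by (induction k arbitrary: c) auto

lemma Ck_bounded_linear:
  assumes "bounded_linear h" "Ck k f"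
  shows "Ck k (\<lambda>x. h (f x))"
  using assms(2)
proof (induction k arbitrary: f)
  case 0
  then show ?case
    using bounded_linear.continuous_on[OF assms(1)] by simp
next
  case (Suc k)
  have D: "((\<lambda>x. h (f x)) has_derivative (\<lambda>v. h (frechet_derivative f (at x) v))) (at x)" for x
    by (rule bounded_linear.has_derivative[OF assms(1) Ck_Suc_has_derivative[OF Suc.prems]])
  show ?case
    using Suc D frechet_derivative_eqI[OF D] by (auto simp: differentiable_def)
qed

lemma Ck_add:
  assumes "Ck k f" "Ck k g"
  shows "Ck k (\<lambda>x. f x + g x)"
  using assms
proof (induction k arbitrary: f g)
  case 0
  then show ?case by (simp add: continuous_on_add)
next
  case (Suc k)
  have D: "((\<lambda>x. f x + g x) has_derivative
      (\<lambda>v. frechet_derivative f (at x) v + frechet_derivative g (at x) v)) (at x)" for x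
    by (intro has_derivative_add Ck_Suc_has_derivative[OF Suc.prems(1)] Ck_Suc_has_derivative[OF Suc.prems(2)])
  show ?case
    using Suc D frechet_derivative_eqI[OF D] by (auto simp: differentiable_def)
qed

text \<open>Both terms of the Leibniz rule are again of the form \<open>bop\<close>, with one factor
  differentiated and the other one downgraded by \<open>Ck_SucD\<close>, so the induction hypothesis
  covers each. An arbitrary bilinear map serves products, scalings and inner products at
  once.\<close>

lemma Ck_bilinear:
  assumes "bounded_bilinear bop" "Ck k f" "Ck k g"
  shows "Ck k (\<lambda>x. bop (f x) (g x))"
  using assms(2,3)
proof (induction k arbitrary: f g)
  case 0
  then show ?case
    using bounded_bilinear.continuous_on[OF assms(1)] by simp
next
  case (Suc k)
  have D: "((\<lambda>x. bop (f x) (g x)) has_derivative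
      (\<lambda>v. bop (f x) (frechet_derivative g (at x) v) + bop (frechet_derivative f (at x) v) (g x))) (at x)" for x
    by (rule bounded_bilinear.FDERIV[OF assms(1) Ck_Suc_has_derivative[OF Suc.prems(1)]
          Ck_Suc_has_derivative[OF Suc.prems(2)]])
  have "Ck k f" "Ck k g"
    using Suc.prems Ck_SucD by blast+
  with Suc D frechet_derivative_eqI[OF D] show ?case
    by (auto simp: differentiable_def intro!: Ck_add)
qed

lemma Ck_sum: "finite I \<Longrightarrow> (\<And>i. i \<in> I \<Longrightarrow> Ck k (f i)) \<Longrightarrow> Ck k (\<lambda>x. \<Sum>i\<in>I. f i x)"
  by (induction I rule: finite_induct) (auto intro!: Ck_add Ck_const)

text \<open>\<open>Ck\<close> differentiates along basis vectors only, while the chain rule asks for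
  the derivative along \<open>l b\<close>; the induction closes because \<open>l b\<close> is a
  basis vector or zero. The projections of space-time onto time and space have this
  property.\<close>

lemma Ck_compose_linear:
  assumes "bounded_linear l" "\<And>b. b \<in> Basis \<Longrightarrow> l b \<in> Basis \<union> {0}" "Ck k f"
  shows "Ck k (\<lambda>x. f (l x))"
  using assms(3)
proof (induction k arbitrary: f)
  case 0
  then show ?case
    using bounded_linear.continuous_on[OF assms(1) continuous_on_id]
    by (auto intro: continuous_on_compose2)
next
  case (Suc k)
  have D: "((\<lambda>x. f (l x)) has_derivative (\<lambda>v. frechet_derivative f (at (l x)) (l v))) (at x)" for x
    by (rule has_derivative_compose[OF bounded_linear_imp_has_derivative[OF assms(1)]
          Ck_Suc_has_derivative[OF Suc.prems]])
  have "Ck k (\<lambda>x. frechet_derivative f (at (l x)) (l b))" if "b \<in> Basis" for b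
  proof (cases "l b = 0")
    case True
    have "frechet_derivative f (at (l x)) 0 = 0" for x
      using Suc.prems by (intro linear_0 linear_frechet_derivative) auto
    then show ?thesis using True Ck_const by simp
  next
    case False
    then show ?thesis
      using Suc assms(2)[OF that] by auto
  qed
  then show ?case
    using D frechet_derivative_eqI[OF D] by (auto simp: differentiable_def)
qed

section \<open>Smoothness and bounded support as separate predicates\<close>

definition smooth :: "('a::euclidean_space \<Rightarrow> 'b::real_normed_vector) \<Rightarrow> bool" where
  "smooth f \<longleftrightarrow> (\<forall>k. Ck k f)"

text \<open>Bounded support in place of a compact closure: the same condition by Heine-Borel, see
  \<open>test_function_iff\<close>, but with a radius at hand for estimates.\<close>

definition cpt_supp :: "('a::real_normed_vector \<Rightarrow> 'b::zero) \<Rightarrow> bool" where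
  "cpt_supp f \<longleftrightarrow> (\<exists>r. \<forall>x. f x \<noteq> 0 \<longrightarrow> norm x \<le> r)"

lemma test_function_iff: "test_function f \<longleftrightarrow> smooth f \<and> cpt_supp f"
proof -
  have "compact (closure {x. f x \<noteq> 0}) \<longleftrightarrow> cpt_supp f"
    unfolding cpt_supp_def compact_closure bounded_iff by auto
  then show ?thesis
    unfolding test_function_def smooth_def by simp
qed

lemma smooth_const: "smooth (\<lambda>x. c)"
  by (simp add: smooth_def Ck_const)

lemma smooth_add: "smooth f \<Longrightarrow> smooth g \<Longrightarrow> smooth (\<lambda>x. f x + g x)"
  by (simp add: smooth_def Ck_add)

lemma smooth_sum: "finite I \<Longrightarrow> (\<And>i. i \<in> I \<Longrightarrow> smooth (f i)) \<Longrightarrow> smooth (\<lambda>x. \<Sum>i\<in>I. f i x)"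
  by (simp add: smooth_def Ck_sum)

lemma smooth_bounded_linear: "bounded_linear h \<Longrightarrow> smooth f \<Longrightarrow> smooth (\<lambda>x. h (f x))"
  by (simp add: smooth_def Ck_bounded_linear)

lemma smooth_bilinear: "bounded_bilinear bop \<Longrightarrow> smooth f \<Longrightarrow> smooth g \<Longrightarrow> smooth (\<lambda>x. bop (f x) (g x))"
  by (simp add: smooth_def Ck_bilinear)

lemma smooth_scaleR: "smooth f \<Longrightarrow> smooth g \<Longrightarrow> smooth (\<lambda>x. f x *\<^sub>R g x)"
  by (rule smooth_bilinear[OF bounded_bilinear_scaleR])

lemma smooth_diff: "smooth f \<Longrightarrow> smooth g \<Longrightarrow> smooth (\<lambda>x. f x - g x)"
  using smooth_add[OF _ smooth_bounded_linear[OF bounded_linear_minus[OF bounded_linear_ident]], of f g] by simp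

lemma smooth_continuous: "smooth f \<Longrightarrow> continuous_on S f"
  by (metis smooth_def Ck_continuous continuous_on_subset subset_UNIV)

lemma smooth_has_derivative: "smooth f \<Longrightarrow> (f has_derivative frechet_derivative f (at x)) (at x)"
  by (meson smooth_def Ck_Suc_has_derivative)

lemma smooth_frechet:
  assumes "smooth f" "b \<in> Basis"
  shows "smooth (\<lambda>x. frechet_derivative f (at x) b)"
proof -
  have "Ck (Suc k) f" for k
    using assms(1) by (simp only: smooth_def)
  then show ?thesis
    using assms(2) by (simp add: smooth_def)
qed

lemma smooth_partial: "smooth f \<Longrightarrow> smooth (partial_deriv i f)"
  unfolding partial_deriv_def[abs_def] by (rule smooth_frechet) (auto simp: axis_in_Basis_iff)

lemma cpt_supp_mono: "cpt_supp f \<Longrightarrow> (\<And>x. f x = 0 \<Longrightarrow> g x = 0) \<Longrightarrow> cpt_supp g"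
  unfolding cpt_supp_def by metis

lemma cpt_supp_add: "cpt_supp f \<Longrightarrow> cpt_supp g \<Longrightarrow> cpt_supp (\<lambda>x. f x + g x :: 'b::monoid_add)"
  unfolding cpt_supp_def
proof (elim exE)
  fix r s assume "\<forall>x. f x \<noteq> 0 \<longrightarrow> norm x \<le> r" "\<forall>x. g x \<noteq> 0 \<longrightarrow> norm x \<le> s"
  then have "f x + g x \<noteq> 0 \<longrightarrow> norm x \<le> max r s" for x
    by (metis add.right_neutral max.coboundedI1 max.coboundedI2)
  then show "\<exists>r. \<forall>x. f x + g x \<noteq> 0 \<longrightarrow> norm x \<le> r" by blast
qed

lemma cpt_supp_zero: "cpt_supp (\<lambda>x. 0)"
  by (simp add: cpt_supp_def)

lemma cpt_supp_sum:
  fixes f :: "'i \<Rightarrow> 'a::real_normed_vector \<Rightarrow> 'b::comm_monoid_add"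
  shows "finite I \<Longrightarrow> (\<And>i. i \<in> I \<Longrightarrow> cpt_supp (f i)) \<Longrightarrow> cpt_supp (\<lambda>x. \<Sum>i\<in>I. f i x)"
  by (induction I rule: finite_induct) (auto intro!: cpt_supp_add cpt_supp_zero)

text \<open>Beyond radius \<open>r\<close> the function vanishes on an open set, so its derivative
  vanishes there too; the radius does not grow.\<close>

lemma cpt_supp_frechet:
  fixes f :: "'a::euclidean_space \<Rightarrow> 'b::real_normed_vector"
  assumes "cpt_supp f"
  shows "cpt_supp (\<lambda>x. frechet_derivative f (at x) b)"
proof -
  obtain r where r: "\<And>x. f x \<noteq> 0 \<Longrightarrow> norm x \<le> r"
    using assms by (auto simp: cpt_supp_def)
  have "frechet_derivative f (at x) b = 0" if "norm x > r" for x
  proof -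
    have "open {x. norm x > r}"
      by (intro open_Collect_less continuous_intros)
    then have "(f has_derivative (\<lambda>_. 0)) (at x)"
      using r that
      by (intro has_derivative_transform_within_open[OF has_derivative_const[of 0]]) force+
    then show ?thesis by (simp add: frechet_derivative_eqI)
  qed
  then show ?thesis
    unfolding cpt_supp_def by (metis not_less)
qed

lemma cpt_supp_partial: "cpt_supp f \<Longrightarrow> cpt_supp (partial_deriv i f)"
  unfolding partial_deriv_def[abs_def] by (rule cpt_supp_frechet)

lemma test_partial: "test_function f \<Longrightarrow> test_function (partial_deriv i f)"
  by (simp add: test_function_iff smooth_partial cpt_supp_partial)

lemma test_add: "test_function f \<Longrightarrow> test_function g \<Longrightarrow> test_function (\<lambda>x. f x + g x)"
  by (simp add: test_function_iff smooth_add cpt_supp_add)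

lemma test_bounded_linear: "bounded_linear h \<Longrightarrow> test_function f \<Longrightarrow> test_function (\<lambda>x. h (f x))"
  by (auto simp: test_function_iff smooth_bounded_linear linear_simps elim: cpt_supp_mono)

lemma test_diff: "test_function f \<Longrightarrow> test_function g \<Longrightarrow> test_function (\<lambda>x. f x - g x)"
  using test_add[OF _ test_bounded_linear[OF bounded_linear_minus[OF bounded_linear_ident]], of f g] by simp

lemma test_sum: "finite I \<Longrightarrow> (\<And>i. i \<in> I \<Longrightarrow> test_function (f i)) \<Longrightarrow> test_function (\<lambda>x. \<Sum>i\<in>I. f i x)"
  by (auto simp: test_function_iff smooth_sum cpt_supp_sum)

lemma test_bilinear_left:
  assumes "bounded_bilinear bop" "test_function f" "smooth g"
  shows "test_function (\<lambda>x. bop (f x) (g x))"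
  using assms by (auto simp: test_function_iff smooth_bilinear bounded_bilinear.zero_left elim: cpt_supp_mono)

lemma test_bilinear_right:
  assumes "bounded_bilinear bop" "smooth f" "test_function g"
  shows "test_function (\<lambda>x. bop (f x) (g x))"
  using assms by (auto simp: test_function_iff smooth_bilinear bounded_bilinear.zero_right elim: cpt_supp_mono)

text \<open>Compactness of the ball of radius \<open>r+1\<close> gives uniform continuity there. Of
  two points at distance below 1, either one lies in the ball of radius \<open>r\<close>, and then
  both are in the larger ball, or both values are zero.\<close>

lemma cpt_supp_uniformly_continuous:
  fixes f :: "'a::euclidean_space \<Rightarrow> 'b::real_normed_vector"
  assumes "continuous_on UNIV f" "cpt_supp f"
  shows "uniformly_continuous_on UNIV f"
proof -
  obtain r where r: "\<And>x. f x \<noteq> 0 \<Longrightarrow> norm x \<le> r"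
    using assms by (auto simp: cpt_supp_def)
  have uc: "uniformly_continuous_on (cball 0 (r+1)) f"
    by (intro compact_uniformly_continuous continuous_on_subset[OF assms(1)]) auto
  show ?thesis
    unfolding uniformly_continuous_on_def
  proof (intro allI impI)
    fix e :: real assume "e > 0"
    then obtain d where d: "d > 0" "\<And>x x'. x \<in> cball 0 (r+1) \<Longrightarrow> x' \<in> cball 0 (r+1) \<Longrightarrow> dist x' x < d \<Longrightarrow> dist (f x') (f x) < e"
      using uc unfolding uniformly_continuous_on_def by metis
    have "dist (f x') (f x) < e" if "dist x' x < min d 1" for x x'
    proof (cases "norm x \<le> r \<or> norm x' \<le> r")
      case True
      moreover have "norm x \<le> norm x' + dist x' x" "norm x' \<le> norm x + dist x' x"
        by (simp_all add: dist_norm) norm+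
      ultimately show ?thesis
        using that by (intro d) auto
    next
      case False
      then have "f x = 0" "f x' = 0" using r by force+
      then show ?thesis using \<open>e > 0\<close> by simp
    qed
    then show "\<exists>d>0. \<forall>x\<in>UNIV. \<forall>x'\<in>UNIV. dist x' x < d \<longrightarrow> dist (f x') (f x) < e"
      using d(1) by (intro exI[of _ "min d 1"]) auto
  qed
qed

lemma cpt_supp_bounded:
  fixes f :: "'a::euclidean_space \<Rightarrow> 'b::real_normed_vector"
  assumes "continuous_on UNIV f" "cpt_supp f"
  obtains B where "B \<ge> 0" "\<And>x. norm (f x) \<le> B"
proof -
  obtain r where r: "\<And>x. f x \<noteq> 0 \<Longrightarrow> norm x \<le> r"
    using assms by (auto simp: cpt_supp_def)
  have "compact (f ` cball 0 r)"
    by (intro compact_continuous_image continuous_on_subset[OF assms(1)]) auto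
  then obtain B where "\<forall>y\<in>f ` cball 0 r. norm y \<le> B"
    using compact_imp_bounded bounded_iff by metis
  then have "norm (f x) \<le> max B 0" for x
    using r[of x] by (cases "f x = 0") (auto simp: le_max_iff_disj)
  then show ?thesis using that[of "max B 0"] by auto
qed

section \<open>Convolution\<close>

lemma lborel_distr_reflect: "distr lborel borel (\<lambda>y. x - y) = (lborel :: 'a::euclidean_space measure)"
  by (subst lborel_affine[of "-1" x]) (auto simp: density_1 one_ennreal_def[symmetric])

lemma integrable_reflect:
  fixes x :: "'a::euclidean_space" and f :: "'a \<Rightarrow> 'b::euclidean_space"
  assumes [measurable]: "f \<in> borel_measurable borel"
  shows "integrable lborel (\<lambda>y. f (x - y)) \<longleftrightarrow> integrable lborel f"
  by (subst (2) lborel_distr_reflect[symmetric, of x]) (simp add: integrable_distr_eq)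

lemma integral_reflect:
  fixes x :: "'a::euclidean_space" and f :: "'a \<Rightarrow> 'b::euclidean_space"
  assumes [measurable]: "f \<in> borel_measurable borel"
  shows "(\<integral>y. f (x - y) \<partial>lborel) = (\<integral>y. f y \<partial>lborel)"
  by (subst (2) lborel_distr_reflect[symmetric, of x]) (simp add: integral_distr)

text \<open>What a convolution with a bounded kernel of compact support requires; the class contains
  continuous functions as well as square integrable ones.\<close>

definition loc_int :: "('a::euclidean_space \<Rightarrow> 'b::euclidean_space) \<Rightarrow> bool" where
  "loc_int w \<longleftrightarrow> w \<in> borel_measurable borel \<and> (\<forall>r. integrable lborel (\<lambda>x. indicat_real (cball 0 r) x *\<^sub>R w x))"

lemma loc_int_measurable: "loc_int w \<Longrightarrow> w \<in> borel_measurable borel"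
  by (simp add: loc_int_def)

lemma loc_int_continuous:
  assumes "continuous_on UNIV w"
  shows "loc_int w"
  unfolding loc_int_def
proof (intro conjI allI)
  show [measurable]: "w \<in> borel_measurable borel"
    by (rule borel_measurable_continuous_onI[OF assms])
  show "integrable lborel (\<lambda>x. indicat_real (cball 0 r) x *\<^sub>R w x)" for r
    by (intro borel_integrable_compact continuous_on_subset[OF assms]) auto
qed

text \<open>Convolution along an arbitrary pairing. The pairing may be a scaling, a product, or one
  of these with its arguments exchanged, so that exchanging the two factors stays within the notion
  (\<open>gcv_commute\<close>).\<close>

definition gcv :: "('b \<Rightarrow> 'c \<Rightarrow> 'd) \<Rightarrow> ('a::euclidean_space \<Rightarrow> 'b) \<Rightarrow> ('a \<Rightarrow> 'c) \<Rightarrow> 'a \<Rightarrow> 'd::euclidean_space" where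
  "gcv bop F w x = (\<integral>y. bop (F (x - y)) (w y) \<partial>lborel)"

lemma bounded_bilinear_measurable:
  fixes f :: "'a \<Rightarrow> 'b::euclidean_space" and g :: "'a \<Rightarrow> 'c::euclidean_space" and bop :: "'b \<Rightarrow> 'c \<Rightarrow> 'd::euclidean_space"
  assumes "bounded_bilinear bop" "f \<in> borel_measurable M" "g \<in> borel_measurable M"
  shows "(\<lambda>x. bop (f x) (g x)) \<in> borel_measurable M"
  using assms(2,3)
  by (rule borel_measurable_continuous_Pair) (intro bounded_bilinear.continuous_on[OF assms(1)] continuous_intros)

text \<open>The one estimate behind the analytic properties of \<open>gcv\<close>: integrability
  takes \<open>H\<close> to be a translate of the kernel, continuity a difference of two translates,
  and differentiability a first-order Taylor remainder.\<close>

lemma gcv_bound: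
  fixes H :: "'a::euclidean_space \<Rightarrow> 'b::euclidean_space" and w :: "'a \<Rightarrow> 'c::euclidean_space"
    and bop :: "'b \<Rightarrow> 'c \<Rightarrow> 'd::euclidean_space"
  assumes bop: "bounded_bilinear bop" and K: "K \<ge> 0" "\<And>a b. norm (bop a b) \<le> norm a * norm b * K"
    and w: "loc_int w" and H: "H \<in> borel_measurable borel"
    and B: "\<And>y. norm (H y) \<le> B" and supp: "\<And>y. norm y > r \<Longrightarrow> H y = 0"
  shows "integrable lborel (\<lambda>y. bop (H y) (w y))"
    and "norm (\<integral>y. bop (H y) (w y) \<partial>lborel) \<le> K * B * (\<integral>y. norm (indicat_real (cball 0 r) y *\<^sub>R w y) \<partial>lborel)"
proof -
  have B0: "B \<ge> 0"
    using B[of 0] norm_ge_zero order_trans by blast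
  have iw: "integrable lborel (\<lambda>y. indicat_real (cball 0 r) y *\<^sub>R w y)"
    using w by (simp add: loc_int_def)
  have le: "norm (bop (H y) (w y)) \<le> K * B * norm (indicat_real (cball 0 r) y *\<^sub>R w y)" for y
  proof (cases "norm y > r")
    case True
    then show ?thesis
      using supp bounded_bilinear.zero_left[OF bop] by simp
  next
    case False
    have "norm (bop (H y) (w y)) \<le> norm (H y) * norm (w y) * K" by (rule K)
    also have "\<dots> \<le> B * norm (w y) * K"
      by (intro mult_right_mono B K) auto
    finally show ?thesis using False by (simp add: ac_simps)
  qed
  have m: "(\<lambda>y. bop (H y) (w y)) \<in> borel_measurable lborel"
    using bounded_bilinear_measurable[OF bop H loc_int_measurable[OF w]] by simp
  show i: "integrable lborel (\<lambda>y. bop (H y) (w y))"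
    by (rule Bochner_Integration.integrable_bound[OF integrable_mult_right[OF integrable_norm[OF iw], of "K * B"] m])
       (intro AE_I2, rule order_trans[OF le], simp only: real_norm_def abs_ge_self)
  show "norm (\<integral>y. bop (H y) (w y) \<partial>lborel) \<le> K * B * (\<integral>y. norm (indicat_real (cball 0 r) y *\<^sub>R w y) \<partial>lborel)"
    unfolding integral_mult_right_zero[symmetric]
    by (rule Bochner_Integration.integral_norm_bound_integral[OF i integrable_mult_right[OF integrable_norm[OF iw], of "K * B"]])
       (use le in auto)
qed

lemma borel_measurable_compose_diff:
  "f \<in> borel_measurable borel \<Longrightarrow> (\<lambda>y. f (x - y :: 'a::euclidean_space)) \<in> borel_measurable borel"
  by (rule measurable_compose[of "\<lambda>y. x - y" borel borel f borel])
     (auto intro!: borel_measurable_continuous_onI continuous_intros)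

lemma gcv_integrable:
  fixes F :: "'a::euclidean_space \<Rightarrow> 'b::euclidean_space" and w :: "'a \<Rightarrow> 'c::euclidean_space"
    and bop :: "'b \<Rightarrow> 'c \<Rightarrow> 'd::euclidean_space"
  assumes "bounded_bilinear bop" "continuous_on UNIV F" "cpt_supp F" "loc_int w"
  shows "integrable lborel (\<lambda>y. bop (F (x - y)) (w y))"
proof -
  obtain K where K: "K \<ge> 0" "\<And>a b. norm (bop a b) \<le> norm a * norm b * K"
    using bounded_bilinear.nonneg_bounded[OF assms(1)] by blast
  obtain B where B: "\<And>x. norm (F x) \<le> B"
    using cpt_supp_bounded[OF assms(2,3)] by blast
  obtain r where r: "\<And>x. F x \<noteq> 0 \<Longrightarrow> norm x \<le> r"
    using assms(3) by (auto simp: cpt_supp_def)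
  have supp: "F (x - y) = 0" if "norm y > norm x + r" for y
  proof (rule ccontr)
    assume "F (x - y) \<noteq> 0"
    from r[OF this] that show False using norm_triangle_ineq2[of y x] by (simp add: norm_minus_commute)
  qed
  show ?thesis
    by (rule gcv_bound(1)[OF assms(1) K assms(4) _ B supp])
       (intro borel_measurable_compose_diff borel_measurable_continuous_onI assms)
qed

lemma continuous_gcv:
  fixes F :: "'a::euclidean_space \<Rightarrow> 'b::euclidean_space" and w :: "'a \<Rightarrow> 'c::euclidean_space"
    and bop :: "'b \<Rightarrow> 'c \<Rightarrow> 'd::euclidean_space"
  assumes bop: "bounded_bilinear bop" and F: "continuous_on UNIV F" "cpt_supp F" and w: "loc_int w"
  shows "continuous_on UNIV (gcv bop F w)"
proof -
  obtain K where K: "K \<ge> 0" "\<And>a b. norm (bop a b) \<le> norm a * norm b * K"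
    using bounded_bilinear.nonneg_bounded[OF bop] by blast
  obtain r where r: "\<And>x. F x \<noteq> 0 \<Longrightarrow> norm x \<le> r"
    using F by (auto simp: cpt_supp_def)
  have uc: "uniformly_continuous_on UNIV F"
    by (rule cpt_supp_uniformly_continuous[OF F])
  show ?thesis
    unfolding continuous_on_iff
  proof (intro ballI allI impI)
    fix x :: 'a and e :: real assume "e > 0"
    \<comment> \<open>For \<open>x'\<close> within distance 1 of \<open>x\<close>, both translates
      of \<open>F\<close> are supported in the ball of radius \<open>norm x + 1 + r\<close>, so a
      single integral of \<open>norm (w y)\<close> serves all nearby points.\<close>
    define C where "C = K * (\<integral>y. norm (indicat_real (cball 0 (norm x + 1 + r)) y *\<^sub>R w y) \<partial>lborel)"
    have C0: "C \<ge> 0" using K by (simp add: C_def)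
    define e' where "e' = e / (2 * (C + 1))"
    have e': "e' > 0" "e' * C < e"
      using \<open>e > 0\<close> C0 by (auto simp: e'_def field_simps add_strict_increasing2)
    obtain d where d: "d > 0" "\<And>x x'. dist x' x < d \<Longrightarrow> dist (F x') (F x) < e'"
      using uc e'(1) unfolding uniformly_continuous_on_def by (metis UNIV_I)
    have "dist (gcv bop F w x') (gcv bop F w x) < e" if x': "dist x' x < min d 1" for x'
    proof -
      have nx: "norm x' \<le> norm x + 1"
        using x' norm_triangle_ineq2[of x' x] by (simp add: dist_norm)
      have supp: "F (x' - y) - F (x - y) = 0" if "norm y > norm x + 1 + r" for y
      proof -
        have "norm y - norm x' \<le> norm (x' - y)" "norm y - norm x \<le> norm (x - y)"
          by (metis norm_minus_commute norm_triangle_ineq2)+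
        then have "\<not> norm (x' - y) \<le> r" "\<not> norm (x - y) \<le> r" using nx that by linarith+
        then have "F (x' - y) = 0" "F (x - y) = 0" using r by blast+
        then show ?thesis by simp
      qed
      have "gcv bop F w x' - gcv bop F w x = (\<integral>y. bop (F (x' - y) - F (x - y)) (w y) \<partial>lborel)"
        unfolding gcv_def bounded_bilinear.diff_left[OF bop]
        by (rule Bochner_Integration.integral_diff[symmetric]) (intro gcv_integrable[OF bop F w])+
      also have "norm \<dots> \<le> K * e' * (\<integral>y. norm (indicat_real (cball 0 (norm x + 1 + r)) y *\<^sub>R w y) \<partial>lborel)"
        using d(2)[of "x' - _" "x - _"] x'
        by (intro gcv_bound(2)[OF bop K w _ _ supp])
           (auto intro!: borel_measurable_diff borel_measurable_compose_diff[OF borel_measurable_continuous_onI[OF F(1)]] less_imp_le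
             simp: dist_norm)
      also have "\<dots> = e' * C" by (simp add: C_def)
      finally show ?thesis using e'(2) by (simp add: dist_norm)
    qed
    then show "\<exists>d>0. \<forall>x'\<in>UNIV. dist x' x < d \<longrightarrow> dist (gcv bop F w x') (gcv bop F w x) < e"
      using d(1) by (intro exI[of _ "min d 1"]) auto
  qed
qed

lemma frechet_derivative_expand:
  fixes F :: "'a::euclidean_space \<Rightarrow> 'b::real_normed_vector"
  assumes "F differentiable (at z)"
  shows "frechet_derivative F (at z) h = (\<Sum>b\<in>Basis. (h \<bullet> b) *\<^sub>R frechet_derivative F (at z) b)"
proof -
  interpret linear "frechet_derivative F (at z)"
    by (rule linear_frechet_derivative[OF assms])
  have "frechet_derivative F (at z) h = frechet_derivative F (at z) (\<Sum>b\<in>Basis. (h \<bullet> b) *\<^sub>R b)"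
    by (simp add: euclidean_representation)
  then show ?thesis by (simp add: sum scale)
qed

text \<open>Uniform continuity of the partial derivatives makes the derivative nearly constant along
  the segment from \<open>x\<close> to \<open>x + h\<close>, with a step width independent of
  \<open>x\<close>; the mean value inequality then bounds the Taylor remainder. The uniformity is
  what permits differentiation under a convolution integral.\<close>

lemma cpt_supp_uniform_derivative:
  fixes F :: "'a::euclidean_space \<Rightarrow> 'b::real_normed_vector"
  assumes F: "Ck (Suc 0) F" "cpt_supp F" and e: "e > 0"
  obtains d where "d > 0"
    "\<And>x h. norm h < d \<Longrightarrow> norm (F (x + h) - F x - frechet_derivative F (at x) h) \<le> e * norm h"
proof -
  \<comment> \<open>The difference of two derivatives is expanded over the basis, and each of the
    \<open>DIM('a)\<close> terms contributes at most \<open>e' * norm v\<close>.\<close>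
  define e' where "e' = e / real DIM('a)"
  have e': "e' > 0" using e by (simp add: e'_def)
  have "\<exists>d>0. \<forall>x x'. dist x' x < d \<longrightarrow> dist (frechet_derivative F (at x') b) (frechet_derivative F (at x) b) < e'"
    if "b \<in> Basis" for b
    using cpt_supp_uniformly_continuous[OF _ cpt_supp_frechet[OF F(2)], of b] F(1) that e'
    unfolding uniformly_continuous_on_def by auto
  then obtain d where d: "\<And>b. b \<in> Basis \<Longrightarrow> d b > 0"
     "\<And>b x x'. b \<in> Basis \<Longrightarrow> dist x' x < d b \<Longrightarrow> dist (frechet_derivative F (at x') b) (frechet_derivative F (at x) b) < e'"
    by metis
  define d0 where "d0 = Min (d ` Basis)"
  have d0: "d0 > 0" "\<And>b. b \<in> Basis \<Longrightarrow> d0 \<le> d b"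
    using d(1) by (auto simp: d0_def)
  have diff: "F differentiable (at z)" for z using F(1) by simp
  have "norm (F (x + h) - F x - frechet_derivative F (at x) h) \<le> e * norm h" if h: "norm h < d0" for x h
  proof -
    have on: "onorm (\<lambda>v. frechet_derivative F (at (x + t *\<^sub>R h)) v - frechet_derivative F (at x) v) \<le> e"
      if t: "t \<in> {0..1}" for t
    proof (rule onorm_le)
      fix v
      have lt: "dist (x + t *\<^sub>R h) x < d b" if "b \<in> Basis" for b
      proof -
        have "dist (x + t *\<^sub>R h) x \<le> norm h" using t mult_left_le_one_le[of "norm h" t] by (simp add: dist_norm)
        then show ?thesis using h d0(2)[OF that] by linarith
      qed
      have "norm (frechet_derivative F (at (x + t *\<^sub>R h)) v - frechet_derivative F (at x) v)
         = norm (\<Sum>b\<in>Basis. (v \<bullet> b) *\<^sub>R (frechet_derivative F (at (x + t *\<^sub>R h)) b - frechet_derivative F (at x) b))"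
        by (simp add: frechet_derivative_expand[OF diff, of _ v] sum_subtractf scaleR_diff_right)
      also have "\<dots> \<le> (\<Sum>b\<in>(Basis::'a set). norm v * e')"
        by (intro sum_norm_le) (auto simp: Basis_le_norm dist_norm intro!: mult_mono less_imp_le[OF d(2)[OF _ lt, unfolded dist_norm]])
      also have "\<dots> = e * norm v" by (simp add: e'_def)
      finally show "norm (frechet_derivative F (at (x + t *\<^sub>R h)) v - frechet_derivative F (at x) v) \<le> e * norm v" .
    qed
    have x0: "x \<in> (\<lambda>t. x + t *\<^sub>R h) ` {0..1}"
      by (rule image_eqI[of _ _ 0]) auto
    have "norm (F (x + h) - F x - frechet_derivative F (at x) (x + h - x)) \<le> norm (x + h - x) * e"
      by (rule differentiable_bound_linearization[where S="(\<lambda>t. x + t *\<^sub>R h) ` {0..1}"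
            and f'="\<lambda>x. frechet_derivative F (at x)"])
         (use on x0 in \<open>auto simp: fun_diff_def intro!: has_derivative_at_withinI[OF Ck_Suc_has_derivative[OF F(1)]]\<close>)
    then show ?thesis by (simp add: mult.commute)
  qed
  with d0(1) that show ?thesis by blast
qed

text \<open>All derivatives go to \<open>F\<close>, so local integrability of \<open>w\<close> is
  enough: the Taylor remainder of \<open>F\<close> is at most \<open>e' * norm (y - x)\<close>
  everywhere and is supported in one ball for all \<open>y\<close> near \<open>x\<close>, which is
  the situation of \<open>gcv_bound\<close>.\<close>

lemma gcv_has_derivative:
  fixes F :: "'a::euclidean_space \<Rightarrow> 'b::euclidean_space" and w :: "'a \<Rightarrow> 'c::euclidean_space"
    and bop :: "'b \<Rightarrow> 'c \<Rightarrow> 'd::euclidean_space"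
  assumes bop: "bounded_bilinear bop" and F: "Ck (Suc 0) F" "cpt_supp F" and w: "loc_int w"
  shows "(gcv bop F w has_derivative (\<lambda>h. gcv bop (\<lambda>z. frechet_derivative F (at z) h) w x)) (at x)"
proof -
  obtain K where K: "K \<ge> 0" "\<And>a b. norm (bop a b) \<le> norm a * norm b * K"
    using bounded_bilinear.nonneg_bounded[OF bop] by blast
  obtain r where r: "\<And>x. F x \<noteq> 0 \<Longrightarrow> norm x \<le> r"
    using F by (auto simp: cpt_supp_def)
  define DF where "DF h z = frechet_derivative F (at z) h" for h z
  have diff: "F differentiable (at z)" for z using F(1) by simp
  have linDF: "linear (\<lambda>h. DF h z)" for z
    unfolding DF_def using linear_frechet_derivative[OF diff] by simp
  have contDF: "continuous_on UNIV (DF h)" for h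
    unfolding DF_def[abs_def] frechet_derivative_expand[OF diff, of _ h]
    using F(1) by (intro continuous_intros) auto
  have csDF: "cpt_supp (DF h)" for h
    unfolding DF_def[abs_def] by (rule cpt_supp_frechet[OF F(2)])
  have contF: "continuous_on UNIV F" using F(1) Ck_continuous by blast
  obtain s where s: "\<And>z h. DF h z \<noteq> 0 \<Longrightarrow> norm z \<le> s"
  proof -
    have "DF h z = 0" if "norm z > r" for h z
    proof -
      have "open {x::'a. norm x > r}" by (intro open_Collect_less continuous_intros)
      then have "(F has_derivative (\<lambda>_. 0)) (at z)"
        using r that
        by (intro has_derivative_transform_within_open[OF has_derivative_const[of 0]]) force+
      then show ?thesis by (simp add: frechet_derivative_eqI DF_def)
    qed
    then show ?thesis using that[of r] by (metis not_less)
  qed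
  show ?thesis
    unfolding has_derivative_at_alt DF_def[symmetric]
  proof (intro conjI allI impI)
    have "linear (\<lambda>h. gcv bop (DF h) w x)"
    proof (rule linearI)
      show "gcv bop (DF (a + b)) w x = gcv bop (DF a) w x + gcv bop (DF b) w x" for a b
        unfolding gcv_def linear_add[OF linDF] bounded_bilinear.add_left[OF bop]
        by (intro Bochner_Integration.integral_add gcv_integrable[OF bop contDF csDF w])
      show "gcv bop (DF (c *\<^sub>R a)) w x = c *\<^sub>R gcv bop (DF a) w x" for a c
        unfolding gcv_def linear_scale[OF linDF] bounded_bilinear.scaleR_left[OF bop]
        by simp
    qed
    then show "bounded_linear (\<lambda>h. gcv bop (DF h) w x)"
      by (rule linear_conv_bounded_linear[THEN iffD1])
  next
    fix e :: real assume "e > 0"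
    define \<rho> where "\<rho> = norm x + 1 + max r s"
    define C where "C = K * (\<integral>y. norm (indicat_real (cball 0 \<rho>) y *\<^sub>R w y) \<partial>lborel)"
    have C0: "C \<ge> 0" using K by (simp add: C_def)
    define e' where "e' = e / (C + 1)"
    have e': "e' > 0" "e' * C \<le> e"
      using \<open>e > 0\<close> C0 by (auto simp: e'_def field_simps)
    obtain d where d: "d > 0"
      "\<And>x h. norm h < d \<Longrightarrow> norm (F (x + h) - F x - frechet_derivative F (at x) h) \<le> e' * norm h"
      using cpt_supp_uniform_derivative[OF F e'(1)] by blast
    have "norm (gcv bop F w y - gcv bop F w x - gcv bop (DF (y - x)) w x) \<le> e * norm (y - x)"
      if y: "norm (y - x) < min d 1" for y
    proof -
      have nx: "norm y \<le> norm x + 1"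
        using y norm_triangle_ineq2[of y x] by (simp)
      have supp: "F (y - t) - F (x - t) - DF (y - x) (x - t) = 0" if "norm t > \<rho>" for t
      proof -
        have "norm t - norm y \<le> norm (y - t)" "norm t - norm x \<le> norm (x - t)"
          by (metis norm_minus_commute norm_triangle_ineq2)+
        then have "\<not> norm (y - t) \<le> r" "\<not> norm (x - t) \<le> r" "\<not> norm (x - t) \<le> s" using nx that unfolding \<rho>_def by linarith+
        then have "F (y - t) = 0" "F (x - t) = 0" "DF (y - x) (x - t) = 0" using r s by blast+
        then show ?thesis by simp
      qed
      have "gcv bop F w y - gcv bop F w x - gcv bop (DF (y - x)) w x
          = (\<integral>t. bop (F (y - t) - F (x - t) - DF (y - x) (x - t)) (w t) \<partial>lborel)"
        unfolding gcv_def bounded_bilinear.diff_left[OF bop]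
        by (subst Bochner_Integration.integral_diff | intro Bochner_Integration.integrable_diff gcv_integrable[OF bop contF F(2) w] gcv_integrable[OF bop contDF csDF w] refl)+
      also have "norm \<dots> \<le> K * (e' * norm (y - x)) * (\<integral>y. norm (indicat_real (cball 0 \<rho>) y *\<^sub>R w y) \<partial>lborel)"
      proof (rule gcv_bound(2)[OF bop K w _ _ supp])
        show "(\<lambda>t. F (y - t) - F (x - t) - DF (y - x) (x - t)) \<in> borel_measurable borel"
          by (intro borel_measurable_diff borel_measurable_compose_diff borel_measurable_continuous_onI contF contDF)
        show "norm (F (y - t) - F (x - t) - DF (y - x) (x - t)) \<le> e' * norm (y - x)" for t
          using d(2)[of "y - x" "x - t"] y by (simp add: DF_def algebra_simps)
      qed
      also have "\<dots> = (e' * C) * norm (y - x)" by (simp add: C_def)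
      also have "\<dots> \<le> e * norm (y - x)" by (intro mult_right_mono e') auto
      finally show ?thesis .
    qed
    then show "\<exists>d>0. \<forall>y. norm (y - x) < d \<longrightarrow> norm (gcv bop F w y - gcv bop F w x - gcv bop (DF (y - x)) w x) \<le> e * norm (y - x)"
      using d(1) by (intro exI[of _ "min d 1"]) auto
  qed
qed

lemma frechet_derivative_gcv:
  fixes F :: "'a::euclidean_space \<Rightarrow> 'b::euclidean_space" and w :: "'a \<Rightarrow> 'c::euclidean_space"
    and bop :: "'b \<Rightarrow> 'c \<Rightarrow> 'd::euclidean_space"
  assumes "bounded_bilinear bop" "Ck (Suc 0) F" "cpt_supp F" "loc_int w"
  shows "frechet_derivative (gcv bop F w) (at x) h = gcv bop (\<lambda>z. frechet_derivative F (at z) h) w x"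
  using frechet_derivative_eqI[OF gcv_has_derivative[OF assms]] by simp

lemma Ck_gcv:
  fixes F :: "'a::euclidean_space \<Rightarrow> 'b::euclidean_space" and w :: "'a \<Rightarrow> 'c::euclidean_space"
    and bop :: "'b \<Rightarrow> 'c \<Rightarrow> 'd::euclidean_space"
  assumes bop: "bounded_bilinear bop" and F: "Ck k F" "cpt_supp F" and w: "loc_int w"
  shows "Ck k (gcv bop F w)"
  using F
proof (induction k arbitrary: F)
  case 0
  then show ?case using continuous_gcv[OF bop _ _ w] by simp
next
  case (Suc k)
  have C1: "Ck (Suc 0) F" by (rule Ck_le[OF Suc.prems(1)]) simp
  show ?case
    unfolding Ck.simps(2) frechet_derivative_gcv[OF bop C1 Suc.prems(2) w]
    using gcv_has_derivative[OF bop C1 Suc.prems(2) w] Suc.IH Suc.prems cpt_supp_frechet[OF Suc.prems(2)]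
    by (auto simp: differentiable_def)
qed

lemma smooth_gcv:
  fixes F :: "'a::euclidean_space \<Rightarrow> 'b::euclidean_space" and w :: "'a \<Rightarrow> 'c::euclidean_space"
    and bop :: "'b \<Rightarrow> 'c \<Rightarrow> 'd::euclidean_space"
  shows "bounded_bilinear bop \<Longrightarrow> test_function F \<Longrightarrow> loc_int w \<Longrightarrow> smooth (gcv bop F w)"
  by (simp add: smooth_def test_function_iff Ck_gcv)

lemma cpt_supp_gcv:
  fixes F :: "'a::euclidean_space \<Rightarrow> 'b::euclidean_space" and w :: "'a \<Rightarrow> 'c::euclidean_space"
    and bop :: "'b \<Rightarrow> 'c \<Rightarrow> 'd::euclidean_space"
  assumes bop: "bounded_bilinear bop" and "cpt_supp F" "cpt_supp w"
  shows "cpt_supp (gcv bop F w)"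
proof -
  obtain r s where r: "\<And>x. F x \<noteq> 0 \<Longrightarrow> norm x \<le> r" and s: "\<And>x. w x \<noteq> 0 \<Longrightarrow> norm x \<le> s"
    using assms by (auto simp: cpt_supp_def)
  have "gcv bop F w x = 0" if "norm x > r + s" for x
  proof -
    have "bop (F (x - y)) (w y) = 0" for y
    proof (cases "w y = 0")
      case False
      then have "norm y \<le> s" by (rule s)
      then have "\<not> norm (x - y) \<le> r"
        using that norm_triangle_ineq2[of x y] by linarith
      then have "F (x - y) = 0" using r by blast
      then show ?thesis using bounded_bilinear.zero_left[OF bop] by simp
    qed (simp add: bounded_bilinear.zero_right[OF bop])
    then show ?thesis by (simp add: gcv_def)
  qed
  then show ?thesis
    unfolding cpt_supp_def by (metis not_less)
qed

lemma test_gcv: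
  fixes F :: "'a::euclidean_space \<Rightarrow> 'b::euclidean_space" and w :: "'a \<Rightarrow> 'c::euclidean_space"
    and bop :: "'b \<Rightarrow> 'c \<Rightarrow> 'd::euclidean_space"
  shows "bounded_bilinear bop \<Longrightarrow> test_function F \<Longrightarrow> loc_int w \<Longrightarrow> cpt_supp w \<Longrightarrow> test_function (gcv bop F w)"
  using smooth_gcv cpt_supp_gcv by (metis test_function_iff)

lemma gcv_commute:
  fixes F :: "'a::euclidean_space \<Rightarrow> 'b::euclidean_space" and w :: "'a \<Rightarrow> 'c::euclidean_space"
    and bop :: "'b \<Rightarrow> 'c \<Rightarrow> 'd::euclidean_space"
  assumes bop: "bounded_bilinear bop" and [measurable]: "F \<in> borel_measurable borel" "w \<in> borel_measurable borel"
  shows "gcv bop F w x = gcv (\<lambda>a b. bop b a) w F x"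
proof -
  have "(\<lambda>y. bop (F y) (w (x - y))) \<in> borel_measurable borel"
    by (rule bounded_bilinear_measurable[OF bop]) measurable
  from integral_reflect[OF this, of x] show ?thesis
    by (simp add: gcv_def)
qed

text \<open>Convolving \<open>F\<close> with the constant 1 gives a constant function. Its
  derivative is zero, but it is also the convolution of the derivative of \<open>F\<close> with 1,
  that is, the integral in question. This avoids iterated integration along lines.\<close>

lemma integral_frechet_derivative_eq_0:
  fixes F :: "'a::euclidean_space \<Rightarrow> 'b::euclidean_space"
  assumes F: "Ck (Suc 0) F" "cpt_supp F" and b: "b \<in> Basis"
  shows "(\<integral>x. frechet_derivative F (at x) b \<partial>lborel) = 0"
proof -
  have contF: "continuous_on UNIV F" using F(1) Ck_continuous by blast
  have m: "F \<in> borel_measurable borel" by (rule borel_measurable_continuous_onI[OF contF])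
  have l1: "loc_int (\<lambda>_. 1::real)" by (intro loc_int_continuous continuous_intros)
  have bb: "bounded_bilinear (\<lambda>(v::'b) (k::real). k *\<^sub>R v)"
    by (rule bounded_bilinear.flip[OF bounded_bilinear_scaleR])
  have "gcv (\<lambda>v k. k *\<^sub>R v) F (\<lambda>_. 1::real) = (\<lambda>x. \<integral>y. F y \<partial>lborel)"
    by (simp add: gcv_def integral_reflect[OF m] fun_eq_iff)
  then have "frechet_derivative (gcv (\<lambda>v k. k *\<^sub>R v) F (\<lambda>_. 1::real)) (at 0) b = 0"
    by simp
  then have "(\<integral>y. frechet_derivative F (at (0 - y)) b \<partial>lborel) = 0"
    unfolding frechet_derivative_gcv[OF bb F l1] by (simp add: gcv_def)
  moreover have "(\<integral>y. frechet_derivative F (at (0 - y)) b \<partial>lborel) = (\<integral>x. frechet_derivative F (at x) b \<partial>lborel)"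
    using F(1) b by (intro integral_reflect borel_measurable_continuous_onI) auto
  ultimately show ?thesis by simp
qed

section \<open>Bump functions and integration by parts\<close>

text \<open>The power in the denominator makes the family closed under differentiation
  (\<open>DERIV_flat_exp\<close>), so smoothness follows by induction on the order, for all
  \<open>n\<close> at once.\<close>

definition flat_exp :: "nat \<Rightarrow> real \<Rightarrow> real" where
  "flat_exp n t = (if t > 0 then exp (- (1 / t)) / t ^ n else 0)"

lemma flat_exp_tendsto_0: "(flat_exp n \<longlongrightarrow> 0) (at 0)"
proof (rule filterlim_split_at)
  show "(flat_exp n \<longlongrightarrow> 0) (at_left 0)"
    by (rule Lim_transform_eventually[OF tendsto_const])
       (auto simp: eventually_at_filter flat_exp_def)
  have "((\<lambda>s::real. s ^ n / exp s) \<longlongrightarrow> 0) at_top"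
    by (rule tendsto_power_div_exp_0)
  then have "((\<lambda>t::real. (inverse t) ^ n / exp (inverse t)) \<longlongrightarrow> 0) (at_right 0)"
    by (rule filterlim_compose) (rule filterlim_inverse_at_top_right)
  then show "(flat_exp n \<longlongrightarrow> 0) (at_right 0)"
    by (rule Lim_transform_eventually)
       (auto simp: eventually_at_filter flat_exp_def exp_minus field_simps)
qed

lemma DERIV_flat_exp:
  "(flat_exp n has_real_derivative (flat_exp (n + 2) t - real n * flat_exp (n + 1) t)) (at t)"
proof (cases "t = 0")
  case True
  \<comment> \<open>At the origin the difference quotient of \<open>flat_exp n\<close> is
    \<open>flat_exp (Suc n)\<close>.\<close>
  have "((\<lambda>h. flat_exp (Suc n) h) \<longlongrightarrow> 0) (at 0)"
    by (rule flat_exp_tendsto_0)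
  then have "((\<lambda>h. (flat_exp n (0 + h) - flat_exp n 0) / h) \<longlongrightarrow> 0) (at 0)"
    by (rule Lim_transform_eventually) (auto simp: flat_exp_def)
  then show ?thesis
    unfolding True DERIV_def by (simp add: flat_exp_def)
next
  case False
  show ?thesis
  proof (cases "t > 0")
    case True
    have "((\<lambda>t. exp (- (1 / t)) / t ^ n) has_real_derivative
        (flat_exp (n + 2) t - real n * flat_exp (n + 1) t)) (at t)"
      using True
      by (auto intro!: derivative_eq_intros simp: flat_exp_def field_simps power2_eq_square)
         (cases n; simp add: field_simps)
    then show ?thesis
      by (rule has_field_derivative_transform_within_open[where S="{0<..}"])
         (use True in \<open>auto simp: flat_exp_def\<close>)
  next
    case F: False
    have "((\<lambda>_. 0) has_real_derivative 0) (at t)" by simp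
    then have "(flat_exp n has_real_derivative 0) (at t)"
      by (rule has_field_derivative_transform_within_open[where S="{..<0}"])
         (use F \<open>t \<noteq> 0\<close> in \<open>auto simp: flat_exp_def\<close>)
    then show ?thesis using F by (simp add: flat_exp_def)
  qed
qed

lemma compose_real_has_derivative:
  assumes "(f has_real_derivative f') (at (q x))" "(q has_derivative q') (at x)"
  shows "((\<lambda>x. f (q x)) has_derivative (\<lambda>v. f' * q' v)) (at x)"
  using has_derivative_compose[OF assms(2), of f "(*) f'"] assms(1)
  by (simp add: has_field_derivative_def)

text \<open>Regularity is climbed one order at a time, from the derivative of \<open>f\<close> to
  \<open>f\<close>. This suits the self-reproducing family \<open>flat_exp\<close> and also
  \<open>newt\<close>, which has just two continuous derivatives.\<close>

lemma Ck_Suc_compose_real: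
  assumes f: "\<And>t. (f has_real_derivative f' t) (at t)" and "Ck k (\<lambda>x. f' (q x))" "smooth q"
  shows "Ck (Suc k) (\<lambda>x. f (q x))"
    and "frechet_derivative (\<lambda>x. f (q x)) (at x) b = f' (q x) * frechet_derivative q (at x) b"
proof -
  have D: "((\<lambda>x. f (q x)) has_derivative (\<lambda>v. f' (q x) * frechet_derivative q (at x) v)) (at x)" for x
    by (rule compose_real_has_derivative[OF f smooth_has_derivative[OF assms(3)]])
  then show "frechet_derivative (\<lambda>x. f (q x)) (at x) b = f' (q x) * frechet_derivative q (at x) b"
    using frechet_derivative_eqI[OF D] by simp
  have "Ck k (\<lambda>x. frechet_derivative q (at x) b)" if "b \<in> Basis" for b
    using smooth_frechet[OF assms(3) that] by (simp add: smooth_def)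
  then show "Ck (Suc k) (\<lambda>x. f (q x))"
    using D frechet_derivative_eqI[OF D] assms(2)
    by (auto simp: differentiable_def intro!: Ck_bilinear[OF bounded_bilinear_mult])
qed

lemma smooth_flat_exp:
  assumes "smooth q"
  shows "smooth (\<lambda>x. flat_exp n (q x))"
proof -
  have "Ck k (\<lambda>x. flat_exp n (q x))" for k
  proof (induction k arbitrary: n)
    case 0
    have "continuous_on UNIV (flat_exp n)"
      using DERIV_flat_exp by (meson DERIV_isCont continuous_at_imp_continuous_on)
    then show ?case
      using smooth_continuous[OF assms] by (auto intro: continuous_on_compose2)
  next
    case (Suc k)
    have "Ck k (\<lambda>x. flat_exp (n + 2) (q x) + (- real n) *\<^sub>R flat_exp (n + 1) (q x))"
      by (intro Ck_add Ck_bounded_linear[OF bounded_linear_scaleR_right] Suc)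
    then show ?case
      by (intro Ck_Suc_compose_real(1)[OF DERIV_flat_exp] assms) simp
  qed
  then show ?thesis by (simp add: smooth_def)
qed

lemma smooth_ident: "smooth (\<lambda>x. x)"
proof -
  have "Ck k (\<lambda>x::'a. x)" for k
    by (cases k) (auto intro!: Ck_const simp: frechet_derivative_ident)
  then show ?thesis by (simp add: smooth_def)
qed

lemma smooth_quadratic: "smooth (\<lambda>x::'a::euclidean_space. a - c * (x \<bullet> x))"
  by (intro smooth_diff smooth_const smooth_bilinear[OF bounded_bilinear_mult]
      smooth_bilinear[OF bounded_bilinear_inner] smooth_ident)

text \<open>For \<open>r = 1\<close> this is \<open>bump\<close>; other radii provide smooth
  functions that are positive exactly on a prescribed ball.\<close>

definition ball_bump :: "real \<Rightarrow> 'a::euclidean_space \<Rightarrow> real" where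
  "ball_bump r x = flat_exp 0 (r\<^sup>2 - x \<bullet> x)"

lemma ball_bump_pos_iff: "r > 0 \<Longrightarrow> ball_bump r x > 0 \<longleftrightarrow> norm x < r"
  using power_strict_mono[of "norm x" r 2] power_less_imp_less_base[of "norm x" 2 r]
  by (auto simp: ball_bump_def flat_exp_def dot_square_norm)

lemma ball_bump_nonneg: "ball_bump r x \<ge> 0"
  by (auto simp: ball_bump_def flat_exp_def)

lemma test_ball_bump: "r > 0 \<Longrightarrow> test_function (ball_bump r :: 'a::euclidean_space \<Rightarrow> real)"
proof -
  assume r: "r > 0"
  have "ball_bump r x \<noteq> 0 \<longrightarrow> norm x \<le> r" for x :: 'a
    using ball_bump_pos_iff[OF r, of x] ball_bump_nonneg[of r x] by (auto simp: less_eq_real_def)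
  then show ?thesis
    unfolding test_function_iff cpt_supp_def
    using smooth_flat_exp[OF smooth_quadratic[of "r\<^sup>2" 1], of 0] by (auto simp: ball_bump_def[abs_def])
qed

lemma integrable_cpt_supp:
  fixes f :: "'a::euclidean_space \<Rightarrow> 'b::euclidean_space"
  assumes "continuous_on UNIV f" "cpt_supp f"
  shows "integrable lborel f"
  using gcv_integrable[OF bounded_bilinear.flip[OF bounded_bilinear_scaleR] assms loc_int_continuous, of "\<lambda>_. 1" 0]
    integrable_reflect[OF borel_measurable_continuous_onI[OF assms(1)], of 0]
  by (simp add: continuous_on_const)

text \<open>A vanishing integral would make \<open>f\<close> zero almost everywhere, hence on a
  closed set of full measure, hence at \<open>a\<close>.\<close>

lemma integral_pos_continuous:
  fixes f :: "'a::euclidean_space \<Rightarrow> real"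
  assumes "continuous_on UNIV f" "\<And>x. f x \<ge> 0" "integrable lborel f" "f a > 0"
  shows "(\<integral>x. f x \<partial>lborel) > 0"
proof (rule ccontr)
  assume "\<not> ?thesis"
  then have "(\<integral>x. f x \<partial>lborel) = 0"
    using Bochner_Integration.integral_nonneg[of lborel f, OF assms(2)] by linarith
  then have "AE x in lborel. f x = 0"
    using integral_nonneg_eq_0_iff_AE[OF assms(3) AE_I2[OF assms(2)]] by blast
  then have "AE x in lebesgue. x \<in> {x. f x = 0}"
    by (intro AE_completion) simp
  then have "a \<in> {x. f x = 0}"
    by (rule mem_closed_if_AE_lebesgue[rotated]) (rule closed_Collect_eq[OF assms(1) continuous_on_const])
  then show False using assms(4) by simp
qed

text \<open>The fundamental lemma of the calculus of variations in convolution form. If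
  \<open>G x\<close> were nonzero, \<open>G x * G (x - y)\<close> would be positive for small
  \<open>y\<close>, and a bump supported there would have a positive integral against it.\<close>

lemma continuous_eq_0_if_gcv:
  fixes G :: "'a::euclidean_space \<Rightarrow> real"
  assumes G: "continuous_on UNIV G" and 0: "\<And>\<psi>. test_function \<psi> \<Longrightarrow> gcv times G \<psi> x = 0"
  shows "G x = 0"
proof (rule ccontr)
  assume nz: "G x \<noteq> 0"
  have cont: "continuous_on UNIV (\<lambda>y. G x * G (x - y))"
    by (intro continuous_intros continuous_on_compose2[OF G]) auto
  moreover have "G x * G (x - 0) > 0"
    using nz by (auto simp: zero_less_mult_iff linorder_neq_iff)
  ultimately have "\<forall>\<^sub>F y in at 0. G x * G (x - y) > 0"
    using cont[unfolded continuous_on_def, rule_format, OF UNIV_I, of 0] by (intro order_tendstoD(1))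
  then obtain r where r: "r > 0" "\<And>y. y \<noteq> 0 \<Longrightarrow> norm y < r \<Longrightarrow> G x * G (x - y) > 0"
    unfolding eventually_at by (auto simp: dist_norm)
  then have r': "norm y < r \<Longrightarrow> G x * G (x - y) \<ge> 0" for y
    using \<open>G x * G (x - 0) > 0\<close> by (cases "y = 0") (auto intro: less_imp_le)
  define f where "f y = G x * G (x - y) * ball_bump r y" for y
  have tb: "test_function (ball_bump r :: 'a \<Rightarrow> real)" by (rule test_ball_bump[OF r(1)])
  have contf: "continuous_on UNIV f"
    unfolding f_def[abs_def] using tb
    by (intro continuous_intros continuous_on_compose2[OF G] smooth_continuous) (auto simp: test_function_iff)
  have "integrable lborel f"
    by (rule integrable_cpt_supp[OF contf])
       (use tb in \<open>auto simp: test_function_iff f_def elim!: cpt_supp_mono\<close>)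
  moreover have "f y \<ge> 0" for y
    using r'[of y] ball_bump_pos_iff[OF r(1), of y] ball_bump_nonneg[of r y]
    by (cases "norm y < r") (auto simp: f_def)
  moreover have "f 0 > 0"
    using \<open>G x * G (x - 0) > 0\<close> ball_bump_pos_iff[OF r(1), of "0::'a"] r(1) by (simp add: f_def)
  ultimately have "(\<integral>y. f y \<partial>lborel) > 0"
    by (intro integral_pos_continuous[OF contf])
  moreover have "(\<integral>y. f y \<partial>lborel) = G x * gcv times G (ball_bump r) x"
    by (simp add: f_def gcv_def mult.assoc)
  ultimately show False using 0[OF tb] by simp
qed

lemma smooth_measurable: "smooth f \<Longrightarrow> f \<in> borel_measurable borel"
  by (intro borel_measurable_continuous_onI smooth_continuous)

lemma test_loc_int: "test_function f \<Longrightarrow> loc_int f"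
  by (intro loc_int_continuous smooth_continuous) (simp add: test_function_iff)

lemma test_measurable: "test_function f \<Longrightarrow> f \<in> borel_measurable borel"
  by (simp add: test_function_iff smooth_measurable)

lemma test_integrable:
  fixes f :: "'a::euclidean_space \<Rightarrow> 'b::euclidean_space"
  shows "test_function f \<Longrightarrow> integrable lborel f"
  by (rule integrable_cpt_supp[OF smooth_continuous]) (auto simp: test_function_iff)

section \<open>Partial derivatives of convolutions, their symmetry, and integration by parts\<close>

lemma partial_gcv:
  fixes F :: "R3 \<Rightarrow> 'b::euclidean_space" and w :: "R3 \<Rightarrow> 'c::euclidean_space"
    and bop :: "'b \<Rightarrow> 'c \<Rightarrow> 'd::euclidean_space"
  assumes "bounded_bilinear bop" "Ck (Suc 0) F" "cpt_supp F" "loc_int w"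
  shows "partial_deriv i (gcv bop F w) = gcv bop (partial_deriv i F) w"
  by (simp add: fun_eq_iff partial_deriv_def[abs_def] frechet_derivative_gcv[OF assms])

lemma test_Ck: "test_function f \<Longrightarrow> Ck k f"
  by (simp add: test_function_def)

lemma test_cpt_supp: "test_function f \<Longrightarrow> cpt_supp f"
  by (simp add: test_function_iff)

lemma test_smooth: "test_function f \<Longrightarrow> smooth f"
  by (simp add: test_function_iff)

text \<open>Commuting the factors lets the derivative fall on the regular one, on whichever side it
  stands.\<close>

lemma partial_gcv_right:
  fixes F :: "R3 \<Rightarrow> 'b::euclidean_space" and w :: "R3 \<Rightarrow> 'c::euclidean_space"
    and bop :: "'b \<Rightarrow> 'c \<Rightarrow> 'd::euclidean_space"
  assumes bop: "bounded_bilinear bop" and F: "loc_int F" and w: "Ck (Suc 0) w" "cpt_supp w"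
  shows "partial_deriv i (gcv bop F w) = gcv bop F (partial_deriv i w)"
proof -
  have mw: "w \<in> borel_measurable borel" "partial_deriv i w \<in> borel_measurable borel"
    using w(1) Ck_continuous[OF w(1)] unfolding partial_deriv_def[abs_def]
    by (auto intro!: borel_measurable_continuous_onI simp: axis_in_Basis_iff)
  have "gcv bop F w = gcv (\<lambda>a b. bop b a) w F"
    by (intro ext gcv_commute bop loc_int_measurable[OF F] mw)
  then have "partial_deriv i (gcv bop F w) = gcv (\<lambda>a b. bop b a) (partial_deriv i w) F"
    by (simp add: partial_gcv[OF bounded_bilinear.flip[OF bop] w F])
  also have "\<dots> = gcv bop F (partial_deriv i w)"
    by (intro ext gcv_commute[symmetric] bop loc_int_measurable[OF F] mw)
  finally show ?thesis .
qed

text \<open>In a convolution of \<open>F\<close> with \<open>\<psi>\<close> one of the two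
  derivatives can be put on each factor, and this arrangement does not remember in which order they
  were taken. Hence both mixed derivatives of \<open>F\<close> have equal convolutions with every
  test function, and \<open>continuous_eq_0_if_gcv\<close> applies to their difference.\<close>

lemma partial_commute:
  fixes F :: "R3 \<Rightarrow> real"
  assumes F: "test_function F"
  shows "partial_deriv i (partial_deriv j F) = partial_deriv j (partial_deriv i F)"
proof
  fix x
  note bm = bounded_bilinear_mult[where 'a=real]
  define G where "G z = partial_deriv i (partial_deriv j F) z - partial_deriv j (partial_deriv i F) z" for z
  have tF: "test_function (partial_deriv i F)" for i by (rule test_partial[OF F])
  have "gcv times G \<psi> x = 0" if \<psi>: "test_function \<psi>" for \<psi>
  proof -
    have L: "gcv times (partial_deriv i (partial_deriv j F)) \<psi> = partial_deriv i (partial_deriv j (gcv times F \<psi>))" for i j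
      using partial_gcv[OF bm test_Ck test_cpt_supp test_loc_int, OF F F \<psi>, of j]
        partial_gcv[OF bm test_Ck test_cpt_supp test_loc_int, OF tF tF \<psi>, of i j] by simp
    have R: "partial_deriv i (partial_deriv j (gcv times F \<psi>)) = gcv times (partial_deriv j F) (partial_deriv i \<psi>)" for i j
      using partial_gcv[OF bm test_Ck test_cpt_supp test_loc_int, OF F F \<psi>, of j]
        partial_gcv_right[OF bm test_loc_int test_Ck test_cpt_supp, OF tF \<psi> \<psi>, of i j] by simp
    have R': "partial_deriv j (partial_deriv i (gcv times F \<psi>)) = gcv times (partial_deriv j F) (partial_deriv i \<psi>)" for i j
      using partial_gcv_right[OF bm test_loc_int test_Ck test_cpt_supp, OF F \<psi> \<psi>, of i]
        partial_gcv[OF bm test_Ck test_cpt_supp test_loc_int, OF F F test_partial[OF \<psi>], of j i] by simp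
    have eq: "gcv times (partial_deriv i (partial_deriv j F)) \<psi> = gcv times (partial_deriv j (partial_deriv i F)) \<psi>"
      by (rule trans[OF L trans[OF R trans[OF R'[symmetric] L[symmetric]]]])
    have "gcv times G \<psi> x = gcv times (partial_deriv i (partial_deriv j F)) \<psi> x - gcv times (partial_deriv j (partial_deriv i F)) \<psi> x"
      unfolding gcv_def G_def left_diff_distrib
      by (intro Bochner_Integration.integral_diff gcv_integrable[OF bm] test_loc_int[OF \<psi>]
          smooth_continuous test_smooth test_cpt_supp test_partial F)
    then show ?thesis using eq by simp
  qed
  moreover have "continuous_on UNIV G"
    unfolding G_def[abs_def] by (intro continuous_intros smooth_continuous test_smooth test_partial F)
  ultimately have "G x = 0" by (rule continuous_eq_0_if_gcv[rotated])
  then show "partial_deriv i (partial_deriv j F) x = partial_deriv j (partial_deriv i F) x"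
    by (simp add: G_def)
qed

lemma partial_eqI: "(f has_derivative f') (at x) \<Longrightarrow> partial_deriv i f x = f' (axis i 1)"
  by (simp add: partial_deriv_def frechet_derivative_eqI)

lemma partial_bilinear:
  assumes bop: "bounded_bilinear bop" and "smooth f" "smooth g"
  shows "partial_deriv i (\<lambda>x. bop (f x) (g x)) x = bop (f x) (partial_deriv i g x) + bop (partial_deriv i f x) (g x)"
  using partial_eqI[OF bounded_bilinear.FDERIV[OF bop smooth_has_derivative[OF assms(2)] smooth_has_derivative[OF assms(3)]], of i]
  by (simp add: partial_deriv_def)

lemma partial_linear:
  assumes "bounded_linear h" and "smooth f"
  shows "partial_deriv i (\<lambda>x. h (f x)) x = h (partial_deriv i f x)"
  using partial_eqI[OF bounded_linear.has_derivative[OF assms(1) smooth_has_derivative[OF assms(2)]], of i]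
  by (simp add: partial_deriv_def)

lemma partial_diff:
  assumes "smooth f" "smooth g"
  shows "partial_deriv i (\<lambda>x. f x - g x) x = partial_deriv i f x - partial_deriv i g x"
  using partial_eqI[OF has_derivative_diff[OF smooth_has_derivative[OF assms(1)] smooth_has_derivative[OF assms(2)]], of i]
  by (simp add: partial_deriv_def)

lemma partial_sum:
  assumes "\<And>j. j \<in> I \<Longrightarrow> smooth (f j)"
  shows "partial_deriv i (\<lambda>x. \<Sum>j\<in>I. f j x) x = (\<Sum>j\<in>I. partial_deriv i (f j) x)"
  using partial_eqI[OF has_derivative_sum[of I f, OF smooth_has_derivative[OF assms]], where x=x and i=i]
  by (simp add: partial_deriv_def)

lemma integral_partial_eq_0:
  fixes f :: "R3 \<Rightarrow> 'b::euclidean_space"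
  assumes "test_function f"
  shows "(\<integral>x. partial_deriv i f x \<partial>lborel) = 0"
  unfolding partial_deriv_def
  by (rule integral_frechet_derivative_eq_0) (auto simp: test_Ck assms test_cpt_supp axis_in_Basis_iff simp del: Ck.simps)

text \<open>Compact support of one factor makes \<open>bop (f x) (g x)\<close> and both of its
  Leibniz terms test functions, so the integral of the derivative is zero and may be split.\<close>

lemma integration_by_parts:
  fixes f :: "R3 \<Rightarrow> 'b::euclidean_space" and g :: "R3 \<Rightarrow> 'c::euclidean_space"
    and bop :: "'b \<Rightarrow> 'c \<Rightarrow> 'd::euclidean_space"
  assumes bop: "bounded_bilinear bop" and f: "smooth f" and g: "smooth g" and cs: "cpt_supp f \<or> cpt_supp g"
  shows "(\<integral>x. bop (f x) (partial_deriv i g x) \<partial>lborel) = - (\<integral>x. bop (partial_deriv i f x) (g x) \<partial>lborel)"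
proof -
  note z = bounded_bilinear.zero_left[OF bop] bounded_bilinear.zero_right[OF bop]
  have t: "test_function (\<lambda>x. bop (f x) (g x))"
    using cs smooth_bilinear[OF bop f g] by (auto simp: test_function_iff z elim: cpt_supp_mono)
  have cs1: "cpt_supp f \<or> cpt_supp (partial_deriv i g)" and cs2: "cpt_supp (partial_deriv i f) \<or> cpt_supp g"
    using cs cpt_supp_partial by blast+
  have 1: "test_function (\<lambda>x. bop (f x) (partial_deriv i g x))"
    using cs1 smooth_bilinear[OF bop f smooth_partial[OF g]]
    by (auto simp: test_function_iff z elim: cpt_supp_mono)
  have 2: "test_function (\<lambda>x. bop (partial_deriv i f x) (g x))"
    using cs2 smooth_bilinear[OF bop smooth_partial[OF f] g]
    by (auto simp: test_function_iff z elim: cpt_supp_mono)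
  have "0 = (\<integral>x. bop (f x) (partial_deriv i g x) + bop (partial_deriv i f x) (g x) \<partial>lborel)"
    using integral_partial_eq_0[OF t, of i] by (simp add: partial_bilinear[OF bop f g])
  also have "\<dots> = (\<integral>x. bop (f x) (partial_deriv i g x) \<partial>lborel) + (\<integral>x. bop (partial_deriv i f x) (g x) \<partial>lborel)"
    by (intro Bochner_Integration.integral_add test_integrable 1 2)
  finally show ?thesis by (simp add: eq_neg_iff_add_eq_0)
qed

lemma integral_scale:
  fixes f :: "'a::euclidean_space \<Rightarrow> real"
  assumes "f \<in> borel_measurable borel" "c > 0"
  shows "(\<integral>x. f x \<partial>lborel) = c ^ DIM('a) * (\<integral>x. f (c *\<^sub>R x) \<partial>lborel)"
  using assms
  by (subst lborel_affine[of c 0])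
     (auto simp: integral_density integral_distr)

section \<open>The standard mollifier\<close>

lemma bump_eq: "bump = ball_bump 1"
  by (auto simp: fun_eq_iff bump_def ball_bump_def flat_exp_def dot_square_norm abs_square_less_1 minus_divide_right)

definition bump_mass :: real where
  "bump_mass = (\<integral>x. ball_bump 1 (x::R3) \<partial>lborel)"

lemma bump_const: "(LINT y|lebesgue. bump y) = bump_mass"
  unfolding bump_eq bump_mass_def using integral_completion[of "ball_bump 1 :: R3 \<Rightarrow> real" lborel]
    test_measurable[OF test_ball_bump[of 1]] by simp

lemma bump_const_pos: "bump_mass > 0"
  unfolding bump_mass_def
  by (rule integral_pos_continuous[where a=0])
     (auto intro!: test_integrable test_ball_bump smooth_continuous test_smooth simp: ball_bump_nonneg ball_bump_pos_iff)

lemma mollifier_eps_eq: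
  assumes "\<epsilon> > 0"
  shows "mollifier_eps \<epsilon> x = flat_exp 0 (1 - (1 / \<epsilon>\<^sup>2) * (x \<bullet> x)) / bump_mass / \<epsilon> ^ 3"
  unfolding mollifier_eps_def mollifier_def bump_const
  using assms by (simp add: bump_eq ball_bump_def power2_eq_square divide_simps)

lemma mollifier_eps_nonneg: "\<epsilon> > 0 \<Longrightarrow> mollifier_eps \<epsilon> x \<ge> 0"
  using bump_const_pos by (auto simp: mollifier_eps_eq flat_exp_def intro!: divide_nonneg_pos)

lemma mollifier_eps_support: "\<epsilon> > 0 \<Longrightarrow> mollifier_eps \<epsilon> x \<noteq> 0 \<Longrightarrow> norm x < \<epsilon>"
proof (rule ccontr)
  assume e: "\<epsilon> > 0" "mollifier_eps \<epsilon> x \<noteq> 0" "\<not> norm x < \<epsilon>"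
  then have "(1 / \<epsilon>\<^sup>2) * (x \<bullet> x) \<ge> 1"
    by (simp add: dot_square_norm field_simps)
  with e show False by (simp add: mollifier_eps_eq flat_exp_def)
qed

lemma test_mollifier_eps: "\<epsilon> > 0 \<Longrightarrow> test_function (mollifier_eps \<epsilon>)"
proof -
  assume e: "\<epsilon> > 0"
  have "smooth (\<lambda>x. inverse (bump_mass * \<epsilon> ^ 3) *\<^sub>R flat_exp 0 (1 - (1 / \<epsilon>\<^sup>2) * (x \<bullet> x)))"
    by (intro smooth_bounded_linear[OF bounded_linear_scaleR_right] smooth_flat_exp smooth_quadratic)
  then have "smooth (mollifier_eps \<epsilon>)"
    by (rule arg_cong[of _ _ smooth, THEN iffD1, rotated]) (auto simp: mollifier_eps_eq[OF e] field_simps)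
  moreover have "cpt_supp (mollifier_eps \<epsilon>)"
    unfolding cpt_supp_def using mollifier_eps_support[OF e] less_imp_le by blast
  ultimately show ?thesis by (simp add: test_function_iff)
qed

lemma mollifier_eps_even: "mollifier_eps \<epsilon> (- x) = mollifier_eps \<epsilon> x"
  by (simp add: mollifier_eps_def mollifier_def bump_def)

lemma integral_mollifier_eps:
  assumes e: "\<epsilon> > 0"
  shows "(\<integral>x. mollifier_eps \<epsilon> x \<partial>lborel) = 1"
proof -
  have "(\<integral>x. mollifier_eps \<epsilon> x \<partial>lborel) = \<epsilon> ^ 3 * (\<integral>x. mollifier_eps \<epsilon> (\<epsilon> *\<^sub>R x) \<partial>lborel)"
    using integral_scale[OF test_measurable[OF test_mollifier_eps[OF e]] e] by simp
  also have "\<dots> = (\<integral>x. ball_bump 1 (x::R3) / bump_mass \<partial>lborel)"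
    using e unfolding mollifier_eps_def mollifier_def bump_const
    by (simp add: bump_eq)
  also have "\<dots> = 1" using bump_const_pos by (simp add: bump_mass_def[symmetric])
  finally show ?thesis .
qed

section \<open>Square integrable functions\<close>

text \<open>The counterpart of \<open>in_L2\<close> for Borel functions and \<open>lborel\<close>,
  where product measures and Fubini's theorem are available.\<close>

definition sqint :: "('a::euclidean_space \<Rightarrow> 'b::euclidean_space) \<Rightarrow> bool" where
  "sqint f \<longleftrightarrow> f \<in> borel_measurable borel \<and> integrable lborel (\<lambda>x. (norm (f x))\<^sup>2)"

definition nrm :: "('a::euclidean_space \<Rightarrow> 'b::euclidean_space) \<Rightarrow> real" where
  "nrm f = sqrt (\<integral>x. (norm (f x))\<^sup>2 \<partial>lborel)"

lemma sqint_measurable: "sqint f \<Longrightarrow> f \<in> borel_measurable borel"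
  by (simp add: sqint_def)

lemma sqint_integrable: "sqint f \<Longrightarrow> integrable lborel (\<lambda>x. (norm (f x))\<^sup>2)"
  by (simp add: sqint_def)

lemma nrm_nonneg: "nrm f \<ge> 0"
  by (simp add: nrm_def)

lemma nrm_sq: "(nrm f)\<^sup>2 = (\<integral>x. (norm (f x))\<^sup>2 \<partial>lborel)"
  by (simp add: nrm_def)

lemma integrable_bilinear:
  fixes f :: "'a::euclidean_space \<Rightarrow> 'b::euclidean_space" and g :: "'a \<Rightarrow> 'c::euclidean_space"
    and bop :: "'b \<Rightarrow> 'c \<Rightarrow> 'd::euclidean_space"
  assumes bop: "bounded_bilinear bop" and "sqint f" "sqint g"
  shows "integrable lborel (\<lambda>x. bop (f x) (g x))"
proof -
  obtain K where K: "K \<ge> 0" "\<And>a b. norm (bop a b) \<le> norm a * norm b * K"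
    using bounded_bilinear.nonneg_bounded[OF bop] by blast
  have le: "norm (bop (f x) (g x)) \<le> K * ((norm (f x))\<^sup>2 + (norm (g x))\<^sup>2)" for x
  proof -
    have "norm (f x) * norm (g x) \<le> (norm (f x))\<^sup>2 + (norm (g x))\<^sup>2"
      using sum_squares_bound[of "norm (f x)" "norm (g x)"] zero_le_power2[of "norm (f x)"]
        zero_le_power2[of "norm (g x)"] mult_nonneg_nonneg[of "norm (f x)" "norm (g x)"] by linarith
    then show ?thesis using K(2)[of "f x" "g x"] mult_left_mono[OF _ K(1)] by (fastforce simp: mult.commute)
  qed
  show ?thesis
  proof (rule Bochner_Integration.integrable_bound)
    show "integrable lborel (\<lambda>x. K * ((norm (f x))\<^sup>2 + (norm (g x))\<^sup>2))"
      using assms by (intro integrable_mult_right Bochner_Integration.integrable_add sqint_integrable)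
    show "(\<lambda>x. bop (f x) (g x)) \<in> borel_measurable lborel"
      using bounded_bilinear_measurable[OF bop sqint_measurable[OF assms(2)] sqint_measurable[OF assms(3)]] by simp
    show "AE x in lborel. norm (bop (f x) (g x)) \<le> norm (K * ((norm (f x))\<^sup>2 + (norm (g x))\<^sup>2))"
      using le by (intro AE_I2 order_trans[OF le]) (simp only: real_norm_def abs_ge_self)
  qed
qed

lemma sqint_norm: "sqint f \<Longrightarrow> sqint (\<lambda>x. norm (f x))"
  unfolding sqint_def by (auto intro: borel_measurable_norm)

lemma nrm_norm: "nrm (\<lambda>x. norm (f x)) = nrm f"
  by (simp add: nrm_def)

lemma integrable_norm_mult: "sqint f \<Longrightarrow> sqint g \<Longrightarrow> integrable lborel (\<lambda>x. norm (f x) * norm (g x))"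
  by (rule integrable_bilinear[OF bounded_bilinear_mult sqint_norm sqint_norm])

text \<open>The weighted arithmetic-geometric inequality is integrated with the optimal weights,
  which are the two norms. Both are enlarged by \<open>e\<close> so that neither denominator
  vanishes, and \<open>e\<close> tends to 0 at the end.\<close>

lemma cauchy_schwarz:
  assumes f: "sqint f" and g: "sqint g"
  shows "(\<integral>x. norm (f x) * norm (g x) \<partial>lborel) \<le> nrm f * nrm g"
proof -
  have le: "(\<integral>x. norm (f x) * norm (g x) \<partial>lborel) \<le> (nrm f + e) * (nrm g + e)" if e: "e > 0" for e
  proof -
    define a b where "a = nrm f + e" and "b = nrm g + e"
    have ab: "a > 0" "b > 0" "nrm f \<le> a" "nrm g \<le> b"
      using e nrm_nonneg[of f] nrm_nonneg[of g] by (auto simp: a_def b_def)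
    have pw: "norm (f x) * norm (g x) \<le> (b / (2 * a)) * (norm (f x))\<^sup>2 + (a / (2 * b)) * (norm (g x))\<^sup>2" for x
    proof -
      have "0 \<le> (b * norm (f x) - a * norm (g x))\<^sup>2 / (2 * a * b)"
        using ab by simp
      also have "\<dots> = (b / (2 * a)) * (norm (f x))\<^sup>2 + (a / (2 * b)) * (norm (g x))\<^sup>2 - norm (f x) * norm (g x)"
        using ab by (simp add: field_simps power2_eq_square)
      finally show ?thesis by simp
    qed
    have i: "integrable lborel (\<lambda>x. (b / (2 * a)) * (norm (f x))\<^sup>2)" "integrable lborel (\<lambda>x. (a / (2 * b)) * (norm (g x))\<^sup>2)"
      using f g by (auto intro!: integrable_mult_right sqint_integrable)
    have "(\<integral>x. norm (f x) * norm (g x) \<partial>lborel) \<le> (\<integral>x. (b / (2 * a)) * (norm (f x))\<^sup>2 + (a / (2 * b)) * (norm (g x))\<^sup>2 \<partial>lborel)"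
      by (intro integral_mono integrable_norm_mult f g Bochner_Integration.integrable_add i pw)
    also have "\<dots> = (b / (2 * a)) * (nrm f)\<^sup>2 + (a / (2 * b)) * (nrm g)\<^sup>2"
      unfolding nrm_sq by (subst Bochner_Integration.integral_add[OF i]) simp
    also have "\<dots> \<le> (b / (2 * a)) * a\<^sup>2 + (a / (2 * b)) * b\<^sup>2"
      using ab nrm_nonneg[of f] nrm_nonneg[of g] by (intro add_mono mult_left_mono power_mono) auto
    also have "\<dots> = a * b" using ab by (simp add: field_simps power2_eq_square)
    finally show ?thesis by (simp add: a_def b_def)
  qed
  have "((\<lambda>e. (nrm f + e) * (nrm g + e)) \<longlongrightarrow> (nrm f + 0) * (nrm g + 0)) (at_right 0)"
    by (intro tendsto_intros)
  then have "(\<integral>x. norm (f x) * norm (g x) \<partial>lborel) \<le> (nrm f + 0) * (nrm g + 0)"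
    by (rule tendsto_lowerbound) (auto simp: eventually_at_filter le)
  then show ?thesis by simp
qed

lemma cauchy_schwarz_bilinear:
  fixes f :: "'a::euclidean_space \<Rightarrow> 'b::euclidean_space" and g :: "'a \<Rightarrow> 'c::euclidean_space"
    and bop :: "'b \<Rightarrow> 'c \<Rightarrow> 'd::euclidean_space"
  assumes bop: "bounded_bilinear bop" and 1: "\<And>a b. norm (bop a b) \<le> norm a * norm b" and f: "sqint f" and g: "sqint g"
  shows "norm (\<integral>x. bop (f x) (g x) \<partial>lborel) \<le> nrm f * nrm g"
  by (rule order_trans[OF Bochner_Integration.integral_norm_bound_integral[OF integrable_bilinear[OF bop f g] integrable_norm_mult[OF f g] 1] cauchy_schwarz[OF f g]])

lemma cauchy_schwarz_inner: "sqint f \<Longrightarrow> sqint g \<Longrightarrow> \<bar>\<integral>x. f x \<bullet> g x \<partial>lborel\<bar> \<le> nrm f * nrm g"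
  using cauchy_schwarz_bilinear[OF bounded_bilinear_inner, of f g] by (simp add: Cauchy_Schwarz_ineq2)

lemma sqint_bound:
  fixes f :: "'a::euclidean_space \<Rightarrow> 'b::euclidean_space" and g :: "'a \<Rightarrow> 'c::euclidean_space"
  assumes "f \<in> borel_measurable borel" "sqint g" "\<And>x. norm (f x) \<le> c * norm (g x)" "c \<ge> 0"
  shows "sqint f" "nrm f \<le> c * nrm g"
proof -
  have le: "(norm (f x))\<^sup>2 \<le> c\<^sup>2 * (norm (g x))\<^sup>2" for x
    using power_mono[OF assms(3)[of x] norm_ge_zero, of 2] by (simp add: power_mult_distrib)
  have i: "integrable lborel (\<lambda>x. c\<^sup>2 * (norm (g x))\<^sup>2)"
    by (intro integrable_mult_right sqint_integrable assms)
  have m[measurable]: "f \<in> borel_measurable lborel" using assms(1) by simp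
  have if': "integrable lborel (\<lambda>x. (norm (f x))\<^sup>2)"
    by (rule Bochner_Integration.integrable_bound[OF i]) (use le in auto)
  then show "sqint f" using assms(1) by (simp add: sqint_def)
  have "(nrm f)\<^sup>2 \<le> (c * nrm g)\<^sup>2"
    unfolding nrm_sq power_mult_distrib using integral_mono[OF if' i le] by simp
  then show "nrm f \<le> c * nrm g"
    by (rule power2_le_imp_le) (simp add: assms nrm_nonneg)
qed

lemma sqint_mono:
  fixes f :: "'a::euclidean_space \<Rightarrow> 'b::euclidean_space" and g :: "'a \<Rightarrow> 'c::euclidean_space"
  assumes "f \<in> borel_measurable borel" "sqint g" "\<And>x. norm (f x) \<le> norm (g x)"
  shows "sqint f" "nrm f \<le> nrm g"
  using sqint_bound[OF assms(1,2), of 1] assms(3) by auto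

lemma sqint_add:
  assumes f: "sqint f" and g: "sqint g"
  shows "sqint (\<lambda>x. f x + g x)" "nrm (\<lambda>x. f x + g x) \<le> nrm f + nrm g"
proof -
  have i: "integrable lborel (\<lambda>x. (norm (f x))\<^sup>2 + 2 * (norm (f x) * norm (g x)) + (norm (g x))\<^sup>2)"
    using f g by (intro Bochner_Integration.integrable_add integrable_mult_right sqint_integrable integrable_norm_mult)
  have le: "(norm (f x + g x))\<^sup>2 \<le> (norm (f x))\<^sup>2 + 2 * (norm (f x) * norm (g x)) + (norm (g x))\<^sup>2" for x
    using power_mono[OF norm_triangle_ineq[of "f x" "g x"] norm_ge_zero, of 2] by (simp add: power2_sum)
  have m: "(\<lambda>x. f x + g x) \<in> borel_measurable borel"
    using f g by (intro borel_measurable_add sqint_measurable)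
  have m2: "(\<lambda>x. (norm (f x + g x))\<^sup>2) \<in> borel_measurable lborel"
    using m by measurable
  have i': "integrable lborel (\<lambda>x. (norm (f x + g x))\<^sup>2)"
    by (rule Bochner_Integration.integrable_bound[OF i m2]) (use le in \<open>auto intro!: AE_I2 order_trans[OF le]\<close>)
  then show "sqint (\<lambda>x. f x + g x)" using m by (simp add: sqint_def)
  have "(nrm (\<lambda>x. f x + g x))\<^sup>2 \<le> (\<integral>x. (norm (f x))\<^sup>2 + 2 * (norm (f x) * norm (g x)) + (norm (g x))\<^sup>2 \<partial>lborel)"
    unfolding nrm_sq by (rule integral_mono[OF i' i le])
  also have "\<dots> = (nrm f)\<^sup>2 + 2 * (\<integral>x. norm (f x) * norm (g x) \<partial>lborel) + (nrm g)\<^sup>2"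
    using sqint_integrable[OF f] sqint_integrable[OF g] integrable_norm_mult[OF f g] unfolding nrm_sq by simp
  also have "\<dots> \<le> (nrm f + nrm g)\<^sup>2"
    using cauchy_schwarz[OF f g] by (simp add: power2_sum)
  finally show "nrm (\<lambda>x. f x + g x) \<le> nrm f + nrm g"
    by (rule power2_le_imp_le) (simp add: nrm_nonneg)
qed

lemma sqint_scaleR:
  assumes "sqint f"
  shows "sqint (\<lambda>x. c *\<^sub>R f x)" "nrm (\<lambda>x. c *\<^sub>R f x) = \<bar>c\<bar> * nrm f"
  using assms by (auto simp: sqint_def nrm_def power_mult_distrib real_sqrt_mult)

lemma sqint_minus:
  assumes "sqint f"
  shows "sqint (\<lambda>x. - f x)" "nrm (\<lambda>x. - f x) = nrm f"
  using sqint_scaleR[OF assms, of "-1"] by auto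

lemma sqint_diff:
  assumes f: "sqint f" and g: "sqint g"
  shows "sqint (\<lambda>x. f x - g x)" "nrm (\<lambda>x. f x - g x) \<le> nrm f + nrm g"
  using sqint_add[OF f sqint_minus(1)[OF g]] sqint_minus(2)[OF g] by auto

lemma nrm_diff_ge:
  assumes f: "sqint f" and g: "sqint g"
  shows "\<bar>nrm f - nrm g\<bar> \<le> nrm (\<lambda>x. f x - g x)"
  using sqint_add(2)[OF sqint_diff(1)[OF f g] g] sqint_add(2)[OF sqint_diff(1)[OF g f] f]
    sqint_minus(2)[OF sqint_diff(1)[OF f g]] by (simp add: abs_le_iff)

lemma sqint_sum:
  assumes "finite I" "\<And>i. i \<in> I \<Longrightarrow> sqint (f i)"
  shows "sqint (\<lambda>x. \<Sum>i\<in>I. f i x) \<and> nrm (\<lambda>x. \<Sum>i\<in>I. f i x) \<le> (\<Sum>i\<in>I. nrm (f i))"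
  using assms
proof (induction I rule: finite_induct)
  case empty
  then show ?case by (simp add: sqint_def nrm_def)
next
  case (insert i I)
  then have "sqint (f i)" "sqint (\<lambda>x. \<Sum>i\<in>I. f i x)" by auto
  from sqint_add[OF this] insert show ?case by auto
qed

lemma test_sqint: "test_function f \<Longrightarrow> sqint (f :: 'a::euclidean_space \<Rightarrow> 'b::euclidean_space)"
proof -
  assume t: "test_function f"
  have "test_function (\<lambda>x. f x \<bullet> f x)"
    by (rule test_bilinear_left[OF bounded_bilinear_inner t test_smooth[OF t]])
  then show "sqint f"
    using test_integrable test_measurable[OF t] by (simp add: sqint_def dot_square_norm)
qed

lemma continuous_sqint:
  fixes f :: "'a::euclidean_space \<Rightarrow> 'b::euclidean_space"
  assumes "continuous_on UNIV f" "cpt_supp f"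
  shows "sqint f"
proof -
  have "integrable lborel (\<lambda>x. (norm (f x))\<^sup>2)"
    by (rule integrable_cpt_supp) (auto intro!: continuous_intros assms(1) cpt_supp_mono[OF assms(2)])
  then show ?thesis
    using borel_measurable_continuous_onI[OF assms(1)] by (simp add: sqint_def)
qed

lemma sqint_loc_int:
  assumes "sqint w"
  shows "loc_int w"
  unfolding loc_int_def
proof (intro conjI allI)
  show [measurable]: "w \<in> borel_measurable borel" by (rule sqint_measurable[OF assms])
  fix r
  have i: "integrable lborel (\<lambda>x. indicat_real (cball 0 r) x + (norm (w x))\<^sup>2)"
    by (intro Bochner_Integration.integrable_add sqint_integrable[OF assms])
       (use emeasure_bounded_finite[OF bounded_cball, of 0 r] in \<open>auto simp: integrable_indicator_iff\<close>)
  have le: "norm (indicat_real (cball 0 r) x *\<^sub>R w x) \<le> norm (indicat_real (cball 0 r) x + (norm (w x))\<^sup>2)" for x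
  proof -
    have "norm (w x) \<le> 1 + (norm (w x))\<^sup>2"
      using sum_squares_bound[of 1 "norm (w x)"] norm_ge_zero[of "w x"] unfolding one_power2 mult_1_right by linarith
    then show ?thesis by (auto simp: indicator_def)
  qed
  show "integrable lborel (\<lambda>x. indicat_real (cball 0 r) x *\<^sub>R w x)"
    by (rule Bochner_Integration.integrable_bound[OF i])
       (use le sqint_measurable[OF assms] in \<open>auto intro!: borel_measurable_scaleR borel_measurable_indicator\<close>)
qed

section \<open>Young's inequality and the adjoint of a convolution\<close>

abbreviation cv :: "('a::euclidean_space \<Rightarrow> real) \<Rightarrow> ('a \<Rightarrow> 'b::euclidean_space) \<Rightarrow> 'a \<Rightarrow> 'b" where
  "cv \<equiv> gcv scaleR"

lemma cv_conv_nonneg: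
  fixes F q :: "'a::euclidean_space \<Rightarrow> real"
  assumes F: "continuous_on UNIV F" "cpt_supp F" "\<And>x. F x \<ge> 0" and q: "integrable lborel q" "q \<in> borel_measurable borel" "\<And>x. q x \<ge> 0"
  shows "integrable lborel (\<lambda>x. \<integral>y. F (x - y) * q y \<partial>lborel)"
    and "(\<integral>x. \<integral>y. F (x - y) * q y \<partial>lborel \<partial>lborel) = (\<integral>x. F x \<partial>lborel) * (\<integral>y. q y \<partial>lborel)"
proof -
  have [measurable]: "F \<in> borel_measurable borel" "q \<in> borel_measurable borel"
    using q(2) borel_measurable_continuous_onI[OF F(1)] by auto
  have iF: "integrable lborel F" by (rule integrable_cpt_supp[OF F(1,2)])
  define G where "G z = F (- z)" for z
  have Gm[measurable]: "G \<in> borel_measurable borel" unfolding G_def by measurable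
  have GF: "F (x - y) = G (y - x)" for x y by (simp add: G_def)
  have iG: "integrable lborel G" "(\<integral>x. G x \<partial>lborel) = (\<integral>x. F x \<partial>lborel)"
    using integrable_reflect[of F 0] integral_reflect[of F 0] iF by (auto simp: G_def[abs_def])
  have ix: "integrable lborel (\<lambda>x. F (x - y))" for y
    unfolding GF using integrable_reflect[of G y] iG by simp
  have eq: "(\<integral>x. F (x - y) \<partial>lborel) = (\<integral>x. F x \<partial>lborel)" for y
    unfolding GF using integral_reflect[of G y] iG by simp
  have I: "integrable (lborel \<Otimes>\<^sub>M lborel) (\<lambda>(y, x). F (x - y) * q y)"
  proof (rule lborel_pair.Fubini_integrable)
    show "(\<lambda>(y, x). F (x - y) * q y) \<in> borel_measurable (lborel \<Otimes>\<^sub>M lborel)" by measurable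
    show "integrable lborel (\<lambda>y. \<integral>x. norm (case (y, x) of (y, x) \<Rightarrow> F (x - y) * q y) \<partial>lborel)"
      using q F(3) by (simp add: eq abs_mult)
    show "AE y in lborel. integrable lborel (\<lambda>x. case (y, x) of (y, x) \<Rightarrow> F (x - y) * q y)"
      using ix by (auto intro!: AE_I2)
  qed
  show "integrable lborel (\<lambda>x. \<integral>y. F (x - y) * q y \<partial>lborel)"
    by (rule lborel_pair.integrable_snd[OF I])
  show "(\<integral>x. \<integral>y. F (x - y) * q y \<partial>lborel \<partial>lborel) = (\<integral>x. F x \<partial>lborel) * (\<integral>y. q y \<partial>lborel)"
    by (subst lborel_pair.Fubini_integral[OF I]) (simp add: eq)
qed

text \<open>Young's inequality for an L1 kernel and an L2 function. The pointwise bound is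
  Cauchy-Schwarz with the weight \<open>norm (F (x - y))\<close> divided evenly between the factors,
  and integrating it gives the norm bound. It is kept as a third claim because
  \<open>conv_norm_mol\<close> uses it as a Jensen inequality.\<close>

lemma sqint_gcv:
  fixes F :: "'a::euclidean_space \<Rightarrow> 'b::euclidean_space" and w :: "'a \<Rightarrow> 'c::euclidean_space"
    and bop :: "'b \<Rightarrow> 'c \<Rightarrow> 'd::euclidean_space"
  assumes bop: "bounded_bilinear bop" and 1: "\<And>a b. norm (bop a b) \<le> norm a * norm b"
    and F: "continuous_on UNIV F" "cpt_supp F" and w: "sqint w"
  shows "sqint (gcv bop F w)"
    and "nrm (gcv bop F w) \<le> (\<integral>x. norm (F x) \<partial>lborel) * nrm w"
    and "\<And>x. (norm (gcv bop F w x))\<^sup>2 \<le> (\<integral>x. norm (F x) \<partial>lborel) * (\<integral>y. norm (F (x - y)) * (norm (w y))\<^sup>2 \<partial>lborel)"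
proof -
  define A where "A = (\<integral>x. norm (F x) \<partial>lborel)"
  have A0: "A \<ge> 0" by (simp add: A_def)
  have [measurable]: "F \<in> borel_measurable borel" "w \<in> borel_measurable borel"
    using sqint_measurable[OF w] borel_measurable_continuous_onI[OF F(1)] by auto
  have NF: "continuous_on UNIV (\<lambda>x. norm (F x))" "cpt_supp (\<lambda>x. norm (F x))"
    by (auto intro!: continuous_intros F(1) cpt_supp_mono[OF F(2)])
  note cn = cv_conv_nonneg[OF NF norm_ge_zero sqint_integrable[OF w] _ zero_le_power2]
  have m2: "(\<lambda>x. (norm (w x))\<^sup>2) \<in> borel_measurable borel" by measurable
  define P where "P x = (\<integral>y. norm (F (x - y)) * (norm (w y))\<^sup>2 \<partial>lborel)" for x
  have P: "integrable lborel P" "(\<integral>x. P x \<partial>lborel) = A * (nrm w)\<^sup>2"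
    using cn[OF m2] by (auto simp: P_def[abs_def] A_def nrm_sq)
  have pw: "(norm (gcv bop F w x))\<^sup>2 \<le> A * P x" for x
  proof -
    define a b where "a y = sqrt (norm (F (x - y)))" and "b y = sqrt (norm (F (x - y))) * norm (w y)" for y
    have ia: "integrable lborel (\<lambda>y. norm (F (x - y)))" "(\<integral>y. norm (F (x - y)) \<partial>lborel) = A"
      using integrable_reflect[of "\<lambda>y. norm (F y)" x] integral_reflect[of "\<lambda>y. norm (F y)" x]
        integrable_cpt_supp[OF NF] by (auto simp: A_def)
    obtain B where B: "\<And>x. norm (F x) \<le> B" using cpt_supp_bounded[OF F] by blast
    have ib: "integrable lborel (\<lambda>y. norm (F (x - y)) * (norm (w y))\<^sup>2)"
      by (rule Bochner_Integration.integrable_bound[OF integrable_mult_right[OF sqint_integrable[OF w], of B]])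
         (auto intro!: AE_I2 mult_right_mono order_trans[OF B] simp: abs_mult)
    have sa: "sqint a" "(nrm a)\<^sup>2 = A"
      unfolding sqint_def nrm_sq a_def using ia by auto
    have sb: "sqint b" "(nrm b)\<^sup>2 = P x"
      unfolding sqint_def nrm_sq b_def using ib by (auto simp: power_mult_distrib P_def)
    have "norm (gcv bop F w x) \<le> (\<integral>y. norm (a y) * norm (b y) \<partial>lborel)"
      unfolding gcv_def
    proof (rule Bochner_Integration.integral_norm_bound_integral)
      show "integrable lborel (\<lambda>y. bop (F (x - y)) (w y))"
        by (rule gcv_integrable[OF bop F sqint_loc_int[OF w]])
      show "integrable lborel (\<lambda>x. norm (a x) * norm (b x))"
        by (rule integrable_norm_mult[OF sa(1) sb(1)])
      show "norm (bop (F (x - y)) (w y)) \<le> norm (a y) * norm (b y)" for y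
        using 1[of "F (x - y)" "w y"] by (simp add: a_def b_def abs_mult mult.assoc[symmetric])
    qed
    also have "\<dots> \<le> nrm a * nrm b" by (rule cauchy_schwarz[OF sa(1) sb(1)])
    finally have "(norm (gcv bop F w x))\<^sup>2 \<le> (nrm a * nrm b)\<^sup>2"
      by (rule power_mono) simp
    then show ?thesis by (simp add: power_mult_distrib sa sb)
  qed
  then show "(norm (gcv bop F w x))\<^sup>2 \<le> (\<integral>x. norm (F x) \<partial>lborel) * (\<integral>y. norm (F (x - y)) * (norm (w y))\<^sup>2 \<partial>lborel)" for x
    by (simp add: A_def P_def)
  have m: "gcv bop F w \<in> borel_measurable borel"
    by (intro borel_measurable_continuous_onI continuous_gcv[OF bop F sqint_loc_int[OF w]])
  have i: "integrable lborel (\<lambda>x. (norm (gcv bop F w x))\<^sup>2)"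
    by (rule Bochner_Integration.integrable_bound[OF integrable_mult_right[OF P(1), of A]])
       (use m pw in \<open>auto intro!: AE_I2 order_trans[OF pw]\<close>)
  with m show "sqint (gcv bop F w)" by (simp add: sqint_def)
  have "(nrm (gcv bop F w))\<^sup>2 \<le> (\<integral>x. A * P x \<partial>lborel)"
    unfolding nrm_sq by (rule integral_mono[OF i integrable_mult_right[OF P(1)] pw])
  also have "\<dots> = (A * nrm w)\<^sup>2" using P by (simp add: power2_eq_square)
  finally show "nrm (gcv bop F w) \<le> (\<integral>x. norm (F x) \<partial>lborel) * nrm w"
    unfolding A_def[symmetric] by (rule power2_le_imp_le) (simp add: A0 nrm_nonneg)
qed

lemma nrm_reflect:
  assumes "F \<in> borel_measurable borel"
  shows "nrm (\<lambda>y. F (x - y)) = nrm F"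
  using integral_reflect[of "\<lambda>y. (norm (F y))\<^sup>2" x] assms by (simp add: nrm_def)

lemma sqint_reflect:
  assumes "sqint F"
  shows "sqint (\<lambda>y. F (x - y))"
  using assms integrable_reflect[of "\<lambda>y. (norm (F y))\<^sup>2" x]
  by (auto simp: sqint_def borel_measurable_compose_diff)

text \<open>Applied to the mollifier, this bounds the regularised velocity pointwise, with a
  constant that depends on \<open>\<epsilon>\<close>.\<close>

lemma gcv_sup_bound:
  fixes F :: "'a::euclidean_space \<Rightarrow> 'b::euclidean_space" and w :: "'a \<Rightarrow> 'c::euclidean_space"
    and bop :: "'b \<Rightarrow> 'c \<Rightarrow> 'd::euclidean_space"
  assumes bop: "bounded_bilinear bop" and 1: "\<And>a b. norm (bop a b) \<le> norm a * norm b"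
    and F: "sqint F" and w: "sqint w"
  shows "norm (gcv bop F w x) \<le> nrm F * nrm w"
  using cauchy_schwarz_bilinear[OF bop 1 sqint_reflect[OF F, of x] w] nrm_reflect[of F x] sqint_measurable[OF F]
  by (simp add: gcv_def)

lemma cv_diff:
  assumes "continuous_on UNIV F" "cpt_supp F" "loc_int w" "loc_int w'"
  shows "cv F (\<lambda>x. w x - w' x) = (\<lambda>x. cv F w x - cv F w' x)"
  unfolding gcv_def fun_eq_iff scaleR_diff_right
  by (intro allI Bochner_Integration.integral_diff gcv_integrable[OF bounded_bilinear_scaleR] assms)

text \<open>Fubini's theorem; the majorant is \<open>norm (w y)\<close> times the convolution of
  \<open>norm (F x)\<close> with \<open>norm (X x)\<close>, both square integrable. Evenness of
  \<open>F\<close> turns the adjoint kernel back into \<open>F\<close>.\<close>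

lemma cv_adjoint:
  fixes w X :: "'a::euclidean_space \<Rightarrow> 'b::euclidean_space"
  assumes F: "continuous_on UNIV F" "cpt_supp F" "\<And>x. F (- x) = F x" and w: "sqint w" and X: "sqint X"
  shows "(\<integral>x. cv F w x \<bullet> X x \<partial>lborel) = (\<integral>y. w y \<bullet> cv F X y \<partial>lborel)"
proof -
  have [measurable]: "F \<in> borel_measurable borel" "w \<in> borel_measurable borel" "X \<in> borel_measurable borel"
    using sqint_measurable[OF w] sqint_measurable[OF X] borel_measurable_continuous_onI[OF F(1)] by auto
  have NF: "continuous_on UNIV (\<lambda>x. norm (F x))" "cpt_supp (\<lambda>x. norm (F x))"
    by (auto intro!: continuous_intros F(1) cpt_supp_mono[OF F(2)])
  have ev: "F (x - y) = F (y - x)" for x y using F(3)[of "x - y"] by simp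
  have iX: "integrable lborel (\<lambda>x. F (x - y) *\<^sub>R X x)" for y
    unfolding ev[of _ y] by (rule gcv_integrable[OF bounded_bilinear_scaleR F(1,2) sqint_loc_int[OF X]])
  have iw: "integrable lborel (\<lambda>y. F (x - y) *\<^sub>R w y)" for x
    by (rule gcv_integrable[OF bounded_bilinear_scaleR F(1,2) sqint_loc_int[OF w]])
  have I: "integrable (lborel \<Otimes>\<^sub>M lborel) (\<lambda>(y, x). F (x - y) * (w y \<bullet> X x))"
  proof (rule lborel_pair.Fubini_integrable)
    show "(\<lambda>(y, x). F (x - y) * (w y \<bullet> X x)) \<in> borel_measurable (lborel \<Otimes>\<^sub>M lborel)" by measurable
    have iy: "integrable lborel (\<lambda>x. F (x - y) * (w y \<bullet> X x))" for y
      using integrable_inner_right[OF iX[of y], of "w y"] by simp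
    then show "AE y in lborel. integrable lborel (\<lambda>x. case (y, x) of (y, x) \<Rightarrow> F (x - y) * (w y \<bullet> X x))"
      by simp
    have iN: "integrable lborel (\<lambda>y. norm (w y) * norm (gcv times (\<lambda>x. norm (F x)) (\<lambda>x. norm (X x)) y))"
      by (intro integrable_norm_mult w sqint_gcv(1)[OF bounded_bilinear_mult] NF sqint_norm X) (simp add: abs_mult)
    have b: "(\<integral>x. norm (F (x - y) * (w y \<bullet> X x)) \<partial>lborel) \<le> norm (w y) * norm (gcv times (\<lambda>x. norm (F x)) (\<lambda>x. norm (X x)) y)" for y
    proof -
      have "(\<integral>x. norm (F (x - y) * (w y \<bullet> X x)) \<partial>lborel) \<le> (\<integral>x. norm (w y) * (norm (F (y - x)) * norm (X x)) \<partial>lborel)"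
      proof (intro integral_mono integrable_norm iy integrable_mult_right)
        show "integrable lborel (\<lambda>x. norm (F (y - x)) * norm (X x))"
          by (rule gcv_integrable[OF bounded_bilinear_mult NF sqint_loc_int[OF sqint_norm[OF X]]])
        show "norm (F (x - y) * (w y \<bullet> X x)) \<le> norm (w y) * (norm (F (y - x)) * norm (X x))" for x
          using mult_left_mono[OF Cauchy_Schwarz_ineq2[of "w y" "X x"], of "\<bar>F (x - y)\<bar>"]
          by (simp add: abs_mult ev[of x] ac_simps)
      qed
      then show ?thesis by (simp add: gcv_def)
    qed
    show "integrable lborel (\<lambda>y. \<integral>x. norm (case (y, x) of (y, x) \<Rightarrow> F (x - y) * (w y \<bullet> X x)) \<partial>lborel)"
    proof (rule Bochner_Integration.integrable_bound[OF iN])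
      show "(\<lambda>y. \<integral>x. norm (case (y, x) of (y, x) \<Rightarrow> F (x - y) * (w y \<bullet> X x)) \<partial>lborel) \<in> borel_measurable lborel"
        by measurable
      show "AE y in lborel. norm (\<integral>x. norm (case (y, x) of (y, x) \<Rightarrow> F (x - y) * (w y \<bullet> X x)) \<partial>lborel)
        \<le> norm (norm (w y) * norm (gcv times (\<lambda>x. norm (F x)) (\<lambda>x. norm (X x)) y))"
        using b by (intro AE_I2) (simp add: abs_mult)
    qed
  qed
  have "(\<integral>x. cv F w x \<bullet> X x \<partial>lborel) = (\<integral>x. \<integral>y. F (x - y) * (w y \<bullet> X x) \<partial>lborel \<partial>lborel)"
    unfolding gcv_def by (subst integral_inner_left[symmetric]) (auto intro: iw)
  also have "\<dots> = (\<integral>y. \<integral>x. F (x - y) * (w y \<bullet> X x) \<partial>lborel \<partial>lborel)"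
    by (rule lborel_pair.Fubini_integral[OF I])
  also have "\<dots> = (\<integral>y. w y \<bullet> cv F X y \<partial>lborel)"
  proof (rule Bochner_Integration.integral_cong[OF refl])
    fix y
    have "(\<integral>x. F (x - y) * (w y \<bullet> X x) \<partial>lborel) = (\<integral>x. w y \<bullet> (F (y - x) *\<^sub>R X x) \<partial>lborel)"
      using ev[of _ y] by simp
    also have "\<dots> = w y \<bullet> cv F X y"
      unfolding gcv_def
      by (rule integral_inner_right) (use gcv_integrable[OF bounded_bilinear_scaleR F(1,2) sqint_loc_int[OF X]] in auto)
    finally show "(\<integral>x. F (x - y) * (w y \<bullet> X x) \<partial>lborel) = w y \<bullet> cv F X y" .
  qed
  finally show ?thesis .
qed

section \<open>Approximation by convolution\<close>

lemma nrm_bound_cball: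
  fixes g :: "'a::euclidean_space \<Rightarrow> 'b::euclidean_space"
  assumes "g \<in> borel_measurable borel" "\<And>x. norm (g x) \<le> B" "\<And>x. norm x > s \<Longrightarrow> g x = 0"
  shows "sqint g" "nrm g \<le> B * sqrt (measure lborel (cball (0::'a) s))"
proof -
  have B: "B \<ge> 0" using assms(2) norm_ge_zero order_trans by blast
  have sq: "(indicat_real A x)\<^sup>2 = indicat_real A x" for A and x :: 'a
    by (simp add: indicator_def)
  have si: "sqint (indicat_real (cball (0::'a) s))"
    using emeasure_bounded_finite[OF bounded_cball, of "0::'a" s]
    by (auto simp: sqint_def sq integrable_indicator_iff intro!: borel_measurable_indicator)
  have n: "nrm (indicat_real (cball (0::'a) s)) = sqrt (measure lborel (cball (0::'a) s))"
    by (simp add: nrm_def sq)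
  have le: "norm (g x) \<le> B * norm (indicat_real (cball (0::'a) s) x)" for x
    using assms(2)[of x] assms(3)[of x] by (auto simp: indicator_def not_le)
  show "sqint g" "nrm g \<le> B * sqrt (measure lborel (cball (0::'a) s))"
    using sqint_bound[OF assms(1) si le B] n by auto
qed

lemma nrm_tendsto_0:
  fixes f :: "nat \<Rightarrow> 'a::euclidean_space \<Rightarrow> 'b::euclidean_space"
  assumes "\<And>n. f n \<in> borel_measurable borel" "integrable lborel h" "\<And>n x. (norm (f n x))\<^sup>2 \<le> h x"
    "AE x in lborel. (\<lambda>n. f n x) \<longlonglongrightarrow> 0"
  shows "(\<lambda>n. nrm (f n)) \<longlonglongrightarrow> 0"
proof -
  have m: "(\<lambda>x. (norm (f n x))\<^sup>2) \<in> borel_measurable lborel" for n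
    using assms(1)[of n] by measurable
  have "(\<lambda>n. \<integral>x. (norm (f n x))\<^sup>2 \<partial>lborel) \<longlonglongrightarrow> (\<integral>x. 0 \<partial>(lborel::'a measure))"
  proof (rule integral_dominated_convergence[OF _ m assms(2)])
    show "AE x in lborel. (\<lambda>n. (norm (f n x))\<^sup>2) \<longlonglongrightarrow> 0"
      using assms(4) by eventually_elim (auto intro!: tendsto_eq_intros tendsto_norm_zero)
    show "AE x in lborel. norm ((norm (f n x))\<^sup>2) \<le> h x" for n
      using assms(3) by simp
  qed simp
  then have "(\<lambda>n. sqrt (\<integral>x. (norm (f n x))\<^sup>2 \<partial>lborel)) \<longlonglongrightarrow> sqrt 0"
    by (intro tendsto_real_sqrt) simp
  then show ?thesis by (simp add: nrm_def)
qed

text \<open>Measurability provides continuous functions \<open>G n\<close> that converge almost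
  everywhere, but without domination. Clipping their values with \<open>P\<close> and their domain
  with \<open>c\<close> leaves the limit \<open>w\<close> unchanged and supplies a common bound of
  bounded support.\<close>

lemma bounded_approximation:
  fixes w :: "'a::euclidean_space \<Rightarrow> 'b::euclidean_space"
  assumes w: "w \<in> borel_measurable borel" "\<And>x. norm (w x) \<le> M" "\<And>x. norm x > r \<Longrightarrow> w x = 0" and e: "e > 0"
  obtains g where "continuous_on UNIV g" "cpt_supp g" "nrm (\<lambda>x. w x - g x) < e"
proof -
  have wl: "w \<in> borel_measurable (lebesgue_on UNIV)"
    using w(1) by (simp add: lebesgue_on_UNIV_eq measurable_completion)
  have "w measurable_on UNIV"
    using measurable_on_iff_borel_measurable[of UNIV w] wl by simp
  then obtain N G where N: "negligible N" and G: "\<And>n. continuous_on UNIV (G n)" "\<And>x. x \<notin> N \<Longrightarrow> (\<lambda>n. G n x) \<longlonglongrightarrow> w x"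
    unfolding measurable_on_def by auto
  have M0: "M \<ge> 0" using w(2) norm_ge_zero order_trans by blast
  define M' where "M' = M + 1"
  have M': "M' > 0" "\<And>x. norm (w x) \<le> M'" using M0 order_trans[OF w(2), of "M + 1"] by (auto simp: M'_def)
  \<comment> \<open>\<open>P\<close> is the radial retraction onto the ball of radius
    \<open>M'\<close>, and \<open>c\<close> is a piecewise linear cutoff that is 1 up to radius
    \<open>r\<close> and 0 beyond \<open>r + 1\<close>. The choice \<open>M' = M + 1\<close> keeps
    the denominator positive.\<close>
  define P where "P g = (M' / max M' (norm g)) *\<^sub>R g" for g :: 'b
  define c where "c x = max 0 (min 1 (r + 1 - norm x))" for x :: 'a
  define h where "h n x = c x *\<^sub>R P (G n x)" for n x
  have contP: "continuous_on UNIV P"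
    unfolding P_def[abs_def] using M'(1) by (intro continuous_intros) auto
  have Ple: "norm (P g) \<le> M'" for g
  proof -
    have "M' * norm g / max M' (norm g) \<le> M'"
      using M'(1) by (simp add: field_simps)
    then show ?thesis using M'(1) by (simp add: P_def)
  qed
  have conth: "continuous_on UNIV (h n)" for n
    unfolding h_def[abs_def] c_def
    by (intro continuous_intros continuous_on_compose2[OF contP G(1)[of n]]) auto
  have c01: "0 \<le> c x" "c x \<le> 1" "norm x > r + 1 \<Longrightarrow> c x = 0" "norm x \<le> r \<Longrightarrow> c x = 1" for x
    by (auto simp: c_def)
  have hle: "norm (h n x) \<le> M'" for n x
    unfolding h_def using c01[of x] Ple[of "G n x"] M'(1) mult_mono[of "c x" 1 "norm (P (G n x))" M'] by simp
  have Pw: "P (w x) = w x" for x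
    using M'(2)[of x] M'(1) by (simp add: P_def max_def)
  have cw: "c x *\<^sub>R w x = w x" for x
    using c01(4)[of x] w(3)[of x] by (cases "norm x \<le> r") auto
  have lim: "(\<lambda>n. w x - h n x) \<longlonglongrightarrow> 0" if "x \<notin> N" for x
  proof -
    have "isCont P (w x)" using contP by (simp add: continuous_on_eq_continuous_at)
    then have "(\<lambda>n. P (G n x)) \<longlonglongrightarrow> P (w x)"
      using G(2)[OF that] by (rule isCont_tendsto_compose)
    then have "(\<lambda>n. w x - h n x) \<longlonglongrightarrow> w x - c x *\<^sub>R P (w x)"
      unfolding h_def by (intro tendsto_intros)
    then show ?thesis by (simp add: Pw cw)
  qed
  have "(\<lambda>n. nrm (\<lambda>x. w x - h n x)) \<longlonglongrightarrow> 0"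
  proof (rule nrm_tendsto_0[where h="\<lambda>x. (2 * M')\<^sup>2 * indicat_real (cball 0 (r+1)) x"])
    show "(\<lambda>x. w x - h n x) \<in> borel_measurable borel" for n
      using w(1) borel_measurable_continuous_onI[OF conth] by measurable
    show "integrable lborel (\<lambda>x. (2 * M')\<^sup>2 * indicat_real (cball (0::'a) (r+1)) x)"
      using emeasure_bounded_finite[OF bounded_cball, of "0::'a" "r+1"] by (auto simp: integrable_indicator_iff)
    show "(norm (w x - h n x))\<^sup>2 \<le> (2 * M')\<^sup>2 * indicat_real (cball (0::'a) (r+1)) x" for n x
    proof (cases "norm x \<le> r + 1")
      case True
      have "norm (w x - h n x) \<le> 2 * M'"
        using norm_triangle_ineq4[of "w x" "h n x"] hle[of n x] M'(2)[of x] by linarith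
      then show ?thesis using True power_mono[of "norm (w x - h n x)" "2 * M'" 2] by (simp add: indicator_def)
    next
      case False
      then show ?thesis using w(3)[of x] c01(3)[of x] by (simp add: h_def)
    qed
    show "AE x in lborel. (\<lambda>n. w x - h n x) \<longlonglongrightarrow> 0"
    proof -
      have "AE x in lebesgue. x \<notin> N"
        using N negligible_iff_null_sets AE_not_in by blast
      then have "AE x in lborel. x \<notin> N" by (simp add: AE_completion_iff)
      then show ?thesis by eventually_elim (rule lim)
    qed
  qed
  then have "\<forall>\<^sub>F n in sequentially. nrm (\<lambda>x. w x - h n x) < e"
    using e by (rule order_tendstoD(2))
  then obtain n where n: "nrm (\<lambda>x. w x - h n x) < e"
    by (auto simp: eventually_sequentially)
  have "cpt_supp (h n)"
    unfolding cpt_supp_def h_def using c01(3) by (metis not_less scale_zero_left)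
  from that[OF conth this n] show ?thesis .
qed

lemma sqint_approximation:
  fixes w :: "'a::euclidean_space \<Rightarrow> 'b::euclidean_space"
  assumes w: "sqint w" and e: "e > 0"
  obtains g where "continuous_on UNIV g" "cpt_supp g" "nrm (\<lambda>x. w x - g x) < e"
proof -
  have [measurable]: "w \<in> borel_measurable borel" by (rule sqint_measurable[OF w])
  \<comment> \<open>Removing large arguments and large values at once makes \<open>W n\<close> a
    case of \<open>bounded_approximation\<close>; dominated convergence controls what is
    removed.\<close>
  define W where "W n x = (if norm x \<le> real n \<and> norm (w x) \<le> real n then w x else 0)" for n x
  have Wm[measurable]: "W n \<in> borel_measurable borel" for n
    unfolding W_def[abs_def] by measurable
  have "(\<lambda>n. nrm (\<lambda>x. w x - W n x)) \<longlonglongrightarrow> 0"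
  proof (rule nrm_tendsto_0[OF _ sqint_integrable[OF w]])
    show "(\<lambda>x. w x - W n x) \<in> borel_measurable borel" for n by measurable
    show "(norm (w x - W n x))\<^sup>2 \<le> (norm (w x))\<^sup>2" for n x by (auto simp: W_def)
    have "(\<lambda>n. w x - W n x) \<longlonglongrightarrow> 0" for x
    proof (rule tendsto_eventually)
      obtain n0 :: nat where n0: "max (norm x) (norm (w x)) \<le> real n0" using real_arch_simple by blast
      show "\<forall>\<^sub>F n in sequentially. w x - W n x = 0"
        using eventually_ge_at_top[of n0] by eventually_elim (use n0 in \<open>auto simp: W_def\<close>)
    qed
    then show "AE x in lborel. (\<lambda>n. w x - W n x) \<longlonglongrightarrow> 0" by simp
  qed
  then have "\<forall>\<^sub>F n in sequentially. nrm (\<lambda>x. w x - W n x) < e / 2"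
    using e by (intro order_tendstoD(2)) auto
  then obtain n where n: "nrm (\<lambda>x. w x - W n x) < e / 2"
    by (auto simp: eventually_sequentially)
  obtain g where g: "continuous_on UNIV g" "cpt_supp g" "nrm (\<lambda>x. W n x - g x) < e / 2"
    by (rule bounded_approximation[of "W n" "real n" "real n" "e / 2"]) (use e in \<open>auto simp: W_def\<close>)
  have sW: "sqint (W n)"
    by (rule nrm_bound_cball(1)[of _ "real n" "real n"]) (auto simp: W_def)
  have "nrm (\<lambda>x. w x - g x) \<le> nrm (\<lambda>x. w x - W n x) + nrm (\<lambda>x. W n x - g x)"
    using sqint_add(2)[OF sqint_diff(1)[OF w sW] sqint_diff(1)[OF sW continuous_sqint[OF g(1,2)]]] by simp
  then have "nrm (\<lambda>x. w x - g x) < e" using n g(3) by simp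
  from that[OF g(1,2) this] show ?thesis .
qed

text \<open>The mass \<open>c\<close> is kept general because the same approximation results serve
  the mollifier, of mass 1, and the Newtonian densities \<open>kap r\<close>, of mass
  \<open>kap_mass\<close>.\<close>

definition kernel :: "('a::euclidean_space \<Rightarrow> real) \<Rightarrow> real \<Rightarrow> real \<Rightarrow> bool" where
  "kernel F r c \<longleftrightarrow> continuous_on UNIV F \<and> (\<forall>x. F x \<ge> 0) \<and> (\<forall>x. F x \<noteq> 0 \<longrightarrow> norm x \<le> r) \<and>
     (\<integral>x. F x \<partial>lborel) = c \<and> (\<forall>x. F (- x) = F x)"

lemma kernelD:
  assumes "kernel F r c"
  shows "continuous_on UNIV F" "cpt_supp F" "F x \<ge> 0" "F x \<noteq> 0 \<Longrightarrow> norm x \<le> r" "(\<integral>x. F x \<partial>lborel) = c"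
    "F (- x) = F x" "F \<in> borel_measurable borel" "integrable lborel F" "c \<ge> 0" "(\<integral>x. norm (F x) \<partial>lborel) = c"
proof -
  note k = assms[unfolded kernel_def]
  show 1: "continuous_on UNIV F" and 2: "cpt_supp F" and 3: "F x \<ge> 0" and "F x \<noteq> 0 \<Longrightarrow> norm x \<le> r"
    and 4: "(\<integral>x. F x \<partial>lborel) = c" and "F (- x) = F x"
    using k by (auto simp: cpt_supp_def)
  show "F \<in> borel_measurable borel" "integrable lborel F"
    by (rule borel_measurable_continuous_onI[OF 1], rule integrable_cpt_supp[OF 1 2])
  have nn: "F x \<ge> 0" for x using k by blast
  show "c \<ge> 0"
    unfolding 4[symmetric] by (rule Bochner_Integration.integral_nonneg) (rule nn)
  have "(\<lambda>x. norm (F x)) = F" using nn by (simp add: fun_eq_iff)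
  then show "(\<integral>x. norm (F x) \<partial>lborel) = c" using 4 by simp
qed

lemma kernel_mollifier_eps: "\<epsilon> > 0 \<Longrightarrow> kernel (mollifier_eps \<epsilon>) \<epsilon> 1"
  unfolding kernel_def
  using integral_mollifier_eps mollifier_eps_nonneg mollifier_eps_support mollifier_eps_even
    smooth_continuous[OF test_smooth[OF test_mollifier_eps]] less_imp_le
  by blast

lemma kernel_cv:
  fixes w :: "'a::euclidean_space \<Rightarrow> 'b::euclidean_space"
  assumes k: "kernel F r c" and w: "sqint w"
  shows "sqint (cv F w)" "nrm (cv F w) \<le> c * nrm w"
  using sqint_gcv(1,2)[OF bounded_bilinear_scaleR _ kernelD(1,2)[OF k] w] kernelD(10)[OF k] by auto

text \<open>Besides approximation, where \<open>a = f x\<close>, this yields two-sided bounds: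
  \<open>a = 1/2\<close> and \<open>\<omega> = 1/2\<close> confine the average of a function with
  values in \<open>[0,1]\<close> to that interval, and \<open>\<omega> = 0\<close> gives the exact
  value on plateaus.\<close>

lemma kernel_cv_sup:
  fixes f :: "'a::euclidean_space \<Rightarrow> 'b::euclidean_space"
  assumes k: "kernel F r c" and f: "loc_int f" and \<omega>: "\<And>y. dist y x \<le> r \<Longrightarrow> norm (f y - a) \<le> \<omega>"
  shows "norm (cv F f x - c *\<^sub>R a) \<le> c * \<omega>"
proof -
  note kd = kernelD[OF k]
  have i1: "integrable lborel (\<lambda>y. F (x - y))" "(\<integral>y. F (x - y) \<partial>lborel) = c"
    using integrable_reflect[OF kd(7), of x] integral_reflect[OF kd(7), of x] kd(8,5) by auto
  have i2: "integrable lborel (\<lambda>y. F (x - y) *\<^sub>R f y)"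
    by (rule gcv_integrable[OF bounded_bilinear_scaleR kd(1,2) f])
  have "cv F f x - c *\<^sub>R a = (\<integral>y. F (x - y) *\<^sub>R f y \<partial>lborel) - (\<integral>y. F (x - y) *\<^sub>R a \<partial>lborel)"
    using i1 by (simp add: gcv_def)
  also have "\<dots> = (\<integral>y. F (x - y) *\<^sub>R (f y - a) \<partial>lborel)"
    unfolding scaleR_diff_right
    by (rule Bochner_Integration.integral_diff[symmetric]) (use i1 i2 in auto)
  also have "norm \<dots> \<le> (\<integral>y. F (x - y) * \<omega> \<partial>lborel)"
  proof (rule Bochner_Integration.integral_norm_bound_integral)
    show "integrable lborel (\<lambda>y. F (x - y) *\<^sub>R (f y - a))"
      unfolding scaleR_diff_right using i1 i2 by auto
    show "integrable lborel (\<lambda>y. F (x - y) * \<omega>)" using i1 by simp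
    show "norm (F (x - y) *\<^sub>R (f y - a)) \<le> F (x - y) * \<omega>" for y
    proof (cases "F (x - y) = 0")
      case False
      have "dist y x \<le> r" using kd(4)[OF False] by (simp add: dist_norm norm_minus_commute)
      from mult_left_mono[OF \<omega>[OF this] kd(3)[of "x - y"]] show ?thesis using kd(3)[of "x - y"] by simp
    qed simp
  qed
  also have "\<dots> = c * \<omega>" using i1 by simp
  finally show ?thesis .
qed

lemma kernel_cv_zero:
  assumes k: "kernel F r c" and f: "\<And>y. dist y x \<le> r \<Longrightarrow> f y = 0"
  shows "cv F f x = 0"
proof -
  have "F (x - y) *\<^sub>R f y = 0" for y
    using kernelD(4)[OF k, of "x - y"] f[of y] by (cases "F (x - y) = 0") (auto simp: dist_norm norm_minus_commute)
  then have "(\<lambda>y. F (x - y) *\<^sub>R f y) = (\<lambda>y. 0)" by blast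
  then show ?thesis by (simp add: gcv_def)
qed

lemma kernel_approx_continuous:
  fixes f :: "'a::euclidean_space \<Rightarrow> 'b::euclidean_space" and F :: "nat \<Rightarrow> 'a \<Rightarrow> real"
  assumes k: "\<And>n. kernel (F n) (r n) c" and r: "r \<longlonglongrightarrow> 0" and f: "continuous_on UNIV f" "cpt_supp f"
  shows "(\<lambda>n. nrm (\<lambda>x. cv (F n) f x - c *\<^sub>R f x)) \<longlonglongrightarrow> 0"
proof (rule LIMSEQ_I)
  fix e :: real assume e: "e > 0"
  obtain s where s: "\<And>x. f x \<noteq> 0 \<Longrightarrow> norm x \<le> s" using f(2) by (auto simp: cpt_supp_def)
  have c0: "c \<ge> 0" using kernelD(9)[OF k] .
  define V where "V = sqrt (measure lborel (cball (0::'a) (s + 1)))"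
  have V0: "V \<ge> 0" by (simp add: V_def)
  define \<omega> where "\<omega> = e / (2 * (c * V + 1))"
  have cV: "c * V \<ge> 0" using c0 V0 by simp
  have \<omega>: "\<omega> > 0" "c * \<omega> * V < e"
  proof -
    show "\<omega> > 0" using e cV by (auto simp: \<omega>_def)
    have "c * \<omega> * V = e * (c * V / (2 * (c * V + 1)))" by (simp add: \<omega>_def)
    also have "\<dots> < e * 1" using e cV by (intro mult_strict_left_mono) (auto simp: field_simps)
    finally show "c * \<omega> * V < e" by simp
  qed
  obtain d where d: "d > 0" "\<And>x x'. dist x' x < d \<Longrightarrow> dist (f x') (f x) < \<omega>"
    using cpt_supp_uniformly_continuous[OF f] \<omega>(1) unfolding uniformly_continuous_on_def by (metis UNIV_I)
  obtain n0 where n0: "\<And>n. n \<ge> n0 \<Longrightarrow> \<bar>r n\<bar> < min d 1"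
    using LIMSEQ_D[OF r, of "min d 1"] d(1) by auto
  have "nrm (\<lambda>x. cv (F n) f x - c *\<^sub>R f x) < e" if n: "n \<ge> n0" for n
  proof -
    have rn: "r n < d" "r n < 1" using n0[OF n] by auto
    have lf: "loc_int f" by (rule loc_int_continuous[OF f(1)])
    have "nrm (\<lambda>x. cv (F n) f x - c *\<^sub>R f x) \<le> (c * \<omega>) * V"
      unfolding V_def
    proof (rule nrm_bound_cball(2))
      show "(\<lambda>x. cv (F n) f x - c *\<^sub>R f x) \<in> borel_measurable borel"
        by (intro borel_measurable_continuous_onI continuous_intros f(1)
            continuous_gcv[OF bounded_bilinear_scaleR kernelD(1,2)[OF k] lf])
      show "norm (cv (F n) f x - c *\<^sub>R f x) \<le> c * \<omega>" for x
        by (rule kernel_cv_sup[OF k lf])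
           (use d(2)[of _ x] rn in \<open>metis dist_norm le_less_trans less_imp_le\<close>)
      show "cv (F n) f x - c *\<^sub>R f x = 0" if "norm x > s + 1" for x
      proof -
        have "f y = 0" if "dist y x \<le> r n" for y
        proof (rule ccontr)
          assume "f y \<noteq> 0"
          then have "norm y \<le> s" by (rule s)
          moreover have "norm x \<le> norm y + dist y x" by (simp add: dist_norm) norm
          ultimately show False using that rn \<open>norm x > s + 1\<close> by linarith
        qed
        then have "cv (F n) f x = 0" by (rule kernel_cv_zero[OF k])
        moreover have "f x = 0" using s[of x] that by force
        ultimately show ?thesis by simp
      qed
    qed
    then show ?thesis using \<omega>(2) by simp
  qed
  then show "\<exists>no. \<forall>n\<ge>no. norm (nrm (\<lambda>x. cv (F n) f x - c *\<^sub>R f x) - 0) < e"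
    by (intro exI[of _ n0]) (simp add: abs_of_nonneg[OF nrm_nonneg])
qed

text \<open>Density argument: the convolutions are bounded on L2 by \<open>c\<close>, uniformly in
  \<open>n\<close>, so it is enough to treat a continuous function of compact support close to
  \<open>w\<close>.\<close>

lemma kernel_approx:
  fixes w :: "'a::euclidean_space \<Rightarrow> 'b::euclidean_space" and F :: "nat \<Rightarrow> 'a \<Rightarrow> real"
  assumes k: "\<And>n. kernel (F n) (r n) c" and r: "r \<longlonglongrightarrow> 0" and w: "sqint w"
  shows "(\<lambda>n. nrm (\<lambda>x. cv (F n) w x - c *\<^sub>R w x)) \<longlonglongrightarrow> 0"
proof (rule LIMSEQ_I)
  fix e :: real assume e: "e > 0"
  have c0: "c \<ge> 0" using kernelD(9)[OF k] .
  define e' where "e' = e / (3 * (c + 1))"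
  have e': "e' > 0" "2 * (c * e') < 2 * e / 3"
    using e c0 by (auto simp: e'_def field_simps)
  obtain g where g: "continuous_on UNIV g" "cpt_supp g" "nrm (\<lambda>x. w x - g x) < e'"
    by (rule sqint_approximation[OF w e'(1)])
  have sg: "sqint g" by (rule continuous_sqint[OF g(1,2)])
  have sd: "sqint (\<lambda>x. w x - g x)" by (rule sqint_diff(1)[OF w sg])
  obtain n0 where n0: "\<And>n. n \<ge> n0 \<Longrightarrow> nrm (\<lambda>x. cv (F n) g x - c *\<^sub>R g x) < e / 3"
    using LIMSEQ_D[OF kernel_approx_continuous[OF k r g(1,2)], of "e / 3"] e by (auto simp: nrm_nonneg)
  have "nrm (\<lambda>x. cv (F n) w x - c *\<^sub>R w x) < e" if n: "n \<ge> n0" for n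
  proof -
    note kc = kernel_cv[OF k[of n]]
    have eq: "cv (F n) w x - c *\<^sub>R w x = (cv (F n) (\<lambda>x. w x - g x) x + (cv (F n) g x - c *\<^sub>R g x)) - c *\<^sub>R (w x - g x)" for x
      using cv_diff[OF kernelD(1,2)[OF k[of n]] sqint_loc_int[OF w] sqint_loc_int[OF sg]]
      by (simp add: algebra_simps)
    have s1: "sqint (\<lambda>x. cv (F n) g x - c *\<^sub>R g x)"
      by (intro sqint_diff(1) kc(1) sg sqint_scaleR(1))
    have "nrm (\<lambda>x. cv (F n) w x - c *\<^sub>R w x) \<le> (nrm (cv (F n) (\<lambda>x. w x - g x)) + nrm (\<lambda>x. cv (F n) g x - c *\<^sub>R g x)) + \<bar>c\<bar> * nrm (\<lambda>x. w x - g x)"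
      unfolding eq
      using sqint_diff(2)[OF sqint_add(1)[OF kc(1)[OF sd] s1] sqint_scaleR(1)[OF sd, of c]]
        sqint_add(2)[OF kc(1)[OF sd] s1] sqint_scaleR(2)[OF sd, of c] by linarith
    also have "\<dots> \<le> (c * nrm (\<lambda>x. w x - g x) + e / 3) + c * nrm (\<lambda>x. w x - g x)"
      using kc(2)[OF sd] n0[OF n] c0 by simp
    also have "\<dots> \<le> (c * e' + e / 3) + c * e'"
      using mult_left_mono[OF less_imp_le[OF g(3)] c0] by linarith
    also have "\<dots> < e" using e' by simp
    finally show ?thesis .
  qed
  then show "\<exists>no. \<forall>n\<ge>no. norm (nrm (\<lambda>x. cv (F n) w x - c *\<^sub>R w x) - 0) < e"
    by (intro exI[of _ n0]) (simp add: abs_of_nonneg[OF nrm_nonneg])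
qed

section \<open>Divergence-free correction of a test field\<close>

text \<open>At the seam the two one-sided difference quotients have a common limit, because values
  and derivatives of both branches agree there.\<close>

lemma DERIV_glue:
  fixes f g :: "real \<Rightarrow> real"
  assumes f: "\<And>s. s \<le> a \<Longrightarrow> (f has_real_derivative f' s) (at s)"
    and g: "\<And>s. s \<ge> a \<Longrightarrow> (g has_real_derivative g' s) (at s)"
    and eq: "f a = g a" "f' a = g' a"
  shows "((\<lambda>s. if s \<le> a then f s else g s) has_real_derivative (if s \<le> a then f' s else g' s)) (at s)"
proof -
  consider "s < a" | "s > a" | "s = a" by linarith
  then show ?thesis
  proof cases
    case 1
    then show ?thesis
      using has_field_derivative_transform_within_open[OF f[of s] open_lessThan[of a]] by auto
  next
    case 2
    then show ?thesis
      using has_field_derivative_transform_within_open[OF g[of s] open_greaterThan[of a]] by auto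
  next
    case 3
    define F where "F s = (if s \<le> a then f s else g s)" for s
    have "((\<lambda>h. (F (a + h) - F a) / h) \<longlongrightarrow> f' a) (at_left 0)"
      by (rule Lim_transform_eventually[OF filterlim_mono[OF f[of a, unfolded DERIV_def] order_refl at_le]])
         (auto simp: F_def eventually_at_filter)
    moreover have "((\<lambda>h. (F (a + h) - F a) / h) \<longlongrightarrow> f' a) (at_right 0)"
      unfolding eq(2)
      by (rule Lim_transform_eventually[OF filterlim_mono[OF g[of a, unfolded DERIV_def] order_refl at_le]])
         (auto simp: F_def eventually_at_filter eq)
    ultimately have "(F has_real_derivative f' a) (at a)"
      unfolding DERIV_def by (rule filterlim_split_at)
    then show ?thesis by (simp add: F_def[abs_def] 3)
  qed
qed

text \<open>The Newtonian profile \<open>s powr (-1/2)\<close>, as a function of \<open>s = |x|\<^sup>2\<close>, is continued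
  below \<open>s = 1\<close> by its second Taylor polynomial, which makes it twice continuously differentiable.\<close>

definition newt :: "real \<Rightarrow> real" where
  "newt s = (if s \<le> 1 then 15/8 - 5/4 * s + 3/8 * s\<^sup>2 else s powr (-1/2))"

definition newt' :: "real \<Rightarrow> real" where
  "newt' s = (if s \<le> 1 then - 5/4 + 3/4 * s else - 1/2 * s powr (-3/2))"

text \<open>The \<open>max\<close> unites both branches: up to \<open>s = 1\<close> the second
  derivative is the constant 3/4.\<close>

definition newt'' :: "real \<Rightarrow> real" where
  "newt'' s = 3/4 * (max s 1) powr (-5/2)"

lemma DERIV_newt: "(newt has_real_derivative newt' s) (at s)"
  unfolding newt_def[abs_def] newt'_def
  by (rule DERIV_glue) (auto intro!: derivative_eq_intros)

lemma DERIV_newt': "(newt' has_real_derivative newt'' s) (at s)"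
proof -
  have "(newt' has_real_derivative (if s \<le> 1 then 3/4 else 3/4 * s powr (-5/2))) (at s)"
    unfolding newt'_def[abs_def]
    by (rule DERIV_glue) (auto intro!: derivative_eq_intros)
  moreover have "(if s \<le> 1 then 3/4 else 3/4 * s powr (-5/2)) = newt'' s"
    by (auto simp: newt''_def max_def)
  ultimately show ?thesis by simp
qed

text \<open>The factors \<open>1 / r\<^sup>2\<close> and \<open>1 / r\<close> are matched so that
  the kernel equals \<open>1 / norm x\<close> beyond radius \<open>r\<close>, whatever
  \<open>r\<close> is (\<open>newt_kernel_outside\<close>).\<close>

definition newt_kernel :: "real \<Rightarrow> R3 \<Rightarrow> real" where
  "newt_kernel r x = newt ((1 / r\<^sup>2) * (x \<bullet> x)) / r"

text \<open>Minus the Laplacian of \<open>newt_kernel r\<close>, hence the density that generates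
  the regularised potential. Its mass is the same for all \<open>r\<close> (it is 4 pi), so up to
  this factor it is an approximate identity as \<open>r\<close> tends to 0.\<close>

definition kap :: "real \<Rightarrow> R3 \<Rightarrow> real" where
  "kap r x = 15/2 * max 0 (1 - (1 / r\<^sup>2) * (x \<bullet> x)) / r ^ 3"

lemma smooth_scaled_square: "smooth (\<lambda>x::R3. c * (x \<bullet> x))"
  using smooth_quadratic[of 0 "- c"] by simp

lemma newt_compose:
  fixes c :: real
  defines "q \<equiv> \<lambda>x::R3. c * (x \<bullet> x)"
  shows "Ck 2 (\<lambda>x. newt (q x))"
    and "partial_deriv i (\<lambda>x. newt (q x)) x = newt' (q x) * (2 * c * x $ i)"
    and "partial_deriv i (\<lambda>x. newt' (q x) * (2 * c * x $ i)) x = newt'' (q x) * (2 * c * x $ i)\<^sup>2 + newt' (q x) * (2 * c)"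
proof -
  have sq: "smooth q" unfolding q_def by (rule smooth_scaled_square)
  have Dq: "(q has_derivative (\<lambda>v. c * (x \<bullet> v + v \<bullet> x))) (at x)" for x
    unfolding q_def by (auto intro!: derivative_eq_intros)
  have "continuous_on UNIV newt''"
    unfolding newt''_def[abs_def] by (intro continuous_intros) auto
  then have "Ck 0 (\<lambda>x. newt'' (q x))"
    using smooth_continuous[OF sq] by (auto intro: continuous_on_compose2)
  then have "Ck (Suc 0) (\<lambda>x. newt' (q x))"
    by (rule Ck_Suc_compose_real(1)[OF DERIV_newt' _ sq])
  then have "Ck (Suc (Suc 0)) (\<lambda>x. newt (q x))"
    by (rule Ck_Suc_compose_real(1)[OF DERIV_newt _ sq])
  then show "Ck 2 (\<lambda>x. newt (q x))" by (simp only: numeral_2_eq_2)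
  show "partial_deriv i (\<lambda>x. newt (q x)) x = newt' (q x) * (2 * c * x $ i)"
    using partial_eqI[OF compose_real_has_derivative[OF DERIV_newt Dq], of i x]
    by (simp add: inner_axis inner_axis')
  have "((\<lambda>x. newt' (q x) * (2 * c * x $ i)) has_derivative
      (\<lambda>v. newt' (q x) * (2 * c * v $ i) + newt'' (q x) * (c * (x \<bullet> v + v \<bullet> x)) * (2 * c * x $ i))) (at x)"
    by (rule has_derivative_mult[OF compose_real_has_derivative[OF DERIV_newt' Dq]])
       (rule bounded_linear_imp_has_derivative[OF bounded_linear_compose[OF bounded_linear_mult_right bounded_linear_vec_nth]])
  from partial_eqI[OF this, of i]
  show "partial_deriv i (\<lambda>x. newt' (q x) * (2 * c * x $ i)) x = newt'' (q x) * (2 * c * x $ i)\<^sup>2 + newt' (q x) * (2 * c)"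
    by (simp add: inner_axis inner_axis' power2_eq_square)
qed

lemma inner_R3: "(x::R3) \<bullet> x = (\<Sum>i\<in>UNIV. (x $ i)\<^sup>2)"
  by (simp add: inner_vec_def power2_eq_square)

text \<open>The left side is the three-dimensional Laplacian of a radial function written in the
  variable \<open>s = |x|\<^sup>2\<close>. The profile \<open>s powr (-1/2)\<close> is harmonic, so
  only the Taylor polynomial below \<open>s = 1\<close> contributes.\<close>

lemma newt_laplace:
  assumes s: "s \<ge> 0"
  shows "4 * s * newt'' s + 6 * newt' s = - (15/2) * max 0 (1 - s)"
proof (cases "s \<le> 1")
  case True
  then show ?thesis by (simp add: newt''_def newt'_def max_def field_simps)
next
  case False
  have "s * s powr (-5/2) = s powr (-3/2)"
    using powr_mult_base[OF s, of "-5/2"] by simp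
  then have "4 * s * newt'' s = 3 * s powr (-3/2)"
    using False by (simp add: newt''_def max_def)
  then show ?thesis using False by (simp add: newt'_def max_def)
qed

lemma newt_kernel_derivs:
  assumes r: "r > 0"
  shows "Ck 2 (newt_kernel r)"
    and "Ck (Suc 0) (partial_deriv i (newt_kernel r))"
    and "(\<Sum>i\<in>UNIV. partial_deriv i (partial_deriv i (newt_kernel r)) x) = - kap r x"
proof -
  define c where "c = 1 / r\<^sup>2"
  have nk: "newt_kernel r = (\<lambda>x. (1 / r) * newt (c * (x \<bullet> x)))"
    by (simp add: newt_kernel_def c_def fun_eq_iff)
  show C2: "Ck 2 (newt_kernel r)"
    unfolding nk by (rule Ck_bounded_linear[OF bounded_linear_mult_right newt_compose(1)])
  then show C1: "Ck (Suc 0) (partial_deriv i (newt_kernel r))" for i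
    unfolding partial_deriv_def[abs_def] numeral_2_eq_2 by (simp add: axis_in_Basis_iff)
  have D: "(f has_derivative frechet_derivative f (at x)) (at x)" if "Ck (Suc 0) f" for f :: "R3 \<Rightarrow> real" and x
    by (rule Ck_Suc_has_derivative[OF that])
  have scale: "partial_deriv i (\<lambda>x. a * f x) x = a * partial_deriv i f x" if "Ck (Suc 0) f" for f :: "R3 \<Rightarrow> real" and i x a
  proof -
    have "((\<lambda>x. a * f x) has_derivative (\<lambda>h. a * frechet_derivative f (at x) h)) (at x)"
      by (rule has_derivative_mult_right[OF D[OF that]])
    from partial_eqI[OF this, of i] show ?thesis by (simp add: partial_deriv_def)
  qed
  have C2': "Ck (Suc (Suc 0)) (\<lambda>x::R3. newt (c * (x \<bullet> x)))" using newt_compose(1)[of c] by (simp only: numeral_2_eq_2)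
  have 1: "partial_deriv i (newt_kernel r) = (\<lambda>x. (1 / r) * (newt' (c * (x \<bullet> x)) * (2 * c * x $ i)))" for i
    unfolding nk fun_eq_iff by (intro allI) (simp only: scale[OF Ck_SucD[OF C2']] newt_compose(2))
  have C1': "Ck (Suc 0) (\<lambda>x::R3. newt' (c * (x \<bullet> x)) * (2 * c * x $ i))" for i
  proof -
    have "partial_deriv i (\<lambda>x::R3. newt (c * (x \<bullet> x))) = (\<lambda>x. newt' (c * (x \<bullet> x)) * (2 * c * x $ i))"
      unfolding fun_eq_iff by (intro allI newt_compose(2))
    moreover have "Ck (Suc 0) (partial_deriv i (\<lambda>x::R3. newt (c * (x \<bullet> x))))"
      using C2' unfolding partial_deriv_def[abs_def] by (simp add: axis_in_Basis_iff)
    ultimately show ?thesis by simp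
  qed
  have 2: "partial_deriv i (partial_deriv i (newt_kernel r)) x =
     (1 / r) * (newt'' (c * (x \<bullet> x)) * (2 * c * x $ i)\<^sup>2 + newt' (c * (x \<bullet> x)) * (2 * c))" for i
    unfolding 1 by (simp only: scale[OF C1'] newt_compose(3))
  have "(\<Sum>i\<in>UNIV. partial_deriv i (partial_deriv i (newt_kernel r)) x)
     = (1 / r) * (newt'' (c * (x \<bullet> x)) * (4 * c\<^sup>2 * (x \<bullet> x)) + 6 * c * newt' (c * (x \<bullet> x)))"
  proof -
    define A B where "A = newt'' (c * (x \<bullet> x))" and "B = newt' (c * (x \<bullet> x))"
    have "x \<bullet> x = (x $ 1)\<^sup>2 + (x $ 2)\<^sup>2 + (x $ 3)\<^sup>2"
      unfolding inner_R3 by (simp add: sum_3)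
    then show ?thesis
      unfolding 2 A_def[symmetric] B_def[symmetric]
      by (simp add: sum_3 power_mult_distrib algebra_simps add_divide_distrib)
  qed
  also have "\<dots> = (c / r) * (4 * (c * (x \<bullet> x)) * newt'' (c * (x \<bullet> x)) + 6 * newt' (c * (x \<bullet> x)))"
    by (simp add: field_simps power2_eq_square)
  also have "\<dots> = - kap r x"
    by (subst newt_laplace) (auto simp: c_def kap_def power2_eq_square power3_eq_cube)
  finally show "(\<Sum>i\<in>UNIV. partial_deriv i (partial_deriv i (newt_kernel r)) x) = - kap r x" .
qed

lemma newt_kernel_outside:
  assumes "r > 0" "norm x \<ge> r"
  shows "newt_kernel r x = 1 / norm x"
proof -
  have ge: "(1 / r\<^sup>2) * (x \<bullet> x) \<ge> 1"
    using assms power_mono[of r "norm x" 2] by (simp add: dot_square_norm)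
  have "newt ((1 / r\<^sup>2) * (x \<bullet> x)) = ((norm x / r) ^ 2) powr (-1/2)"
    using ge by (auto simp: newt_def dot_square_norm power_divide)
  also have "\<dots> = inverse (sqrt ((norm x / r) ^ 2))"
    by (simp add: powr_minus powr_half_sqrt)
  also have "\<dots> = r / norm x" using assms by simp
  finally show ?thesis using assms by (simp add: newt_kernel_def)
qed

definition kap_mass :: real where "kap_mass = (\<integral>x. kap 1 x \<partial>lborel)"

lemma kap_cont: "r > 0 \<Longrightarrow> continuous_on UNIV (kap r)"
  unfolding kap_def[abs_def] by (intro continuous_intros) auto

lemma kap_supp: "r > 0 \<Longrightarrow> kap r x \<noteq> 0 \<Longrightarrow> norm x \<le> r"
proof (rule ccontr)
  assume r: "r > 0" "kap r x \<noteq> 0" "\<not> norm x \<le> r"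
  then have "(1 / r\<^sup>2) * (x \<bullet> x) \<ge> 1"
    using power_mono[of r "norm x" 2] by (simp add: dot_square_norm)
  with r show False by (simp add: kap_def)
qed

lemma kap_nonneg: "r > 0 \<Longrightarrow> kap r x \<ge> 0"
  by (simp add: kap_def)

lemma kap_le: "r > 0 \<Longrightarrow> kap r x \<le> 15/2 / r ^ 3"
  by (auto simp: kap_def intro!: divide_right_mono)

lemma kap_mass_pos: "kap_mass > 0"
  unfolding kap_mass_def
proof (rule integral_pos_continuous[where a=0])
  show "integrable lborel (kap 1)"
    by (rule integrable_cpt_supp[OF kap_cont]) (use kap_supp[of 1] in \<open>auto simp: cpt_supp_def\<close>)
  show "continuous_on UNIV (kap 1)" "\<And>x. kap 1 x \<ge> 0"
    by (auto intro: kap_cont kap_nonneg)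
  show "kap 1 0 > 0" by (simp add: kap_def)
qed

lemma kernel_kap: "r > 0 \<Longrightarrow> kernel (kap r) r kap_mass"
proof -
  assume r: "r > 0"
  have "(\<integral>x. kap r x \<partial>lborel) = r ^ 3 * (\<integral>x. kap r (r *\<^sub>R x) \<partial>lborel)"
    using integral_scale[OF borel_measurable_continuous_onI[OF kap_cont[OF r]] r] by simp
  moreover have "kap r (r *\<^sub>R x) = kap 1 x / r ^ 3" for x
    using r by (simp add: kap_def power2_eq_square)
  ultimately have "(\<integral>x. kap r x \<partial>lborel) = kap_mass"
    using r by (simp add: kap_mass_def)
  moreover have "kap r (- x) = kap r x" for x by (simp add: kap_def)
  ultimately show ?thesis
    unfolding kernel_def using r kap_cont kap_nonneg kap_supp by blast
qed

text \<open>The maximum \<open>15/2 / r ^ 3\<close> times the fixed mass bounds the squared norm: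
  the kernel spreads out and disappears in L2 although its L1 norm stays the same.\<close>

lemma nrm_kap_tendsto_0: "(\<lambda>n. nrm (kap (real (Suc n)))) \<longlonglongrightarrow> 0"
proof -
  have b: "nrm (kap r) \<le> sqrt (15/2 * kap_mass / r ^ 3)" if r: "r > 0" for r
  proof -
    note k = kernelD[OF kernel_kap[OF r]]
    have "(nrm (kap r))\<^sup>2 \<le> (\<integral>x. 15/2 / r ^ 3 * kap r x \<partial>lborel)"
      unfolding nrm_sq
    proof (rule integral_mono)
      show "integrable lborel (\<lambda>x. (norm (kap r x))\<^sup>2)"
        using sqint_integrable[OF continuous_sqint[OF k(1,2)]] .
      show "integrable lborel (\<lambda>x. 15/2 / r ^ 3 * kap r x)" using k(8) by simp
      show "(norm (kap r x))\<^sup>2 \<le> 15/2 / r ^ 3 * kap r x" for x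
        using mult_right_mono[OF kap_le[OF r, of x] kap_nonneg[OF r, of x]] by (simp add: power2_eq_square)
    qed
    then have "(nrm (kap r))\<^sup>2 \<le> 15/2 * kap_mass / r ^ 3" using k(5) by simp
    then show ?thesis by (rule real_le_rsqrt)
  qed
  have "(\<lambda>n. sqrt (15/2 * kap_mass / real (Suc n) ^ 3)) \<longlonglongrightarrow> sqrt 0"
    by (intro tendsto_real_sqrt) real_asymp
  then have L: "(\<lambda>n. sqrt (15/2 * kap_mass / real (Suc n) ^ 3)) \<longlonglongrightarrow> 0" by simp
  show ?thesis
  proof (rule tendsto_sandwich[OF _ _ tendsto_const L])
    show "\<forall>\<^sub>F n in sequentially. 0 \<le> nrm (kap (real (Suc n)))" by (simp add: nrm_nonneg)
    show "\<forall>\<^sub>F n in sequentially. nrm (kap (real (Suc n))) \<le> sqrt (15/2 * kap_mass / real (Suc n) ^ 3)"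
      by (intro always_eventually allI b) simp
  qed
qed

section \<open>Gradient, divergence and Laplacian of convolutions\<close>

lemma partial_nth:
  fixes F :: "R3 \<Rightarrow> R3"
  shows "smooth F \<Longrightarrow> partial_deriv i (\<lambda>x. F x $ j) x = partial_deriv i F x $ j"
  by (rule partial_linear[OF bounded_linear_vec_nth])

lemma smooth_nth:
  fixes F :: "R3 \<Rightarrow> R3"
  shows "smooth F \<Longrightarrow> smooth (\<lambda>x. F x $ j)"
  by (rule smooth_bounded_linear[OF bounded_linear_vec_nth])

lemma grad_eq: "grad g x = (\<Sum>i\<in>UNIV. partial_deriv i g x *\<^sub>R axis i 1)"
  by (simp add: grad_def vec_eq_iff axis_def if_distrib cong: if_cong)

lemma test_grad: "test_function g \<Longrightarrow> test_function (grad g)"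
  unfolding grad_eq[abs_def]
  by (intro test_sum test_bilinear_left[OF bounded_bilinear_scaleR] test_partial smooth_const) auto

lemma test_divergence: "test_function Y \<Longrightarrow> test_function (divergence Y)"
  unfolding divergence_def[abs_def]
  by (intro test_sum test_bounded_linear[OF bounded_linear_vec_nth] test_partial) auto

lemma test_laplacian: "test_function Y \<Longrightarrow> test_function (laplacian Y)"
  unfolding laplacian_def[abs_def] by (intro test_sum test_partial) auto

lemma partial_grad:
  assumes "smooth g"
  shows "partial_deriv i (grad g) x $ j = partial_deriv i (partial_deriv j g) x"
proof -
  have "smooth (grad g)"
    unfolding grad_eq[abs_def]
    by (intro smooth_sum smooth_scaleR smooth_partial assms smooth_const) auto
  then have "partial_deriv i (grad g) x $ j = partial_deriv i (\<lambda>x. grad g x $ j) x"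
    by (rule partial_nth[symmetric])
  then show ?thesis by (simp add: grad_def)
qed

lemma divergence_grad: "smooth g \<Longrightarrow> divergence (grad g) x = laplacian g x"
  by (simp add: divergence_def laplacian_def partial_grad)

lemma partial_cv:
  fixes Y :: "R3 \<Rightarrow> 'b::euclidean_space"
  assumes "loc_int F" "test_function Y"
  shows "partial_deriv i (cv F Y) = cv F (partial_deriv i Y)"
  by (rule partial_gcv_right[OF bounded_bilinear_scaleR assms(1) test_Ck test_cpt_supp]) (rule assms(2))+

text \<open>Here the regularity comes from \<open>Y\<close>, the kernel being just locally
  integrable with bounded support.\<close>

lemma test_cv:
  fixes Y :: "'a::euclidean_space \<Rightarrow> 'b::euclidean_space"
  assumes "loc_int F" "cpt_supp F" "test_function Y"
  shows "test_function (cv F Y)"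
proof -
  have "cv F Y = gcv (\<lambda>a b. b *\<^sub>R a) Y F"
    by (intro ext gcv_commute bounded_bilinear_scaleR loc_int_measurable[OF assms(1)] test_measurable[OF assms(3)])
  then show ?thesis
    using test_gcv[OF bounded_bilinear.flip[OF bounded_bilinear_scaleR] assms(3) assms(1,2)] by simp
qed

lemma kernel_loc_int: "kernel F r c \<Longrightarrow> loc_int F"
  by (rule loc_int_continuous[OF kernelD(1)])

lemma kernel_test_cv: "kernel F r c \<Longrightarrow> test_function Y \<Longrightarrow> test_function (cv F (Y :: _ \<Rightarrow> 'b::euclidean_space))"
  using test_cv kernel_loc_int kernelD(2) by blast

lemma cv_sum:
  fixes f :: "'i \<Rightarrow> 'a::euclidean_space \<Rightarrow> 'b::euclidean_space"
  assumes "continuous_on UNIV F" "cpt_supp F" "\<And>i. i \<in> I \<Longrightarrow> loc_int (f i)"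
  shows "cv F (\<lambda>x. \<Sum>i\<in>I. f i x) x = (\<Sum>i\<in>I. cv F (f i) x)"
  unfolding gcv_def scaleR_sum_right
  by (intro Bochner_Integration.integral_sum gcv_integrable[OF bounded_bilinear_scaleR] assms)

lemma laplacian_cv:
  fixes Y :: "R3 \<Rightarrow> 'b::euclidean_space"
  assumes k: "kernel F r c" and Y: "test_function Y"
  shows "laplacian (cv F Y) = cv F (laplacian Y)"
  unfolding laplacian_def[abs_def]
  by (simp add: partial_cv[OF kernel_loc_int[OF k]] Y test_partial fun_eq_iff
      cv_sum[OF kernelD(1,2)[OF k]] test_loc_int)

lemma cv_nth:
  fixes Y :: "R3 \<Rightarrow> R3"
  assumes "continuous_on UNIV F" "cpt_supp F" "loc_int Y"
  shows "cv F Y x $ j = cv F (\<lambda>y. Y y $ j) x"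
proof -
  have "integrable lborel (\<lambda>y. F (x - y) *\<^sub>R Y y)"
    by (rule gcv_integrable[OF bounded_bilinear_scaleR assms])
  from integral_bounded_linear[OF bounded_linear_vec_nth this, of j]
  show ?thesis by (simp add: gcv_def)
qed

lemma divergence_cv:
  assumes k: "kernel F r c" and Y: "test_function Y"
  shows "divergence (cv F Y) x = cv F (divergence Y) x"
  unfolding divergence_def[abs_def] partial_cv[OF kernel_loc_int[OF k] Y]
  by (simp add: cv_nth[OF kernelD(1,2)[OF k]] Y test_partial test_loc_int cv_sum[OF kernelD(1,2)[OF k]]
      test_bounded_linear[OF bounded_linear_vec_nth])

text \<open>A Helmholtz projection at finite scales: \<open>\<psi>\<close> is the convolution of
  \<open>divergence Y\<close> with the difference of the kernels at scales \<open>R\<close> and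
  \<open>r\<close>, so its Laplacian is the divergence of
  \<open>cv (kap r) Y - cv (kap R) Y\<close>. As \<open>r\<close> tends to 0 and \<open>R\<close> to
  infinity, the first of these convolutions tends to \<open>kap_mass\<close> times \<open>Y\<close>
  and the second one vanishes.\<close>

lemma div_free_correction:
  fixes Y :: "R3 \<Rightarrow> R3"
  assumes rR: "0 < r" "r \<le> R" and Y: "test_function Y"
  obtains \<psi> where "test_function \<psi>"
    "laplacian \<psi> = (\<lambda>x. cv (kap r) (divergence Y) x - cv (kap R) (divergence Y) x)"
    "\<And>x. divergence (\<lambda>x. cv (kap r) Y x - cv (kap R) Y x - grad \<psi> x) x = 0"
proof -
  define K where "K x = newt_kernel R x - newt_kernel r x" for x
  define f where "f = divergence Y"
  define \<psi> where "\<psi> = cv K f"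
  have R: "R > 0" using rR by simp
  have f: "test_function f" unfolding f_def by (rule test_divergence[OF Y])
  have C2: "Ck (Suc (Suc 0)) (newt_kernel R)" "Ck (Suc (Suc 0)) (newt_kernel r)"
    using newt_kernel_derivs(1)[OF R] newt_kernel_derivs(1)[OF rR(1)] by (simp_all only: numeral_2_eq_2)
  have Cdiff: "Ck k (\<lambda>x. F x - G x)" if "Ck k F" "Ck k G" for k and F G :: "R3 \<Rightarrow> real"
    using Ck_add[OF that(1) Ck_bounded_linear[OF bounded_linear_minus[OF bounded_linear_ident] that(2)]] by simp
  have CK: "Ck (Suc (Suc 0)) K"
    unfolding K_def[abs_def] by (rule Cdiff[OF C2])
  have contK: "continuous_on UNIV K" by (rule Ck_continuous[OF CK])
  \<comment> \<open>Both kernels equal \<open>1 / norm x\<close> beyond \<open>R\<close>, so they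
    cancel there; this makes \<open>\<psi>\<close> a test function.\<close>
  have "K x = 0" if "\<not> norm x \<le> R" for x
    using newt_kernel_outside[OF R, of x] newt_kernel_outside[OF rR(1), of x] rR(2) that by (simp add: K_def)
  then have csK: "cpt_supp K"
    unfolding cpt_supp_def by blast
  have lf: "loc_int f" by (rule test_loc_int[OF f])
  have t\<psi>: "test_function \<psi>"
    unfolding \<psi>_def by (rule test_cv[OF loc_int_continuous[OF contK] csK f])
  have pK: "partial_deriv i K = (\<lambda>x. partial_deriv i (newt_kernel R) x - partial_deriv i (newt_kernel r) x)" for i
    unfolding K_def[abs_def] fun_eq_iff
    using partial_eqI[OF has_derivative_diff[OF Ck_Suc_has_derivative[OF C2(1)] Ck_Suc_has_derivative[OF C2(2)]]]
    by (simp add: partial_deriv_def)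
  note C1 = newt_kernel_derivs(2)[OF R] newt_kernel_derivs(2)[OF rR(1)]
  have CpK: "Ck (Suc 0) (partial_deriv i K)" for i
    unfolding pK by (rule Cdiff[OF C1])
  have ppK: "partial_deriv i (partial_deriv i K) x =
     partial_deriv i (partial_deriv i (newt_kernel R)) x - partial_deriv i (partial_deriv i (newt_kernel r)) x" for i x
    unfolding pK
    using partial_eqI[OF has_derivative_diff[OF Ck_Suc_has_derivative[OF C1(1)[of i]] Ck_Suc_has_derivative[OF C1(2)[of i]]]]
    by (simp add: partial_deriv_def)
  \<comment> \<open>\<open>K\<close> is only twice continuously differentiable, just enough to carry
    both derivatives here; the smoothness of \<open>\<psi>\<close> rests on \<open>f\<close>
    instead.\<close>
  have p2: "partial_deriv i (partial_deriv i \<psi>) = cv (partial_deriv i (partial_deriv i K)) f" for i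
    unfolding \<psi>_def
    using partial_gcv[OF bounded_bilinear_scaleR Ck_SucD[OF CK] csK lf]
      partial_gcv[OF bounded_bilinear_scaleR CpK cpt_supp_partial[OF csK] lf] by simp
  note kr = kernel_kap[OF rR(1)] and kR = kernel_kap[OF R]
  have contppK: "continuous_on UNIV (partial_deriv i (partial_deriv i K))" for i
    using CpK[of i] unfolding partial_deriv_def[of i "partial_deriv i K", abs_def] by (simp add: axis_in_Basis_iff)
  have lap: "laplacian \<psi> x = cv (kap r) f x - cv (kap R) f x" for x
  proof -
    have "laplacian \<psi> x = (\<Sum>i\<in>UNIV. \<integral>y. partial_deriv i (partial_deriv i K) (x - y) *\<^sub>R f y \<partial>lborel)"
      unfolding laplacian_def p2 gcv_def ..
    also have "\<dots> = (\<integral>y. (\<Sum>i\<in>UNIV. partial_deriv i (partial_deriv i K) (x - y) *\<^sub>R f y) \<partial>lborel)"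
      by (intro Bochner_Integration.integral_sum[symmetric] gcv_integrable[OF bounded_bilinear_scaleR contppK _ lf]
          cpt_supp_partial csK)
    also have "\<dots> = (\<integral>y. kap r (x - y) *\<^sub>R f y - kap R (x - y) *\<^sub>R f y \<partial>lborel)"
      using newt_kernel_derivs(3)[OF R] newt_kernel_derivs(3)[OF rR(1)]
      by (simp add: ppK sum_subtractf scaleR_diff_left algebra_simps flip: sum_distrib_left sum_distrib_right)
    also have "\<dots> = cv (kap r) f x - cv (kap R) f x"
      unfolding gcv_def
      by (intro Bochner_Integration.integral_diff gcv_integrable[OF bounded_bilinear_scaleR _ _ lf] kernelD(1,2)[OF kr] kernelD(1,2)[OF kR])
    finally show ?thesis .
  qed
  have "divergence (\<lambda>x. cv (kap r) Y x - cv (kap R) Y x - grad \<psi> x) x = 0" for x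
  proof -
    have s: "smooth (cv (kap r) Y)" "smooth (cv (kap R) Y)" "smooth (grad \<psi>)"
      using kernel_test_cv[OF kr Y] kernel_test_cv[OF kR Y] test_grad[OF t\<psi>] test_smooth by blast+
    have "divergence (\<lambda>x. cv (kap r) Y x - cv (kap R) Y x - grad \<psi> x) x =
       divergence (cv (kap r) Y) x - divergence (cv (kap R) Y) x - divergence (grad \<psi>) x"
      by (simp add: divergence_def partial_diff s smooth_diff sum_subtractf)
    also have "\<dots> = 0"
      by (simp add: divergence_cv[OF kr Y] divergence_cv[OF kR Y] divergence_grad[OF test_smooth[OF t\<psi>]] lap f_def)
    finally show ?thesis .
  qed
  with t\<psi> lap that show ?thesis by (auto simp: f_def fun_eq_iff)
qed

section \<open>The right-hand side of the weak formulation\<close>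

text \<open>The Frobenius norm of the gradient at a point, for scalar and vector functions
  alike.\<close>

definition gn :: "(R3 \<Rightarrow> 'b::euclidean_space) \<Rightarrow> R3 \<Rightarrow> real" where
  "gn F x = sqrt (\<Sum>i\<in>UNIV. (norm (partial_deriv i F x))\<^sup>2)"

lemma gn_nonneg: "gn F x \<ge> 0"
  by (simp add: gn_def sum_nonneg)

lemma gn_sq: "(gn F x)\<^sup>2 = (\<Sum>i\<in>UNIV. (norm (partial_deriv i F x))\<^sup>2)"
  by (simp add: gn_def sum_nonneg)

lemma norm_sum_scaleR_le:
  fixes p :: "3 \<Rightarrow> 'b::euclidean_space"
  shows "norm (\<Sum>i\<in>UNIV. (a $ i) *\<^sub>R p i) \<le> norm (a::R3) * sqrt (\<Sum>i\<in>UNIV. (norm (p i))\<^sup>2)"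
proof -
  have "norm (\<Sum>i\<in>UNIV. (a $ i) *\<^sub>R p i) \<le> (\<Sum>i\<in>UNIV. \<bar>a $ i\<bar> * \<bar>norm (p i)\<bar>)"
    by (intro sum_norm_le) simp
  also have "\<dots> \<le> L2_set (\<lambda>i. a $ i) UNIV * L2_set (\<lambda>i. norm (p i)) UNIV"
    by (rule L2_set_mult_ineq)
  finally show ?thesis by (simp add: L2_set_def norm_vec_def)
qed

lemma norm_advect_le: "norm (advect a F x) \<le> norm (a x) * gn F x"
  unfolding advect_def gn_def by (rule norm_sum_scaleR_le)

lemma gn_measurable:
  assumes "\<And>i. partial_deriv i F \<in> borel_measurable borel"
  shows "gn F \<in> borel_measurable borel"
  unfolding gn_def[abs_def] using assms by measurable

lemma sqint_gn:
  assumes "\<And>i. sqint (partial_deriv i F)"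
  shows "sqint (gn F)" "(nrm (gn F))\<^sup>2 = (\<Sum>i\<in>UNIV. (nrm (partial_deriv i F))\<^sup>2)"
    "nrm (gn F) \<le> (\<Sum>i\<in>UNIV. nrm (partial_deriv i F))"
proof -
  have i: "integrable lborel (\<lambda>x. \<Sum>i\<in>UNIV. (norm (partial_deriv i F x))\<^sup>2)"
    by (intro Bochner_Integration.integrable_sum sqint_integrable assms)
  show "sqint (gn F)"
    using gn_measurable[OF sqint_measurable[OF assms]] i by (simp add: sqint_def gn_sq)
  show sq: "(nrm (gn F))\<^sup>2 = (\<Sum>i\<in>UNIV. (nrm (partial_deriv i F))\<^sup>2)"
    unfolding nrm_sq by (simp add: gn_sq Bochner_Integration.integral_sum sqint_integrable[OF assms])
  have "(\<Sum>i\<in>UNIV. (nrm (partial_deriv i F))\<^sup>2) \<le> (\<Sum>i\<in>UNIV. nrm (partial_deriv i F))\<^sup>2"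
    by (simp add: sum_3 power2_sum nrm_nonneg)
  then show "nrm (gn F) \<le> (\<Sum>i\<in>UNIV. nrm (partial_deriv i F))"
    unfolding sq[symmetric] by (rule power2_le_imp_le) (simp add: sum_nonneg nrm_nonneg)
qed

lemma test_gn:
  assumes "test_function (F :: R3 \<Rightarrow> 'b::euclidean_space)"
  shows "sqint (gn F)" "(nrm (gn F))\<^sup>2 = (\<Sum>i\<in>UNIV. (nrm (partial_deriv i F))\<^sup>2)"
    "nrm (gn F) \<le> (\<Sum>i\<in>UNIV. nrm (partial_deriv i F))"
  using sqint_gn[OF test_sqint[OF test_partial[OF assms]]] by auto

text \<open>Integrating by parts twice turns the square of a mixed derivative into the product of
  two pure ones, and the sum of these products over all index pairs is the square of the Laplacian.
  This takes the place of the L2 bound for Riesz transforms.\<close>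

lemma hessian_identity:
  fixes g :: "R3 \<Rightarrow> real"
  assumes g: "test_function g"
  shows "nrm (gn (grad g)) = nrm (laplacian g)"
proof -
  note p = test_partial[OF g] and pp = test_partial[OF test_partial[OF g]]
  note ppp = test_partial[OF test_partial[OF test_partial[OF g]]]
  have ibp: "(\<integral>x. partial_deriv i (partial_deriv j g) x * partial_deriv i (partial_deriv j g) x \<partial>lborel)
     = (\<integral>x. partial_deriv i (partial_deriv i g) x * partial_deriv j (partial_deriv j g) x \<partial>lborel)" for i j
  proof -
    have ib: "(\<integral>x. a x * partial_deriv i b x \<partial>lborel) = - (\<integral>x. partial_deriv i a x * b x \<partial>lborel)"
      if "test_function a" "test_function b" for a b :: "R3 \<Rightarrow> real" and i
      using integration_by_parts[OF bounded_bilinear_mult, of a b i] that by (auto simp: test_function_iff)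
    have "(\<integral>x. partial_deriv i (partial_deriv j g) x * partial_deriv i (partial_deriv j g) x \<partial>lborel)
        = - (\<integral>x. partial_deriv i (partial_deriv i (partial_deriv j g)) x * partial_deriv j g x \<partial>lborel)"
      by (rule ib[OF pp p])
    also have "partial_deriv i (partial_deriv i (partial_deriv j g)) = partial_deriv j (partial_deriv i (partial_deriv i g))"
      using partial_commute[OF g, of i j] partial_commute[OF p[of i], of i j] by simp
    also have "- (\<integral>x. partial_deriv j (partial_deriv i (partial_deriv i g)) x * partial_deriv j g x \<partial>lborel)
        = (\<integral>x. partial_deriv i (partial_deriv i g) x * partial_deriv j (partial_deriv j g) x \<partial>lborel)"
      using ib[OF pp p, of i i j j] by simp
    finally show ?thesis .
  qed
  have ii: "integrable lborel (\<lambda>x. a x * b x)" if "test_function a" "test_function b" for a b :: "R3 \<Rightarrow> real"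
    by (rule test_integrable[OF test_bilinear_left[OF bounded_bilinear_mult that(1) test_smooth[OF that(2)]]])
  have nv: "(norm v)\<^sup>2 = (\<Sum>j\<in>UNIV. v $ j * v $ j)" for v :: R3
    by (simp add: power2_norm_eq_inner inner_vec_def)
  have "(nrm (gn (grad g)))\<^sup>2 = (\<Sum>i\<in>UNIV. \<integral>x. (\<Sum>j\<in>UNIV. partial_deriv i (partial_deriv j g) x * partial_deriv i (partial_deriv j g) x) \<partial>lborel)"
    unfolding test_gn(2)[OF test_grad[OF g]] unfolding nrm_sq
    by (simp add: nv partial_grad[OF test_smooth[OF g]])
  also have "\<dots> = (\<Sum>i\<in>UNIV. \<Sum>j\<in>UNIV. \<integral>x. partial_deriv i (partial_deriv i g) x * partial_deriv j (partial_deriv j g) x \<partial>lborel)"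
    by (simp add: Bochner_Integration.integral_sum ii pp ibp)
  also have "\<dots> = (\<integral>x. (\<Sum>i\<in>UNIV. \<Sum>j\<in>UNIV. partial_deriv i (partial_deriv i g) x * partial_deriv j (partial_deriv j g) x) \<partial>lborel)"
    by (simp add: Bochner_Integration.integral_sum ii pp)
  also have "\<dots> = (nrm (laplacian g))\<^sup>2"
    unfolding nrm_sq by (simp add: laplacian_def power2_eq_square sum_product)
  finally show ?thesis
    using nrm_nonneg[of "gn (grad g)"] nrm_nonneg[of "laplacian g"] by (simp add: power2_eq_iff_nonneg)
qed

lemma laplacian_grad:
  assumes g: "test_function g"
  shows "laplacian (grad g) = grad (laplacian g)"
proof
  fix x
  have "laplacian (grad g) x $ j = grad (laplacian g) x $ j" for j
  proof -
    have s: "smooth (grad g)" by (rule test_smooth[OF test_grad[OF g]])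
    have "laplacian (grad g) x $ j = (\<Sum>i\<in>UNIV. partial_deriv i (partial_deriv i (grad g)) x $ j)"
      by (simp add: laplacian_def)
    also have "\<dots> = (\<Sum>i\<in>UNIV. partial_deriv i (\<lambda>x. partial_deriv i (grad g) x $ j) x)"
      using partial_nth[OF smooth_partial[OF s]] by simp
    also have "\<dots> = (\<Sum>i\<in>UNIV. partial_deriv i (partial_deriv i (partial_deriv j g)) x)"
      by (simp add: partial_grad[OF test_smooth[OF g]])
    also have "\<dots> = (\<Sum>i\<in>UNIV. partial_deriv j (partial_deriv i (partial_deriv i g)) x)"
    proof (rule sum.cong[OF refl])
      fix i
      show "partial_deriv i (partial_deriv i (partial_deriv j g)) x = partial_deriv j (partial_deriv i (partial_deriv i g)) x"
        using partial_commute[OF g, of i j] partial_commute[OF test_partial[OF g, of i], of i j] by simp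
    qed
    also have "\<dots> = partial_deriv j (laplacian g) x"
      unfolding laplacian_def[abs_def]
      by (rule partial_sum[symmetric]) (intro smooth_partial test_smooth[OF g])
    finally show ?thesis by (simp add: grad_def)
  qed
  then show "laplacian (grad g) x = grad (laplacian g) x" by (simp add: vec_eq_iff)
qed

section \<open>Viscous and convective functionals on L2\<close>

definition ip :: "(R3 \<Rightarrow> R3) \<Rightarrow> (R3 \<Rightarrow> R3) \<Rightarrow> real" where
  "ip w g = (\<integral>x. w x \<bullet> g x \<partial>lborel)"

definition mol :: "real \<Rightarrow> (R3 \<Rightarrow> R3) \<Rightarrow> R3 \<Rightarrow> R3" where
  "mol \<epsilon> w = cv (mollifier_eps \<epsilon>) w"

text \<open>The L2 size of the tensor product of transporting and transported velocity. The product
  stays undivided because its final bound is uniform in \<open>\<epsilon>\<close>, unlike a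
  pointwise bound of \<open>mol \<epsilon> w\<close>.\<close>

definition conv_norm :: "real \<Rightarrow> (R3 \<Rightarrow> R3) \<Rightarrow> real" where
  "conv_norm \<epsilon> w = nrm (\<lambda>x. norm (mol \<epsilon> w x) * norm (w x))"

text \<open>The rate of change of \<open>ip (u t) g\<close> for divergence-free \<open>g\<close>,
  with all derivatives on the test field.\<close>

definition rhs :: "real \<Rightarrow> (R3 \<Rightarrow> R3) \<Rightarrow> (R3 \<Rightarrow> R3) \<Rightarrow> real" where
  "rhs \<epsilon> w g = ip w (laplacian g) + ip w (advect (mol \<epsilon> w) g)"

lemma ip_diff_right: "sqint w \<Longrightarrow> sqint f \<Longrightarrow> sqint g \<Longrightarrow> ip w (\<lambda>x. f x - g x) = ip w f - ip w g"
  unfolding ip_def inner_diff_right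
  by (intro Bochner_Integration.integral_diff integrable_bilinear[OF bounded_bilinear_inner])

lemma ip_add_right: "sqint w \<Longrightarrow> sqint f \<Longrightarrow> sqint g \<Longrightarrow> ip w (\<lambda>x. f x + g x) = ip w f + ip w g"
  unfolding ip_def inner_add_right
  by (intro Bochner_Integration.integral_add integrable_bilinear[OF bounded_bilinear_inner])

lemma ip_diff_left: "sqint f \<Longrightarrow> sqint g \<Longrightarrow> sqint w \<Longrightarrow> ip (\<lambda>x. f x - g x) w = ip f w - ip g w"
  unfolding ip_def inner_diff_left
  by (intro Bochner_Integration.integral_diff integrable_bilinear[OF bounded_bilinear_inner])

lemma ip_le: "sqint w \<Longrightarrow> sqint g \<Longrightarrow> \<bar>ip w g\<bar> \<le> nrm w * nrm g"
  unfolding ip_def by (rule cauchy_schwarz_inner)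

lemma ip_scaleR_right: "ip w (\<lambda>x. c *\<^sub>R g x) = c * ip w g"
  by (simp add: ip_def)

lemma mol_measurable: "\<epsilon> > 0 \<Longrightarrow> sqint w \<Longrightarrow> mol \<epsilon> w \<in> borel_measurable borel"
  unfolding mol_def by (rule sqint_measurable[OF kernel_cv(1)[OF kernel_mollifier_eps]])

lemma mol_sup:
  assumes "\<epsilon> > 0" "sqint w"
  shows "norm (mol \<epsilon> w x) \<le> nrm (mollifier_eps \<epsilon>) * nrm w"
  unfolding mol_def
  by (rule gcv_sup_bound[OF bounded_bilinear_scaleR _ test_sqint[OF test_mollifier_eps] assms(2)]) (use assms in auto)

lemma mol_diff:
  assumes "\<epsilon> > 0" "sqint w" "sqint w'"
  shows "mol \<epsilon> (\<lambda>x. w x - w' x) x = mol \<epsilon> w x - mol \<epsilon> w' x"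
  unfolding mol_def
  using cv_diff[OF kernelD(1,2)[OF kernel_mollifier_eps] sqint_loc_int sqint_loc_int, of \<epsilon> w w'] assms by simp

lemma sqint_conv:
  assumes a: "a \<in> borel_measurable borel" "\<And>x. norm (a x :: R3) \<le> A" and w: "sqint (w :: R3 \<Rightarrow> R3)"
  shows "sqint (\<lambda>x. norm (a x) * norm (w x))" "nrm (\<lambda>x. norm (a x) * norm (w x)) \<le> A * nrm w"
proof -
  have A0: "A \<ge> 0" using a(2) norm_ge_zero order_trans by blast
  have m: "(\<lambda>x. norm (a x) * norm (w x)) \<in> borel_measurable borel"
    using a(1) sqint_measurable[OF w] by measurable
  show "sqint (\<lambda>x. norm (a x) * norm (w x))" "nrm (\<lambda>x. norm (a x) * norm (w x)) \<le> A * nrm w"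
    using sqint_bound[OF m w _ A0] a(2) by (auto simp: mult_right_mono)
qed

lemma advect_measurable:
  assumes "a \<in> borel_measurable borel" "smooth F"
  shows "advect a F \<in> borel_measurable borel"
proof -
  have [measurable]: "partial_deriv i F \<in> borel_measurable borel" for i
    by (rule smooth_measurable[OF smooth_partial[OF assms(2)]])
  have [measurable]: "(\<lambda>x. a x $ i) \<in> borel_measurable borel" for i
    using assms(1) by (simp add: cart_eq_inner_axis)
  show ?thesis unfolding advect_def[abs_def] by measurable
qed

lemma sqint_advect:
  assumes a: "a \<in> borel_measurable borel" "\<And>x. norm (a x :: R3) \<le> A" and g: "test_function (g :: R3 \<Rightarrow> R3)"
  shows "sqint (advect a g)" "nrm (advect a g) \<le> A * nrm (gn g)"
proof -
  have A0: "A \<ge> 0" using a(2) norm_ge_zero order_trans by blast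
  have "norm (advect a g x) \<le> A * norm (gn g x)" for x
    by (rule order_trans[OF norm_advect_le]) (simp add: gn_nonneg a(2) mult_right_mono)
  then show "sqint (advect a g)" "nrm (advect a g) \<le> A * nrm (gn g)"
    using sqint_bound[OF advect_measurable[OF a(1) test_smooth[OF g]] test_gn(1)[OF g] _ A0] by auto
qed

lemma ip_advect_le:
  assumes a: "a \<in> borel_measurable borel" "\<And>x. norm (a x :: R3) \<le> A" and w: "sqint (w :: R3 \<Rightarrow> R3)"
    and g: "test_function (g :: R3 \<Rightarrow> R3)"
  shows "\<bar>ip w (advect a g)\<bar> \<le> nrm (\<lambda>x. norm (a x) * norm (w x)) * nrm (gn g)"
proof -
  note sc = sqint_conv[OF a w] and sa = sqint_advect[OF a g]
  have "\<bar>ip w (advect a g)\<bar> \<le> (\<integral>x. norm (norm (a x) * norm (w x)) * norm (gn g x) \<partial>lborel)"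
    unfolding ip_def real_norm_def[symmetric, of "\<integral>x. w x \<bullet> advect a g x \<partial>lborel"]
  proof (rule Bochner_Integration.integral_norm_bound_integral)
    show "integrable lborel (\<lambda>x. w x \<bullet> advect a g x)"
      by (rule integrable_bilinear[OF bounded_bilinear_inner w sa(1)])
    show "integrable lborel (\<lambda>x. norm (norm (a x) * norm (w x)) * norm (gn g x))"
      by (rule integrable_norm_mult[OF sc(1) test_gn(1)[OF g]])
    show "norm (w x \<bullet> advect a g x) \<le> norm (norm (a x) * norm (w x)) * norm (gn g x)" for x
    proof -
      have "norm (w x \<bullet> advect a g x) \<le> norm (w x) * norm (advect a g x)"
        by (simp add: Cauchy_Schwarz_ineq2)
      also have "\<dots> \<le> norm (w x) * (norm (a x) * gn g x)"
        by (intro mult_left_mono norm_advect_le) auto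
      finally show ?thesis by (simp add: gn_nonneg abs_mult ac_simps)
    qed
  qed
  also have "\<dots> \<le> nrm (\<lambda>x. norm (a x) * norm (w x)) * nrm (gn g)"
    by (rule cauchy_schwarz[OF sc(1) test_gn(1)[OF g]])
  finally show ?thesis .
qed

lemma conv_norm_le:
  assumes "\<epsilon> > 0" "sqint w"
  shows "sqint (\<lambda>x. norm (mol \<epsilon> w x) * norm (w x))" "conv_norm \<epsilon> w \<le> nrm (mollifier_eps \<epsilon>) * (nrm w)\<^sup>2"
  using sqint_conv[OF mol_measurable[OF assms] mol_sup[OF assms] assms(2)]
  by (auto simp: conv_norm_def power2_eq_square)

lemma rhs_le:
  assumes e: "\<epsilon> > 0" and w: "sqint w" and g: "test_function g"
  shows "\<bar>rhs \<epsilon> w g\<bar> \<le> nrm w * nrm (laplacian g) + conv_norm \<epsilon> w * nrm (gn g)"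
  using ip_le[OF w test_sqint[OF test_laplacian[OF g]]]
    ip_advect_le[OF mol_measurable[OF e w] mol_sup[OF e w] w g]
  unfolding rhs_def conv_norm_def by linarith

lemma advect_diff_left: "advect (\<lambda>x. a x - b x) g x = advect a g x - advect b g x"
  by (simp add: advect_def scaleR_diff_left sum_subtractf)

text \<open>The convective part is quadratic in \<open>w\<close>, so the Lipschitz constant grows
  with the norms. It also depends on \<open>\<epsilon>\<close>, which is harmless since the estimate
  serves continuity in time.\<close>

lemma rhs_lipschitz:
  assumes e: "\<epsilon> > 0" and w: "sqint w" and w': "sqint w'" and g: "test_function g"
  shows "\<bar>rhs \<epsilon> w g - rhs \<epsilon> w' g\<bar> \<le> (nrm (laplacian g) + nrm (mollifier_eps \<epsilon>) * nrm (gn g)) * (1 + nrm w + nrm w')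
     * nrm (\<lambda>x. w x - w' x)"
proof -
  define d where "d x = w x - w' x" for x
  define K where "K = nrm (mollifier_eps \<epsilon>)"
  have sd: "sqint d" unfolding d_def[abs_def] by (rule sqint_diff(1)[OF w w'])
  note m = mol_measurable[OF e] and ms = mol_sup[OF e, folded K_def]
  note tl = test_sqint[OF test_laplacian[OF g]]
  have a: "advect (mol \<epsilon> w) g = (\<lambda>x. advect (mol \<epsilon> w') g x + advect (mol \<epsilon> d) g x)"
  proof -
    have "mol \<epsilon> d = (\<lambda>x. mol \<epsilon> w x - mol \<epsilon> w' x)"
      unfolding d_def[abs_def] fun_eq_iff by (intro allI mol_diff e w w')
    then show ?thesis by (intro ext) (simp add: advect_diff_left)
  qed
  note sa = sqint_advect(1)[OF m ms g]
  have eq: "rhs \<epsilon> w g - rhs \<epsilon> w' g = ip d (laplacian g) + ip d (advect (mol \<epsilon> w) g) + ip w' (advect (mol \<epsilon> d) g)"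
  proof -
    have l: "ip d h = ip w h - ip w' h" if "sqint h" for h
      unfolding d_def[abs_def] by (rule ip_diff_left[OF w w' that])
    have r: "ip w' (advect (mol \<epsilon> w) g) = ip w' (advect (mol \<epsilon> w') g) + ip w' (advect (mol \<epsilon> d) g)"
      unfolding a by (rule ip_add_right[OF w' sa[OF w' w'] sa[OF sd sd]])
    show ?thesis
      unfolding rhs_def l[OF tl] l[OF sa[OF w w]] r by simp
  qed
  have "\<bar>rhs \<epsilon> w g - rhs \<epsilon> w' g\<bar> \<le> nrm d * nrm (laplacian g) + (K * nrm w * nrm d) * nrm (gn g) + (K * nrm d * nrm w') * nrm (gn g)"
  proof -
    have "\<bar>ip d (laplacian g)\<bar> \<le> nrm d * nrm (laplacian g)" by (rule ip_le[OF sd tl])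
    moreover have "\<bar>ip d (advect (mol \<epsilon> w) g)\<bar> \<le> (K * nrm w * nrm d) * nrm (gn g)"
      by (rule order_trans[OF ip_advect_le[OF m[OF w] ms[OF w] sd g] mult_right_mono[OF sqint_conv(2)[OF m[OF w] ms[OF w] sd]]])
         (rule nrm_nonneg)
    moreover have "\<bar>ip w' (advect (mol \<epsilon> d) g)\<bar> \<le> (K * nrm d * nrm w') * nrm (gn g)"
      by (rule order_trans[OF ip_advect_le[OF m[OF sd] ms[OF sd] w' g] mult_right_mono[OF sqint_conv(2)[OF m[OF sd] ms[OF sd] w']]])
         (rule nrm_nonneg)
    ultimately show ?thesis unfolding eq by linarith
  qed
  also have "\<dots> \<le> (nrm (laplacian g) + K * nrm (gn g)) * (1 + nrm w + nrm w') * nrm d"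
    using mult_nonneg_nonneg[OF nrm_nonneg[of "laplacian g"] mult_nonneg_nonneg[OF nrm_nonneg[of d] nrm_nonneg[of w]]]
      mult_nonneg_nonneg[OF nrm_nonneg[of "laplacian g"] mult_nonneg_nonneg[OF nrm_nonneg[of d] nrm_nonneg[of w']]]
      mult_nonneg_nonneg[OF nrm_nonneg[of "mollifier_eps \<epsilon>"] mult_nonneg_nonneg[OF nrm_nonneg[of "gn g"] nrm_nonneg[of d]]]
    unfolding K_def by (simp add: algebra_simps)
  finally show ?thesis unfolding d_def K_def .
qed

text \<open>This serves continuity in time and also, in \<open>limit_local_energy\<close>, the
  passage from \<open>mol \<delta> w\<close> back to \<open>w\<close>, where the constant depending
  on \<open>\<epsilon>\<close> multiplies an error that vanishes with
  \<open>\<delta>\<close>.\<close>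

lemma conv_norm_lipschitz:
  assumes e: "\<epsilon> > 0" and w: "sqint w" and w': "sqint w'"
  shows "\<bar>conv_norm \<epsilon> w - conv_norm \<epsilon> w'\<bar> \<le> nrm (mollifier_eps \<epsilon>) * (1 + nrm w + nrm w') * nrm (\<lambda>x. w x - w' x)"
proof -
  define d where "d x = w x - w' x" for x
  define K where "K = nrm (mollifier_eps \<epsilon>)"
  have sd: "sqint d" unfolding d_def[abs_def] by (rule sqint_diff(1)[OF w w'])
  note m = mol_measurable[OF e] and ms = mol_sup[OF e, folded K_def]
  define f where "f x = norm (mol \<epsilon> w x) * norm (w x) - norm (mol \<epsilon> w' x) * norm (w' x)" for x
  note s1 = sqint_conv[OF m[OF sd] ms[OF sd] w] and s2 = sqint_conv[OF m[OF w'] ms[OF w'] sd]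
  have fm: "f \<in> borel_measurable borel"
    unfolding f_def[abs_def] using m[OF w] m[OF w'] sqint_measurable[OF w] sqint_measurable[OF w'] by measurable
  have pw: "norm (f x) \<le> norm (norm (mol \<epsilon> d x) * norm (w x) + norm (mol \<epsilon> w' x) * norm (d x))" for x
  proof -
    have 1: "\<bar>norm (mol \<epsilon> w x) - norm (mol \<epsilon> w' x)\<bar> \<le> norm (mol \<epsilon> d x)"
      using norm_triangle_ineq3[of "mol \<epsilon> w x" "mol \<epsilon> w' x"] mol_diff[OF e w w', of x] by (simp add: d_def[abs_def])
    have 2: "\<bar>norm (w x) - norm (w' x)\<bar> \<le> norm (d x)"
      unfolding d_def by (rule norm_triangle_ineq3)
    have "f x = (norm (mol \<epsilon> w x) - norm (mol \<epsilon> w' x)) * norm (w x) + norm (mol \<epsilon> w' x) * (norm (w x) - norm (w' x))"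
      by (simp add: f_def algebra_simps)
    also have "\<bar>\<dots>\<bar> \<le> norm (mol \<epsilon> d x) * norm (w x) + norm (mol \<epsilon> w' x) * norm (d x)"
      by (intro order_trans[OF abs_triangle_ineq] add_mono) (auto simp: abs_mult intro!: mult_mono 1 2)
    finally show ?thesis by simp
  qed
  have "\<bar>conv_norm \<epsilon> w - conv_norm \<epsilon> w'\<bar> \<le> nrm f"
    unfolding conv_norm_def f_def[abs_def]
    by (rule nrm_diff_ge[OF conv_norm_le(1)[OF e w] conv_norm_le(1)[OF e w']])
  also have "\<dots> \<le> nrm (\<lambda>x. norm (mol \<epsilon> d x) * norm (w x) + norm (mol \<epsilon> w' x) * norm (d x))"
    by (rule sqint_mono(2)[OF fm sqint_add(1)[OF s1(1) s2(1)] pw])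
  also have "\<dots> \<le> K * nrm d * nrm w + K * nrm w' * nrm d"
    using sqint_add(2)[OF s1(1) s2(1)] s1(2) s2(2) by linarith
  also have "\<dots> \<le> K * (1 + nrm w + nrm w') * nrm d"
    using mult_nonneg_nonneg[OF nrm_nonneg[of "mollifier_eps \<epsilon>"] nrm_nonneg[of d]]
    unfolding K_def by (simp add: algebra_simps)
  finally show ?thesis unfolding d_def K_def .
qed

lemma laplacian_diff:
  assumes "smooth f" "smooth g"
  shows "laplacian (\<lambda>x. f x - g x) = (\<lambda>x. laplacian f x - laplacian g x)"
proof -
  have p: "partial_deriv i (\<lambda>x. f x - g x) = (\<lambda>x. partial_deriv i f x - partial_deriv i g x)" for i
    using assms by (simp add: fun_eq_iff partial_diff)
  then show ?thesis
    using assms unfolding laplacian_def p by (simp add: fun_eq_iff partial_diff smooth_partial sum_subtractf)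
qed

lemma advect_diff_right: "smooth f \<Longrightarrow> smooth g \<Longrightarrow> advect a (\<lambda>x. f x - g x) = (\<lambda>x. advect a f x - advect a g x)"
  by (simp add: advect_def fun_eq_iff partial_diff scaleR_diff_right sum_subtractf)

lemma rhs_diff_right:
  assumes e: "\<epsilon> > 0" and w: "sqint w" and f: "test_function f" and g: "test_function g"
  shows "rhs \<epsilon> w (\<lambda>x. f x - g x) = rhs \<epsilon> w f - rhs \<epsilon> w g"
proof -
  note m = mol_measurable[OF e w] and ms = mol_sup[OF e w]
  show ?thesis
    unfolding rhs_def laplacian_diff[OF test_smooth[OF f] test_smooth[OF g]]
      advect_diff_right[OF test_smooth[OF f] test_smooth[OF g]]
      ip_diff_right[OF w test_sqint[OF test_laplacian[OF f]] test_sqint[OF test_laplacian[OF g]]]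
      ip_diff_right[OF w sqint_advect(1)[OF m ms f] sqint_advect(1)[OF m ms g]]
    by simp
qed

lemma partial_scaleR: "smooth f \<Longrightarrow> partial_deriv i (\<lambda>x. c *\<^sub>R f x) = (\<lambda>x. c *\<^sub>R partial_deriv i f x)"
  by (simp add: fun_eq_iff partial_linear[OF bounded_linear_scaleR_right])

lemma laplacian_scaleR: "smooth f \<Longrightarrow> laplacian (\<lambda>x. c *\<^sub>R f x) = (\<lambda>x. c *\<^sub>R laplacian f x)"
  by (simp add: laplacian_def fun_eq_iff partial_scaleR smooth_partial scaleR_sum_right)

lemma advect_scaleR: "smooth f \<Longrightarrow> advect a (\<lambda>x. c *\<^sub>R f x) = (\<lambda>x. c *\<^sub>R advect a f x)"
  by (simp add: advect_def fun_eq_iff partial_scaleR scaleR_sum_right ac_simps)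

lemma rhs_scaleR: "smooth f \<Longrightarrow> rhs \<epsilon> w (\<lambda>x. c *\<^sub>R f x) = c * rhs \<epsilon> w f"
  by (simp add: rhs_def laplacian_scaleR advect_scaleR ip_scaleR_right distrib_left)

section \<open>The pressure-free weak formulation\<close>

text \<open>Young's inequality with exchanged roles: the test field is measured in L1 and the kernel
  in L2, the norm in which a widely spread kernel is small.\<close>

lemma nrm_cv_le_L1:
  fixes Y :: "'a::euclidean_space \<Rightarrow> 'b::euclidean_space"
  assumes F: "continuous_on UNIV F" "cpt_supp F" and Y: "test_function Y"
  shows "nrm (cv F Y) \<le> (\<integral>x. norm (Y x) \<partial>lborel) * nrm F"
proof -
  have "cv F Y = gcv (\<lambda>a b. b *\<^sub>R a) Y F"
    by (intro ext gcv_commute bounded_bilinear_scaleR borel_measurable_continuous_onI[OF F(1)] test_measurable[OF Y])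
  then show ?thesis
    using sqint_gcv(2)[OF bounded_bilinear.flip[OF bounded_bilinear_scaleR] _ smooth_continuous[OF test_smooth[OF Y]]
        test_cpt_supp[OF Y] continuous_sqint[OF F]]
    by simp
qed

text \<open>Strong enough to dominate \<open>ip\<close> and \<open>rhs\<close> against
  \<open>Y\<close>. Each term is the norm of something that commutes with convolution, so smallness
  passes from \<open>nrm\<close> to \<open>sob\<close>.\<close>

definition sob :: "(R3 \<Rightarrow> R3) \<Rightarrow> real" where
  "sob Y = nrm Y + nrm (laplacian Y) + (\<Sum>i\<in>UNIV. nrm (partial_deriv i Y))"

lemma sob_kap_small:
  assumes Y: "test_function Y"
  shows "(\<lambda>n. sob (\<lambda>x. cv (kap (1 / real (Suc n))) Y x - kap_mass *\<^sub>R Y x)) \<longlonglongrightarrow> 0"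
proof -
  have k: "kernel (kap (1 / real (Suc n))) (1 / real (Suc n)) kap_mass" for n
    by (rule kernel_kap) simp
  have r: "(\<lambda>n. 1 / real (Suc n)) \<longlonglongrightarrow> 0" by real_asymp
  have A: "(\<lambda>n. nrm (\<lambda>x. cv (kap (1 / real (Suc n))) Z x - kap_mass *\<^sub>R Z x)) \<longlonglongrightarrow> 0"
    if "test_function Z" for Z :: "R3 \<Rightarrow> R3"
    by (rule kernel_approx[OF k r test_sqint[OF that]])
  have sY: "smooth Y" by (rule test_smooth[OF Y])
  have scY: "smooth (\<lambda>x. kap_mass *\<^sub>R Y x)"
    by (rule smooth_bounded_linear[OF bounded_linear_scaleR_right sY])
  have 1: "laplacian (\<lambda>x. cv (kap (1 / real (Suc n))) Y x - kap_mass *\<^sub>R Y x)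
     = (\<lambda>x. cv (kap (1 / real (Suc n))) (laplacian Y) x - kap_mass *\<^sub>R laplacian Y x)" for n
    by (simp del: of_nat_Suc add: laplacian_diff test_smooth[OF kernel_test_cv[OF k Y]] scY laplacian_cv[OF k Y] laplacian_scaleR[OF sY])
  have 2: "partial_deriv i (\<lambda>x. cv (kap (1 / real (Suc n))) Y x - kap_mass *\<^sub>R Y x)
     = (\<lambda>x. cv (kap (1 / real (Suc n))) (partial_deriv i Y) x - kap_mass *\<^sub>R partial_deriv i Y x)" for n i
    by (simp del: of_nat_Suc add: fun_eq_iff partial_diff test_smooth[OF kernel_test_cv[OF k Y]] scY
        partial_cv[OF kernel_loc_int[OF k] Y] partial_scaleR[OF sY])
  show ?thesis
    unfolding sob_def 1 2
    by (intro tendsto_add_zero tendsto_null_sum A test_laplacian test_partial Y)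
qed

lemma sob_kap_large:
  assumes Y: "test_function Y"
  shows "(\<lambda>n. sob (cv (kap (real (Suc n))) Y)) \<longlonglongrightarrow> 0"
proof -
  have k: "kernel (kap (real (Suc n))) (real (Suc n)) kap_mass" for n
    by (rule kernel_kap) simp
  have A: "(\<lambda>n. nrm (cv (kap (real (Suc n))) Z)) \<longlonglongrightarrow> 0" if Z: "test_function Z" for Z :: "R3 \<Rightarrow> R3"
  proof (rule tendsto_sandwich[OF _ _ tendsto_const])
    show "\<forall>\<^sub>F n in sequentially. 0 \<le> nrm (cv (kap (real (Suc n))) Z)" by (simp add: nrm_nonneg)
    show "\<forall>\<^sub>F n in sequentially. nrm (cv (kap (real (Suc n))) Z) \<le> (\<integral>x. norm (Z x) \<partial>lborel) * nrm (kap (real (Suc n)))"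
      by (intro always_eventually allI nrm_cv_le_L1 kernelD(1,2)[OF k] Z)
    show "(\<lambda>n. (\<integral>x. norm (Z x) \<partial>lborel) * nrm (kap (real (Suc n)))) \<longlonglongrightarrow> 0"
      by (rule tendsto_mult_right_zero[OF nrm_kap_tendsto_0])
  qed
  show ?thesis
    unfolding sob_def laplacian_cv[OF k Y] partial_cv[OF kernel_loc_int[OF k] Y]
    by (intro tendsto_add_zero tendsto_null_sum A test_laplacian test_partial Y)
qed

text \<open>A substitute for integrating a differential inequality: \<open>E\<close> need not be
  differentiable if its increments over short intervals obey the inequality up to an error
  proportional to their length.\<close>

lemma increment_bound:
  fixes E a :: "real \<Rightarrow> real"
  assumes T: "T \<ge> 0" and a: "continuous_on {0..T} a"
    and step: "\<And>e. e > 0 \<Longrightarrow> \<exists>d>0. \<forall>s t. 0 \<le> s \<and> s \<le> t \<and> t \<le> T \<and> t - s < d \<longrightarrow> E t - E s \<le> integral {s..t} a + e * (t - s)"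
  shows "E T - E 0 \<le> integral {0..T} a"
proof (cases "T = 0")
  case False
  then have T0: "T > 0" using T by simp
  have "E T - E 0 \<le> integral {0..T} a + e" if e: "e > 0" for e
  proof -
    \<comment> \<open>The error rate \<open>e / T\<close> adds up to \<open>e\<close> over the whole
      interval.\<close>
    obtain d where d: "d > 0"
      "\<And>s t. 0 \<le> s \<Longrightarrow> s \<le> t \<Longrightarrow> t \<le> T \<Longrightarrow> t - s < d \<Longrightarrow> E t - E s \<le> integral {s..t} a + e / T * (t - s)"
      using step[of "e / T"] e T0 by auto
    obtain n :: nat where n: "T / d < real n" using reals_Archimedean2 by blast
    then have n0: "n > 0"
      using d(1) T0 by (intro Nat.gr0I) (auto simp: divide_less_0_iff)
    then have n1: "T / real n < d"
      using n d(1) by (simp add: field_simps)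
    define p where "p k = real k * T / real n" for k
    have p: "p k \<ge> 0" "p k \<le> p (Suc k)" "p (Suc k) - p k = T / real n" for k
      using T0 n0 by (auto simp: p_def field_simps)
    have pT: "p k \<le> T" if "k \<le> n" for k
      using that T0 n0 by (simp add: p_def field_simps)
    have "E (p k) - E 0 \<le> integral {0..p k} a + e / T * p k" if "k \<le> n" for k
      using that
    proof (induction k)
      case 0
      then show ?case by (simp add: p_def)
    next
      case (Suc k)
      have "integral {0..p k} a + integral {p k..p (Suc k)} a = integral {0..p (Suc k)} a"
        using p[of k] pT[OF Suc.prems]
        by (intro Henstock_Kurzweil_Integration.integral_combine integrable_continuous_real continuous_on_subset[OF a]) auto
      moreover have "E (p (Suc k)) - E (p k) \<le> integral {p k..p (Suc k)} a + e / T * (p (Suc k) - p k)"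
        using p[of k] pT[OF Suc.prems] n1 by (intro d(2)) auto
      ultimately show ?case using Suc by (simp add: algebra_simps)
    qed
    from this[of n] show ?thesis using n0 T0 by (simp add: p_def)
  qed
  then show ?thesis by (rule field_le_epsilon)
qed simp

section \<open>Continuous curves in L2\<close>

locale l2_curve =
  fixes u :: "real \<Rightarrow> R3 \<Rightarrow> R3" and \<epsilon> :: real
  assumes eps: "\<epsilon> > 0"
    and usq: "\<And>t. t \<ge> 0 \<Longrightarrow> sqint (u t)"
    and ucont: "\<And>t. t \<ge> 0 \<Longrightarrow> ((\<lambda>s. nrm (\<lambda>x. u s x - u t x)) \<longlongrightarrow> 0) (at t within {0..})"
begin

lemma nrm_u_tendsto: "t \<ge> 0 \<Longrightarrow> ((\<lambda>s. nrm (u s)) \<longlongrightarrow> nrm (u t)) (at t within {0..})"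
proof -
  assume t: "t \<ge> 0"
  have "((\<lambda>s. nrm (u s) - nrm (u t)) \<longlongrightarrow> 0) (at t within {0..})"
  proof (rule Lim_null_comparison[OF _ ucont[OF t]])
    show "\<forall>\<^sub>F s in at t within {0..}. norm (nrm (u s) - nrm (u t)) \<le> nrm (\<lambda>x. u s x - u t x)"
      unfolding eventually_at_filter
      by (intro always_eventually) (auto intro!: nrm_diff_ge usq t)
  qed
  then show ?thesis by (simp add: LIM_zero_iff)
qed

text \<open>The factor \<open>1 + nrm w + nrm w'\<close> admits functionals that are quadratic in
  the field; along the curve it stays bounded near each time.\<close>

lemma functional_continuous:
  assumes N: "\<And>w w'. sqint w \<Longrightarrow> sqint w' \<Longrightarrow> \<bar>N w - N w'\<bar> \<le> C * (1 + nrm w + nrm w') * nrm (\<lambda>x. w x - w' x)"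
  shows "continuous_on {0..} (\<lambda>t. N (u t) :: real)"
  unfolding continuous_on_def
proof
  fix t :: real assume "t \<in> {0..}"
  then have t: "t \<ge> 0" by simp
  have "((\<lambda>s. N (u s) - N (u t)) \<longlongrightarrow> 0) (at t within {0..})"
  proof (rule Lim_null_comparison)
    show "\<forall>\<^sub>F s in at t within {0..}. norm (N (u s) - N (u t)) \<le> C * (1 + nrm (u s) + nrm (u t)) * nrm (\<lambda>x. u s x - u t x)"
      unfolding eventually_at_filter
      by (intro always_eventually) (auto intro!: N usq t)
    have "((\<lambda>s. C * (1 + nrm (u s) + nrm (u t)) * nrm (\<lambda>x. u s x - u t x)) \<longlongrightarrow> C * (1 + nrm (u t) + nrm (u t)) * 0) (at t within {0..})"
      by (intro tendsto_intros nrm_u_tendsto ucont t)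
    then show "((\<lambda>s. C * (1 + nrm (u s) + nrm (u t)) * nrm (\<lambda>x. u s x - u t x)) \<longlongrightarrow> 0) (at t within {0..})" by simp
  qed
  then show "((\<lambda>t. N (u t)) \<longlongrightarrow> N (u t)) (at t within {0..})" by (simp add: LIM_zero_iff)
qed

lemma nrm_u_continuous: "continuous_on {0..} (\<lambda>t. nrm (u t))"
  unfolding continuous_on_def using nrm_u_tendsto by simp

lemma nrm_u_bounded:
  obtains M where "M \<ge> 0" "\<And>t. 0 \<le> t \<Longrightarrow> t \<le> T \<Longrightarrow> nrm (u t) \<le> M"
proof -
  have "compact ((\<lambda>t. nrm (u t)) ` {0..T})"
    by (intro compact_continuous_image continuous_on_subset[OF nrm_u_continuous]) auto
  then obtain B where "\<forall>y\<in>(\<lambda>t. nrm (u t)) ` {0..T}. norm y \<le> B"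
    using compact_imp_bounded bounded_iff by metis
  then have "nrm (u t) \<le> max B 0" if "0 \<le> t" "t \<le> T" for t
    using that nrm_nonneg[of "u t"] by (force simp: le_max_iff_disj)
  then show ?thesis using that[of "max B 0"] by simp
qed

lemma rhs_continuous: "test_function g \<Longrightarrow> continuous_on {0..} (\<lambda>\<tau>. rhs \<epsilon> (u \<tau>) g)"
  by (rule functional_continuous) (rule rhs_lipschitz[OF eps])

lemma conv_norm_continuous: "continuous_on {0..} (\<lambda>\<tau>. conv_norm \<epsilon> (u \<tau>))"
  by (rule functional_continuous) (rule conv_norm_lipschitz[OF eps])

text \<open>The Heine-Cantor argument by hand, through a Lebesgue number, since the values of the
  curve are plain functions and \<open>nrm\<close> is not the metric of their type.\<close>

lemma u_uniformly_continuous: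
  assumes e: "e > 0"
  obtains d where "d > 0" "\<And>s t. 0 \<le> s \<Longrightarrow> s \<le> T \<Longrightarrow> 0 \<le> t \<Longrightarrow> t \<le> T \<Longrightarrow> \<bar>t - s\<bar> < d \<Longrightarrow> nrm (\<lambda>x. u t x - u s x) < e"
proof -
  have "\<exists>d>0. \<forall>s\<ge>0. \<bar>s - t\<bar> < d \<longrightarrow> nrm (\<lambda>x. u s x - u t x) < e / 2" if t: "t \<in> {0..T}" for t
  proof -
    have "\<forall>\<^sub>F s in at t within {0..}. nrm (\<lambda>x. u s x - u t x) < e / 2"
      using order_tendstoD(2)[OF ucont, of t "e / 2"] t e by auto
    then obtain d where d: "d > 0" "\<And>s. s \<ge> 0 \<Longrightarrow> s \<noteq> t \<Longrightarrow> dist s t < d \<Longrightarrow> nrm (\<lambda>x. u s x - u t x) < e / 2"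
      unfolding eventually_at by auto
    have "nrm (\<lambda>x. u s x - u t x) < e / 2" if "s \<ge> 0" "\<bar>s - t\<bar> < d" for s
      using d(2)[of s] that e by (cases "s = t") (auto simp: dist_real_def nrm_def)
    then show ?thesis using d(1) by blast
  qed
  then obtain d where d: "\<And>t. t \<in> {0..T} \<Longrightarrow> d t > 0"
    "\<And>t s. t \<in> {0..T} \<Longrightarrow> s \<ge> 0 \<Longrightarrow> \<bar>s - t\<bar> < d t \<Longrightarrow> nrm (\<lambda>x. u s x - u t x) < e / 2"
    by metis
  have cov: "{0..T} \<subseteq> \<Union> ((\<lambda>t. ball t (d t)) ` {0..T})"
  proof
    fix x assume x: "x \<in> {0..T}"
    then have "x \<in> ball x (d x)" using d(1) by simp
    then show "x \<in> \<Union> ((\<lambda>t. ball t (d t)) ` {0..T})" using x by blast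
  qed
  have op: "\<And>G. G \<in> (\<lambda>t. ball t (d t)) ` {0..T} \<Longrightarrow> open G" by auto
  obtain \<delta> where \<delta>: "\<delta> > 0" "\<And>x. x \<in> {0..T} \<Longrightarrow> \<exists>B\<in>(\<lambda>t. ball t (d t)) ` {0..T}. ball x \<delta> \<subseteq> B"
    by (rule Heine_Borel_lemma[OF compact_Icc cov op], assumption) (rule that; assumption)
  have "nrm (\<lambda>x. u t x - u s x) < e" if st: "0 \<le> s" "s \<le> T" "0 \<le> t" "t \<le> T" "\<bar>t - s\<bar> < \<delta>" for s t
  proof -
    obtain r where r: "r \<in> {0..T}" "ball s \<delta> \<subseteq> ball r (d r)"
      using \<delta>(2)[of s] st by auto
    have "s \<in> ball s \<delta>" "t \<in> ball s \<delta>" using st \<delta>(1) by (auto simp: dist_real_def)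
    then have "s \<in> ball r (d r)" "t \<in> ball r (d r)" using r(2) by blast+
    then have "nrm (\<lambda>x. u s x - u r x) < e / 2" "nrm (\<lambda>x. u t x - u r x) < e / 2"
      using r(1) st d(2)[of r s] d(2)[of r t] by (auto simp: dist_real_def abs_minus_commute)
    moreover have "nrm (\<lambda>x. u t x - u s x) \<le> nrm (\<lambda>x. u t x - u r x) + nrm (\<lambda>x. u s x - u r x)"
      using sqint_diff(2)[OF sqint_diff(1)[OF usq usq] sqint_diff(1)[OF usq usq], of t r s r] st r by simp
    ultimately show ?thesis by simp
  qed
  with \<delta>(1) that show ?thesis by blast
qed

end

section \<open>Flows without pressure and their defect\<close>

locale flow = l2_curve u \<epsilon> for u \<epsilon> +
  assumes udiv: "\<And>t g. t \<ge> 0 \<Longrightarrow> test_function g \<Longrightarrow> ip (u t) (grad g) = 0"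
    and uweak: "\<And>t g. t \<ge> 0 \<Longrightarrow> test_function g \<Longrightarrow> (\<And>x. divergence g x = 0) \<Longrightarrow>
      ip (u t) g = ip (u 0) g + integral {0..t} (\<lambda>\<tau>. rhs \<epsilon> (u \<tau>) g)"
begin

text \<open>The defect in the pressure-free weak formulation for a test field that need not be
  divergence free.  It equals \<open>\<integral>\<integral> p div Y\<close>, but the pressure is never used.\<close>

definition defect :: "real \<Rightarrow> real \<Rightarrow> (R3 \<Rightarrow> R3) \<Rightarrow> real" where
  "defect s t Y = ip (u t) Y - ip (u s) Y - integral {s..t} (\<lambda>\<tau>. rhs \<epsilon> (u \<tau>) Y)"

context
  fixes s t :: real
  assumes st: "0 \<le> s" "s \<le> t"
begin

lemma rhs_integrable: "test_function g \<Longrightarrow> (\<lambda>\<tau>. rhs \<epsilon> (u \<tau>) g) integrable_on {s..t}"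
  using st by (intro integrable_continuous_real continuous_on_subset[OF rhs_continuous]) auto

lemma defect_diff:
  assumes "test_function f" "test_function g"
  shows "defect s t (\<lambda>x. f x - g x) = defect s t f - defect s t g"
proof -
  have "integral {s..t} (\<lambda>\<tau>. rhs \<epsilon> (u \<tau>) (\<lambda>x. f x - g x)) = integral {s..t} (\<lambda>\<tau>. rhs \<epsilon> (u \<tau>) f - rhs \<epsilon> (u \<tau>) g)"
    using st by (intro Henstock_Kurzweil_Integration.integral_cong rhs_diff_right[OF eps usq] assms) auto
  also have "\<dots> = integral {s..t} (\<lambda>\<tau>. rhs \<epsilon> (u \<tau>) f) - integral {s..t} (\<lambda>\<tau>. rhs \<epsilon> (u \<tau>) g)"
    by (intro Henstock_Kurzweil_Integration.integral_diff rhs_integrable assms)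
  finally show ?thesis
    using st by (simp add: defect_def ip_diff_right usq test_sqint assms)
qed

lemma defect_scaleR: "test_function f \<Longrightarrow> defect s t (\<lambda>x. c *\<^sub>R f x) = c * defect s t f"
  by (simp add: defect_def ip_scaleR_right rhs_scaleR test_smooth right_diff_distrib)

lemma defect_div_free:
  assumes "test_function g" "\<And>x. divergence g x = 0"
  shows "defect s t g = 0"
proof -
  have "integral {0..s} (\<lambda>\<tau>. rhs \<epsilon> (u \<tau>) g) + integral {s..t} (\<lambda>\<tau>. rhs \<epsilon> (u \<tau>) g) = integral {0..t} (\<lambda>\<tau>. rhs \<epsilon> (u \<tau>) g)"
    using st by (intro Henstock_Kurzweil_Integration.integral_combine integrable_continuous_real
        continuous_on_subset[OF rhs_continuous[OF assms(1)]]) auto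
  then show ?thesis
    using uweak[OF _ assms, of s] uweak[OF _ assms, of t] st by (simp add: defect_def)
qed

text \<open>A crude bound, with a constant that depends on the curve; it is applied to test fields
  whose \<open>sob\<close> tends to 0.\<close>

lemma defect_le_sob: "\<exists>C. \<forall>Y. test_function Y \<longrightarrow> \<bar>defect s t Y\<bar> \<le> C * sob Y"
proof -
  obtain M where M: "M \<ge> 0" "\<And>\<tau>. 0 \<le> \<tau> \<Longrightarrow> \<tau> \<le> t \<Longrightarrow> nrm (u \<tau>) \<le> M"
    using nrm_u_bounded[of t] by blast
  define K where "K = nrm (mollifier_eps \<epsilon>)"
  have K0: "K \<ge> 0" by (simp add: K_def nrm_nonneg)
  have "\<bar>defect s t Y\<bar> \<le> (2 * M + (M + K * M\<^sup>2) * (t - s)) * sob Y" if Y: "test_function Y" for Y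
  proof -
    have le: "nrm Y \<le> sob Y" "nrm (laplacian Y) \<le> sob Y" "nrm (gn Y) \<le> sob Y" "0 \<le> sob Y"
      using test_gn(3)[OF Y] nrm_nonneg[of Y] nrm_nonneg[of "laplacian Y"]
        sum_nonneg[of UNIV "\<lambda>i. nrm (partial_deriv i Y)", OF nrm_nonneg]
      unfolding sob_def by linarith+
    have "norm (integral {s..t} (\<lambda>\<tau>. rhs \<epsilon> (u \<tau>) Y)) \<le> ((M + K * M\<^sup>2) * sob Y) * (t - s)"
    proof (rule integral_bound[OF st(2)])
      show "continuous_on {s..t} (\<lambda>\<tau>. rhs \<epsilon> (u \<tau>) Y)"
        using st by (intro continuous_on_subset[OF rhs_continuous[OF Y]]) auto
      fix \<tau> assume \<tau>: "\<tau> \<in> {s..t}"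
      then have sq: "sqint (u \<tau>)" and M\<tau>: "nrm (u \<tau>) \<le> M" using st M(2) by (auto intro: usq)
      have c: "conv_norm \<epsilon> (u \<tau>) \<le> K * M\<^sup>2"
        by (rule order_trans[OF conv_norm_le(2)[OF eps sq, folded K_def]])
           (intro mult_left_mono power_mono M\<tau> nrm_nonneg K0)
      have "\<bar>rhs \<epsilon> (u \<tau>) Y\<bar> \<le> nrm (u \<tau>) * nrm (laplacian Y) + conv_norm \<epsilon> (u \<tau>) * nrm (gn Y)"
        by (rule rhs_le[OF eps sq Y])
      also have "\<dots> \<le> M * sob Y + (K * M\<^sup>2) * sob Y"
        using K0 M(1) by (intro add_mono mult_mono M\<tau> c le nrm_nonneg mult_nonneg_nonneg zero_le_power2)
      finally show "norm (rhs \<epsilon> (u \<tau>) Y) \<le> (M + K * M\<^sup>2) * sob Y" by (simp add: algebra_simps)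
    qed
    moreover have "\<bar>ip (u t) Y\<bar> \<le> M * sob Y"
      using st M(1)
      by (intro order_trans[OF ip_le[OF usq test_sqint[OF Y]]] mult_mono M(2) le nrm_nonneg) auto
    moreover have "\<bar>ip (u s) Y\<bar> \<le> M * sob Y"
      using st M(1)
      by (intro order_trans[OF ip_le[OF usq test_sqint[OF Y]]] mult_mono M(2) le nrm_nonneg) auto
    ultimately show ?thesis
      unfolding defect_def by (simp add: algebra_simps)
  qed
  then show ?thesis by blast
qed

text \<open>For a gradient both endpoint terms vanish by incompressibility, and so does the viscous
  term, because the Laplacian of a gradient is a gradient. Convection remains, and its Hessian
  factor is \<open>nrm (laplacian g)\<close> by \<open>hessian_identity\<close>.\<close>

lemma defect_grad_le:
  assumes g: "test_function g"
  shows "\<bar>defect s t (grad g)\<bar> \<le> integral {s..t} (\<lambda>\<tau>. conv_norm \<epsilon> (u \<tau>)) * nrm (laplacian g)"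
proof -
  have tg: "test_function (grad g)" by (rule test_grad[OF g])
  have r: "\<bar>rhs \<epsilon> (u \<tau>) (grad g)\<bar> \<le> conv_norm \<epsilon> (u \<tau>) * nrm (laplacian g)" if \<tau>: "\<tau> \<in> {s..t}" for \<tau>
  proof -
    have sq: "sqint (u \<tau>)" and t0: "\<tau> \<ge> 0" using \<tau> st by (auto intro: usq)
    have "ip (u \<tau>) (laplacian (grad g)) = 0"
      unfolding laplacian_grad[OF g] by (rule udiv[OF t0 test_laplacian[OF g]])
    then show ?thesis
      using ip_advect_le[OF mol_measurable[OF eps sq] mol_sup[OF eps sq] sq tg]
      by (simp add: rhs_def conv_norm_def hessian_identity[OF g])
  qed
  have ci: "(\<lambda>\<tau>. conv_norm \<epsilon> (u \<tau>)) integrable_on {s..t}"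
    using st by (intro integrable_continuous_real continuous_on_subset[OF conv_norm_continuous]) auto
  have "norm (integral {s..t} (\<lambda>\<tau>. rhs \<epsilon> (u \<tau>) (grad g))) \<le> integral {s..t} (\<lambda>\<tau>. conv_norm \<epsilon> (u \<tau>) * nrm (laplacian g))"
    using r by (intro integral_norm_bound_integral rhs_integrable tg integrable_on_mult_left ci) auto
  then show ?thesis
    using st udiv[OF _ g] by (simp add: defect_def)
qed

text \<open>The defect is linear and vanishes on divergence-free fields. After the correction it
  therefore equals, up to errors that are small in \<open>sob\<close>, the defect of a gradient. The
  factor 2 counts the two kernels in the Laplacian of \<open>\<psi>\<close>, and
  \<open>kap_mass\<close> cancels.\<close>

lemma defect_le:
  assumes Y: "test_function Y"
  shows "\<bar>defect s t Y\<bar> \<le> 2 * integral {s..t} (\<lambda>\<tau>. conv_norm \<epsilon> (u \<tau>)) * nrm (divergence Y)"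
proof -
  obtain C where C: "\<And>Y. test_function Y \<Longrightarrow> \<bar>defect s t Y\<bar> \<le> C * sob Y"
    using defect_le_sob by blast
  define P where "P = integral {s..t} (\<lambda>\<tau>. conv_norm \<epsilon> (u \<tau>))"
  have P0: "P \<ge> 0"
    unfolding P_def by (rule Henstock_Kurzweil_Integration.integral_nonneg)
      (use st in \<open>auto simp: conv_norm_def[of \<epsilon> "u _"] nrm_nonneg
        intro!: integrable_continuous_real continuous_on_subset[OF conv_norm_continuous[unfolded conv_norm_def]]\<close>)
  define a b where "a n = sob (\<lambda>x. cv (kap (1 / real (Suc n))) Y x - kap_mass *\<^sub>R Y x)"
    and "b n = sob (cv (kap (real (Suc n))) Y)" for n
  have ab: "kap_mass * \<bar>defect s t Y\<bar> \<le> C * b n + P * (2 * kap_mass * nrm (divergence Y)) + C * a n" for n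
  proof -
    \<comment> \<open>One index drives both scales, and \<open>r \<le> 1 \<le> R\<close> gives the
      order that \<open>div_free_correction\<close> asks for.\<close>
    define r R where "r = 1 / real (Suc n)" and "R = real (Suc n)"
    have "r \<le> 1" "1 \<le> R" by (auto simp: r_def R_def)
    moreover have "r > 0" by (simp add: r_def)
    ultimately have rR: "0 < r" "r \<le> R" "R > 0" by linarith+
    obtain \<psi> where \<psi>: "test_function \<psi>"
      "laplacian \<psi> = (\<lambda>x. cv (kap r) (divergence Y) x - cv (kap R) (divergence Y) x)"
      "\<And>x. divergence (\<lambda>x. cv (kap r) Y x - cv (kap R) Y x - grad \<psi> x) x = 0"
      by (rule div_free_correction[OF rR(1,2) Y]) blast
    note kr = kernel_kap[OF rR(1)] and kR = kernel_kap[OF rR(3)]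
    note tr = kernel_test_cv[OF kr Y] and tR = kernel_test_cv[OF kR Y] and tg = test_grad[OF \<psi>(1)]
    have tc: "test_function (\<lambda>x. kap_mass *\<^sub>R Y x)"
      by (rule test_bounded_linear[OF bounded_linear_scaleR_right Y])
    have "0 = defect s t (cv (kap r) Y) - defect s t (cv (kap R) Y) - defect s t (grad \<psi>)"
      using defect_div_free[OF test_diff[OF test_diff[OF tr tR] tg] \<psi>(3)]
      by (simp add: defect_diff[OF test_diff[OF tr tR] tg] defect_diff[OF tr tR])
    moreover have "defect s t (\<lambda>x. cv (kap r) Y x - kap_mass *\<^sub>R Y x) = defect s t (cv (kap r) Y) - kap_mass * defect s t Y"
      by (simp add: defect_diff[OF tr tc] defect_scaleR[OF Y])
    moreover have "\<bar>defect s t (\<lambda>x. cv (kap r) Y x - kap_mass *\<^sub>R Y x)\<bar> \<le> C * a n"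
      unfolding a_def r_def[symmetric] by (rule C[OF test_diff[OF tr tc]])
    moreover have "\<bar>defect s t (cv (kap R) Y)\<bar> \<le> C * b n"
      unfolding b_def R_def[symmetric] by (rule C[OF tR])
    moreover have "\<bar>defect s t (grad \<psi>)\<bar> \<le> P * (2 * kap_mass * nrm (divergence Y))"
    proof -
      have sd: "sqint (divergence Y)" by (rule test_sqint[OF test_divergence[OF Y]])
      have "nrm (laplacian \<psi>) \<le> 2 * kap_mass * nrm (divergence Y)"
        unfolding \<psi>(2) using sqint_diff(2)[OF kernel_cv(1)[OF kr sd] kernel_cv(1)[OF kR sd]]
          kernel_cv(2)[OF kr sd] kernel_cv(2)[OF kR sd] by linarith
      then show ?thesis
        using defect_grad_le[OF \<psi>(1)] mult_left_mono[OF _ P0] unfolding P_def by fastforce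
    qed
    moreover have "kap_mass * \<bar>defect s t Y\<bar> = \<bar>kap_mass * defect s t Y\<bar>"
      using kap_mass_pos by (simp add: abs_mult)
    ultimately show ?thesis by linarith
  qed
  have "(\<lambda>n. C * b n + P * (2 * kap_mass * nrm (divergence Y)) + C * a n) \<longlonglongrightarrow> C * 0 + P * (2 * kap_mass * nrm (divergence Y)) + C * 0"
    unfolding a_def b_def by (intro tendsto_intros sob_kap_small sob_kap_large Y)
  then have "kap_mass * \<bar>defect s t Y\<bar> \<le> C * 0 + P * (2 * kap_mass * nrm (divergence Y)) + C * 0"
    by (rule LIMSEQ_le_const) (use ab in blast)
  then have "kap_mass * \<bar>defect s t Y\<bar> \<le> kap_mass * (2 * P * nrm (divergence Y))"
    by (simp add: algebra_simps)
  then show ?thesis using kap_mass_pos by (simp add: P_def)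
qed

end

end

section \<open>Localised energy balance at a fixed time\<close>

text \<open>A reflection sends basis vectors to their negatives, which
  \<open>Ck_compose_linear\<close> does not admit; hence a separate induction.\<close>

lemma smooth_reflect:
  fixes f :: "'a::euclidean_space \<Rightarrow> 'b::real_normed_vector"
  assumes "smooth f"
  shows "smooth (\<lambda>y. f (x - y))"
    and "frechet_derivative (\<lambda>y. f (x - y)) (at y) b = - frechet_derivative f (at (x - y)) b"
proof -
  have D: "((\<lambda>y. f (x - y)) has_derivative (\<lambda>v. - frechet_derivative f (at (x - y)) v)) (at y)"
    if "Ck (Suc k) f" for f :: "'a \<Rightarrow> 'b" and y k
  proof -
    have "((\<lambda>y. x - y) has_derivative (\<lambda>v. - v)) (at y)" by (auto intro!: derivative_eq_intros)
    from has_derivative_compose[OF this Ck_Suc_has_derivative[OF that]]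
    have "((\<lambda>y. f (x - y)) has_derivative (\<lambda>v. frechet_derivative f (at (x - y)) (- v))) (at y)" .
    moreover have "linear (frechet_derivative f (at (x - y)))"
      using that by (intro linear_frechet_derivative) auto
    ultimately show ?thesis by (simp add: linear_neg)
  qed
  have "Ck k (\<lambda>y. f (x - y))" if "Ck k f" for k and f :: "'a \<Rightarrow> 'b"
    using that
  proof (induction k arbitrary: f)
    case 0
    then show ?case by (auto intro!: continuous_on_compose2[of UNIV f] continuous_intros)
  next
    case (Suc k)
    have "Ck k (\<lambda>y. - frechet_derivative f (at (x - y)) b)" if "b \<in> Basis" for b
      using Ck_bounded_linear[OF bounded_linear_minus[OF bounded_linear_ident]
          Suc.IH[of "\<lambda>z. frechet_derivative f (at z) b"]] Suc.prems that by simp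
    then show ?case
      using D[OF Suc.prems] frechet_derivative_eqI[OF D[OF Suc.prems]] by (auto simp: differentiable_def)
  qed
  then show "smooth (\<lambda>y. f (x - y))" using assms by (simp add: smooth_def)
  have "Ck (Suc 0) f" using assms by (simp only: smooth_def)
  from frechet_derivative_eqI[OF D[OF this]]
  show "frechet_derivative (\<lambda>y. f (x - y)) (at y) b = - frechet_derivative f (at (x - y)) b" by simp
qed

lemma test_reflect:
  fixes f :: "'a::euclidean_space \<Rightarrow> 'b::real_normed_vector"
  assumes "test_function f"
  shows "test_function (\<lambda>y. f (x - y))"
proof -
  obtain r where r: "\<And>x. f x \<noteq> 0 \<Longrightarrow> norm x \<le> r" using test_cpt_supp[OF assms] by (auto simp: cpt_supp_def)
  have "norm y \<le> norm x + r" if "f (x - y) \<noteq> 0" for y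
    using r[OF that] norm_triangle_ineq2[of y x] by (simp add: norm_minus_commute)
  then show ?thesis
    using smooth_reflect(1)[OF test_smooth[OF assms]] unfolding test_function_iff cpt_supp_def by blast
qed

definition wdiv_free :: "(R3 \<Rightarrow> R3) \<Rightarrow> bool" where
  "wdiv_free w \<longleftrightarrow> (\<forall>g. test_function g \<longrightarrow> ip w (grad g) = 0)"

lemma smooth_mol: "\<delta> > 0 \<Longrightarrow> sqint w \<Longrightarrow> smooth (mol \<delta> w)"
  unfolding mol_def by (intro smooth_gcv bounded_bilinear_scaleR test_mollifier_eps sqint_loc_int)

lemma partial_mol:
  assumes "\<delta> > 0" "sqint w"
  shows "partial_deriv i (mol \<delta> w) = cv (partial_deriv i (mollifier_eps \<delta>)) w"
  unfolding mol_def
  by (rule partial_gcv[OF bounded_bilinear_scaleR test_Ck test_cpt_supp sqint_loc_int])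
     (intro test_mollifier_eps assms)+

lemma sqint_mol:
  assumes "\<delta> > 0" "sqint w"
  shows "sqint (mol \<delta> w)" "nrm (mol \<delta> w) \<le> nrm w"
  using kernel_cv[OF kernel_mollifier_eps[OF assms(1)] assms(2)] by (auto simp: mol_def)

lemma sqint_cv_test:
  fixes w :: "'a::euclidean_space \<Rightarrow> 'b::euclidean_space"
  assumes "test_function F" "sqint w"
  shows "sqint (cv F w)" "nrm (cv F w) \<le> (\<integral>x. norm (F x) \<partial>lborel) * nrm w"
  using sqint_gcv(1,2)[OF bounded_bilinear_scaleR _ smooth_continuous[OF test_smooth[OF assms(1)]] test_cpt_supp[OF assms(1)] assms(2)]
  by auto

lemma sqint_partial_mol:
  assumes "\<delta> > 0" "sqint w"
  shows "sqint (partial_deriv i (mol \<delta> w))"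
  unfolding partial_mol[OF assms] by (rule sqint_cv_test(1)[OF test_partial[OF test_mollifier_eps] assms(2)]) (rule assms)

text \<open>Up to sign, the divergence at \<open>x\<close> is the pairing of \<open>w\<close> with
  the gradient of the test function that maps \<open>y\<close> to
  \<open>mollifier_eps \<delta> (x - y)\<close>. Mollification thus turns weak incompressibility
  into pointwise incompressibility.\<close>

lemma divergence_mol:
  assumes d: "\<delta> > 0" and w: "sqint w" "wdiv_free w"
  shows "divergence (mol \<delta> w) x = 0"
proof -
  let ?F = "mollifier_eps \<delta>"
  have t: "test_function ?F" by (rule test_mollifier_eps[OF d])
  have i: "integrable lborel (\<lambda>y. partial_deriv i ?F (x - y) *\<^sub>R w y)" for i
    by (rule gcv_integrable[OF bounded_bilinear_scaleR smooth_continuous[OF test_smooth] test_cpt_supp sqint_loc_int[OF w(1)]])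
       (intro test_partial t)+
  have i': "integrable lborel (\<lambda>y. partial_deriv i ?F (x - y) * w y $ i)" for i
    using integrable_bounded_linear[OF bounded_linear_vec_nth i[of i], of i] by simp
  have "divergence (mol \<delta> w) x = (\<Sum>i\<in>UNIV. (\<integral>y. partial_deriv i ?F (x - y) *\<^sub>R w y \<partial>lborel) $ i)"
    by (simp add: divergence_def partial_mol[OF d w(1)] gcv_def)
  also have "\<dots> = (\<Sum>i\<in>UNIV. \<integral>y. partial_deriv i ?F (x - y) * w y $ i \<partial>lborel)"
    using integral_bounded_linear[OF bounded_linear_vec_nth i] by simp
  also have "\<dots> = (\<integral>y. (\<Sum>i\<in>UNIV. partial_deriv i ?F (x - y) * w y $ i) \<partial>lborel)"
    by (rule Bochner_Integration.integral_sum[symmetric]) (rule i')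
  also have "\<dots> = - ip w (grad (\<lambda>y. ?F (x - y)))"
  proof -
    have "w y \<bullet> grad (\<lambda>y. ?F (x - y)) y = - (\<Sum>i\<in>UNIV. partial_deriv i ?F (x - y) * w y $ i)" for y
      by (simp add: inner_vec_def grad_def partial_deriv_def smooth_reflect(2)[OF test_smooth[OF t]] sum_negf mult.commute)
    then show ?thesis by (simp add: ip_def)
  qed
  also have "\<dots> = 0"
    using w(2) test_reflect[OF t] by (simp add: wdiv_free_def)
  finally show ?thesis .
qed

text \<open>The compact support of \<open>g\<close> justifies the integration by parts, so the
  mollified velocity may be inserted although it has no compact support.\<close>

lemma ip_grad_smooth_div_free:
  assumes b: "smooth b" "\<And>x. divergence b x = 0" and g: "test_function g"
  shows "(\<integral>x. b x \<bullet> grad g x \<partial>lborel) = 0"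
proof -
  have sb: "smooth (\<lambda>x. b x $ i)" for i by (rule smooth_nth[OF b(1)])
  have ti: "integrable lborel (\<lambda>x. b x $ i * partial_deriv i g x)" "integrable lborel (\<lambda>x. partial_deriv i b x $ i * g x)" for i
    by (intro test_integrable test_bilinear_right[OF bounded_bilinear_mult] sb test_partial g smooth_nth smooth_partial b)+
  have "(\<integral>x. b x \<bullet> grad g x \<partial>lborel) = (\<Sum>i\<in>UNIV. \<integral>x. b x $ i * partial_deriv i g x \<partial>lborel)"
    by (simp add: inner_vec_def grad_def Bochner_Integration.integral_sum ti)
  also have "\<dots> = (\<Sum>i\<in>UNIV. - (\<integral>x. partial_deriv i b x $ i * g x \<partial>lborel))"
    using integration_by_parts[OF bounded_bilinear_mult sb test_smooth[OF g]] test_cpt_supp[OF g]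
    by (simp add: partial_nth[OF b(1)])
  also have "\<dots> = - (\<integral>x. divergence b x * g x \<partial>lborel)"
    by (simp add: sum_negf divergence_def sum_distrib_right Bochner_Integration.integral_sum ti)
  finally show ?thesis by (simp add: b(2))
qed

lemma abs_le_sqrt_sum:
  fixes a :: "3 \<Rightarrow> real"
  shows "\<bar>a i\<bar> \<le> sqrt (\<Sum>j\<in>UNIV. (a j)\<^sup>2)"
  by (rule real_le_rsqrt) (simp add: member_le_sum[of i UNIV "\<lambda>j. (a j)\<^sup>2"])

lemma gn_real_inner: "(\<Sum>i\<in>UNIV. partial_deriv i \<phi> x * a $ i) \<le> gn \<phi> x * norm (a::R3)" for \<phi> :: "R3 \<Rightarrow> real"
proof -
  have "(\<Sum>i\<in>UNIV. partial_deriv i \<phi> x * a $ i) \<le> (\<Sum>i\<in>UNIV. \<bar>partial_deriv i \<phi> x\<bar> * \<bar>a $ i\<bar>)"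
    by (intro sum_mono) (simp add: abs_mult[symmetric])
  also have "\<dots> \<le> L2_set (\<lambda>i. partial_deriv i \<phi> x) UNIV * L2_set (\<lambda>i. a $ i) UNIV"
    by (rule L2_set_mult_ineq)
  finally show ?thesis by (simp add: gn_def L2_set_def norm_vec_def)
qed

lemma sum_partial_inner_le:
  fixes \<phi> :: "R3 \<Rightarrow> real" and v :: "R3 \<Rightarrow> R3"
  shows "\<bar>\<Sum>i\<in>UNIV. partial_deriv i \<phi> x * (partial_deriv i v x \<bullet> v x)\<bar> \<le> gn \<phi> x * (gn v x * norm (v x))"
proof -
  have "\<bar>\<Sum>i\<in>UNIV. partial_deriv i \<phi> x * (partial_deriv i v x \<bullet> v x)\<bar> \<le> (\<Sum>i\<in>UNIV. \<bar>partial_deriv i \<phi> x\<bar> * \<bar>norm (partial_deriv i v x)\<bar> * norm (v x))"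
  proof (intro order_trans[OF sum_abs] sum_mono)
    fix i
    show "\<bar>partial_deriv i \<phi> x * (partial_deriv i v x \<bullet> v x)\<bar> \<le> \<bar>partial_deriv i \<phi> x\<bar> * \<bar>norm (partial_deriv i v x)\<bar> * norm (v x)"
      using mult_left_mono[OF Cauchy_Schwarz_ineq2[of "partial_deriv i v x" "v x"], of "\<bar>partial_deriv i \<phi> x\<bar>"]
      by (simp add: abs_mult mult.assoc)
  qed
  also have "\<dots> = (\<Sum>i\<in>UNIV. \<bar>partial_deriv i \<phi> x\<bar> * \<bar>norm (partial_deriv i v x)\<bar>) * norm (v x)"
    by (simp add: sum_distrib_right)
  also have "\<dots> \<le> (L2_set (\<lambda>i. partial_deriv i \<phi> x) UNIV * L2_set (\<lambda>i. norm (partial_deriv i v x)) UNIV) * norm (v x)"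
    by (intro mult_right_mono L2_set_mult_ineq) simp
  finally show ?thesis by (simp add: gn_def L2_set_def mult.assoc)
qed

section \<open>The localised, doubly mollified test field\<close>

locale cutoff =
  fixes \<phi> :: "R3 \<Rightarrow> real" and L \<delta> :: real
  assumes phi: "test_function \<phi>" and phi0: "\<And>x. 0 \<le> \<phi> x" and phi1: "\<And>x. \<phi> x \<le> 1"
    and phiL: "\<And>x. gn \<phi> x \<le> L" and del: "\<delta> > 0"
begin

definition lmol :: "(R3 \<Rightarrow> R3) \<Rightarrow> R3 \<Rightarrow> R3" where
  "lmol w x = \<phi> x *\<^sub>R mol \<delta> w x"

text \<open>Since the mollifier is self-adjoint, the outer mollification makes
  \<open>ip w (tfield w)\<close> the integral of \<open>\<phi>\<close> times the square of
  \<open>mol \<delta> w\<close> (\<open>ip_tfield_self\<close>).\<close>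

definition tfield :: "(R3 \<Rightarrow> R3) \<Rightarrow> R3 \<Rightarrow> R3" where
  "tfield w = mol \<delta> (lmol w)"

text \<open>The localised dissipation. The root of \<open>\<phi>\<close> stands inside so that each
  term is the squared norm of a weighted convolution, whose continuity in time is given by
  \<open>cv_norm_continuous\<close>.\<close>

definition diss :: "(R3 \<Rightarrow> R3) \<Rightarrow> real" where
  "diss w = (\<Sum>i\<in>UNIV. (nrm (\<lambda>x. sqrt (\<phi> x) *\<^sub>R partial_deriv i (mol \<delta> w) x))\<^sup>2)"

lemma L_nonneg: "L \<ge> 0"
  using phiL[of 0] gn_nonneg[of \<phi> 0] by linarith

lemma test_lmol: "sqint w \<Longrightarrow> test_function (lmol w)"
  unfolding lmol_def[abs_def]
  by (rule test_bilinear_left[OF bounded_bilinear_scaleR phi smooth_mol[OF del]])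

lemma test_tfield: "sqint w \<Longrightarrow> test_function (tfield w)"
  unfolding tfield_def mol_def[of \<delta> "lmol w"]
  by (rule kernel_test_cv[OF kernel_mollifier_eps[OF del] test_lmol])

lemma partial_lmol:
  assumes "sqint w"
  shows "partial_deriv i (lmol w) x = \<phi> x *\<^sub>R partial_deriv i (mol \<delta> w) x + partial_deriv i \<phi> x *\<^sub>R mol \<delta> w x"
  unfolding lmol_def[abs_def]
  by (rule partial_bilinear[OF bounded_bilinear_scaleR test_smooth[OF phi] smooth_mol[OF del assms]])

lemma ip_mol_adjoint:
  assumes "sqint w" "sqint X"
  shows "ip w (mol \<delta> X) = ip (mol \<delta> w) X"
  unfolding ip_def mol_def
  by (rule cv_adjoint[symmetric, OF kernelD(1,2)[OF kernel_mollifier_eps[OF del]] mollifier_eps_even assms])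

lemma abs_partial_phi: "\<bar>partial_deriv i \<phi> x\<bar> \<le> L"
proof -
  have "\<bar>partial_deriv i \<phi> x\<bar> \<le> gn \<phi> x"
    unfolding gn_def using abs_le_sqrt_sum[of "\<lambda>i. partial_deriv i \<phi> x" i] by simp
  then show ?thesis using phiL[of x] by linarith
qed

context
  fixes w :: "R3 \<Rightarrow> R3"
  assumes w: "sqint w" "wdiv_free w"
begin

lemma sqint_gn_mol: "sqint (gn (mol \<delta> w))"
  by (rule sqint_gn(1)[OF sqint_partial_mol[OF del w(1)]])

lemma nrm_partial_le_gn: "nrm (partial_deriv i (mol \<delta> w)) \<le> nrm (gn (mol \<delta> w))"
proof (rule sqint_mono(2)[OF sqint_measurable[OF sqint_partial_mol[OF del w(1)]] sqint_gn_mol])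
  show "norm (partial_deriv i (mol \<delta> w) x) \<le> norm (gn (mol \<delta> w) x)" for x
    unfolding gn_def using abs_le_sqrt_sum[of "\<lambda>i. norm (partial_deriv i (mol \<delta> w) x)" i] by (simp add: sum_nonneg)
qed

text \<open>The outer mollifier is moved onto \<open>w\<close>, one derivative is integrated by
  parts, and the Leibniz rule for \<open>lmol w\<close> splits the result into the dissipation and a
  term with the gradient of \<open>\<phi>\<close>, which is at most \<open>L\<close>.\<close>

lemma viscous_term: "ip w (laplacian (tfield w)) \<le> - diss w + L * nrm w * nrm (gn (mol \<delta> w))"
proof -
  define v where "v = mol \<delta> w"
  have sv: "smooth v" and qv: "sqint v" "nrm v \<le> nrm w"
    using smooth_mol[OF del w(1)] sqint_mol[OF del w(1)] by (auto simp: v_def)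
  note tX = test_lmol[OF w(1)]
  have tpp: "sqint (partial_deriv i (partial_deriv i (lmol w)))" for i
    by (intro test_sqint test_partial tX)
  have tp: "sqint (partial_deriv i (lmol w))" for i by (intro test_sqint test_partial tX)
  have qp: "sqint (partial_deriv i v)" for i unfolding v_def by (rule sqint_partial_mol[OF del w(1)])
  have "ip w (laplacian (tfield w)) = ip v (laplacian (lmol w))"
    unfolding tfield_def mol_def[of \<delta> "lmol w"] laplacian_cv[OF kernel_mollifier_eps[OF del] tX]
    using ip_mol_adjoint[OF w(1) test_sqint[OF test_laplacian[OF tX]]] by (simp add: mol_def v_def)
  also have "\<dots> = (\<Sum>i\<in>UNIV. \<integral>x. v x \<bullet> partial_deriv i (partial_deriv i (lmol w)) x \<partial>lborel)"
    by (simp add: ip_def laplacian_def inner_sum_right Bochner_Integration.integral_sum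
        integrable_bilinear[OF bounded_bilinear_inner qv(1) tpp])
  also have "\<dots> = (\<Sum>i\<in>UNIV. - (\<integral>x. partial_deriv i v x \<bullet> partial_deriv i (lmol w) x \<partial>lborel))"
    using integration_by_parts[OF bounded_bilinear_inner sv test_smooth[OF test_partial[OF tX]]]
      test_cpt_supp[OF test_partial[OF tX]] by simp
  also have "\<dots> = - (\<integral>x. (\<Sum>i\<in>UNIV. partial_deriv i v x \<bullet> partial_deriv i (lmol w) x) \<partial>lborel)"
    by (simp add: sum_negf Bochner_Integration.integral_sum integrable_bilinear[OF bounded_bilinear_inner qp tp])
  also have "\<dots> \<le> - diss w + L * (\<integral>x. norm (v x) * norm (gn v x) \<partial>lborel)"
  proof -
    have sd: "sqint (\<lambda>x. sqrt (\<phi> x) *\<^sub>R partial_deriv i v x)" for i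
    proof (rule sqint_mono(1)[OF _ qp[of i]])
      show "(\<lambda>x. sqrt (\<phi> x) *\<^sub>R partial_deriv i v x) \<in> borel_measurable borel"
        using test_measurable[OF phi] sqint_measurable[OF qp[of i]] by measurable
      show "norm (sqrt (\<phi> x) *\<^sub>R partial_deriv i v x) \<le> norm (partial_deriv i v x)" for x
        using phi0 phi1 by (simp add: mult_left_le_one_le)
    qed
    have dd: "diss w = (\<integral>x. (\<Sum>i\<in>UNIV. \<phi> x * (norm (partial_deriv i v x))\<^sup>2) \<partial>lborel)"
    proof -
      have "diss w = (\<Sum>i\<in>UNIV. \<integral>x. (norm (sqrt (\<phi> x) *\<^sub>R partial_deriv i v x))\<^sup>2 \<partial>lborel)"
        by (simp add: diss_def v_def nrm_sq del: norm_scaleR)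
      also have "\<dots> = (\<integral>x. (\<Sum>i\<in>UNIV. (norm (sqrt (\<phi> x) *\<^sub>R partial_deriv i v x))\<^sup>2) \<partial>lborel)"
        by (rule Bochner_Integration.integral_sum[symmetric]) (rule sqint_integrable[OF sd])
      finally show ?thesis by (simp add: power_mult_distrib phi0)
    qed
    have id: "integrable lborel (\<lambda>x. (\<Sum>i\<in>UNIV. \<phi> x * (norm (partial_deriv i v x))\<^sup>2))"
    proof -
      have "integrable lborel (\<lambda>x. \<Sum>i\<in>UNIV. (norm (sqrt (\<phi> x) *\<^sub>R partial_deriv i v x))\<^sup>2)"
        by (rule Bochner_Integration.integrable_sum) (rule sqint_integrable[OF sd])
      then show ?thesis by (simp add: power_mult_distrib phi0)
    qed
    have im: "integrable lborel (\<lambda>x. norm (v x) * norm (gn v x))"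
      using integrable_norm_mult[OF qv(1) sqint_gn_mol] by (simp add: v_def)
    have "diss w - L * (\<integral>x. norm (v x) * norm (gn v x) \<partial>lborel)
       = (\<integral>x. (\<Sum>i\<in>UNIV. \<phi> x * (norm (partial_deriv i v x))\<^sup>2) - L * (norm (v x) * norm (gn v x)) \<partial>lborel)"
      unfolding dd using id im by simp
    also have "\<dots> \<le> (\<integral>x. (\<Sum>i\<in>UNIV. partial_deriv i v x \<bullet> partial_deriv i (lmol w) x) \<partial>lborel)"
    proof (rule integral_mono)
      show "integrable lborel (\<lambda>x. (\<Sum>i\<in>UNIV. \<phi> x * (norm (partial_deriv i v x))\<^sup>2) - L * (norm (v x) * norm (gn v x)))"
        using id im by simp
      show "integrable lborel (\<lambda>x. (\<Sum>i\<in>UNIV. partial_deriv i v x \<bullet> partial_deriv i (lmol w) x))"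
        by (intro Bochner_Integration.integrable_sum integrable_bilinear[OF bounded_bilinear_inner qp tp])
      fix x
      have eq: "(\<Sum>i\<in>UNIV. partial_deriv i v x \<bullet> partial_deriv i (lmol w) x) =
         (\<Sum>i\<in>UNIV. \<phi> x * (norm (partial_deriv i v x))\<^sup>2) + (\<Sum>i\<in>UNIV. partial_deriv i \<phi> x * (partial_deriv i v x \<bullet> v x))"
        by (simp add: partial_lmol[OF w(1)] v_def inner_add_right sum.distrib power2_norm_eq_inner)
      have "\<bar>\<Sum>i\<in>UNIV. partial_deriv i \<phi> x * (partial_deriv i v x \<bullet> v x)\<bar> \<le> gn \<phi> x * (gn v x * norm (v x))"
        by (rule sum_partial_inner_le)
      also have "\<dots> \<le> L * (norm (v x) * norm (gn v x))"
        using mult_right_mono[OF phiL[of x], of "gn v x * norm (v x)"] gn_nonneg[of v x] by (simp add: mult.commute)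
      finally show "(\<Sum>i\<in>UNIV. \<phi> x * (norm (partial_deriv i v x))\<^sup>2) - L * (norm (v x) * norm (gn v x))
         \<le> (\<Sum>i\<in>UNIV. partial_deriv i v x \<bullet> partial_deriv i (lmol w) x)"
        unfolding eq by linarith
    qed
    finally show ?thesis by simp
  qed
  also have "\<dots> \<le> - diss w + L * (nrm w * nrm (gn v))"
    using cauchy_schwarz[OF qv(1) sqint_gn_mol[folded v_def]] mult_right_mono[OF qv(2) nrm_nonneg[of "gn v"]] L_nonneg
    by (intro add_left_mono mult_left_mono) auto
  finally show ?thesis by (simp add: v_def)
qed

text \<open>The mollified field is divergence free, so only the gradient of \<open>\<phi>\<close>
  survives in the divergence of \<open>lmol w\<close>. This gives the contribution of the pressure
  its factor \<open>L\<close>.\<close>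

lemma divergence_tfield: "nrm (divergence (tfield w)) \<le> L * nrm w"
proof -
  define v where "v = mol \<delta> w"
  have qv: "sqint v" "nrm v \<le> nrm w"
    using sqint_mol[OF del w(1)] by (auto simp: v_def)
  note tX = test_lmol[OF w(1)]
  have div: "divergence (lmol w) x = (\<Sum>i\<in>UNIV. partial_deriv i \<phi> x * v x $ i)" for x
  proof -
    have "divergence (lmol w) x = \<phi> x * divergence v x + (\<Sum>i\<in>UNIV. partial_deriv i \<phi> x * v x $ i)"
      by (simp add: divergence_def partial_lmol[OF w(1)] v_def sum.distrib sum_distrib_left)
    then show ?thesis using divergence_mol[OF del w] by (simp add: v_def)
  qed
  have "\<bar>divergence (lmol w) x\<bar> \<le> L * norm (v x)" for x
  proof -
    have "- (\<Sum>i\<in>UNIV. partial_deriv i \<phi> x * v x $ i) \<le> gn \<phi> x * norm (v x)"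
      using gn_real_inner[of \<phi> x "- v x"] by (simp add: sum_negf)
    then have "\<bar>divergence (lmol w) x\<bar> \<le> gn \<phi> x * norm (v x)"
      using gn_real_inner[of \<phi> x "v x"] unfolding div by linarith
    also have "\<dots> \<le> L * norm (v x)" by (intro mult_right_mono phiL) simp
    finally show ?thesis .
  qed
  then have "nrm (divergence (lmol w)) \<le> L * nrm v"
    by (intro sqint_bound(2)[OF test_measurable[OF test_divergence[OF tX]] qv(1) _ L_nonneg]) simp
  moreover have "nrm (divergence (tfield w)) \<le> nrm (divergence (lmol w))"
  proof -
    have "divergence (tfield w) = cv (mollifier_eps \<delta>) (divergence (lmol w))"
      unfolding tfield_def mol_def[of \<delta> "lmol w"]
      by (intro ext divergence_cv[OF kernel_mollifier_eps[OF del] tX])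
    then show ?thesis
      using kernel_cv(2)[OF kernel_mollifier_eps[OF del] test_sqint[OF test_divergence[OF tX]]] by simp
  qed
  ultimately show ?thesis
    using mult_left_mono[OF qv(2) L_nonneg] by linarith
qed

end

end

section \<open>Commutators of mollification with transport\<close>

definition osc_bound :: "real \<Rightarrow> real \<Rightarrow> real \<Rightarrow> bool" where
  "osc_bound \<epsilon> \<delta> \<mu> \<longleftrightarrow> (\<forall>h. norm h \<le> \<delta> \<longrightarrow> nrm (\<lambda>z. mollifier_eps \<epsilon> (z + h) - mollifier_eps \<epsilon> z) \<le> \<mu>)"

text \<open>A shift of the argument is a shift of the kernel, to which Cauchy-Schwarz
  applies.\<close>

lemma mol_modulus:
  assumes e: "\<epsilon> > 0" and w: "sqint w" and osc: "osc_bound \<epsilon> \<delta> \<mu>" and xy: "norm (y - x) \<le> \<delta>"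
  shows "norm (mol \<epsilon> w y - mol \<epsilon> w x) \<le> \<mu> * nrm w"
proof -
  let ?F = "mollifier_eps \<epsilon>"
  have t: "test_function ?F" by (rule test_mollifier_eps[OF e])
  have i: "integrable lborel (\<lambda>z. ?F (a - z) *\<^sub>R w z)" for a
    by (rule gcv_integrable[OF bounded_bilinear_scaleR kernelD(1,2)[OF kernel_mollifier_eps[OF e]] sqint_loc_int[OF w]])
  define G where "G z = ?F (z + (y - x)) - ?F z" for z
  have sq: "sqint G"
  proof -
    have "sqint (\<lambda>z. ?F (- (x - y) - (- z)))"
      using test_sqint[OF test_reflect[OF test_reflect[OF t, of "- (x - y)"], of 0]] by simp
    then have "sqint (\<lambda>z. ?F (z + (y - x)))" by (simp add: algebra_simps)
    then show ?thesis unfolding G_def[abs_def] by (rule sqint_diff(1)) (rule test_sqint[OF t])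
  qed
  have "mol \<epsilon> w y - mol \<epsilon> w x = (\<integral>z. ?F (y - z) *\<^sub>R w z - ?F (x - z) *\<^sub>R w z \<partial>lborel)"
    unfolding mol_def gcv_def by (rule Bochner_Integration.integral_diff[symmetric]) (rule i)+
  also have "\<dots> = (\<integral>z. G (x - z) *\<^sub>R w z \<partial>lborel)"
    by (simp add: G_def scaleR_diff_left algebra_simps)
  also have "norm \<dots> \<le> nrm (\<lambda>z. G (x - z)) * nrm w"
    by (rule cauchy_schwarz_bilinear[OF bounded_bilinear_scaleR _ sqint_reflect[OF sq] w]) simp
  also have "nrm (\<lambda>z. G (x - z)) = nrm G" by (rule nrm_reflect[OF sqint_measurable[OF sq]])
  also have "nrm G * nrm w \<le> \<mu> * nrm w"
    using osc xy unfolding osc_bound_def G_def[abs_def] by (intro mult_right_mono nrm_nonneg) auto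
  finally show ?thesis .
qed

lemma sum_ip:
  fixes f g :: "3 \<Rightarrow> R3 \<Rightarrow> R3"
  assumes "\<And>i. sqint (f i)" "\<And>i. sqint (g i)"
  shows "(\<Sum>i\<in>UNIV. ip (f i) (g i)) = (\<integral>x. (\<Sum>i\<in>UNIV. f i x \<bullet> g i x) \<partial>lborel)"
  unfolding ip_def
  by (rule Bochner_Integration.integral_sum[symmetric]) (intro integrable_bilinear[OF bounded_bilinear_inner] assms)

context cutoff
begin

context
  fixes w :: "R3 \<Rightarrow> R3" and \<epsilon> :: real
  assumes w: "sqint w" "wdiv_free w" and e: "\<epsilon> > 0"
begin

text \<open>A Friedrichs commutator. Over the support of the mollifier at scale
  \<open>\<delta>\<close> the transporting field changes by at most \<open>\<mu> * nrm w\<close>;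
  this factor leaves the integral, and what remains is a mollification of
  \<open>norm (w y)\<close>.\<close>

lemma commutator_le:
  assumes osc: "osc_bound \<epsilon> \<delta> \<mu>" and mu: "\<mu> \<ge> 0"
  shows "nrm (\<lambda>x. mol \<delta> (\<lambda>y. mol \<epsilon> w y $ i *\<^sub>R w y) x - mol \<epsilon> w x $ i *\<^sub>R mol \<delta> w x) \<le> \<mu> * (nrm w)\<^sup>2"
    and "sqint (\<lambda>x. mol \<delta> (\<lambda>y. mol \<epsilon> w y $ i *\<^sub>R w y) x - mol \<epsilon> w x $ i *\<^sub>R mol \<delta> w x)"
proof -
  define b where "b = mol \<epsilon> w"
  define F where "F = mollifier_eps \<delta>"
  define A where "A = nrm (mollifier_eps \<epsilon>) * nrm w"
  have k: "kernel F \<delta> 1" unfolding F_def by (rule kernel_mollifier_eps[OF del])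
  note kd = kernelD[OF k]
  have bm: "b \<in> borel_measurable borel" and bA: "\<And>x. norm (b x) \<le> A"
    using mol_measurable[OF e w(1)] mol_sup[OF e w(1)] by (auto simp: b_def A_def)
  have bim: "(\<lambda>x. b x $ i) \<in> borel_measurable borel"
    using bm by (simp add: cart_eq_inner_axis)
  have biA: "\<bar>b x $ i\<bar> \<le> A" for x
    using component_le_norm_cart[of "b x" i] bA[of x] by linarith
  have A0: "A \<ge> 0" by (simp add: A_def nrm_nonneg)
  have sbw: "sqint (\<lambda>y. b y $ i *\<^sub>R w y)"
    by (rule sqint_bound(1)[OF borel_measurable_scaleR[OF bim sqint_measurable[OF w(1)]] w(1) _ A0])
       (simp add: mult_right_mono biA)
  have sv: "sqint (mol \<delta> w)" by (rule sqint_mol(1)[OF del w(1)])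
  have sbv: "sqint (\<lambda>x. b x $ i *\<^sub>R mol \<delta> w x)"
    by (rule sqint_bound(1)[OF borel_measurable_scaleR[OF bim sqint_measurable[OF sv]] sv _ A0])
       (simp add: mult_right_mono biA)
  define c where "c x = mol \<delta> (\<lambda>y. b y $ i *\<^sub>R w y) x - b x $ i *\<^sub>R mol \<delta> w x" for x
  show sc: "sqint (\<lambda>x. mol \<delta> (\<lambda>y. mol \<epsilon> w y $ i *\<^sub>R w y) x - mol \<epsilon> w x $ i *\<^sub>R mol \<delta> w x)"
    using sqint_diff(1)[OF sqint_mol(1)[OF del sbw] sbv] by (simp add: b_def)
  have sN: "sqint (cv F (\<lambda>y. norm (w y)))" by (rule kernel_cv(1)[OF k sqint_norm[OF w(1)]])
  have pw: "norm (c x) \<le> (\<mu> * nrm w) * norm (cv F (\<lambda>y. norm (w y)) x)" for x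
  proof -
    have i1: "integrable lborel (\<lambda>y. F (x - y) *\<^sub>R (b y $ i *\<^sub>R w y))"
      by (rule gcv_integrable[OF bounded_bilinear_scaleR kd(1,2) sqint_loc_int[OF sbw]])
    have i2: "integrable lborel (\<lambda>y. F (x - y) *\<^sub>R w y)"
      by (rule gcv_integrable[OF bounded_bilinear_scaleR kd(1,2) sqint_loc_int[OF w(1)]])
    have i3: "integrable lborel (\<lambda>y. F (x - y) *\<^sub>R norm (w y))"
      by (rule gcv_integrable[OF bounded_bilinear_scaleR kd(1,2) sqint_loc_int[OF sqint_norm[OF w(1)]]])
    have "c x = (\<integral>y. F (x - y) *\<^sub>R (b y $ i *\<^sub>R w y) - b x $ i *\<^sub>R (F (x - y) *\<^sub>R w y) \<partial>lborel)"
      unfolding c_def mol_def F_def[symmetric] gcv_def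
      using Bochner_Integration.integral_diff[OF i1 integrable_scaleR_right[OF i2, of "b x $ i"]]
      by (simp del: scaleR_scaleR)
    also have "norm \<dots> \<le> (\<integral>y. (\<mu> * nrm w) * (F (x - y) *\<^sub>R norm (w y)) \<partial>lborel)"
    proof (rule Bochner_Integration.integral_norm_bound_integral)
      show "integrable lborel (\<lambda>y. F (x - y) *\<^sub>R (b y $ i *\<^sub>R w y) - b x $ i *\<^sub>R (F (x - y) *\<^sub>R w y))"
        by (rule Bochner_Integration.integrable_diff[OF i1 integrable_scaleR_right[OF i2]])
      show "integrable lborel (\<lambda>y. (\<mu> * nrm w) * (F (x - y) *\<^sub>R norm (w y)))"
        by (rule integrable_mult_right[OF i3])
      fix y
      have eq: "F (x - y) *\<^sub>R (b y $ i *\<^sub>R w y) - b x $ i *\<^sub>R (F (x - y) *\<^sub>R w y) = (F (x - y) * (b y - b x) $ i) *\<^sub>R w y"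
        by (simp add: algebra_simps)
      have "F (x - y) * \<bar>(b y - b x) $ i\<bar> \<le> F (x - y) * (\<mu> * nrm w)"
      proof (cases "F (x - y) = 0")
        case False
        have "norm (y - x) \<le> \<delta>" using kd(4)[OF False] by (simp add: norm_minus_commute)
        from mol_modulus[OF e w(1) osc this]
        have "\<bar>(b y - b x) $ i\<bar> \<le> \<mu> * nrm w"
          using component_le_norm_cart[of "b y - b x" i] by (simp add: b_def)
        then show ?thesis by (intro mult_left_mono kd(3))
      qed simp
      then have "F (x - y) * \<bar>(b y - b x) $ i\<bar> * norm (w y) \<le> F (x - y) * (\<mu> * nrm w) * norm (w y)"
        by (intro mult_right_mono) auto
      then show "norm (F (x - y) *\<^sub>R (b y $ i *\<^sub>R w y) - b x $ i *\<^sub>R (F (x - y) *\<^sub>R w y))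
         \<le> (\<mu> * nrm w) * (F (x - y) *\<^sub>R norm (w y))"
        unfolding eq using kd(3)[of "x - y"] by (simp add: abs_mult ac_simps)
    qed
    also have "\<dots> = (\<mu> * nrm w) * cv F (\<lambda>y. norm (w y)) x"
      by (simp add: gcv_def)
    also have "\<dots> \<le> (\<mu> * nrm w) * norm (cv F (\<lambda>y. norm (w y)) x)"
      using mu nrm_nonneg[of w] by (intro mult_left_mono) auto
    finally show ?thesis .
  qed
  have mw: "0 \<le> \<mu> * nrm w" using mu nrm_nonneg[of w] by simp
  have "nrm c \<le> (\<mu> * nrm w) * nrm (cv F (\<lambda>y. norm (w y)))"
    by (rule sqint_bound(2)[OF _ sN pw mw]) (use sqint_measurable[OF sc] in \<open>simp add: c_def[abs_def] b_def\<close>)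
  also have "\<dots> \<le> (\<mu> * nrm w) * nrm w"
    using kernel_cv(2)[OF k sqint_norm[OF w(1)]] mw by (intro mult_left_mono) (auto simp: nrm_norm)
  finally show "nrm (\<lambda>x. mol \<delta> (\<lambda>y. mol \<epsilon> w y $ i *\<^sub>R w y) x - mol \<epsilon> w x $ i *\<^sub>R mol \<delta> w x) \<le> \<mu> * (nrm w)\<^sup>2"
    by (simp add: c_def[abs_def] b_def power2_eq_square)
qed

text \<open>The integrand is half of \<open>b \<bullet> grad g x\<close>, where \<open>g\<close> is
  \<open>\<phi>\<close> times the square of \<open>v\<close>, plus half of the stated integrand. As
  \<open>b\<close> is divergence free, the first half integrates to zero.\<close>

lemma transport_identity:
  "ip (mol \<delta> w) (advect (mol \<epsilon> w) (lmol w))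
     = (\<integral>x. (\<Sum>i\<in>UNIV. mol \<epsilon> w x $ i * partial_deriv i \<phi> x) * (norm (mol \<delta> w x))\<^sup>2 \<partial>lborel) / 2"
proof -
  define b v where "b = mol \<epsilon> w" and "v = mol \<delta> w"
  have sb: "smooth b" and sv: "smooth v"
    using smooth_mol[OF e w(1)] smooth_mol[OF del w(1)] by (auto simp: b_def v_def)
  have svv: "smooth (\<lambda>x. v x \<bullet> v x)" by (rule smooth_bilinear[OF bounded_bilinear_inner sv sv])
  define g where "g x = \<phi> x * (v x \<bullet> v x)" for x
  have tg: "test_function g"
    unfolding g_def[abs_def] by (rule test_bilinear_left[OF bounded_bilinear_mult phi svv])
  have pg: "partial_deriv i g x = \<phi> x * (2 * (v x \<bullet> partial_deriv i v x)) + partial_deriv i \<phi> x * (v x \<bullet> v x)" for i x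
    unfolding g_def[abs_def] partial_bilinear[OF bounded_bilinear_mult test_smooth[OF phi] svv]
      partial_bilinear[OF bounded_bilinear_inner sv sv]
    by (simp add: inner_commute)
  have pw: "v x \<bullet> advect b (lmol w) x = (b x \<bullet> grad g x) / 2 + ((\<Sum>i\<in>UNIV. b x $ i * partial_deriv i \<phi> x) * (norm (v x))\<^sup>2) / 2" for x
    by (simp add: advect_def partial_lmol[OF w(1)] v_def[symmetric] inner_vec_def[of "b x"] grad_def pg
        sum_3 inner_add_right power2_norm_eq_inner algebra_simps add_divide_distrib)
  have i1: "integrable lborel (\<lambda>x. b x \<bullet> grad g x)"
    by (intro test_integrable test_bilinear_right[OF bounded_bilinear_inner sb] test_grad tg)
  have i2: "integrable lborel (\<lambda>x. (\<Sum>i\<in>UNIV. b x $ i * partial_deriv i \<phi> x) * (norm (v x))\<^sup>2)"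
    unfolding power2_norm_eq_inner
    by (intro test_integrable test_bilinear_left[OF bounded_bilinear_mult _ svv] test_sum
        test_bilinear_right[OF bounded_bilinear_mult smooth_nth[OF sb]] test_partial phi) auto
  have "ip v (advect b (lmol w)) = (\<integral>x. b x \<bullet> grad g x \<partial>lborel) / 2
      + (\<integral>x. (\<Sum>i\<in>UNIV. b x $ i * partial_deriv i \<phi> x) * (norm (v x))\<^sup>2 \<partial>lborel) / 2"
    unfolding ip_def pw using i1 i2 by simp
  also have "(\<integral>x. b x \<bullet> grad g x \<partial>lborel) = 0"
    by (rule ip_grad_smooth_div_free[OF sb _ tg]) (simp add: b_def divergence_mol[OF e w])
  finally show ?thesis by (simp add: b_def v_def)
qed

text \<open>Moving the outer mollifier past the transporting field costs a commutator in each of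
  three components, whence \<open>3 * \<mu>\<close>; the rest is \<open>transport_identity\<close>,
  whence \<open>L / 2\<close>. There the product of \<open>b\<close> with the mollified
  \<open>v\<close> is compared with \<open>conv_norm \<epsilon> w\<close>, at the price of the
  mollification error of \<open>w\<close>.\<close>

lemma convective_term:
  assumes osc: "osc_bound \<epsilon> \<delta> \<mu>" and mu: "\<mu> \<ge> 0"
  shows "ip w (advect (mol \<epsilon> w) (tfield w)) \<le>
    L / 2 * nrm w * (conv_norm \<epsilon> w + nrm (mollifier_eps \<epsilon>) * nrm w * nrm (\<lambda>x. mol \<delta> w x - w x))
    + 3 * \<mu> * (nrm w)\<^sup>2 * (nrm (gn (mol \<delta> w)) + L * nrm w)"
proof -
  define b v where "b = mol \<epsilon> w" and "v = mol \<delta> w"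
  define A where "A = nrm (mollifier_eps \<epsilon>) * nrm w"
  have bm: "b \<in> borel_measurable borel" and bA: "\<And>x. norm (b x) \<le> A"
    using mol_measurable[OF e w(1)] mol_sup[OF e w(1)] by (auto simp: b_def A_def)
  have bim: "(\<lambda>x. b x $ i) \<in> borel_measurable borel" for i
    using bm by (simp add: cart_eq_inner_axis)
  have biA: "\<bar>b x $ i\<bar> \<le> A" for x i
    using component_le_norm_cart[of "b x" i] bA[of x] by linarith
  have A0: "A \<ge> 0" by (simp add: A_def nrm_nonneg)
  have sv: "sqint v" "nrm v \<le> nrm w" using sqint_mol[OF del w(1)] by (auto simp: v_def)
  have sbf: "sqint (\<lambda>y. b y $ i *\<^sub>R f y)" if "sqint f" for f :: "R3 \<Rightarrow> R3" and i
    by (rule sqint_bound(1)[OF borel_measurable_scaleR[OF bim sqint_measurable[OF that]] that _ A0])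
       (simp add: mult_right_mono biA)
  note tX = test_lmol[OF w(1)]
  have spX: "sqint (partial_deriv i (lmol w))" for i by (intro test_sqint test_partial tX)
  have nX: "nrm (partial_deriv i (lmol w)) \<le> nrm (gn v) + L * nrm w" for i
  proof -
    have sp: "sqint (partial_deriv i v)" unfolding v_def by (rule sqint_partial_mol[OF del w(1)])
    have s1: "sqint (\<lambda>x. \<phi> x *\<^sub>R partial_deriv i v x)" "nrm (\<lambda>x. \<phi> x *\<^sub>R partial_deriv i v x) \<le> nrm (partial_deriv i v)"
      using phi0 phi1 sqint_mono[OF borel_measurable_scaleR[OF test_measurable[OF phi] sqint_measurable[OF sp]] sp]
      by (auto simp: mult_left_le_one_le)
    have s2: "sqint (\<lambda>x. partial_deriv i \<phi> x *\<^sub>R v x)" "nrm (\<lambda>x. partial_deriv i \<phi> x *\<^sub>R v x) \<le> L * nrm v"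
      using abs_partial_phi sqint_bound[OF borel_measurable_scaleR[OF test_measurable[OF test_partial[OF phi]] sqint_measurable[OF sv(1)]] sv(1) _ L_nonneg]
      by (auto simp: mult_right_mono)
    have "partial_deriv i (lmol w) = (\<lambda>x. \<phi> x *\<^sub>R partial_deriv i v x + partial_deriv i \<phi> x *\<^sub>R v x)"
      by (simp add: fun_eq_iff partial_lmol[OF w(1)] v_def)
    then have "nrm (partial_deriv i (lmol w)) \<le> nrm (partial_deriv i v) + L * nrm v"
      using sqint_add(2)[OF s1(1) s2(1)] s1(2) s2(2) by simp
    then show ?thesis
      using nrm_partial_le_gn[OF w, of i] mult_left_mono[OF sv(2) L_nonneg] by (simp add: v_def)
  qed
  define c where "c i x = mol \<delta> (\<lambda>y. b y $ i *\<^sub>R w y) x - b x $ i *\<^sub>R v x" for i x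
  have sc: "sqint (c i)" "nrm (c i) \<le> \<mu> * (nrm w)\<^sup>2" for i
    using commutator_le[OF osc mu, of i] by (auto simp: c_def[abs_def] b_def v_def)
  have py: "partial_deriv i (tfield w) = mol \<delta> (partial_deriv i (lmol w))" for i
    unfolding tfield_def mol_def[of \<delta> "lmol w"]
    by (simp add: partial_cv[OF kernel_loc_int[OF kernel_mollifier_eps[OF del]] tX] mol_def)
  have spY: "sqint (partial_deriv i (tfield w))" for i
    unfolding py by (rule sqint_mol(1)[OF del spX])
  have "ip w (advect b (tfield w)) = (\<Sum>i\<in>UNIV. ip (\<lambda>y. b y $ i *\<^sub>R w y) (partial_deriv i (tfield w)))"
    unfolding sum_ip[OF sbf[OF w(1)] spY] unfolding ip_def advect_def inner_sum_right by simp
  also have "\<dots> = (\<Sum>i\<in>UNIV. ip (\<lambda>x. b x $ i *\<^sub>R v x + c i x) (partial_deriv i (lmol w)))"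
    unfolding py ip_mol_adjoint[OF sbf[OF w(1)] spX] by (simp add: c_def)
  also have "\<dots> = (\<Sum>i\<in>UNIV. ip (\<lambda>x. b x $ i *\<^sub>R v x) (partial_deriv i (lmol w))) + (\<Sum>i\<in>UNIV. ip (c i) (partial_deriv i (lmol w)))"
    unfolding ip_def inner_add_left sum.distrib[symmetric]
    by (intro sum.cong refl Bochner_Integration.integral_add integrable_bilinear[OF bounded_bilinear_inner] sbf sv sc spX)
  also have "(\<Sum>i\<in>UNIV. ip (\<lambda>x. b x $ i *\<^sub>R v x) (partial_deriv i (lmol w))) = ip v (advect b (lmol w))"
    unfolding sum_ip[OF sbf[OF sv(1)] spX] unfolding ip_def advect_def inner_sum_right by simp
  also have "ip v (advect b (lmol w)) \<le> L / 2 * nrm w * (conv_norm \<epsilon> w + A * nrm (\<lambda>x. v x - w x))"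
  proof -
    note s1 = sqint_conv[OF bm bA sv(1)] and s2 = sqint_conv[OF bm bA w(1)]
    have sd: "sqint (\<lambda>x. v x - w x)" by (rule sqint_diff(1)[OF sv(1) w(1)])
    note s3 = sqint_conv[OF bm bA sd]
    have le: "(\<Sum>i\<in>UNIV. b x $ i * partial_deriv i \<phi> x) * (norm (v x))\<^sup>2 \<le> L * (norm (norm (b x) * norm (v x)) * norm (v x))" for x
    proof -
      have "(\<Sum>i\<in>UNIV. b x $ i * partial_deriv i \<phi> x) \<le> gn \<phi> x * norm (b x)"
        using gn_real_inner[of \<phi> x "b x"] by (simp add: mult.commute)
      also have "\<dots> \<le> L * norm (b x)" by (intro mult_right_mono phiL) simp
      finally have "(\<Sum>i\<in>UNIV. b x $ i * partial_deriv i \<phi> x) * (norm (v x))\<^sup>2 \<le> L * norm (b x) * (norm (v x))\<^sup>2"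
        by (rule mult_right_mono) simp
      then show ?thesis by (simp add: power2_eq_square ac_simps)
    qed
    have "integrable lborel (\<lambda>x. (\<Sum>i\<in>UNIV. b x $ i * partial_deriv i \<phi> x) * (norm (v x))\<^sup>2)"
      unfolding power2_norm_eq_inner b_def v_def
      by (intro test_integrable test_bilinear_left[OF bounded_bilinear_mult] test_sum smooth_bilinear[OF bounded_bilinear_inner]
        test_bilinear_right[OF bounded_bilinear_mult smooth_nth[OF smooth_mol[OF e w(1)]]] test_partial phi smooth_mol[OF del w(1)]) auto
    then have "(\<integral>x. (\<Sum>i\<in>UNIV. b x $ i * partial_deriv i \<phi> x) * (norm (v x))\<^sup>2 \<partial>lborel)
       \<le> (\<integral>x. L * (norm (norm (b x) * norm (v x)) * norm (v x)) \<partial>lborel)"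
      by (intro integral_mono integrable_mult_right integrable_norm_mult s1 sv le)
    also have "\<dots> = L * (\<integral>x. norm (norm (b x) * norm (v x)) * norm (v x) \<partial>lborel)" by simp
    also have "\<dots> \<le> L * (nrm (\<lambda>x. norm (b x) * norm (v x)) * nrm v)"
      by (intro mult_left_mono cauchy_schwarz s1 sv L_nonneg)
    also have "\<dots> \<le> L * ((conv_norm \<epsilon> w + A * nrm (\<lambda>x. v x - w x)) * nrm w)"
    proof (intro mult_left_mono mult_mono sv L_nonneg nrm_nonneg)
      have "nrm (\<lambda>x. norm (b x) * norm (v x)) \<le> nrm (\<lambda>x. norm (b x) * norm (w x) + norm (b x) * norm (v x - w x))"
      proof (rule sqint_mono(2)[OF sqint_measurable[OF s1(1)] sqint_add(1)[OF s2(1) s3(1)]])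
        fix x
        have "norm (v x) \<le> norm (w x) + norm (v x - w x)" by norm
        from mult_left_mono[OF this norm_ge_zero[of "b x"]]
        show "norm (norm (b x) * norm (v x)) \<le> norm (norm (b x) * norm (w x) + norm (b x) * norm (v x - w x))"
          by (simp add: distrib_left)
      qed
      also have "\<dots> \<le> conv_norm \<epsilon> w + A * nrm (\<lambda>x. v x - w x)"
        using sqint_add(2)[OF s2(1) s3(1)] s3(2) by (simp add: conv_norm_def b_def)
      finally show "nrm (\<lambda>x. norm (b x) * norm (v x)) \<le> conv_norm \<epsilon> w + A * nrm (\<lambda>x. v x - w x)" .
      then show "0 \<le> conv_norm \<epsilon> w + A * nrm (\<lambda>x. v x - w x)"
        using nrm_nonneg order_trans by blast
    qed
    finally show ?thesis
      using transport_identity by (simp add: b_def v_def algebra_simps)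
  qed
  also have "(\<Sum>i\<in>UNIV. ip (c i) (partial_deriv i (lmol w))) \<le> (\<Sum>i\<in>(UNIV::3 set). (\<mu> * (nrm w)\<^sup>2) * (nrm (gn v) + L * nrm w))"
  proof (rule sum_mono)
    fix i
    have "ip (c i) (partial_deriv i (lmol w)) \<le> nrm (c i) * nrm (partial_deriv i (lmol w))"
      using ip_le[OF sc(1) spX, of i i] by linarith
    also have "\<dots> \<le> (\<mu> * (nrm w)\<^sup>2) * (nrm (gn v) + L * nrm w)"
      using mu by (intro mult_mono sc nX nrm_nonneg) auto
    finally show "ip (c i) (partial_deriv i (lmol w)) \<le> (\<mu> * (nrm w)\<^sup>2) * (nrm (gn v) + L * nrm w)" .
  qed
  finally show ?thesis
    by (simp add: b_def v_def A_def algebra_simps)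
qed

end

text \<open>Twice the sum of the viscous, convective and pressure bounds. Of the coefficient 5
  before \<open>conv_norm\<close>, one unit is due to transport and four to the defect.\<close>

definition rate_bound :: "real \<Rightarrow> real \<Rightarrow> (R3 \<Rightarrow> R3) \<Rightarrow> real" where
  "rate_bound \<epsilon> \<mu> w = - 2 * diss w + 2 * L * nrm w * nrm (gn (mol \<delta> w)) + 5 * L * nrm w * conv_norm \<epsilon> w
     + L * nrm (mollifier_eps \<epsilon>) * (nrm w)\<^sup>2 * nrm (\<lambda>x. mol \<delta> w x - w x)
     + 6 * \<mu> * (nrm w)\<^sup>2 * (nrm (gn (mol \<delta> w)) + L * nrm w)"

lemma rate_le:
  assumes "sqint w" "wdiv_free w" "\<epsilon> > 0" "osc_bound \<epsilon> \<delta> \<mu>" "\<mu> \<ge> 0"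
  shows "2 * (rhs \<epsilon> w (tfield w) + 2 * conv_norm \<epsilon> w * nrm (divergence (tfield w))) \<le> rate_bound \<epsilon> \<mu> w"
proof -
  have cn: "conv_norm \<epsilon> w \<ge> 0" by (simp add: conv_norm_def nrm_nonneg)
  show ?thesis
    using viscous_term[OF assms(1,2)] convective_term[OF assms] mult_left_mono[OF divergence_tfield[OF assms(1,2)] cn]
    unfolding rhs_def rate_bound_def by (simp add: algebra_simps power2_eq_square)
qed

end

section \<open>Ladyzhenskaya's inequality\<close>

text \<open>The third coordinate comes first in the product, so that the outer integral runs over
  the planes on which the two-dimensional inequality is used.\<close>

definition vec3 :: "real \<times> (real \<times> real) \<Rightarrow> R3" where
  "vec3 = (\<lambda>(c, a, b). vector [a, b, c])"

lemma vec3_nth: "vec3 (c, a, b) $ 1 = a" "vec3 (c, a, b) $ 2 = b" "vec3 (c, a, b) $ 3 = c"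
  by (simp_all add: vec3_def)

lemma continuous_vec3: "continuous_on UNIV vec3"
proof -
  have "vec3 z = (\<Sum>i\<in>UNIV. (if i = 1 then fst (snd z) else if i = 2 then snd (snd z) else fst z) *\<^sub>R axis i 1)" for z
    by (cases z) (auto simp: vec_eq_iff forall_3 vec3_nth sum_3 axis_def)
  then show ?thesis
    unfolding fun_eq_iff[symmetric, of vec3] by (simp add: sum_3) (intro continuous_intros)
qed

lemma vec3_measurable: "vec3 \<in> (lborel \<Otimes>\<^sub>M (lborel \<Otimes>\<^sub>M lborel)) \<rightarrow>\<^sub>M borel"
proof -
  have "vec3 \<in> borel_measurable borel" by (rule borel_measurable_continuous_onI[OF continuous_vec3])
  moreover have "sets (lborel \<Otimes>\<^sub>M (lborel \<Otimes>\<^sub>M lborel)) = sets (borel :: (real \<times> real \<times> real) measure)"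
    by (simp only: lborel_prod sets_lborel)
  ultimately show ?thesis using measurable_cong_sets by blast
qed

lemma sigma_finite_plane: "sigma_finite_measure (lborel \<Otimes>\<^sub>M lborel :: (real \<times> real) measure)"
  by (rule sigma_finite_pair_measure) (rule lborel.sigma_finite_measure_axioms)+

lemma pair_sigma_finite_line_plane:
  "pair_sigma_finite (lborel :: real measure) (lborel \<Otimes>\<^sub>M lborel :: (real \<times> real) measure)"
  by (rule pair_sigma_finite.intro[OF lborel.sigma_finite_measure_axioms sigma_finite_plane])

lemma Basis_R3: "(Basis :: R3 set) = {axis 1 1, axis 2 1, axis 3 1}"
  by (auto simp: Basis_vec_def UNIV_3)

text \<open>Both measures give boxes the same volume, and this determines Lebesgue measure.\<close>

lemma lborel_vec3: "lborel = distr (lborel \<Otimes>\<^sub>M (lborel \<Otimes>\<^sub>M lborel)) borel vec3"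
proof (rule lborel_eqI)
  fix l u :: R3 assume le: "\<And>b. b \<in> Basis \<Longrightarrow> l \<bullet> b \<le> u \<bullet> b"
  have le': "l $ 1 \<le> u $ 1" "l $ 2 \<le> u $ 2" "l $ 3 \<le> u $ 3"
    using le[of "axis 1 1"] le[of "axis 2 1"] le[of "axis 3 1"] by (simp_all add: Basis_R3 inner_axis)
  have box: "vec3 -` box l u = {l $ 3<..<u $ 3} \<times> ({l $ 1<..<u $ 1} \<times> {l $ 2<..<u $ 2})"
    by (auto simp: mem_box Basis_R3 inner_axis vec3_nth)
  have "emeasure (distr (lborel \<Otimes>\<^sub>M (lborel \<Otimes>\<^sub>M lborel)) borel vec3) (box l u)
     = emeasure (lborel \<Otimes>\<^sub>M (lborel \<Otimes>\<^sub>M lborel)) ({l $ 3<..<u $ 3} \<times> ({l $ 1<..<u $ 1} \<times> {l $ 2<..<u $ 2}))"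
    by (subst emeasure_distr[OF vec3_measurable]) (auto simp: box space_pair_measure)
  also have "\<dots> = ennreal (u $ 3 - l $ 3) * (ennreal (u $ 1 - l $ 1) * ennreal (u $ 2 - l $ 2))"
    using le' by (simp add: sigma_finite_measure.emeasure_pair_measure_Times[OF sigma_finite_plane]
        lborel.emeasure_pair_measure_Times)
  also have "\<dots> = ennreal (\<Prod>b\<in>Basis. (u - l) \<bullet> b)"
    using le' by (simp add: Basis_R3 inner_axis axis_eq_axis ennreal_mult'[symmetric] ac_simps)
  finally show "emeasure (distr (lborel \<Otimes>\<^sub>M (lborel \<Otimes>\<^sub>M lborel)) borel vec3) (box l u) = ennreal (\<Prod>b\<in>Basis. (u - l) \<bullet> b)" .
qed simp

text \<open>Valued in \<open>ennreal\<close>, so that Tonelli's theorem applies to single planes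
  without a proof of integrability.\<close>

definition slice :: "(R3 \<Rightarrow> ennreal) \<Rightarrow> real \<Rightarrow> ennreal" where
  "slice h c = (\<integral>\<^sup>+z. h (vec3 (c, z)) \<partial>(lborel \<Otimes>\<^sub>M lborel))"

lemma vec3_compose_measurable:
  assumes "h \<in> borel_measurable borel"
  shows "(\<lambda>p. h (vec3 p) :: ennreal) \<in> borel_measurable (lborel \<Otimes>\<^sub>M (lborel \<Otimes>\<^sub>M lborel))"
  using measurable_compose[OF vec3_measurable assms] .

lemma vec3_slice_measurable: "(\<lambda>z. vec3 (c, z)) \<in> (lborel \<Otimes>\<^sub>M lborel) \<rightarrow>\<^sub>M borel"
  by (rule measurable_compose[OF measurable_Pair1' vec3_measurable]) simp

lemma nn_integral_slice:
  assumes "h \<in> borel_measurable borel"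
  shows "(\<integral>\<^sup>+x. h x \<partial>lborel) = (\<integral>\<^sup>+c. slice h c \<partial>lborel)"
    and "(\<integral>\<^sup>+x. h x \<partial>lborel) = (\<integral>\<^sup>+z. \<integral>\<^sup>+c. h (vec3 (c, z)) \<partial>lborel \<partial>(lborel \<Otimes>\<^sub>M lborel))"
proof -
  note m = vec3_compose_measurable[OF assms]
  have eq: "(\<integral>\<^sup>+x. h x \<partial>lborel) = (\<integral>\<^sup>+p. h (vec3 p) \<partial>(lborel \<Otimes>\<^sub>M (lborel \<Otimes>\<^sub>M lborel)))"
    by (subst lborel_vec3, subst nn_integral_distr[OF vec3_measurable]) (use assms in simp_all)
  show "(\<integral>\<^sup>+x. h x \<partial>lborel) = (\<integral>\<^sup>+c. slice h c \<partial>lborel)"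
    unfolding eq slice_def by (rule sigma_finite_measure.nn_integral_fst[OF sigma_finite_plane m, symmetric])
  show "(\<integral>\<^sup>+x. h x \<partial>lborel) = (\<integral>\<^sup>+z. \<integral>\<^sup>+c. h (vec3 (c, z)) \<partial>lborel \<partial>(lborel \<Otimes>\<^sub>M lborel))"
    unfolding eq by (rule pair_sigma_finite.nn_integral_snd[OF pair_sigma_finite_line_plane m, symmetric])
qed

lemma slice_measurable:
  assumes "h \<in> borel_measurable borel"
  shows "slice h \<in> borel_measurable lborel"
  unfolding slice_def[abs_def]
  using sigma_finite_measure.borel_measurable_nn_integral_fst[OF sigma_finite_plane vec3_compose_measurable[OF assms]] .

lemma line_bound:
  fixes f f' :: "real \<Rightarrow> real"
  assumes D: "\<And>s. (f has_real_derivative f' s) (at s)" and c: "continuous_on UNIV f'" and z: "\<And>s. \<bar>s\<bar> > R \<Longrightarrow> f s = 0"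
  shows "ennreal \<bar>f t\<bar> \<le> (\<integral>\<^sup>+s. ennreal \<bar>f' s\<bar> \<partial>lborel)"
proof -
  \<comment> \<open>Starting the integration at this point covers every \<open>t\<close>: either it
    lies left of the support and \<open>f a = 0\<close>, or it is \<open>t\<close> itself and
    \<open>f t = 0\<close>.\<close>
  define a where "a = min (- \<bar>R\<bar> - 1) t"
  have fa: "f a = 0 \<or> a = t" using z[of a] by (auto simp: a_def min_def)
  show ?thesis
  proof (cases "a = t")
    case True
    then have "f t = 0" using z[of t] by (auto simp: a_def min_def split: if_splits)
    then show ?thesis by simp
  next
    case False
    then have at: "a \<le> t" "f a = 0" using fa by (auto simp: a_def)
    have i: "integrable lborel (\<lambda>x. indicator {a..t} x *\<^sub>R f' x)"
      by (rule borel_integrable_compact) (auto intro: continuous_on_subset[OF c])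
    have "(\<integral>x. indicator {a..t} x *\<^sub>R f' x \<partial>lborel) = f t - f a"
    proof (rule integral_FTC_atLeastAtMost[OF at(1)])
      show "(f has_vector_derivative f' x) (at x within {a..t})" for x
        using D[of x] has_vector_derivative_at_within by (simp add: has_real_derivative_iff_has_vector_derivative)
      show "continuous_on {a..t} f'" by (rule continuous_on_subset[OF c]) simp
    qed
    then have "f t = (\<integral>x. indicator {a..t} x *\<^sub>R f' x \<partial>lborel)" using at by simp
    then have "ennreal \<bar>f t\<bar> \<le> (\<integral>\<^sup>+x. ennreal (norm (indicator {a..t} x *\<^sub>R f' x)) \<partial>lborel)"
      using integral_norm_bound_ennreal[OF i] by simp
    also have "\<dots> \<le> (\<integral>\<^sup>+s. ennreal \<bar>f' s\<bar> \<partial>lborel)"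
      by (intro nn_integral_mono ennreal_leI) (auto simp: indicator_def)
    finally show ?thesis .
  qed
qed

lemma coordinate_line_bound:
  fixes q :: "R3 \<Rightarrow> real"
  assumes q: "test_function q"
  shows "ennreal \<bar>q x\<bar> \<le> (\<integral>\<^sup>+s. ennreal \<bar>partial_deriv i q (x + (s - x $ i) *\<^sub>R axis i 1)\<bar> \<partial>lborel)"
proof -
  define p where "p s = x + (s - x $ i) *\<^sub>R axis i 1" for s
  obtain R where R: "\<And>x. q x \<noteq> 0 \<Longrightarrow> norm x \<le> R" using test_cpt_supp[OF q] by (auto simp: cpt_supp_def)
  have D: "((\<lambda>s. q (p s)) has_real_derivative partial_deriv i q (p s)) (at s)" for s
  proof -
    have "(p has_derivative (\<lambda>h. h *\<^sub>R axis i 1)) (at s)"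
      unfolding p_def[abs_def] by (auto intro!: derivative_eq_intros)
    from has_derivative_compose[OF this smooth_has_derivative[OF test_smooth[OF q]]]
    have "((\<lambda>s. q (p s)) has_derivative (\<lambda>h. frechet_derivative q (at (p s)) (h *\<^sub>R axis i 1))) (at s)" .
    moreover have "frechet_derivative q (at (p s)) (h *\<^sub>R axis i 1) = partial_deriv i q (p s) * h" for h
      using linear_scale[OF has_derivative_linear[OF smooth_has_derivative[OF test_smooth[OF q]]], of "p s" h "axis i 1"]
      by (simp add: partial_deriv_def)
    ultimately show ?thesis
      unfolding has_field_derivative_def by simp
  qed
  have c: "continuous_on UNIV (\<lambda>s. partial_deriv i q (p s))"
    unfolding p_def
    by (intro continuous_on_compose2[OF smooth_continuous[OF test_smooth[OF test_partial[OF q]], of UNIV]] continuous_intros) auto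
  have z: "q (p s) = 0" if "\<bar>s\<bar> > R" for s
  proof -
    have "p s $ i = s" by (simp add: p_def)
    then have "\<bar>s\<bar> \<le> norm (p s)" using component_le_norm_cart[of "p s" i] by simp
    then show ?thesis using R[of "p s"] that by force
  qed
  have "p (x $ i) = x" by (simp add: p_def)
  then show ?thesis using line_bound[of "\<lambda>s. q (p s)" "\<lambda>s. partial_deriv i q (p s)" R "x $ i", OF D c z]
    by (simp add: p_def[abs_def])
qed

lemma vec3_shift:
  "vec3 (c, a, b) + (s - vec3 (c, a, b) $ 1) *\<^sub>R axis 1 1 = vec3 (c, s, b)"
  "vec3 (c, a, b) + (s - vec3 (c, a, b) $ 2) *\<^sub>R axis 2 1 = vec3 (c, a, s)"
  "vec3 (c, a, b) + (s - vec3 (c, a, b) $ 3) *\<^sub>R axis 3 1 = vec3 (s, a, b)"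
  by (simp_all add: vec_eq_iff forall_3 vec3_nth axis_def)

text \<open>On each plane the integral of \<open>(Q x)\<^sup>2\<close> is at most the product of the
  integrals of \<open>h 1\<close> and \<open>h 2\<close>, and Cauchy-Schwarz on the plane bounds
  each of these by the integrals of \<open>Q\<close> and of one squared derivative of
  \<open>v\<close>. The plane integral of \<open>Q\<close> is at most \<open>S\<close>, the full
  integral of \<open>h 3\<close>, for all planes alike, and \<open>S\<close> is at most
  \<open>2 * (nrm v * nrm (gn v))\<close>. Integrating over the planes then involves only the
  derivatives in directions 1 and 2.\<close>

lemma ladyzhenskaya_test:
  fixes v :: "R3 \<Rightarrow> R3"
  assumes v: "test_function v"
  shows "(\<integral>x. (norm (v x)) ^ 4 \<partial>lborel) \<le> 4 * nrm v * (nrm (gn v)) ^ 3"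
proof -
  define q where "q x = v x \<bullet> v x" for x
  define h where "h i x = ennreal \<bar>partial_deriv i q x\<bar>" for i x
  define D where "D i x = ennreal ((norm (partial_deriv i v x))\<^sup>2)" for i x
  have tq: "test_function q"
    unfolding q_def[abs_def] by (rule test_bilinear_left[OF bounded_bilinear_inner v test_smooth[OF v]])
  have vm[measurable]: "v \<in> borel_measurable borel" and qm[measurable]: "q \<in> borel_measurable borel"
    and pm[measurable]: "\<And>i. partial_deriv i v \<in> borel_measurable borel" "\<And>i. partial_deriv i q \<in> borel_measurable borel"
    by (intro test_measurable test_partial v tq)+
  have hm[measurable]: "h i \<in> borel_measurable borel" for i unfolding h_def[abs_def] by measurable
  have Dm[measurable]: "D i \<in> borel_measurable borel" for i unfolding D_def[abs_def] by measurable
  have hle: "h i x \<le> 2 * (ennreal (norm (v x)) * ennreal (norm (partial_deriv i v x)))" for i x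
  proof -
    have "partial_deriv i q x = 2 * (v x \<bullet> partial_deriv i v x)"
      unfolding q_def[abs_def] partial_bilinear[OF bounded_bilinear_inner test_smooth[OF v] test_smooth[OF v]]
      by (simp add: inner_commute)
    then have "\<bar>partial_deriv i q x\<bar> \<le> 2 * (norm (v x) * norm (partial_deriv i v x))"
      using Cauchy_Schwarz_ineq2[of "v x" "partial_deriv i v x"] by simp
    then show ?thesis
      unfolding h_def by (subst ennreal_mult[symmetric], simp, simp)+ (simp add: ennreal_leI flip: ennreal_numeral ennreal_mult)
  qed
  have q0: "q x \<ge> 0" for x by (simp add: q_def)
  define Q where "Q x = ennreal (q x)" for x
  have Qm[measurable]: "Q \<in> borel_measurable borel" unfolding Q_def[abs_def] by measurable
  have Qle: "Q x \<le> (\<integral>\<^sup>+s. h i (x + (s - x $ i) *\<^sub>R axis i 1) \<partial>lborel)" for x i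
    using coordinate_line_bound[OF tq, of x i] q0[of x] by (simp add: Q_def h_def)
  define S where "S = (\<integral>\<^sup>+x. h 3 x \<partial>lborel)"
  have sliceQ: "slice Q c \<le> S" for c
  proof -
    have "slice Q c \<le> (\<integral>\<^sup>+z. \<integral>\<^sup>+s. h 3 (vec3 (s, z)) \<partial>lborel \<partial>(lborel \<Otimes>\<^sub>M lborel))"
      unfolding slice_def
    proof (rule nn_integral_mono)
      fix z :: "real \<times> real"
      show "Q (vec3 (c, z)) \<le> (\<integral>\<^sup>+s. h 3 (vec3 (s, z)) \<partial>lborel)"
        using Qle[of "vec3 (c, z)" 3] by (cases z) (simp only: vec3_shift)
    qed
    then show ?thesis unfolding S_def nn_integral_slice(2)[OF hm] .
  qed
  have sliceCS: "(slice (h i) c)\<^sup>2 \<le> 4 * (slice Q c * slice (D i) c)" for i c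
  proof -
    have m1: "(\<lambda>z. ennreal (norm (v (vec3 (c, z))))) \<in> borel_measurable (lborel \<Otimes>\<^sub>M lborel)"
      and m2: "(\<lambda>z. ennreal (norm (partial_deriv i v (vec3 (c, z))))) \<in> borel_measurable (lborel \<Otimes>\<^sub>M lborel)"
      using measurable_compose[OF vec3_slice_measurable, of "\<lambda>x. ennreal (norm (v x))" borel c]
        measurable_compose[OF vec3_slice_measurable, of "\<lambda>x. ennreal (norm (partial_deriv i v x))" borel c] by measurable
    have "slice (h i) c \<le> (\<integral>\<^sup>+z. 2 * (ennreal (norm (v (vec3 (c, z)))) * ennreal (norm (partial_deriv i v (vec3 (c, z))))) \<partial>(lborel \<Otimes>\<^sub>M lborel))"
      unfolding slice_def by (intro nn_integral_mono hle)
    also have "\<dots> = 2 * (\<integral>\<^sup>+z. ennreal (norm (v (vec3 (c, z)))) * ennreal (norm (partial_deriv i v (vec3 (c, z)))) \<partial>(lborel \<Otimes>\<^sub>M lborel))"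
      by (rule nn_integral_cmult[OF borel_measurable_times_ennreal[OF m1 m2]])
    finally have "(slice (h i) c)\<^sup>2 \<le> (2 * (\<integral>\<^sup>+z. ennreal (norm (v (vec3 (c, z)))) * ennreal (norm (partial_deriv i v (vec3 (c, z)))) \<partial>(lborel \<Otimes>\<^sub>M lborel)))\<^sup>2"
      by (rule power_mono) simp
    also have "\<dots> = 4 * (\<integral>\<^sup>+z. ennreal (norm (v (vec3 (c, z)))) * ennreal (norm (partial_deriv i v (vec3 (c, z)))) \<partial>(lborel \<Otimes>\<^sub>M lborel))\<^sup>2"
      by (simp add: power_mult_distrib)
    also have "\<dots> \<le> 4 * ((\<integral>\<^sup>+z. (ennreal (norm (v (vec3 (c, z)))))\<^sup>2 \<partial>(lborel \<Otimes>\<^sub>M lborel)) * (\<integral>\<^sup>+z. (ennreal (norm (partial_deriv i v (vec3 (c, z)))))\<^sup>2 \<partial>(lborel \<Otimes>\<^sub>M lborel)))"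
      by (intro mult_left_mono Cauchy_Schwarz_nn_integral m1 m2) simp
    also have "\<dots> = 4 * (slice Q c * slice (D i) c)"
      by (simp add: slice_def Q_def D_def q_def ennreal_power dot_square_norm)
    finally show ?thesis .
  qed
  \<comment> \<open>The line bound in direction 1 depends only on the second coordinate and the one
    in direction 2 only on the first, so their product integrates to a product.\<close>
  have sq: "slice (\<lambda>x. (Q x)\<^sup>2) c \<le> slice (h 1) c * slice (h 2) c" for c
  proof -
    define A1 where "A1 b = (\<integral>\<^sup>+s. h 1 (vec3 (c, s, b)) \<partial>lborel)" for b
    define A2 where "A2 a = (\<integral>\<^sup>+s. h 2 (vec3 (c, a, s)) \<partial>lborel)" for a
    have hc: "(\<lambda>z. h i (vec3 (c, z))) \<in> borel_measurable (lborel \<Otimes>\<^sub>M lborel)" for i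
      by (rule measurable_compose[OF vec3_slice_measurable hm])
    have A1m[measurable]: "A1 \<in> borel_measurable lborel"
      unfolding A1_def[abs_def]
      using lborel.borel_measurable_nn_integral_fst[OF measurable_pair_swap[OF hc[of 1]]] by simp
    have A2m[measurable]: "A2 \<in> borel_measurable lborel"
      unfolding A2_def[abs_def] using lborel.borel_measurable_nn_integral_fst[OF hc[of 2]] by simp
    have e1: "slice (h 1) c = (\<integral>\<^sup>+b. A1 b \<partial>lborel)"
      unfolding slice_def A1_def using lborel_pair.nn_integral_snd[OF hc[of 1]] by simp
    have e2: "slice (h 2) c = (\<integral>\<^sup>+a. A2 a \<partial>lborel)"
      unfolding slice_def A2_def using lborel.nn_integral_fst[OF hc[of 2]] by simp
    have "slice (\<lambda>x. (Q x)\<^sup>2) c \<le> (\<integral>\<^sup>+z. (case z of (a, b) \<Rightarrow> A2 a * A1 b) \<partial>(lborel \<Otimes>\<^sub>M lborel))"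
      unfolding slice_def
    proof (rule nn_integral_mono)
      fix z :: "real \<times> real"
      obtain a b where z: "z = (a, b)" by (cases z)
      show "(Q (vec3 (c, z)))\<^sup>2 \<le> (case z of (a, b) \<Rightarrow> A2 a * A1 b)"
        using mult_mono[OF Qle[of "vec3 (c, z)" 2] Qle[of "vec3 (c, z)" 1]]
        by (simp add: z vec3_shift A1_def A2_def power2_eq_square)
    qed
    also have "\<dots> = (\<integral>\<^sup>+a. \<integral>\<^sup>+b. A2 a * A1 b \<partial>lborel \<partial>lborel)"
      by (subst lborel.nn_integral_fst[symmetric]) simp_all
    also have "\<dots> = slice (h 1) c * slice (h 2) c"
      by (simp add: nn_integral_cmult nn_integral_multc e1 e2 mult.commute)
    finally show ?thesis .
  qed
  have "(\<integral>\<^sup>+x. (Q x)\<^sup>2 \<partial>lborel) \<le> (\<integral>\<^sup>+c. 2 * (S * (slice (D 1) c + slice (D 2) c)) \<partial>lborel)"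
  proof (subst nn_integral_slice(1))
    show "(\<integral>\<^sup>+c. slice (\<lambda>x. (Q x)\<^sup>2) c \<partial>lborel) \<le> (\<integral>\<^sup>+c. 2 * (S * (slice (D 1) c + slice (D 2) c)) \<partial>lborel)"
    proof (rule nn_integral_mono)
      fix c
      \<comment> \<open>Doubling admits the arithmetic-geometric inequality without square roots in
        \<open>ennreal\<close>; the factor is cancelled at the end.\<close>
      have "2 * slice (\<lambda>x. (Q x)\<^sup>2) c \<le> 2 * (slice (h 1) c * slice (h 2) c)"
        by (rule mult_left_mono[OF sq]) simp
      also have "\<dots> \<le> (slice (h 1) c)\<^sup>2 + (slice (h 2) c)\<^sup>2"
        using sum_of_squares_ge_ennreal[of "slice (h 1) c" "slice (h 2) c"] by (simp add: mult.assoc)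
      also have "\<dots> \<le> 4 * (S * slice (D 1) c) + 4 * (S * slice (D 2) c)"
        by (intro add_mono order_trans[OF sliceCS] mult_left_mono mult_right_mono sliceQ) auto
      also have "\<dots> = 2 * (2 * (S * (slice (D 1) c + slice (D 2) c)))"
        by (simp add: distrib_left mult.assoc[symmetric])
      finally show "slice (\<lambda>x. (Q x)\<^sup>2) c \<le> 2 * (S * (slice (D 1) c + slice (D 2) c))"
        by (subst (asm) ennreal_mult_le_mult_iff) auto
    qed
  qed measurable
  also have "\<dots> = 2 * (S * ((\<integral>\<^sup>+x. D 1 x \<partial>lborel) + (\<integral>\<^sup>+x. D 2 x \<partial>lborel)))"
    using slice_measurable[OF Dm] by (simp add: nn_integral_cmult nn_integral_add nn_integral_slice(1)[OF Dm])
  also have "\<dots> \<le> 2 * (ennreal (2 * (nrm v * nrm (gn v))) * ennreal ((nrm (gn v))\<^sup>2))"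
  proof (intro mult_left_mono mult_mono)
    have sp: "sqint (partial_deriv i v)" for i by (intro test_sqint test_partial v)
    have "S \<le> (\<integral>\<^sup>+x. ennreal (2 * (norm (v x) * norm (gn v x))) \<partial>lborel)"
      unfolding S_def
    proof (rule nn_integral_mono)
      fix x
      have "norm (partial_deriv 3 v x) \<le> gn v x"
        unfolding gn_def using abs_le_sqrt_sum[of "\<lambda>i. norm (partial_deriv i v x)" 3] by simp
      then have "2 * (norm (v x) * norm (partial_deriv 3 v x)) \<le> 2 * (norm (v x) * norm (gn v x))"
        by (intro mult_left_mono) (auto simp: gn_nonneg)
      then show "h 3 x \<le> ennreal (2 * (norm (v x) * norm (gn v x)))"
        using hle[of 3 x] order_trans by (fastforce simp: ennreal_mult[symmetric] intro: ennreal_leI simp flip: ennreal_numeral)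
    qed
    also have "\<dots> = ennreal (\<integral>x. 2 * (norm (v x) * norm (gn v x)) \<partial>lborel)"
      by (intro nn_integral_eq_integral integrable_mult_right integrable_norm_mult test_sqint v test_gn(1)) auto
    also have "\<dots> \<le> ennreal (2 * (nrm v * nrm (gn v)))"
      using cauchy_schwarz[OF test_sqint[OF v] test_gn(1)[OF v]] by (intro ennreal_leI) simp
    finally show "S \<le> ennreal (2 * (nrm v * nrm (gn v)))" .
    have Di: "(\<integral>\<^sup>+x. D i x \<partial>lborel) = ennreal ((nrm (partial_deriv i v))\<^sup>2)" for i
      unfolding D_def nrm_sq by (intro nn_integral_eq_integral sqint_integrable sp) auto
    show "(\<integral>\<^sup>+x. D 1 x \<partial>lborel) + (\<integral>\<^sup>+x. D 2 x \<partial>lborel) \<le> ennreal ((nrm (gn v))\<^sup>2)"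
      unfolding Di test_gn(2)[OF v] by (simp add: sum_3 ennreal_plus[symmetric] del: ennreal_plus)
  qed auto
  also have "\<dots> = ennreal (4 * nrm v * (nrm (gn v)) ^ 3)"
    using nrm_nonneg[of v] nrm_nonneg[of "gn v"]
    by (simp add: ennreal_mult[symmetric] power2_eq_square power3_eq_cube ac_simps flip: ennreal_numeral)
  finally have fin: "(\<integral>\<^sup>+x. (Q x)\<^sup>2 \<partial>lborel) \<le> ennreal (4 * nrm v * (nrm (gn v)) ^ 3)" .
  have "(\<lambda>x. (Q x)\<^sup>2) = (\<lambda>x. ennreal ((norm (v x)) ^ 4))"
    by (simp add: Q_def q_def dot_square_norm ennreal_power fun_eq_iff flip: power_mult)
  moreover have "(\<integral>\<^sup>+x. ennreal ((norm (v x)) ^ 4) \<partial>lborel) = ennreal (\<integral>x. (norm (v x)) ^ 4 \<partial>lborel)"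
  proof (rule nn_integral_eq_integral)
    have "test_function (\<lambda>x. q x * q x)"
      by (rule test_bilinear_left[OF bounded_bilinear_mult tq test_smooth[OF tq]])
    moreover have "(\<lambda>x. q x * q x) = (\<lambda>x. (norm (v x)) ^ 4)"
      by (simp add: q_def dot_square_norm fun_eq_iff power2_eq_square[symmetric] flip: power_mult)
    ultimately show "integrable lborel (\<lambda>x. (norm (v x)) ^ 4)" using test_integrable by metis
  qed simp
  ultimately show ?thesis
    using fin nrm_nonneg[of v] nrm_nonneg[of "gn v"] by (simp add: ennreal_le_iff)
qed

section \<open>Local energy inequality for the mollified flow\<close>

lemma sqint_weighted:
  fixes s :: "'a::euclidean_space \<Rightarrow> real" and f :: "'a \<Rightarrow> 'b::euclidean_space"
  assumes s: "s \<in> borel_measurable borel" "\<And>x. \<bar>s x\<bar> \<le> 1" and f: "sqint f"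
  shows "sqint (\<lambda>x. s x *\<^sub>R f x)" "nrm (\<lambda>x. s x *\<^sub>R f x) \<le> nrm f"
  using sqint_mono[OF borel_measurable_scaleR[OF s(1) sqint_measurable[OF f]] f] s(2)
  by (auto simp: mult_left_le_one_le)

lemma nrm_weighted_diff:
  fixes s :: "'a::euclidean_space \<Rightarrow> real" and f g :: "'a \<Rightarrow> 'b::euclidean_space"
  assumes s: "s \<in> borel_measurable borel" "\<And>x. \<bar>s x\<bar> \<le> 1" and f: "sqint f" and g: "sqint g"
  shows "\<bar>nrm (\<lambda>x. s x *\<^sub>R f x) - nrm (\<lambda>x. s x *\<^sub>R g x)\<bar> \<le> nrm (\<lambda>x. f x - g x)"
proof -
  have "\<bar>nrm (\<lambda>x. s x *\<^sub>R f x) - nrm (\<lambda>x. s x *\<^sub>R g x)\<bar> \<le> nrm (\<lambda>x. s x *\<^sub>R f x - s x *\<^sub>R g x)"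
    by (intro nrm_diff_ge sqint_weighted s f g)
  also have "\<dots> = nrm (\<lambda>x. s x *\<^sub>R (f x - g x))" by (simp add: scaleR_diff_right)
  also have "\<dots> \<le> nrm (\<lambda>x. f x - g x)" by (intro sqint_weighted s sqint_diff f g)
  finally show ?thesis .
qed

section \<open>Continuity in time of mollified quantities\<close>

context flow
begin

lemma lipschitz_functional_continuous:
  assumes N: "\<And>w w'. sqint w \<Longrightarrow> sqint w' \<Longrightarrow> \<bar>N w - N w'\<bar> \<le> C * nrm (\<lambda>x. w x - w' x)" and C: "C \<ge> 0"
  shows "continuous_on {0..} (\<lambda>t. N (u t) :: real)"
proof (rule functional_continuous)
  fix w w' :: "R3 \<Rightarrow> R3" assume w: "sqint w" "sqint w'"
  have "C * nrm (\<lambda>x. w x - w' x) \<le> C * (1 + nrm w + nrm w') * nrm (\<lambda>x. w x - w' x)"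
    using mult_left_mono[of 1 "1 + nrm w + nrm w'" C] C nrm_nonneg[of w] nrm_nonneg[of w']
    by (intro mult_right_mono nrm_nonneg) simp
  then show "\<bar>N w - N w'\<bar> \<le> C * (1 + nrm w + nrm w') * nrm (\<lambda>x. w x - w' x)"
    using N[OF w] by linarith
qed

lemma cv_norm_continuous:
  assumes F: "test_function F" and s: "s \<in> borel_measurable borel" "\<And>x. \<bar>s x\<bar> \<le> 1"
  shows "continuous_on {0..} (\<lambda>t. nrm (\<lambda>x. s x *\<^sub>R cv F (u t) x))"
proof (rule lipschitz_functional_continuous)
  fix w w' :: "R3 \<Rightarrow> R3" assume w: "sqint w" "sqint w'"
  have eq: "(\<lambda>x. cv F w x - cv F w' x) = cv F (\<lambda>x. w x - w' x)"
    by (rule cv_diff[symmetric]) (auto intro: smooth_continuous test_smooth F test_cpt_supp sqint_loc_int w)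
  have "\<bar>nrm (\<lambda>x. s x *\<^sub>R cv F w x) - nrm (\<lambda>x. s x *\<^sub>R cv F w' x)\<bar> \<le> nrm (\<lambda>x. cv F w x - cv F w' x)"
    by (intro nrm_weighted_diff s sqint_cv_test F w)
  then show "\<bar>nrm (\<lambda>x. s x *\<^sub>R cv F w x) - nrm (\<lambda>x. s x *\<^sub>R cv F w' x)\<bar> \<le> (\<integral>x. norm (F x) \<partial>lborel) * nrm (\<lambda>x. w x - w' x)"
    using sqint_cv_test(2)[OF F sqint_diff(1)[OF w]] unfolding eq by linarith
qed simp

lemma nrm_gn_mol_continuous: "\<delta> > 0 \<Longrightarrow> continuous_on {0..} (\<lambda>t. nrm (gn (mol \<delta> (u t))))"
proof -
  assume d: "\<delta> > 0"
  \<comment> \<open>The weight 1 is inserted to match the form of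
    \<open>cv_norm_continuous\<close>.\<close>
  have "nrm (gn (mol \<delta> (u t))) = sqrt (\<Sum>i\<in>UNIV. (nrm (\<lambda>x. 1 *\<^sub>R cv (partial_deriv i (mollifier_eps \<delta>)) (u t) x))\<^sup>2)"
    if "t \<in> {0..}" for t
    by (rule real_sqrt_unique[symmetric])
      (use sqint_gn(2)[OF sqint_partial_mol[OF d usq]] that in \<open>simp_all add: nrm_nonneg partial_mol[OF d usq]\<close>)
  moreover have "continuous_on {0..} (\<lambda>t. sqrt (\<Sum>i\<in>UNIV. (nrm (\<lambda>x. 1 *\<^sub>R cv (partial_deriv i (mollifier_eps \<delta>)) (u t) x))\<^sup>2))"
    by (intro continuous_on_real_sqrt continuous_on_sum continuous_on_power cv_norm_continuous test_partial test_mollifier_eps d) auto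
  ultimately show ?thesis by (subst continuous_on_cong[OF refl]) auto
qed

lemma mol_error_continuous: "\<delta> > 0 \<Longrightarrow> continuous_on {0..} (\<lambda>t. nrm (\<lambda>x. mol \<delta> (u t) x - u t x))"
proof (rule lipschitz_functional_continuous[of "\<lambda>w. nrm (\<lambda>x. mol \<delta> w x - w x)" 2])
  fix w w' :: "R3 \<Rightarrow> R3" assume d: "\<delta> > 0" and w: "sqint w" "sqint w'"
  note sd = sqint_diff(1)[OF w]
  have "\<bar>nrm (\<lambda>x. mol \<delta> w x - w x) - nrm (\<lambda>x. mol \<delta> w' x - w' x)\<bar> \<le> nrm (\<lambda>x. (mol \<delta> w x - w x) - (mol \<delta> w' x - w' x))"
    by (intro nrm_diff_ge sqint_diff sqint_mol d w)
  also have "(\<lambda>x. (mol \<delta> w x - w x) - (mol \<delta> w' x - w' x)) = (\<lambda>x. mol \<delta> (\<lambda>x. w x - w' x) x - (w x - w' x))"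
    by (simp add: mol_diff[OF d w] algebra_simps)
  also have "nrm \<dots> \<le> 2 * nrm (\<lambda>x. w x - w' x)"
    using sqint_diff(2)[OF sqint_mol(1)[OF d sd] sd] sqint_mol(2)[OF d sd] by linarith
  finally show "\<bar>nrm (\<lambda>x. mol \<delta> w x - w x) - nrm (\<lambda>x. mol \<delta> w' x - w' x)\<bar> \<le> 2 * nrm (\<lambda>x. w x - w' x)" .
qed simp

lemma wdiv_free_u: "t \<ge> 0 \<Longrightarrow> wdiv_free (u t)"
  by (simp add: wdiv_free_def udiv)

end

context cutoff
begin

lemma sqrt_phi: "(\<lambda>x. sqrt (\<phi> x)) \<in> borel_measurable borel" "\<bar>sqrt (\<phi> x)\<bar> \<le> 1"
  using test_measurable[OF phi] phi0[of x] phi1[of x] by auto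

lemma lmol_diff:
  assumes "sqint w" "sqint w'"
  shows "lmol (\<lambda>x. w x - w' x) = (\<lambda>x. lmol w x - lmol w' x)"
  by (simp add: lmol_def fun_eq_iff mol_diff[OF del assms] scaleR_diff_right)

lemma tfield_diff:
  assumes "sqint w" "sqint w'"
  shows "tfield (\<lambda>x. w x - w' x) = (\<lambda>x. tfield w x - tfield w' x)"
  unfolding tfield_def lmol_diff[OF assms]
  by (intro ext mol_diff[OF del] test_sqint test_lmol assms)

lemma nrm_lmol_le: "sqint w \<Longrightarrow> nrm (lmol w) \<le> nrm w"
  using sqint_weighted(2)[OF test_measurable[OF phi] _ sqint_mol(1)[OF del], of w] phi0 phi1 sqint_mol(2)[OF del, of w]
  by (simp add: lmol_def[abs_def])

text \<open>The outer mollifier takes all derivatives, so the constant depends on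
  \<open>\<delta>\<close>. It is needed to compare test fields at neighbouring times, where
  \<open>w\<close> is a small difference.\<close>

lemma tfield_bounds:
  obtains C where "C \<ge> 0"
    "\<And>w. sqint w \<Longrightarrow> nrm (laplacian (tfield w)) \<le> C * nrm w" "\<And>w. sqint w \<Longrightarrow> nrm (gn (tfield w)) \<le> C * nrm w"
proof -
  let ?F = "mollifier_eps \<delta>"
  have tF: "test_function ?F" by (rule test_mollifier_eps[OF del])
  define I where "I F = (\<integral>x. norm (F x) \<partial>lborel)" for F :: "R3 \<Rightarrow> real"
  have I0: "I F \<ge> 0" for F by (simp add: I_def)
  define C1 where "C1 = (\<Sum>i\<in>(UNIV::3 set). I (partial_deriv i (partial_deriv i ?F)))"
  define C2 where "C2 = (\<Sum>i\<in>(UNIV::3 set). I (partial_deriv i ?F))"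
  have C0: "C1 \<ge> 0" "C2 \<ge> 0" by (auto simp: C1_def C2_def I0 sum_nonneg)
  have p1: "partial_deriv i (tfield w) = cv (partial_deriv i ?F) (lmol w)" if "sqint w" for i w
    unfolding tfield_def by (rule partial_mol[OF del test_sqint[OF test_lmol[OF that]]])
  have p2: "partial_deriv i (partial_deriv i (tfield w)) = cv (partial_deriv i (partial_deriv i ?F)) (lmol w)" if "sqint w" for i w
    unfolding p1[OF that]
    by (rule partial_gcv[OF bounded_bilinear_scaleR test_Ck test_cpt_supp test_loc_int]) (intro test_partial tF test_lmol that)+
  have 1: "nrm (laplacian (tfield w)) \<le> C1 * nrm w" if w: "sqint w" for w
  proof -
    have sX: "sqint (lmol w)" by (rule test_sqint[OF test_lmol[OF w]])
    have "nrm (laplacian (tfield w)) \<le> (\<Sum>i\<in>UNIV. nrm (cv (partial_deriv i (partial_deriv i ?F)) (lmol w)))"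
      unfolding laplacian_def[abs_def] p2[OF w]
      using sqint_sum[of UNIV "\<lambda>i. cv (partial_deriv i (partial_deriv i ?F)) (lmol w)"] sqint_cv_test(1)[OF test_partial[OF test_partial[OF tF]] sX]
      by simp
    also have "\<dots> \<le> (\<Sum>i\<in>(UNIV::3 set). I (partial_deriv i (partial_deriv i ?F)) * nrm w)"
    proof (rule sum_mono)
      fix i
      show "nrm (cv (partial_deriv i (partial_deriv i ?F)) (lmol w)) \<le> I (partial_deriv i (partial_deriv i ?F)) * nrm w"
        using sqint_cv_test(2)[OF test_partial[OF test_partial[OF tF]] sX, of i i]
          mult_left_mono[OF nrm_lmol_le[OF w] I0[of "partial_deriv i (partial_deriv i ?F)"]] by (simp add: I_def)
    qed
    finally show ?thesis by (simp add: C1_def sum_distrib_right)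
  qed
  have 2: "nrm (gn (tfield w)) \<le> C2 * nrm w" if w: "sqint w" for w
  proof -
    have sX: "sqint (lmol w)" by (rule test_sqint[OF test_lmol[OF w]])
    have "nrm (gn (tfield w)) \<le> (\<Sum>i\<in>UNIV. nrm (partial_deriv i (tfield w)))"
      by (rule test_gn(3)[OF test_tfield[OF w]])
    also have "\<dots> \<le> (\<Sum>i\<in>(UNIV::3 set). I (partial_deriv i ?F) * nrm w)"
    proof (rule sum_mono)
      fix i
      show "nrm (partial_deriv i (tfield w)) \<le> I (partial_deriv i ?F) * nrm w"
        using sqint_cv_test(2)[OF test_partial[OF tF] sX, of i]
          mult_left_mono[OF nrm_lmol_le[OF w] I0[of "partial_deriv i ?F"]] by (simp add: I_def p1[OF w])
    qed
    finally show ?thesis by (simp add: C2_def sum_distrib_right)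
  qed
  have "nrm (laplacian (tfield w)) \<le> (C1 + C2) * nrm w" "nrm (gn (tfield w)) \<le> (C1 + C2) * nrm w" if "sqint w" for w
    using 1[OF that] 2[OF that] C0 mult_nonneg_nonneg[OF C0(1) nrm_nonneg[of w]] mult_nonneg_nonneg[OF C0(2) nrm_nonneg[of w]]
    by (auto simp: distrib_right)
  then show ?thesis using that[of "C1 + C2"] C0 by simp
qed

text \<open>Both sides are the integral of \<open>\<phi>\<close> times the inner product of the two
  mollified fields. This symmetry replaces the product rule in time.\<close>

lemma ip_tfield_commute:
  assumes "sqint w" "sqint w'"
  shows "ip w (tfield w') = ip w' (tfield w)"
proof -
  have "ip w (tfield w') = ip (mol \<delta> w) (lmol w')"
    unfolding tfield_def by (rule ip_mol_adjoint[OF assms(1) test_sqint[OF test_lmol[OF assms(2)]]])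
  also have "\<dots> = ip (mol \<delta> w') (lmol w)"
    by (simp add: ip_def lmol_def inner_commute)
  also have "\<dots> = ip w' (tfield w)"
    unfolding tfield_def by (rule ip_mol_adjoint[OF assms(2) test_sqint[OF test_lmol[OF assms(1)]], symmetric])
  finally show ?thesis .
qed

lemma ip_tfield_self: "sqint w \<Longrightarrow> ip w (tfield w) = (\<integral>x. \<phi> x * (norm (mol \<delta> w x))\<^sup>2 \<partial>lborel)"
  unfolding tfield_def
  by (subst ip_mol_adjoint) (auto simp: test_sqint test_lmol ip_def lmol_def power2_norm_eq_inner)

end

section \<open>Growth of the localised energy\<close>

locale flow_cutoff = flow u \<epsilon> + cutoff \<phi> L \<delta> for u \<epsilon> \<phi> L \<delta>
begin

lemma diss_continuous: "continuous_on {0..} (\<lambda>t. diss (u t))"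
proof -
  have "diss (u t) = (\<Sum>i\<in>UNIV. (nrm (\<lambda>x. sqrt (\<phi> x) *\<^sub>R cv (partial_deriv i (mollifier_eps \<delta>)) (u t) x))\<^sup>2)" if "t \<in> {0..}" for t
    using that by (simp add: diss_def partial_mol[OF del usq])
  moreover have "continuous_on {0..} (\<lambda>t. \<Sum>i\<in>UNIV. (nrm (\<lambda>x. sqrt (\<phi> x) *\<^sub>R cv (partial_deriv i (mollifier_eps \<delta>)) (u t) x))\<^sup>2)"
    by (intro continuous_on_sum continuous_on_power cv_norm_continuous test_partial test_mollifier_eps del sqrt_phi)
  ultimately show ?thesis by (subst continuous_on_cong[OF refl]) auto
qed

lemma rate_bound_continuous: "continuous_on {0..} (\<lambda>t. rate_bound \<epsilon> \<mu> (u t))"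
  unfolding rate_bound_def
  by (intro continuous_intros diss_continuous nrm_u_continuous nrm_gn_mol_continuous conv_norm_continuous mol_error_continuous del)

lemma local_energy:
  assumes T: "T \<ge> 0" and osc: "osc_bound \<epsilon> \<delta> \<mu>" and mu: "\<mu> \<ge> 0"
  shows "(\<integral>x. \<phi> x * (norm (mol \<delta> (u T) x))\<^sup>2 \<partial>lborel) - (\<integral>x. \<phi> x * (norm (mol \<delta> (u 0) x))\<^sup>2 \<partial>lborel)
     \<le> integral {0..T} (\<lambda>t. rate_bound \<epsilon> \<mu> (u t))"
proof -
  define E where "E t = ip (u t) (tfield (u t))" for t
  define A where "A w Y = rhs \<epsilon> w Y + 2 * conv_norm \<epsilon> w * nrm (divergence Y)" for w Y
  obtain M where M: "M \<ge> 0" "\<And>t. 0 \<le> t \<Longrightarrow> t \<le> T \<Longrightarrow> nrm (u t) \<le> M" using nrm_u_bounded by blast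
  obtain C where C: "C \<ge> 0" "\<And>w. sqint w \<Longrightarrow> nrm (laplacian (tfield w)) \<le> C * nrm w" "\<And>w. sqint w \<Longrightarrow> nrm (gn (tfield w)) \<le> C * nrm w"
    using tfield_bounds by blast
  define K where "K = nrm (mollifier_eps \<epsilon>)"
  have K0: "K \<ge> 0" by (simp add: K_def nrm_nonneg)
  \<comment> \<open>A Lipschitz constant, along the curve, for the dependence of
    \<open>A (u \<tau>)\<close> on its test field; the summands stem from the Laplacian, the
    convective gradient and the divergence.\<close>
  define B where "B = M * C + K * M\<^sup>2 * (C + 2 * L)"
  have B0: "B \<ge> 0" using M(1) C(1) K0 L_nonneg by (simp add: B_def)
  have A_le: "A (u \<tau>) (tfield (u r)) \<le> A (u \<tau>) (tfield (u \<tau>)) + B * nrm (\<lambda>x. u r x - u \<tau> x)"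
    if t: "0 \<le> \<tau>" "\<tau> \<le> T" "0 \<le> r" for \<tau> r
  proof -
    define d where "d x = u r x - u \<tau> x" for x
    have sq: "sqint (u \<tau>)" "sqint (u r)" "sqint d" using t by (auto simp: d_def[abs_def] usq sqint_diff)
    have wd: "wdiv_free d"
      unfolding wdiv_free_def d_def[abs_def]
      using udiv t by (simp add: ip_diff_left[OF sq(2,1)] test_sqint test_grad)
    have td: "tfield d = (\<lambda>x. tfield (u r) x - tfield (u \<tau>) x)"
      unfolding d_def[abs_def] by (rule tfield_diff[OF sq(2,1)])
    note tt = test_tfield[OF sq(1)] test_tfield[OF sq(2)] test_tfield[OF sq(3)]
    have cn: "0 \<le> conv_norm \<epsilon> (u \<tau>)" "conv_norm \<epsilon> (u \<tau>) \<le> K * M\<^sup>2"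
      using order_trans[OF conv_norm_le(2)[OF eps sq(1), folded K_def]
          mult_left_mono[OF power_mono[OF M(2)[OF t(1,2)] nrm_nonneg] K0]]
      by (auto simp: conv_norm_def nrm_nonneg)
    have r1: "rhs \<epsilon> (u \<tau>) (tfield (u r)) - rhs \<epsilon> (u \<tau>) (tfield (u \<tau>)) \<le> M * (C * nrm d) + K * M\<^sup>2 * (C * nrm d)"
    proof -
      have "rhs \<epsilon> (u \<tau>) (tfield (u r)) - rhs \<epsilon> (u \<tau>) (tfield (u \<tau>)) = rhs \<epsilon> (u \<tau>) (tfield d)"
        unfolding td by (rule rhs_diff_right[OF eps sq(1) tt(2,1), symmetric])
      also have "\<dots> \<le> nrm (u \<tau>) * nrm (laplacian (tfield d)) + conv_norm \<epsilon> (u \<tau>) * nrm (gn (tfield d))"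
        using rhs_le[OF eps sq(1) tt(3)] by linarith
      also have "\<dots> \<le> M * (C * nrm d) + K * M\<^sup>2 * (C * nrm d)"
        using M K0 t by (intro add_mono mult_mono cn C sq nrm_nonneg) auto
      finally show ?thesis .
    qed
    have r2: "nrm (divergence (tfield (u r))) \<le> nrm (divergence (tfield (u \<tau>))) + L * nrm d"
    proof -
      have "divergence (tfield (u r)) = (\<lambda>x. divergence (tfield (u \<tau>)) x + divergence (tfield d) x)"
        unfolding td by (simp add: divergence_def partial_diff test_smooth[OF tt(1)] test_smooth[OF tt(2)] sum_subtractf fun_eq_iff)
      then show ?thesis
        using sqint_add(2)[OF test_sqint[OF test_divergence[OF tt(1)]] test_sqint[OF test_divergence[OF tt(3)]]]
          divergence_tfield[OF sq(3) wd] by simp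
    qed
    have "2 * conv_norm \<epsilon> (u \<tau>) * nrm (divergence (tfield (u r)))
        \<le> 2 * conv_norm \<epsilon> (u \<tau>) * nrm (divergence (tfield (u \<tau>))) + 2 * (K * M\<^sup>2) * (L * nrm d)"
      using mult_left_mono[OF r2, of "2 * conv_norm \<epsilon> (u \<tau>)"] cn
        mult_right_mono[OF cn(2), of "L * nrm d"] L_nonneg nrm_nonneg[of d] by (simp add: distrib_left)
    then show ?thesis
      using r1 by (simp add: A_def B_def d_def[symmetric, abs_def] algebra_simps)
  qed
  \<comment> \<open>The defect bound stands in for the pressure; it is the second summand of
    \<open>A\<close>.\<close>
  have inc: "ip (u t) Y - ip (u s) Y \<le> integral {s..t} (\<lambda>\<tau>. A (u \<tau>) Y)" if st: "0 \<le> s" "s \<le> t" and Y: "test_function Y" for s t Y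
  proof -
    have i: "(\<lambda>\<tau>. conv_norm \<epsilon> (u \<tau>)) integrable_on {s..t}" "(\<lambda>\<tau>. rhs \<epsilon> (u \<tau>) Y) integrable_on {s..t}"
      using st by (auto intro!: integrable_continuous_real continuous_on_subset[OF conv_norm_continuous] continuous_on_subset[OF rhs_continuous[OF Y]])
    have "integral {s..t} (\<lambda>\<tau>. A (u \<tau>) Y) = integral {s..t} (\<lambda>\<tau>. rhs \<epsilon> (u \<tau>) Y) + integral {s..t} (\<lambda>\<tau>. conv_norm \<epsilon> (u \<tau>) * (2 * nrm (divergence Y)))"
      unfolding A_def using i
      by (subst Henstock_Kurzweil_Integration.integral_add[symmetric]) (auto intro: integrable_on_mult_left integrable_on_mult_right simp: ac_simps)
    then show ?thesis
      using defect_le[OF st Y] by (simp add: defect_def algebra_simps)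
  qed
  have A_cont: "continuous_on {0..} (\<lambda>\<tau>. A (u \<tau>) Y)" if "test_function Y" for Y
    unfolding A_def by (intro continuous_intros rhs_continuous conv_norm_continuous that)
  have "E T - E 0 \<le> integral {0..T} (\<lambda>t. rate_bound \<epsilon> \<mu> (u t))"
  proof (rule increment_bound[OF T])
    show "continuous_on {0..T} (\<lambda>t. rate_bound \<epsilon> \<mu> (u t))"
      by (rule continuous_on_subset[OF rate_bound_continuous]) auto
    fix e :: real assume e: "e > 0"
    define e' where "e' = e / (2 * B + 1)"
    have e': "e' > 0" "2 * (B * e') \<le> e" using e B0 by (auto simp: e'_def field_simps)
    obtain d where d: "d > 0" "\<And>s t. 0 \<le> s \<Longrightarrow> s \<le> T \<Longrightarrow> 0 \<le> t \<Longrightarrow> t \<le> T \<Longrightarrow> \<bar>t - s\<bar> < d \<Longrightarrow> nrm (\<lambda>x. u t x - u s x) < e'"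
      using u_uniformly_continuous[OF e'(1)] by blast
    have "E t - E s \<le> integral {s..t} (\<lambda>t. rate_bound \<epsilon> \<mu> (u t)) + e * (t - s)" if st: "0 \<le> s" "s \<le> t" "t \<le> T" "t - s < d" for s t
    proof -
      have sq: "sqint (u s)" "sqint (u t)" using st by (auto intro: usq)
      note ts = test_tfield[OF sq(1)] and tt = test_tfield[OF sq(2)]
      have iA: "(\<lambda>\<tau>. A (u \<tau>) Y) integrable_on {s..t}" if "test_function Y" for Y
        using st by (intro integrable_continuous_real continuous_on_subset[OF A_cont[OF that]]) auto
      have iR: "(\<lambda>t. rate_bound \<epsilon> \<mu> (u t)) integrable_on {s..t}"
        using st by (intro integrable_continuous_real continuous_on_subset[OF rate_bound_continuous]) auto
      \<comment> \<open>The two mixed terms inserted here cancel by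
        \<open>ip_tfield_commute\<close>.\<close>
      have "E t - E s = (ip (u t) (tfield (u t)) - ip (u s) (tfield (u t))) + (ip (u t) (tfield (u s)) - ip (u s) (tfield (u s)))"
        using ip_tfield_commute[OF sq] by (simp add: E_def)
      also have "\<dots> \<le> integral {s..t} (\<lambda>\<tau>. A (u \<tau>) (tfield (u t))) + integral {s..t} (\<lambda>\<tau>. A (u \<tau>) (tfield (u s)))"
        using inc[OF st(1,2) tt] inc[OF st(1,2) ts] by linarith
      also have "\<dots> = integral {s..t} (\<lambda>\<tau>. A (u \<tau>) (tfield (u t)) + A (u \<tau>) (tfield (u s)))"
        by (rule Henstock_Kurzweil_Integration.integral_add[symmetric]) (intro iA tt ts)+
      also have "\<dots> \<le> integral {s..t} (\<lambda>\<tau>. rate_bound \<epsilon> \<mu> (u \<tau>) + e)"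
      proof (rule integral_le)
        show "(\<lambda>\<tau>. A (u \<tau>) (tfield (u t)) + A (u \<tau>) (tfield (u s))) integrable_on {s..t}"
          by (intro Henstock_Kurzweil_Integration.integrable_add iA tt ts)
        show "(\<lambda>\<tau>. rate_bound \<epsilon> \<mu> (u \<tau>) + e) integrable_on {s..t}"
          by (intro Henstock_Kurzweil_Integration.integrable_add iR integrable_const_ivl)
        fix \<tau> assume \<tau>: "\<tau> \<in> {s..t}"
        then have t0: "0 \<le> \<tau>" "\<tau> \<le> T" "\<bar>t - \<tau>\<bar> < d" "\<bar>s - \<tau>\<bar> < d" using st by auto
        have "A (u \<tau>) (tfield (u t)) \<le> A (u \<tau>) (tfield (u \<tau>)) + B * e'"
          using A_le[OF t0(1,2), of t] mult_left_mono[OF less_imp_le[OF d(2)[of \<tau> t]] B0] t0 st by auto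
        moreover have "A (u \<tau>) (tfield (u s)) \<le> A (u \<tau>) (tfield (u \<tau>)) + B * e'"
          using A_le[OF t0(1,2), of s] mult_left_mono[OF less_imp_le[OF d(2)[of \<tau> s]] B0] t0 st by auto
        moreover have "2 * A (u \<tau>) (tfield (u \<tau>)) \<le> rate_bound \<epsilon> \<mu> (u \<tau>)"
          unfolding A_def by (rule rate_le[OF usq[OF t0(1)] wdiv_free_u[OF t0(1)] eps osc mu])
        ultimately show "A (u \<tau>) (tfield (u t)) + A (u \<tau>) (tfield (u s)) \<le> rate_bound \<epsilon> \<mu> (u \<tau>) + e"
          using e'(2) by linarith
      qed
      also have "\<dots> = integral {s..t} (\<lambda>t. rate_bound \<epsilon> \<mu> (u t)) + e * (t - s)"
        using st by (subst Henstock_Kurzweil_Integration.integral_add[OF iR integrable_const_ivl]) simp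
      finally show ?thesis .
    qed
    then show "\<exists>d>0. \<forall>s t. 0 \<le> s \<and> s \<le> t \<and> t \<le> T \<and> t - s < d \<longrightarrow> E t - E s \<le> integral {s..t} (\<lambda>t. rate_bound \<epsilon> \<mu> (u t)) + e * (t - s)"
      using d(1) by blast
  qed
  then show ?thesis using T by (simp add: E_def ip_tfield_self usq)
qed

end

section \<open>Cutoff functions\<close>

lemma test_lipschitz:
  fixes F :: "'a::euclidean_space \<Rightarrow> 'b::real_normed_vector"
  assumes F: "test_function F"
  obtains B where "B \<ge> 0" "\<And>x y. norm (F x - F y) \<le> B * norm (x - y)"
proof -
  have D: "F differentiable (at z)" for z
    using smooth_has_derivative[OF test_smooth[OF F]] differentiable_def by blast
  have "\<exists>B. B \<ge> 0 \<and> (\<forall>x. norm (frechet_derivative F (at x) b) \<le> B)" if "b \<in> Basis" for b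
    using cpt_supp_bounded[OF smooth_continuous[OF smooth_frechet[OF test_smooth[OF F] that]] cpt_supp_frechet[OF test_cpt_supp[OF F]]]
    by metis
  then obtain B where B: "\<And>b. b \<in> Basis \<Longrightarrow> B b \<ge> 0" "\<And>b x. b \<in> Basis \<Longrightarrow> norm (frechet_derivative F (at x) b) \<le> B b"
    by metis
  define B0 where "B0 = (\<Sum>b\<in>Basis. B b)"
  have on: "onorm (frechet_derivative F (at x)) \<le> B0" for x
  proof (rule onorm_le)
    fix v
    have "norm (frechet_derivative F (at x) v) \<le> (\<Sum>b\<in>Basis. norm ((v \<bullet> b) *\<^sub>R frechet_derivative F (at x) b))"
      unfolding frechet_derivative_expand[OF D, of x v] by (rule norm_sum)
    also have "\<dots> \<le> (\<Sum>b\<in>Basis. norm v * B b)"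
      by (intro sum_mono) (auto simp: Basis_le_norm intro!: mult_mono B)
    finally show "norm (frechet_derivative F (at x) v) \<le> B0 * norm v"
      by (simp add: B0_def sum_distrib_right[symmetric] sum_distrib_left[symmetric] mult.commute)
  qed
  have "norm (F x - F y) \<le> B0 * norm (x - y)" for x y
    by (rule differentiable_bound[of UNIV F "\<lambda>x. frechet_derivative F (at x)"])
       (use on in \<open>auto intro: has_derivative_at_withinI smooth_has_derivative[OF test_smooth[OF F]]\<close>)
  then show ?thesis using that[of B0] B(1) by (simp add: B0_def sum_nonneg)
qed

text \<open>The mollifier is Lipschitz, and for shifts of length at most 1 the difference lives in
  the ball of radius \<open>\<epsilon> + 1\<close>. So for fixed \<open>\<epsilon>\<close> the
  commutators are linear in \<open>\<delta>\<close>.\<close>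

lemma osc_bound_linear:
  assumes e: "\<epsilon> > 0"
  obtains C where "C \<ge> 0" "\<And>\<delta>. \<delta> \<le> 1 \<Longrightarrow> osc_bound \<epsilon> \<delta> (C * \<delta>)"
proof -
  let ?F = "mollifier_eps \<epsilon>"
  have t: "test_function ?F" by (rule test_mollifier_eps[OF e])
  obtain B where B: "B \<ge> 0" "\<And>x y. norm (?F x - ?F y) \<le> B * norm (x - y)"
    using test_lipschitz[OF t] by blast
  define V where "V = sqrt (measure lborel (cball (0::R3) (\<epsilon> + 1)))"
  have V0: "V \<ge> 0" by (simp add: V_def)
  have "osc_bound \<epsilon> \<delta> ((B * V) * \<delta>)" if d: "\<delta> \<le> 1" for \<delta>
    unfolding osc_bound_def
  proof (intro allI impI)
    fix h :: R3 assume h: "norm h \<le> \<delta>"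
    have "nrm (\<lambda>z. ?F (z + h) - ?F z) \<le> (B * norm h) * V"
      unfolding V_def
    proof (rule nrm_bound_cball(2))
      have "continuous_on UNIV (\<lambda>z. ?F (z + h) - ?F z)"
        by (intro continuous_intros continuous_on_compose2[OF smooth_continuous[OF test_smooth[OF t], of UNIV]]) auto
      then show "(\<lambda>z. ?F (z + h) - ?F z) \<in> borel_measurable borel" by (rule borel_measurable_continuous_onI)
      show "norm (?F (z + h) - ?F z) \<le> B * norm h" for z
        using B(2)[of "z + h" z] by simp
      show "?F (z + h) - ?F z = 0" if "norm z > \<epsilon> + 1" for z
      proof -
        have "norm z \<le> norm (z + h) + norm h" using norm_triangle_ineq4[of "z + h" h] by simp
        then have "\<not> norm (z + h) < \<epsilon>" "\<not> norm z < \<epsilon>" using that h d by auto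
        then have "?F (z + h) = 0" "?F z = 0" using mollifier_eps_support[OF e] by blast+
        then show ?thesis by simp
      qed
    qed
    also have "\<dots> \<le> (B * V) * \<delta>"
      using mult_left_mono[OF h, of "B * V"] B(1) V0 by (simp add: ac_simps)
    finally show "nrm (\<lambda>z. ?F (z + h) - ?F z) \<le> (B * V) * \<delta>" .
  qed
  then show ?thesis using that[of "B * V"] B(1) V0 by simp
qed

lemma partial_has_real_derivative:
  fixes q :: "R3 \<Rightarrow> real"
  assumes "smooth q"
  shows "((\<lambda>s. q (x + s *\<^sub>R axis i 1)) has_real_derivative partial_deriv i q x) (at 0)"
proof -
  have "((\<lambda>s. x + s *\<^sub>R axis i 1) has_derivative (\<lambda>h. h *\<^sub>R (axis i 1 :: R3))) (at 0)"
    by (auto intro!: derivative_eq_intros)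
  from has_derivative_compose[OF this, of q "frechet_derivative q (at x)"] smooth_has_derivative[OF assms, of x]
  have "((\<lambda>s. q (x + s *\<^sub>R axis i 1)) has_derivative (\<lambda>h. frechet_derivative q (at x) (h *\<^sub>R axis i 1))) (at 0)"
    by simp
  moreover have "frechet_derivative q (at x) (h *\<^sub>R axis i 1) = partial_deriv i q x * h" for h
    using linear_scale[OF has_derivative_linear[OF smooth_has_derivative[OF assms]], of x h "axis i 1"]
    by (simp add: partial_deriv_def)
  ultimately show ?thesis
    unfolding has_field_derivative_def by simp
qed

lemma partial_le_lipschitz:
  fixes q :: "R3 \<Rightarrow> real"
  assumes q: "smooth q" and L: "\<And>x y. \<bar>q x - q y\<bar> \<le> L * norm (x - y)"
  shows "\<bar>partial_deriv i q x\<bar> \<le> L"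
proof -
  have "((\<lambda>h. (q (x + (0 + h) *\<^sub>R axis i 1) - q (x + 0 *\<^sub>R axis i 1)) / h) \<longlongrightarrow> partial_deriv i q x) (at 0)"
    using partial_has_real_derivative[OF q, of x i] unfolding DERIV_def .
  then have "((\<lambda>h. \<bar>(q (x + h *\<^sub>R axis i 1) - q x) / h\<bar>) \<longlongrightarrow> \<bar>partial_deriv i q x\<bar>) (at 0)"
    by (intro tendsto_rabs) simp
  then show ?thesis
  proof (rule tendsto_upperbound)
    show "\<forall>\<^sub>F h in at 0. \<bar>(q (x + h *\<^sub>R axis i 1) - q x) / h\<bar> \<le> L"
      unfolding eventually_at_filter
    proof (intro always_eventually allI impI)
      fix h :: real assume "h \<noteq> 0"
      then show "\<bar>(q (x + h *\<^sub>R axis i 1) - q x) / h\<bar> \<le> L"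
        using L[of "x + h *\<^sub>R axis i 1" x] by (simp add: field_simps abs_divide)
    qed
  qed simp
qed

text \<open>Mollification preserves the Lipschitz constant and the range of \<open>l\<close>, and
  its plateaus up to a margin \<open>\<mu>\<close>. The factor 2 majorises the square root of 3 that
  comes from three partial derivatives.\<close>

lemma mollified_cutoff:
  fixes l :: "R3 \<Rightarrow> real"
  assumes l: "\<And>x y. \<bar>l x - l y\<bar> \<le> L * norm (x - y)" "\<And>x. 0 \<le> l x" "\<And>x. l x \<le> 1" "cpt_supp l" and m: "\<mu> > 0" and L: "L \<ge> 0"
  shows "\<exists>\<phi>::R3 \<Rightarrow> real. test_function \<phi> \<and> (\<forall>x. 0 \<le> \<phi> x) \<and> (\<forall>x. \<phi> x \<le> 1) \<and> (\<forall>x. gn \<phi> x \<le> 2 * L) \<and>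
    (\<forall>x. (\<forall>y. dist y x \<le> \<mu> \<longrightarrow> l y = 1) \<longrightarrow> \<phi> x = 1) \<and> (\<forall>x. (\<forall>y. dist y x \<le> \<mu> \<longrightarrow> l y = 0) \<longrightarrow> \<phi> x = 0)"
proof -
  let ?F = "mollifier_eps \<mu>"
  have k: "kernel ?F \<mu> 1" by (rule kernel_mollifier_eps[OF m])
  note kd = kernelD[OF k]
  have tF: "test_function ?F" by (rule test_mollifier_eps[OF m])
  have cl: "continuous_on UNIV l"
    unfolding continuous_on_iff
  proof (intro ballI allI impI)
    fix x :: R3 and e :: real assume e: "e > 0"
    have "dist (l y) (l x) < e" if "dist y x < e / (L + 1)" for y
    proof -
      have "L * norm (y - x) \<le> (L + 1) * norm (y - x)" by (simp add: distrib_right)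
      also have "\<dots> < e" using that L by (simp add: dist_norm field_simps)
      finally show ?thesis using l(1)[of y x] by (simp add: dist_real_def)
    qed
    then show "\<exists>d>0. \<forall>x'\<in>UNIV. dist x' x < d \<longrightarrow> dist (l x') (l x) < e"
      using e L by (intro exI[of _ "e / (L + 1)"]) auto
  qed
  have ll: "loc_int l" by (rule loc_int_continuous[OF cl])
  have lm: "l \<in> borel_measurable borel" by (rule loc_int_measurable[OF ll])
  define \<phi> where "\<phi> = cv ?F l"
  have t: "test_function \<phi>"
    unfolding \<phi>_def by (rule test_gcv[OF bounded_bilinear_scaleR tF ll l(4)])
  \<comment> \<open>Values in \<open>[0,1]\<close> are those within 1/2 of 1/2, the form in which
    \<open>kernel_cv_sup\<close> applies.\<close>
  have half: "\<bar>\<phi> x - 1 * (1 / 2)\<bar> \<le> 1 * (1 / 2)" for x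
  proof -
    have "norm (l y - 1 / 2) \<le> 1 / 2" for y
      using l(2,3)[of y] unfolding real_norm_def abs_le_iff by linarith
    then have "norm (cv ?F l x - 1 *\<^sub>R (1 / 2)) \<le> 1 * (1 / 2)"
      by (intro kernel_cv_sup[OF k ll])
    then show ?thesis by (simp add: \<phi>_def)
  qed
  then have 01: "0 \<le> \<phi> x" "\<phi> x \<le> 1" for x using half[of x] unfolding abs_le_iff by linarith+
  have lip: "\<bar>\<phi> x - \<phi> y\<bar> \<le> L * norm (x - y)" for x y
  proof -
    \<comment> \<open>Commuted so that the translation acts on \<open>l\<close>, where the Lipschitz
      bound is.\<close>
    have c: "\<phi> x = (\<integral>z. ?F z * l (x - z) \<partial>lborel)" for x
      unfolding \<phi>_def using gcv_commute[OF bounded_bilinear_scaleR kd(7) lm, of x]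
      by (simp add: gcv_def mult.commute)
    have i: "integrable lborel (\<lambda>z. ?F z * l (x - z))" for x
    proof -
      have "integrable lborel (\<lambda>z. l (x - z) *\<^sub>R ?F z)"
        by (rule gcv_integrable[OF bounded_bilinear_scaleR cl l(4) loc_int_continuous[OF kd(1)]])
      then show ?thesis by (simp add: mult.commute)
    qed
    have "\<phi> x - \<phi> y = (\<integral>z. ?F z * l (x - z) - ?F z * l (y - z) \<partial>lborel)"
      unfolding c by (rule Bochner_Integration.integral_diff[symmetric]) (rule i)+
    also have "norm \<dots> \<le> (\<integral>z. ?F z * (L * norm (x - y)) \<partial>lborel)"
    proof (rule Bochner_Integration.integral_norm_bound_integral)
      show "integrable lborel (\<lambda>z. ?F z * l (x - z) - ?F z * l (y - z))" using i by auto
      show "integrable lborel (\<lambda>z. ?F z * (L * norm (x - y)))" using kd(8) by simp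
      show "norm (?F z * l (x - z) - ?F z * l (y - z)) \<le> ?F z * (L * norm (x - y))" for z
        using mult_left_mono[OF l(1)[of "x - z" "y - z"] kd(3)[of z]] kd(3)[of z]
        by (simp add: right_diff_distrib[symmetric] abs_mult)
    qed
    also have "\<dots> = L * norm (x - y)" using kd(5) by simp
    finally show ?thesis by simp
  qed
  have g: "gn \<phi> x \<le> 2 * L" for x
    unfolding gn_def
  proof (rule real_le_lsqrt)
    have "(norm (partial_deriv i \<phi> x))\<^sup>2 \<le> L\<^sup>2" for i
      using power_mono[OF partial_le_lipschitz[OF test_smooth[OF t] lip, of i x], of 2] by simp
    then have "(\<Sum>i\<in>UNIV. (norm (partial_deriv i \<phi> x))\<^sup>2) \<le> (\<Sum>i\<in>(UNIV::3 set). L\<^sup>2)" by (intro sum_mono)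
    also have "\<dots> \<le> (2 * L)\<^sup>2" by (simp add: power_mult_distrib)
    finally show "(\<Sum>i\<in>UNIV. (norm (partial_deriv i \<phi> x))\<^sup>2) \<le> (2 * L)\<^sup>2" .
  qed (use L in auto)
  have o: "\<phi> x = 1" if "\<And>y. dist y x \<le> \<mu> \<Longrightarrow> l y = 1" for x
    using kernel_cv_sup[OF k ll, of x 1 0] that by (simp add: \<phi>_def)
  have z: "\<phi> x = 0" if "\<And>y. dist y x \<le> \<mu> \<Longrightarrow> l y = 0" for x
    unfolding \<phi>_def by (rule kernel_cv_zero[OF k that])
  show ?thesis
  proof -
    have "(\<forall>x. 0 \<le> \<phi> x) \<and> (\<forall>x. \<phi> x \<le> 1) \<and> (\<forall>x. gn \<phi> x \<le> 2 * L)" using 01 g by simp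
    moreover have "\<forall>x. (\<forall>y. dist y x \<le> \<mu> \<longrightarrow> l y = 1) \<longrightarrow> \<phi> x = 1" using o by simp
    moreover have "\<forall>x. (\<forall>y. dist y x \<le> \<mu> \<longrightarrow> l y = 0) \<longrightarrow> \<phi> x = 0" using z by simp
    ultimately show ?thesis using t by blast
  qed
qed

section \<open>Radial cutoffs\<close>

definition ramp :: "real \<Rightarrow> real" where "ramp t = max 0 (min 1 t)"

lemma ramp_1: "t \<ge> 1 \<Longrightarrow> ramp t = 1" and ramp_0: "t \<le> 0 \<Longrightarrow> ramp t = 0"
  by (simp_all add: ramp_def)

lemma ramp_lipschitz: "\<bar>ramp s - ramp t\<bar> \<le> \<bar>s - t\<bar>"
  by (auto simp: ramp_def max_def min_def)

lemma ramp_norm_lipschitz: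
  fixes x y :: R3
  assumes "b \<ge> 0"
  shows "\<bar>ramp (a + c * norm x / b) - ramp (a + c * norm y / b)\<bar> \<le> \<bar>c\<bar> / b * norm (x - y)"
proof -
  have "\<bar>ramp (a + c * norm x / b) - ramp (a + c * norm y / b)\<bar> \<le> \<bar>c / b * (norm x - norm y)\<bar>"
    using ramp_lipschitz[of "a + c * norm x / b" "a + c * norm y / b"] by (simp add: right_diff_distrib)
  also have "\<dots> \<le> \<bar>c\<bar> / b * norm (x - y)"
    unfolding abs_mult abs_divide using assms by (intro mult_mono norm_triangle_ineq3) auto
  finally show ?thesis .
qed

lemma inner_cutoff:
  assumes S: "S > 0"
  shows "\<exists>\<phi>::R3 \<Rightarrow> real. test_function \<phi> \<and> (\<forall>x. 0 \<le> \<phi> x) \<and> (\<forall>x. \<phi> x \<le> 1) \<and> (\<forall>x. gn \<phi> x \<le> 2 / S) \<and>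
    (\<forall>x. norm x \<le> S \<longrightarrow> \<phi> x = 1)"
proof -
  \<comment> \<open>The scale \<open>S + 1\<close> leaves a margin of 1 around the ball of radius
    \<open>S\<close> for the mollification.\<close>
  define l where "l x = ramp (2 + (- 1) * norm x / (S + 1))" for x :: R3
  have l1: "\<bar>l x - l y\<bar> \<le> 1 / (S + 1) * norm (x - y)" for x y
    unfolding l_def using ramp_norm_lipschitz[of "S + 1" 2 "-1" x y] S by simp
  have l2: "0 \<le> l x" "l x \<le> 1" for x by (auto simp: l_def ramp_def)
  have "l x = 0" if "norm x > 2 * (S + 1)" for x
    using that S by (simp add: l_def ramp_def field_simps)
  then have l3: "cpt_supp l" unfolding cpt_supp_def by (metis not_less)
  have l4: "l y = 1" if "norm y \<le> S + 1" for y
    using that S by (simp add: l_def ramp_def min_def max_def field_simps)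
  have L0: "0 \<le> 1 / (S + 1)" using S by simp
  obtain \<phi> :: "R3 \<Rightarrow> real" where \<phi>: "test_function \<phi>" "\<And>x. 0 \<le> \<phi> x" "\<And>x. \<phi> x \<le> 1" "\<And>x. gn \<phi> x \<le> 2 * (1 / (S + 1))"
    "\<And>x. (\<forall>y. dist y x \<le> 1 \<longrightarrow> l y = 1) \<Longrightarrow> \<phi> x = 1"
    using mollified_cutoff[OF l1 l2 l3 zero_less_one L0] by blast
  have "2 * (1 / (S + 1)) \<le> 2 / S" using S by (simp add: field_simps)
  then have g: "gn \<phi> x \<le> 2 / S" for x using \<phi>(4)[of x] by linarith
  have o: "\<phi> x = 1" if "norm x \<le> S" for x
  proof (rule \<phi>(5), intro allI impI)
    fix y assume "dist y x \<le> 1"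
    then have "norm y \<le> S + 1" using that norm_triangle_ineq2[of y x] by (simp add: dist_norm)
    then show "l y = 1" by (rule l4)
  qed
  show ?thesis using \<phi>(1-3) g o by blast
qed

lemma outer_cutoff:
  assumes R: "R1 < R2" and S: "S > 0" "R2 - R1 \<le> 2 * S"
  shows "\<exists>\<phi>::R3 \<Rightarrow> real. test_function \<phi> \<and> (\<forall>x. 0 \<le> \<phi> x) \<and> (\<forall>x. \<phi> x \<le> 1) \<and> (\<forall>x. gn \<phi> x \<le> 4 / (R2 - R1)) \<and>
    (\<forall>x. R2 \<le> norm x \<and> norm x \<le> S \<longrightarrow> \<phi> x = 1) \<and> (\<forall>x. norm x \<le> R1 \<longrightarrow> \<phi> x = 0)"
proof -
  \<comment> \<open>The gap is cut into quarters: the ramp rises over the middle half, from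
    \<open>R1 + \<mu>\<close> to \<open>R2 - \<mu>\<close>, with slope \<open>2 / (R2 - R1)\<close>,
    and the outer quarters absorb the mollification. The 4 in the claim is this 2 doubled by
    \<open>mollified_cutoff\<close>.\<close>
  define \<mu> where "\<mu> = (R2 - R1) / 4"
  have "R2 = R1 + 4 * \<mu>" by (simp add: \<mu>_def diff_divide_distrib)
  have m: "\<mu> > 0" "R2 - \<mu> - (R1 + \<mu>) = (R2 - R1) / 2"
    using R \<open>R2 = R1 + 4 * \<mu>\<close> by simp_all
  define L where "L = 2 / (R2 - R1)"
  have L0: "L > 0" using R by (simp add: L_def)
  define l1 where "l1 x = ramp (- (R1 + \<mu>) * L + L * norm x / 1)" for x :: R3
  \<comment> \<open>This ramp descends from \<open>S + \<mu>\<close> to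
    \<open>2 * (S + \<mu>)\<close>; \<open>R2 - R1 \<le> 2 * S\<close> makes it no steeper than the
    first one.\<close>
  define l2 where "l2 x = ramp (2 + (- 1) * norm x / (S + \<mu>))" for x :: R3
  define l where "l x = min (l1 x) (l2 x)" for x
  have lip1: "\<bar>l1 x - l1 y\<bar> \<le> L * norm (x - y)" for x y
    unfolding l1_def using ramp_norm_lipschitz[of 1 "- (R1 + \<mu>) * L" L x y] L0 by simp
  have lip2: "\<bar>l2 x - l2 y\<bar> \<le> L * norm (x - y)" for x y
  proof -
    have "1 / (S + \<mu>) \<le> L" using S m(1) R by (simp add: L_def field_simps)
    then show ?thesis
      unfolding l2_def using ramp_norm_lipschitz[of "S + \<mu>" 2 "-1" x y] S m(1)
        mult_right_mono[of "1 / (S + \<mu>)" L "norm (x - y)"] by simp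
  qed
  have lip: "\<bar>l x - l y\<bar> \<le> L * norm (x - y)" for x y
    using lip1[of x y] lip2[of x y] unfolding l_def min_def abs_le_iff by auto
  have l01: "0 \<le> l x" "l x \<le> 1" for x by (auto simp: l_def l1_def l2_def ramp_def)
  have "l x = 0" if "norm x > 2 * (S + \<mu>)" for x
  proof -
    have "l2 x = 0" using that S m(1) by (simp add: l2_def ramp_def field_simps)
    then show ?thesis by (simp add: l_def l1_def ramp_def)
  qed
  then have cs: "cpt_supp l" unfolding cpt_supp_def by (metis not_less)
  have one: "l y = 1" if "R2 - \<mu> \<le> norm y" "norm y \<le> S + \<mu>" for y
  proof -
    have "(R1 + \<mu>) * L + 1 \<le> L * norm y"
    proof -
      have "(R1 + \<mu>) * L + 1 = L * (R2 - \<mu>)"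
      proof -
        have "L * (R2 - \<mu>) - L * (R1 + \<mu>) = L * ((R2 - R1) / 2)"
          unfolding right_diff_distrib[symmetric] m(2) ..
        also have "\<dots> = 1" using R by (simp add: L_def)
        finally show ?thesis by (simp add: mult.commute)
      qed
      also have "\<dots> \<le> L * norm y" using that(1) L0 by simp
      finally show ?thesis .
    qed
    then have "- (R1 + \<mu>) * L + L * norm y / 1 \<ge> 1" by (simp add: algebra_simps)
    then have "l1 y = 1" unfolding l1_def by (rule ramp_1)
    moreover have "l2 y = 1" using that(2) S m(1) by (simp add: l2_def ramp_def min_def max_def field_simps)
    ultimately show ?thesis by (simp add: l_def)
  qed
  have zero: "l y = 0" if "norm y \<le> R1 + \<mu>" for y
  proof -
    have "L * norm y \<le> (R1 + \<mu>) * L" using that L0 by (simp add: mult.commute)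
    then have "- (R1 + \<mu>) * L + L * norm y / 1 \<le> 0" by (simp add: algebra_simps)
    then have "l1 y = 0" unfolding l1_def by (rule ramp_0)
    then show ?thesis by (simp add: l_def l2_def ramp_def)
  qed
  obtain \<phi> :: "R3 \<Rightarrow> real" where \<phi>: "test_function \<phi>" "\<And>x. 0 \<le> \<phi> x" "\<And>x. \<phi> x \<le> 1" "\<And>x. gn \<phi> x \<le> 2 * L"
    "\<And>x. (\<forall>y. dist y x \<le> \<mu> \<longrightarrow> l y = 1) \<Longrightarrow> \<phi> x = 1" "\<And>x. (\<forall>y. dist y x \<le> \<mu> \<longrightarrow> l y = 0) \<Longrightarrow> \<phi> x = 0"
    using mollified_cutoff[OF lip l01 cs m(1) less_imp_le[OF L0]] by blast
  have o: "\<phi> x = 1" if "R2 \<le> norm x" "norm x \<le> S" for x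
  proof (rule \<phi>(5), intro allI impI)
    fix y assume "dist y x \<le> \<mu>"
    then have "R2 - \<mu> \<le> norm y" "norm y \<le> S + \<mu>"
      using that norm_triangle_ineq2[of y x] norm_triangle_ineq2[of x y] by (auto simp: dist_norm norm_minus_commute)
    then show "l y = 1" by (rule one)
  qed
  have z: "\<phi> x = 0" if "norm x \<le> R1" for x
  proof (rule \<phi>(6), intro allI impI)
    fix y assume "dist y x \<le> \<mu>"
    then have "norm y \<le> R1 + \<mu>" using that norm_triangle_ineq2[of y x] by (simp add: dist_norm)
    then show "l y = 0" by (rule zero)
  qed
  have g: "gn \<phi> x \<le> 4 / (R2 - R1)" for x using \<phi>(4)[of x] by (simp add: L_def)
  show ?thesis using \<phi>(1-3) g o z by blast
qed

section \<open>Removing the mollification\<close>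

text \<open>One factor is bounded pointwise and the other is square integrable, so the mollified
  field lies in L4.\<close>

lemma sqint_norm_sq_mol:
  assumes d: "\<delta> > 0" and w: "sqint w"
  shows "sqint (\<lambda>x. (norm (mol \<delta> w x))\<^sup>2)"
proof (rule sqint_bound(1)[OF _ sqint_mol(1)[OF d w]])
  show "(\<lambda>x. (norm (mol \<delta> w x))\<^sup>2) \<in> borel_measurable borel"
    using mol_measurable[OF d w] by measurable
  show "norm ((norm (mol \<delta> w x))\<^sup>2) \<le> (nrm (mollifier_eps \<delta>) * nrm w) * norm (mol \<delta> w x)" for x
    using mult_right_mono[OF mol_sup[OF d w, of x], of "norm (mol \<delta> w x)"] by (simp add: power2_eq_square)
  show "0 \<le> nrm (mollifier_eps \<delta>) * nrm w" by (simp add: nrm_nonneg)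
qed

lemma cutoff_sequence:
  obtains X :: "nat \<Rightarrow> R3 \<Rightarrow> real" where "\<And>n. test_function (X n)" "\<And>n x. 0 \<le> X n x" "\<And>n x. X n x \<le> 1"
    "\<And>n x. gn (X n) x \<le> 2 / real (Suc n)" "\<And>x. (\<lambda>n. X n x) \<longlonglongrightarrow> 1"
proof -
  have "\<exists>\<phi>::R3 \<Rightarrow> real. test_function \<phi> \<and> (\<forall>x. 0 \<le> \<phi> x) \<and> (\<forall>x. \<phi> x \<le> 1) \<and> (\<forall>x. gn \<phi> x \<le> 2 / real (Suc n)) \<and>
    (\<forall>x. norm x \<le> real (Suc n) \<longrightarrow> \<phi> x = 1)" for n
    by (rule inner_cutoff) simp
  then obtain X :: "nat \<Rightarrow> R3 \<Rightarrow> real" where X: "\<And>n. test_function (X n)" "\<And>n x. 0 \<le> X n x" "\<And>n x. X n x \<le> 1"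
    "\<And>n x. gn (X n) x \<le> 2 / real (Suc n)" "\<And>n x. norm x \<le> real (Suc n) \<Longrightarrow> X n x = 1"
    by metis
  have "(\<lambda>n. X n x) \<longlonglongrightarrow> 1" for x
  proof (rule tendsto_eventually)
    obtain N where N: "norm x \<le> real N" using real_arch_simple by blast
    show "\<forall>\<^sub>F n in sequentially. X n x = 1"
      using eventually_ge_at_top[of N] by eventually_elim (use N in \<open>auto intro!: X(5)\<close>)
  qed
  with X that show ?thesis by blast
qed

text \<open>Cutoffs reduce this to test fields: the gradient of the cutoff contributes at most
  \<open>2 / real (Suc n) * nrm w\<close>, which disappears in the limit.\<close>

lemma ladyzhenskaya_mol:
  assumes d: "\<delta> > 0" and w: "sqint w"
  shows "(nrm (\<lambda>x. (norm (mol \<delta> w x))\<^sup>2))\<^sup>2 \<le> 4 * nrm w * (nrm (gn (mol \<delta> w))) ^ 3"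
proof -
  define v where "v = mol \<delta> w"
  have sv: "smooth v" and qv: "sqint v" "nrm v \<le> nrm w"
    using smooth_mol[OF d w] sqint_mol[OF d w] by (auto simp: v_def)
  have sp: "sqint (partial_deriv i v)" for i unfolding v_def by (rule sqint_partial_mol[OF d w])
  have sgv: "sqint (gn v)" by (rule sqint_gn(1)[OF sp])
  have q4: "integrable lborel (\<lambda>x. (norm (v x)) ^ 4)" "(nrm (\<lambda>x. (norm (v x))\<^sup>2))\<^sup>2 = (\<integral>x. (norm (v x)) ^ 4 \<partial>lborel)"
    using sqint_integrable[OF sqint_norm_sq_mol[OF d w]] by (auto simp: v_def nrm_sq simp flip: power_mult)
  obtain X :: "nat \<Rightarrow> R3 \<Rightarrow> real" where X: "\<And>n. test_function (X n)" "\<And>n x. 0 \<le> X n x" "\<And>n x. X n x \<le> 1"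
    "\<And>n x. gn (X n) x \<le> 2 / real (Suc n)" "\<And>x. (\<lambda>n. X n x) \<longlonglongrightarrow> 1"
    using cutoff_sequence by blast
  have tX: "test_function (\<lambda>x. X n x *\<^sub>R v x)" for n
    by (rule test_bilinear_left[OF bounded_bilinear_scaleR X(1) sv])
  have lim: "(\<lambda>n. \<integral>x. (norm (X n x *\<^sub>R v x)) ^ 4 \<partial>lborel) \<longlonglongrightarrow> (\<integral>x. (norm (v x)) ^ 4 \<partial>lborel)"
  proof (rule integral_dominated_convergence[where w="\<lambda>x. (norm (v x)) ^ 4"])
    show "(\<lambda>x. (norm (v x)) ^ 4) \<in> borel_measurable lborel"
      using sqint_measurable[OF qv(1)] by measurable
    show "(\<lambda>x. (norm (X n x *\<^sub>R v x)) ^ 4) \<in> borel_measurable lborel" for n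
      using test_measurable[OF tX] by measurable
    show "integrable lborel (\<lambda>x. (norm (v x)) ^ 4)" by (rule q4)
    have "(\<lambda>n. (norm (X n x *\<^sub>R v x)) ^ 4) \<longlonglongrightarrow> (norm (1 *\<^sub>R v x)) ^ 4" for x
      by (intro tendsto_intros X)
    then show "AE x in lborel. (\<lambda>n. (norm (X n x *\<^sub>R v x)) ^ 4) \<longlonglongrightarrow> (norm (v x)) ^ 4" by simp
    show "AE x in lborel. norm ((norm (X n x *\<^sub>R v x)) ^ 4) \<le> (norm (v x)) ^ 4" for n
      using X(2,3)[of n] by (intro AE_I2) (auto intro!: power_mono simp: mult_left_le_one_le)
  qed
  have le: "(\<integral>x. (norm (X n x *\<^sub>R v x)) ^ 4 \<partial>lborel) \<le> 4 * nrm w * (nrm (gn v) + 2 / real (Suc n) * nrm w) ^ 3" for n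
  proof -
    have gle: "norm (gn (\<lambda>x. X n x *\<^sub>R v x) x) \<le> norm (gn v x + (2 / real (Suc n)) * norm (v x))" for x
    proof -
      have "gn (\<lambda>x. X n x *\<^sub>R v x) x = L2_set (\<lambda>i. norm (X n x *\<^sub>R partial_deriv i v x + partial_deriv i (X n) x *\<^sub>R v x)) UNIV"
        by (simp add: gn_def L2_set_def partial_bilinear[OF bounded_bilinear_scaleR test_smooth[OF X(1)] sv])
      also have "\<dots> \<le> L2_set (\<lambda>i. norm (X n x *\<^sub>R partial_deriv i v x) + norm (partial_deriv i (X n) x *\<^sub>R v x)) UNIV"
        by (intro L2_set_mono norm_triangle_ineq) auto
      also have "\<dots> \<le> L2_set (\<lambda>i. norm (X n x *\<^sub>R partial_deriv i v x)) UNIV + L2_set (\<lambda>i. norm (partial_deriv i (X n) x *\<^sub>R v x)) UNIV"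
        by (rule L2_set_triangle_ineq)
      also have "\<dots> = \<bar>X n x\<bar> * gn v x + gn (X n) x * norm (v x)"
        by (simp add: L2_set_def gn_def power_mult_distrib real_sqrt_mult flip: sum_distrib_left sum_distrib_right)
      also have "\<dots> \<le> gn v x + (2 / real (Suc n)) * norm (v x)"
        using X(2,3)[of n x] by (intro add_mono mult_right_mono X(4)) (auto simp: gn_nonneg mult_left_le_one_le)
      finally show ?thesis using gn_nonneg[of "\<lambda>x. X n x *\<^sub>R v x" x] gn_nonneg[of v x] by simp
    qed
    have s2: "sqint (\<lambda>x. (2 / real (Suc n)) * norm (v x))" "nrm (\<lambda>x. (2 / real (Suc n)) * norm (v x)) = 2 / real (Suc n) * nrm v"
      using sqint_scaleR[OF sqint_norm[OF qv(1)], of "2 / real (Suc n)"] by (auto simp: nrm_norm)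
    have g: "nrm (gn (\<lambda>x. X n x *\<^sub>R v x)) \<le> nrm (gn v) + 2 / real (Suc n) * nrm w"
    proof -
      have "nrm (gn (\<lambda>x. X n x *\<^sub>R v x)) \<le> nrm (\<lambda>x. gn v x + (2 / real (Suc n)) * norm (v x))"
        by (rule sqint_mono(2)[OF sqint_measurable[OF test_gn(1)[OF tX]] sqint_add(1)[OF sgv s2(1)] gle])
      also have "\<dots> \<le> nrm (gn v) + 2 / real (Suc n) * nrm v" using sqint_add(2)[OF sgv s2(1)] s2(2) by simp
      also have "\<dots> \<le> nrm (gn v) + 2 / real (Suc n) * nrm w"
        using mult_left_mono[OF qv(2), of "2 / real (Suc n)"] by simp
      finally show ?thesis .
    qed
    have "nrm (\<lambda>x. X n x *\<^sub>R v x) \<le> nrm w"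
      using sqint_weighted(2)[OF test_measurable[OF X(1)[of n]] _ qv(1)] X(2,3)[of n] qv(2) by fastforce
    then have "4 * nrm (\<lambda>x. X n x *\<^sub>R v x) * (nrm (gn (\<lambda>x. X n x *\<^sub>R v x))) ^ 3 \<le> 4 * nrm w * (nrm (gn v) + 2 / real (Suc n) * nrm w) ^ 3"
      by (intro mult_mono power_mono g) (auto simp: nrm_nonneg)
    then show ?thesis using ladyzhenskaya_test[OF tX, of n] by linarith
  qed
  have "(\<lambda>n. 2 / real (Suc n)) \<longlonglongrightarrow> 0" by real_asymp
  then have "(\<lambda>n. 4 * nrm w * (nrm (gn v) + 2 / real (Suc n) * nrm w) ^ 3) \<longlonglongrightarrow> 4 * nrm w * (nrm (gn v) + 0 * nrm w) ^ 3"
    by (intro tendsto_intros)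
  from LIMSEQ_le[OF lim this] le show ?thesis
    unfolding q4(2)[unfolded v_def] by (auto simp: v_def)
qed

text \<open>Jensen's inequality bounds the square of \<open>mol \<epsilon> v\<close> by the
  mollified square \<open>cv F q\<close>, and mollification does not increase the norm of
  \<open>q\<close>. Ladyzhenskaya's inequality thus carries over with a constant independent of
  \<open>\<epsilon>\<close>.\<close>

lemma conv_norm_mol:
  assumes e: "\<epsilon> > 0" and d: "\<delta> > 0" and w: "sqint w"
  shows "(conv_norm \<epsilon> (mol \<delta> w))\<^sup>2 \<le> 4 * nrm w * (nrm (gn (mol \<delta> w))) ^ 3"
proof -
  define v where "v = mol \<delta> w"
  define F where "F = mollifier_eps \<epsilon>"
  have k: "kernel F \<epsilon> 1" unfolding F_def by (rule kernel_mollifier_eps[OF e])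
  note kd = kernelD[OF k]
  have qv: "sqint v" using sqint_mol[OF d w] by (auto simp: v_def)
  define q where "q x = (norm (v x))\<^sup>2" for x
  have sq: "sqint q" unfolding q_def[abs_def] v_def by (rule sqint_norm_sq_mol[OF d w])
  have sc: "sqint (cv F q)" by (rule kernel_cv(1)[OF k sq])
  have pw: "(norm (norm (mol \<epsilon> v x) * norm (v x)))\<^sup>2 \<le> norm (cv F q x) * norm (q x)" for x
  proof -
    have "(norm (mol \<epsilon> v x))\<^sup>2 \<le> 1 * (\<integral>y. norm (F (x - y)) * (norm (v y))\<^sup>2 \<partial>lborel)"
      using sqint_gcv(3)[OF bounded_bilinear_scaleR _ kd(1,2) qv, of x] kd(10) by (simp add: mol_def F_def)
    also have "\<dots> = cv F q x" using kd(3) by (simp add: gcv_def q_def)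
    finally have 1: "(norm (mol \<epsilon> v x))\<^sup>2 \<le> cv F q x" .
    have "(norm (mol \<epsilon> v x))\<^sup>2 * q x \<le> norm (cv F q x) * norm (q x)"
      using 1 by (intro mult_mono) (auto simp: q_def)
    then show ?thesis by (simp add: power_mult_distrib q_def)
  qed
  have "(conv_norm \<epsilon> v)\<^sup>2 \<le> (\<integral>x. norm (cv F q x) * norm (q x) \<partial>lborel)"
    unfolding conv_norm_def nrm_sq
    by (intro integral_mono sqint_integrable conv_norm_le e qv integrable_norm_mult sc sq pw)
  also have "\<dots> \<le> nrm (cv F q) * nrm q" by (rule cauchy_schwarz[OF sc sq])
  also have "\<dots> \<le> nrm q * nrm q"
    using kernel_cv(2)[OF k sq] by (intro mult_right_mono nrm_nonneg) simp
  also have "\<dots> \<le> 4 * nrm w * (nrm (gn v)) ^ 3"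
    using ladyzhenskaya_mol[OF d w] by (simp add: q_def[abs_def] v_def power2_eq_square)
  finally show ?thesis by (simp add: v_def)
qed

lemma weighted_sq_tendsto:
  fixes f :: "'a::euclidean_space \<Rightarrow> 'b::euclidean_space" and X :: "nat \<Rightarrow> 'a \<Rightarrow> real"
  assumes X: "\<And>n. X n \<in> borel_measurable borel" "\<And>n x. 0 \<le> X n x" "\<And>n x. X n x \<le> 1" "\<And>x. (\<lambda>n. X n x) \<longlonglongrightarrow> h x" and f: "sqint f"
  shows "(\<lambda>n. \<integral>x. X n x * (norm (f x))\<^sup>2 \<partial>lborel) \<longlonglongrightarrow> (\<integral>x. h x * (norm (f x))\<^sup>2 \<partial>lborel)"
proof (rule integral_dominated_convergence[OF _ _ sqint_integrable[OF f]])
  have [measurable]: "f \<in> borel_measurable borel" by (rule sqint_measurable[OF f])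
  have [measurable]: "X n \<in> borel_measurable borel" for n by (rule X)
  have [measurable]: "h \<in> borel_measurable borel" using borel_measurable_LIMSEQ_real[of borel X h] X by auto
  show "(\<lambda>x. h x * (norm (f x))\<^sup>2) \<in> borel_measurable lborel" by measurable
  show "(\<lambda>x. X n x * (norm (f x))\<^sup>2) \<in> borel_measurable lborel" for n by measurable
  show "AE x in lborel. (\<lambda>n. X n x * (norm (f x))\<^sup>2) \<longlonglongrightarrow> h x * (norm (f x))\<^sup>2"
    by (intro AE_I2 tendsto_intros X)
  show "AE x in lborel. norm (X n x * (norm (f x))\<^sup>2) \<le> (norm (f x))\<^sup>2" for n
    using X(2,3) by (intro AE_I2) (simp add: mult_left_le_one_le)
qed

lemma weighted_integrable:
  fixes f :: "'a::euclidean_space \<Rightarrow> 'b::euclidean_space"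
  assumes p: "p \<in> borel_measurable borel" "\<And>x. 0 \<le> p x" "\<And>x. p x \<le> (1::real)" and f: "sqint f"
  shows "integrable lborel (\<lambda>x. p x * (norm (f x))\<^sup>2)"
proof (rule Bochner_Integration.integrable_bound[OF sqint_integrable[OF f]])
  show "(\<lambda>x. p x * (norm (f x))\<^sup>2) \<in> borel_measurable lborel"
    using p(1) sqint_measurable[OF f] by measurable
  show "AE x in lborel. norm (p x * (norm (f x))\<^sup>2) \<le> norm ((norm (f x))\<^sup>2)"
    using p(2,3) by (intro AE_I2) (simp add: mult_left_le_one_le)
qed

lemma nrm_sqrt_weight:
  fixes f :: "'a::euclidean_space \<Rightarrow> 'b::euclidean_space"
  assumes "\<And>x. 0 \<le> p x"
  shows "(nrm (\<lambda>x. sqrt (p x) *\<^sub>R f x))\<^sup>2 = (\<integral>x. p x * (norm (f x))\<^sup>2 \<partial>lborel)"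
  unfolding nrm_sq using assms by (simp add: power_mult_distrib)

lemma mol_tendsto:
  assumes w: "sqint w"
  shows "(\<lambda>k. nrm (\<lambda>x. mol (1 / real (Suc k)) w x - w x)) \<longlonglongrightarrow> 0"
proof -
  have k: "kernel (mollifier_eps (1 / real (Suc k))) (1 / real (Suc k)) 1" for k
    by (rule kernel_mollifier_eps) simp
  have "(\<lambda>k. 1 / real (Suc k)) \<longlonglongrightarrow> 0" by real_asymp
  from kernel_approx[OF k this w] show ?thesis by (simp add: mol_def)
qed

section \<open>The energy inequality\<close>

context flow
begin

text \<open>As the slopes of the cutoffs tend to 0, all terms with \<open>L\<close> vanish and the
  commutator is left. Half of the dissipation absorbs it, since
  \<open>6 * \<mu> * M\<^sup>2 * G t\<close> is at most
  \<open>(G t)\<^sup>2 + 9 * \<mu>\<^sup>2 * M ^ 4\<close>; the other half stays on the left.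
  \<open>M\<close> is any a priori bound and will disappear together with
  \<open>\<mu>\<close>.\<close>

lemma energy_delta:
  assumes d: "\<delta> > 0" and osc: "osc_bound \<epsilon> \<delta> \<mu>" and mu: "\<mu> \<ge> 0" and T: "T \<ge> 0"
    and M: "\<And>t. 0 \<le> t \<Longrightarrow> t \<le> T \<Longrightarrow> nrm (u t) \<le> M"
  shows "(nrm (mol \<delta> (u T)))\<^sup>2 + integral {0..T} (\<lambda>t. (nrm (gn (mol \<delta> (u t))))\<^sup>2) \<le> (nrm (u 0))\<^sup>2 + 9 * \<mu>\<^sup>2 * M ^ 4 * T"
proof -
  obtain X :: "nat \<Rightarrow> R3 \<Rightarrow> real" where X: "\<And>n. test_function (X n)" "\<And>n x. 0 \<le> X n x" "\<And>n x. X n x \<le> 1"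
    "\<And>n x. gn (X n) x \<le> 2 / real (Suc n)" "\<And>x. (\<lambda>n. X n x) \<longlonglongrightarrow> 1"
    using cutoff_sequence by blast
  have C: "cutoff (X n) (2 / real (Suc n)) \<delta>" for n
    by unfold_locales (use X d in auto)
  have FC: "flow_cutoff u \<epsilon> (X n) (2 / real (Suc n)) \<delta>" for n
    using flow_axioms C by (rule flow_cutoff.intro)
  have M0: "M \<ge> 0" using M[of 0] T nrm_nonneg[of "u 0"] by linarith
  define G where "G t = nrm (gn (mol \<delta> (u t)))" for t
  define K where "K = nrm (mollifier_eps \<epsilon>)"
  define D where "D n t = cutoff.diss (X n) \<delta> (u t)" for n t
  \<comment> \<open>Gathers everything that is multiplied by the slope; all that counts is that its
    integral is finite and independent of \<open>n\<close>.\<close>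
  define h where "h t = 2 * M * G t + 5 * M * conv_norm \<epsilon> (u t) + K * M\<^sup>2 * nrm (\<lambda>x. mol \<delta> (u t) x - u t x) + 6 * \<mu> * M\<^sup>2 * M" for t
  have pos: "0 \<le> K" "0 \<le> G t" "0 \<le> conv_norm \<epsilon> w" for t w by (auto simp: K_def G_def conv_norm_def nrm_nonneg)
  have Gc: "continuous_on {0..T} G"
    unfolding G_def by (rule continuous_on_subset[OF nrm_gn_mol_continuous[OF d]]) auto
  have hc: "continuous_on {0..T} h"
    unfolding h_def
    by (intro continuous_intros Gc continuous_on_subset[OF conv_norm_continuous] continuous_on_subset[OF mol_error_continuous[OF d]]) auto
  have Dc: "continuous_on {0..T} (D n)" for n
    unfolding D_def[abs_def] by (rule continuous_on_subset[OF flow_cutoff.diss_continuous[OF FC]]) auto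
  note ints = integrable_continuous_real[OF Gc] integrable_continuous_real[OF hc] integrable_continuous_real[OF Dc]
  have G2c: "(\<lambda>t. (G t)\<^sup>2) integrable_on {0..T}"
    by (intro integrable_continuous_real continuous_intros Gc)
  have rate: "cutoff.rate_bound (X n) (2 / real (Suc n)) \<delta> \<epsilon> \<mu> (u t) \<le> - 2 * D n t + 2 / real (Suc n) * h t + 6 * \<mu> * M\<^sup>2 * G t"
    if t: "t \<in> {0..T}" for n t
  proof -
    define l where "l = 2 / real (Suc n)"
    have l0: "l \<ge> 0" by (simp add: l_def)
    have Mt: "nrm (u t) \<le> M" using M t by simp
    have M2: "(nrm (u t))\<^sup>2 \<le> M\<^sup>2" by (intro power_mono Mt nrm_nonneg)
    have "2 * l * nrm (u t) * G t \<le> 2 * l * M * G t"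
      using l0 pos by (intro mult_right_mono mult_left_mono Mt) auto
    moreover have "5 * l * nrm (u t) * conv_norm \<epsilon> (u t) \<le> 5 * l * M * conv_norm \<epsilon> (u t)"
      using l0 pos by (intro mult_right_mono mult_left_mono Mt) auto
    moreover have "l * K * (nrm (u t))\<^sup>2 * nrm (\<lambda>x. mol \<delta> (u t) x - u t x) \<le> l * K * M\<^sup>2 * nrm (\<lambda>x. mol \<delta> (u t) x - u t x)"
      using l0 pos by (intro mult_right_mono mult_left_mono M2 nrm_nonneg) auto
    moreover have "6 * \<mu> * (nrm (u t))\<^sup>2 * (G t + l * nrm (u t)) \<le> 6 * \<mu> * M\<^sup>2 * (G t + l * M)"
      using mu l0 pos M0 by (intro mult_mono mult_left_mono M2 add_left_mono Mt) (auto simp: nrm_nonneg)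
    ultimately show ?thesis
      unfolding cutoff.rate_bound_def[OF C]
      unfolding l_def[symmetric] G_def[symmetric] K_def[symmetric] D_def[symmetric] h_def
      by (simp add: algebra_simps)
  qed
  have ineq: "(\<integral>x. X n x * (norm (mol \<delta> (u T) x))\<^sup>2 \<partial>lborel) - (\<integral>x. X n x * (norm (mol \<delta> (u 0) x))\<^sup>2 \<partial>lborel)
     \<le> - 2 * integral {0..T} (D n) + 2 / real (Suc n) * integral {0..T} h + 6 * \<mu> * M\<^sup>2 * integral {0..T} G" for n
  proof -
    have "integral {0..T} (\<lambda>t. cutoff.rate_bound (X n) (2 / real (Suc n)) \<delta> \<epsilon> \<mu> (u t))
       \<le> integral {0..T} (\<lambda>t. - 2 * D n t + 2 / real (Suc n) * h t + 6 * \<mu> * M\<^sup>2 * G t)"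
    proof (rule integral_le)
      show "(\<lambda>t. cutoff.rate_bound (X n) (2 / real (Suc n)) \<delta> \<epsilon> \<mu> (u t)) integrable_on {0..T}"
        by (intro integrable_continuous_real continuous_on_subset[OF flow_cutoff.rate_bound_continuous[OF FC]]) auto
      show "(\<lambda>t. - 2 * D n t + 2 / real (Suc n) * h t + 6 * \<mu> * M\<^sup>2 * G t) integrable_on {0..T}"
        by (intro integrable_continuous_real continuous_intros Gc hc Dc)
    qed (rule rate)
    also have "\<dots> = - 2 * integral {0..T} (D n) + 2 / real (Suc n) * integral {0..T} h + 6 * \<mu> * M\<^sup>2 * integral {0..T} G"
    proof -
      have "((\<lambda>t. - 2 * D n t + 2 / real (Suc n) * h t + 6 * \<mu> * M\<^sup>2 * G t) has_integral
         - 2 * integral {0..T} (D n) + 2 / real (Suc n) * integral {0..T} h + 6 * \<mu> * M\<^sup>2 * integral {0..T} G) {0..T}"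
        by (intro has_integral_add has_integral_mult_right integrable_integral ints)
      then show ?thesis by (rule integral_unique)
    qed
    finally show ?thesis
      using flow_cutoff.local_energy[OF FC T osc mu, of n] by linarith
  qed
  have sp: "sqint (partial_deriv i (mol \<delta> (u t)))" if "t \<ge> 0" for i t by (rule sqint_partial_mol[OF d usq[OF that]])
  have Dn: "D n t = (\<Sum>i\<in>UNIV. \<integral>x. X n x * (norm (partial_deriv i (mol \<delta> (u t)) x))\<^sup>2 \<partial>lborel)" for n t
    unfolding D_def cutoff.diss_def[OF C] nrm_sqrt_weight[OF X(2)] ..
  have G2: "(G t)\<^sup>2 = (\<Sum>i\<in>UNIV. \<integral>x. 1 * (norm (partial_deriv i (mol \<delta> (u t)) x))\<^sup>2 \<partial>lborel)" if "t \<ge> 0" for t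
    unfolding G_def sqint_gn(2)[OF sp[OF that]] by (simp add: nrm_sq)
  have Xm: "X n \<in> borel_measurable borel" for n by (rule test_measurable[OF X(1)])
  \<comment> \<open>At each time the weights tend to 1 and \<open>(G t)\<^sup>2\<close> dominates,
    so the cutoffs lose no dissipation in the limit.\<close>
  have Dl: "(\<lambda>n. integral {0..T} (D n)) \<longlonglongrightarrow> integral {0..T} (\<lambda>t. (G t)\<^sup>2)"
  proof (rule dominated_convergence(2)[OF ints(3) G2c])
    show "norm (D n t) \<le> (G t)\<^sup>2" if "t \<in> {0..T}" for n t
    proof -
      have t0: "t \<ge> 0" using that by simp
      have le: "(\<integral>x. X n x * (norm (partial_deriv i (mol \<delta> (u t)) x))\<^sup>2 \<partial>lborel) \<le> (\<integral>x. 1 * (norm (partial_deriv i (mol \<delta> (u t)) x))\<^sup>2 \<partial>lborel)" for i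
        by (intro integral_mono weighted_integrable Xm X sp t0) (auto simp: X mult_left_le_one_le intro!: sqint_integrable sp t0)
      have "0 \<le> D n t"
        unfolding Dn by (intro sum_nonneg Bochner_Integration.integral_nonneg mult_nonneg_nonneg X) auto
      moreover have "D n t \<le> (G t)\<^sup>2" unfolding Dn G2[OF t0] by (intro sum_mono le)
      ultimately show ?thesis by simp
    qed
    show "(\<lambda>n. D n t) \<longlonglongrightarrow> (G t)\<^sup>2" if "t \<in> {0..T}" for t
      unfolding Dn using that G2[of t]
      by (simp only: atLeastAtMost_iff) (intro tendsto_sum weighted_sq_tendsto Xm X sp, simp)
  qed
  have wl: "(\<lambda>n. \<integral>x. X n x * (norm (mol \<delta> (u t) x))\<^sup>2 \<partial>lborel) \<longlonglongrightarrow> (nrm (mol \<delta> (u t)))\<^sup>2" if "t \<ge> 0" for t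
    using weighted_sq_tendsto[OF Xm X(2,3,5) sqint_mol(1)[OF d usq[OF that]]] by (simp add: nrm_sq)
  have zl: "(\<lambda>n. 2 / real (Suc n)) \<longlonglongrightarrow> 0" by real_asymp
  have rl: "(\<lambda>n. - 2 * integral {0..T} (D n) + 2 / real (Suc n) * integral {0..T} h + 6 * \<mu> * M\<^sup>2 * integral {0..T} G)
    \<longlonglongrightarrow> - 2 * integral {0..T} (\<lambda>t. (G t)\<^sup>2) + 0 * integral {0..T} h + 6 * \<mu> * M\<^sup>2 * integral {0..T} G"
    by (intro tendsto_intros Dl zl)
  have "(nrm (mol \<delta> (u T)))\<^sup>2 - (nrm (mol \<delta> (u 0)))\<^sup>2
     \<le> - 2 * integral {0..T} (\<lambda>t. (G t)\<^sup>2) + 0 * integral {0..T} h + 6 * \<mu> * M\<^sup>2 * integral {0..T} G"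
    by (rule LIMSEQ_le[OF tendsto_diff[OF wl[OF T] wl[OF order_refl]] rl]) (intro exI[of _ 0] allI impI ineq)
  moreover have "6 * \<mu> * M\<^sup>2 * integral {0..T} G \<le> integral {0..T} (\<lambda>t. (G t)\<^sup>2) + 9 * \<mu>\<^sup>2 * M ^ 4 * T"
  proof -
    have "((\<lambda>t. 6 * \<mu> * M\<^sup>2 * G t) has_integral 6 * \<mu> * M\<^sup>2 * integral {0..T} G) {0..T}"
      by (intro has_integral_mult_right integrable_integral ints)
    moreover have "((\<lambda>t. (G t)\<^sup>2 + 9 * \<mu>\<^sup>2 * M ^ 4) has_integral integral {0..T} (\<lambda>t. (G t)\<^sup>2) + 9 * \<mu>\<^sup>2 * M ^ 4 * T) {0..T}"
      using has_integral_const_real[of "9 * \<mu>\<^sup>2 * M ^ 4" 0 T] T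
      by (intro has_integral_add integrable_integral G2c) (simp add: mult.commute)
    ultimately show ?thesis
    proof (rule has_integral_le)
      fix t
      have "0 \<le> (G t - 3 * \<mu> * M\<^sup>2)\<^sup>2" by simp
      then show "6 * \<mu> * M\<^sup>2 * G t \<le> (G t)\<^sup>2 + 9 * \<mu>\<^sup>2 * M ^ 4"
        by (simp add: power2_eq_square power4_eq_xxxx algebra_simps)
    qed
  qed
  moreover have "(nrm (mol \<delta> (u 0)))\<^sup>2 \<le> (nrm (u 0))\<^sup>2"
    by (intro power_mono sqint_mol(2)[OF d] usq nrm_nonneg) simp
  ultimately show ?thesis unfolding G_def by simp
qed

text \<open>The coupling \<open>\<mu> = C * \<delta>\<close> makes the error in
  \<open>energy_delta\<close> quadratic in \<open>\<delta>\<close>, so the a priori bound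
  \<open>M\<close> drops out in the limit.\<close>

lemma energy_inequality:
  assumes T: "T \<ge> 0"
  shows "nrm (u T) \<le> nrm (u 0)"
proof -
  obtain C where C: "C \<ge> 0" "\<And>\<delta>. \<delta> \<le> 1 \<Longrightarrow> osc_bound \<epsilon> \<delta> (C * \<delta>)" using osc_bound_linear[OF eps] by blast
  obtain M where M: "M \<ge> 0" "\<And>t. 0 \<le> t \<Longrightarrow> t \<le> T \<Longrightarrow> nrm (u t) \<le> M" using nrm_u_bounded by blast
  define \<delta> where "\<delta> k = 1 / real (Suc k)" for k
  have d: "\<delta> k > 0" "\<delta> k \<le> 1" for k by (auto simp: \<delta>_def)
  have le: "(nrm (mol (\<delta> k) (u T)))\<^sup>2 \<le> (nrm (u 0))\<^sup>2 + 9 * (C * \<delta> k)\<^sup>2 * M ^ 4 * T" for k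
  proof -
    have "integral {0..T} (\<lambda>t. (nrm (gn (mol (\<delta> k) (u t))))\<^sup>2) \<ge> 0"
      by (intro Henstock_Kurzweil_Integration.integral_nonneg integrable_continuous_real continuous_intros
          continuous_on_subset[OF nrm_gn_mol_continuous[OF d(1)]]) auto
    moreover have "C * \<delta> k \<ge> 0" using C(1) d(1)[of k] by simp
    ultimately show ?thesis
      using energy_delta[OF d(1)[of k] C(2)[OF d(2)[of k]] _ T M(2)] by linarith
  qed
  have dl: "\<delta> \<longlonglongrightarrow> 0" unfolding \<delta>_def[abs_def] by real_asymp
  have "(\<lambda>k. nrm (mol (\<delta> k) (u T)) - nrm (u T)) \<longlonglongrightarrow> 0"
  proof (rule Lim_null_comparison)
    show "\<forall>\<^sub>F k in sequentially. norm (nrm (mol (\<delta> k) (u T)) - nrm (u T)) \<le> nrm (\<lambda>x. mol (\<delta> k) (u T) x - u T x)"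
      using T by (intro always_eventually allI) (auto intro!: nrm_diff_ge sqint_mol d usq)
    show "(\<lambda>k. nrm (\<lambda>x. mol (\<delta> k) (u T) x - u T x)) \<longlonglongrightarrow> 0"
      unfolding \<delta>_def by (rule mol_tendsto[OF usq[OF T]])
  qed
  then have "(\<lambda>k. (nrm (mol (\<delta> k) (u T)))\<^sup>2) \<longlonglongrightarrow> (nrm (u T))\<^sup>2"
    by (intro tendsto_power) (simp add: LIM_zero_iff)
  moreover have "(\<lambda>k. (nrm (u 0))\<^sup>2 + 9 * (C * \<delta> k)\<^sup>2 * M ^ 4 * T) \<longlonglongrightarrow> (nrm (u 0))\<^sup>2 + 9 * (C * 0)\<^sup>2 * M ^ 4 * T"
    by (intro tendsto_intros dl)
  ultimately have "(nrm (u T))\<^sup>2 \<le> (nrm (u 0))\<^sup>2 + 9 * (C * 0)\<^sup>2 * M ^ 4 * T"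
    by (rule LIMSEQ_le) (intro exI[of _ 0] allI impI le)
  then have "(nrm (u T))\<^sup>2 \<le> (nrm (u 0))\<^sup>2" by simp
  then show ?thesis by (rule power2_le_imp_le) (rule nrm_nonneg)
qed

end

text \<open>The root of \<open>A * g ^ 3\<close> is a geometric mean of
  \<open>p * g\<^sup>2\<close>, with exponent 3/4, and \<open>A\<^sup>2 / p ^ 3\<close>, with
  exponent 1/4. Comparing \<open>A\<close> with \<open>p\<^sup>2 * g\<close> decides which of the
  two dominates.\<close>

lemma quarter_power_bound:
  fixes A g p :: real
  assumes A: "A \<ge> 0" and g: "g \<ge> 0" and p: "p > 0"
  shows "A * g ^ 3 \<le> (p * g\<^sup>2 + A\<^sup>2 / p ^ 3)\<^sup>2"
proof (cases "A \<le> p\<^sup>2 * g")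
  case True
  have "A * g ^ 3 \<le> (p\<^sup>2 * g) * g ^ 3" by (intro mult_right_mono True) (simp add: g)
  also have "\<dots> = (p * g\<^sup>2)\<^sup>2" by (simp add: power2_eq_square power3_eq_cube)
  also have "\<dots> \<le> (p * g\<^sup>2 + A\<^sup>2 / p ^ 3)\<^sup>2" using A p by (intro power_mono) auto
  finally show ?thesis .
next
  case False
  then have "g \<le> A / p\<^sup>2" using p by (simp add: field_simps)
  then have "A * g ^ 3 \<le> A * (A / p\<^sup>2) ^ 3" by (intro mult_left_mono power_mono A g)
  also have "\<dots> = (A\<^sup>2 / p ^ 3)\<^sup>2" using p by (simp add: field_simps power2_eq_square power3_eq_cube)
  also have "\<dots> \<le> (p * g\<^sup>2 + A\<^sup>2 / p ^ 3)\<^sup>2" using A p by (intro power_mono) auto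
  finally show ?thesis .
qed

section \<open>The exterior estimate\<close>

context flow
begin

text \<open>At time \<open>p ^ 4\<close> the weight \<open>p\<close> balances both Young
  inequalities. In the limit the dissipation integrates to at most \<open>A\<^sup>2\<close> by
  \<open>energy_delta\<close>; so \<open>p\<^sup>2\<close> times the dissipation and
  \<open>A\<^sup>2 / p\<^sup>2\<close> times \<open>p ^ 4\<close> both give
  \<open>A\<^sup>2 * p\<^sup>2\<close>, while \<open>A * p\<close> times the dissipation and
  \<open>A ^ 3 / p ^ 3\<close> times \<open>p ^ 4\<close> both give
  \<open>A ^ 3 * p\<close>.\<close>

lemma limit_local_energy:
  assumes phi: "test_function \<phi>" "\<And>x. 0 \<le> \<phi> x" "\<And>x. \<phi> x \<le> 1" "\<And>x. gn \<phi> x \<le> L"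
    and p: "p > 0" and A: "nrm (u 0) = A" "A > 0"
  shows "(\<integral>x. \<phi> x * (norm (u (p ^ 4) x))\<^sup>2 \<partial>lborel)
     \<le> (\<integral>x. \<phi> x * (norm (u 0 x))\<^sup>2 \<partial>lborel) + 2 * L * A\<^sup>2 * p\<^sup>2 + 20 * L * A ^ 3 * p"
proof -
  define T where "T = p ^ 4"
  have T: "T > 0" "T \<ge> 0" using p by (auto simp: T_def)
  have L0: "L \<ge> 0" using phi(4)[of 0] gn_nonneg[of \<phi> 0] by linarith
  obtain C where C: "C \<ge> 0" "\<And>\<delta>. \<delta> \<le> 1 \<Longrightarrow> osc_bound \<epsilon> \<delta> (C * \<delta>)" using osc_bound_linear[OF eps] by blast
  define \<delta> where "\<delta> k = 1 / real (Suc k)" for k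
  define \<mu> where "\<mu> k = C * \<delta> k" for k
  have d: "\<delta> k > 0" "\<delta> k \<le> 1" for k by (auto simp: \<delta>_def)
  have mu: "\<mu> k \<ge> 0" "osc_bound \<epsilon> (\<delta> k) (\<mu> k)" for k using C d[of k] by (auto simp: \<mu>_def)
  have ml: "\<mu> \<longlonglongrightarrow> 0"
  proof -
    have "\<delta> \<longlonglongrightarrow> 0" unfolding \<delta>_def[abs_def] by real_asymp
    then show ?thesis unfolding \<mu>_def[abs_def] by (rule tendsto_mult_right_zero)
  qed
  have CU: "cutoff \<phi> L (\<delta> k)" for k by unfold_locales (use phi d in auto)
  have FC: "flow_cutoff u \<epsilon> \<phi> L (\<delta> k)" for k
    using flow_axioms CU by (rule flow_cutoff.intro)
  define K where "K = nrm (mollifier_eps \<epsilon>)"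
  have K0: "K \<ge> 0" by (simp add: K_def nrm_nonneg)
  define G where "G k t = nrm (gn (mol (\<delta> k) (u t)))" for k t
  define e where "e k t = nrm (\<lambda>x. mol (\<delta> k) (u t) x - u t x)" for k t
  have pos: "0 \<le> G k t" "0 \<le> e k t" "0 \<le> conv_norm \<epsilon> w" for k t w
    by (auto simp: G_def e_def conv_norm_def nrm_nonneg)
  have uA: "nrm (u t) \<le> A" if "t \<ge> 0" for t using energy_inequality[OF that] A by simp
  \<comment> \<open>\<open>c1\<close> multiplies the squared gradient, \<open>c2\<close> is constant
    in time, and \<open>c3\<close> multiplies the mollification error. Apart from the vanishing
    \<open>\<mu> k\<close>, only \<open>c3\<close> depends on \<open>\<epsilon>\<close>, and the
    error next to it tends to 0.\<close>
  define c1 where "c1 k = L * p\<^sup>2 + 10 * L * A * p + 6 * \<mu> k * A\<^sup>2" for k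
  define c2 where "c2 k = L * A\<^sup>2 / p\<^sup>2 + 10 * L * A ^ 3 / p ^ 3 + 6 * \<mu> k * A\<^sup>2 * (1 + L * A)" for k
  define c3 where "c3 = 5 * L * A * (K * (1 + 2 * A)) + L * K * A\<^sup>2"
  have rate: "cutoff.rate_bound \<phi> L (\<delta> k) \<epsilon> (\<mu> k) (u t) \<le> c1 k * (G k t)\<^sup>2 + c2 k + c3 * e k t" if t: "t \<ge> 0" for k t
  proof -
    define w where "w = u t"
    have w: "sqint w" "nrm w \<le> A" using usq[OF t] uA[OF t] by (auto simp: w_def)
    define g where "g = G k t"
    define d' where "d' = e k t"
    have g0: "g \<ge> 0" and d0: "d' \<ge> 0" by (auto simp: g_def d'_def pos)
    have w2: "(nrm w)\<^sup>2 \<le> A\<^sup>2" by (intro power_mono w nrm_nonneg)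
    have v: "sqint (mol (\<delta> k) w)" "nrm (mol (\<delta> k) w) \<le> A"
      using sqint_mol[OF d(1) w(1)] w(2) by (auto intro: order_trans)
    \<comment> \<open>The root of Ladyzhenskaya's bound \<open>4 * A * g ^ 3\<close>, split by
      \<open>quarter_power_bound\<close>; the leading 2 is the root of 4.\<close>
    have "conv_norm \<epsilon> (mol (\<delta> k) w) \<le> 2 * (p * g\<^sup>2 + A\<^sup>2 / p ^ 3)"
    proof (rule power2_le_imp_le)
      have "(conv_norm \<epsilon> (mol (\<delta> k) w))\<^sup>2 \<le> 4 * nrm w * g ^ 3"
        using conv_norm_mol[OF eps d(1) w(1)] by (simp add: g_def G_def w_def)
      also have "\<dots> \<le> 4 * (A * g ^ 3)" using w(2) g0 by (simp add: mult_right_mono)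
      also have "\<dots> \<le> 4 * (p * g\<^sup>2 + A\<^sup>2 / p ^ 3)\<^sup>2"
        using quarter_power_bound[of A g p] A g0 p by simp
      also have "\<dots> = (2 * (p * g\<^sup>2 + A\<^sup>2 / p ^ 3))\<^sup>2"
        by (subst power_mult_distrib) simp
      finally show "(conv_norm \<epsilon> (mol (\<delta> k) w))\<^sup>2 \<le> (2 * (p * g\<^sup>2 + A\<^sup>2 / p ^ 3))\<^sup>2" .
      show "0 \<le> 2 * (p * g\<^sup>2 + A\<^sup>2 / p ^ 3)" using p A by simp
    qed
    \<comment> \<open>The previous bound concerns the mollified field; the Lipschitz estimate
      carries it over to \<open>w\<close>.\<close>
    moreover have "conv_norm \<epsilon> w - conv_norm \<epsilon> (mol (\<delta> k) w) \<le> K * (1 + 2 * A) * d'"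
    proof -
      have "nrm (\<lambda>x. w x - mol (\<delta> k) w x) = d'"
        using sqint_minus(2)[OF sqint_diff(1)[OF v(1) w(1)]] by (simp add: d'_def e_def w_def)
      then have "conv_norm \<epsilon> w - conv_norm \<epsilon> (mol (\<delta> k) w) \<le> K * (1 + nrm w + nrm (mol (\<delta> k) w)) * d'"
        using conv_norm_lipschitz[OF eps w(1) v(1)] by (simp add: K_def)
      also have "\<dots> \<le> K * (1 + 2 * A) * d'"
        using w(2) v(2) K0 d0 by (intro mult_right_mono mult_left_mono) auto
      finally show ?thesis .
    qed
    ultimately have cn: "conv_norm \<epsilon> w \<le> 2 * (p * g\<^sup>2 + A\<^sup>2 / p ^ 3) + K * (1 + 2 * A) * d'" by linarith
    have t1: "2 * L * nrm w * g \<le> L * p\<^sup>2 * g\<^sup>2 + L * A\<^sup>2 / p\<^sup>2"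
    proof -
      have "2 * L * nrm w * g \<le> 2 * L * A * g" using w(2) L0 g0 by (intro mult_right_mono mult_left_mono) auto
      also have "\<dots> = L * (2 * (p * g) * (A / p))" using p by simp
      also have "\<dots> \<le> L * ((p * g)\<^sup>2 + (A / p)\<^sup>2)" by (intro mult_left_mono sum_squares_bound L0)
      also have "\<dots> = L * p\<^sup>2 * g\<^sup>2 + L * A\<^sup>2 / p\<^sup>2" by (simp add: power_mult_distrib power_divide distrib_left)
      finally show ?thesis .
    qed
    have t2: "5 * L * nrm w * conv_norm \<epsilon> w \<le> 5 * L * A * (2 * (p * g\<^sup>2 + A\<^sup>2 / p ^ 3) + K * (1 + 2 * A) * d')"
      using L0 w(2) A by (intro mult_mono cn pos) (auto simp: nrm_nonneg)
    have t3: "L * K * (nrm w)\<^sup>2 * d' \<le> L * K * A\<^sup>2 * d'"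
      using L0 K0 d0 by (intro mult_right_mono mult_left_mono w2) auto
    \<comment> \<open>Replacing \<open>g\<close> by \<open>g\<^sup>2 + 1\<close> is crude, but the
      factor \<open>\<mu> k\<close> pays for it.\<close>
    have t4: "6 * \<mu> k * (nrm w)\<^sup>2 * (g + L * nrm w) \<le> 6 * \<mu> k * A\<^sup>2 * (g\<^sup>2 + 1 + L * A)"
    proof (rule mult_mono)
      have "2 * g * 1 \<le> g\<^sup>2 + 1\<^sup>2" by (rule sum_squares_bound)
      then have "g \<le> g\<^sup>2 + 1" using g0 by simp
      then show "g + L * nrm w \<le> g\<^sup>2 + 1 + L * A" using mult_left_mono[OF w(2) L0] by linarith
      show "6 * \<mu> k * (nrm w)\<^sup>2 \<le> 6 * \<mu> k * A\<^sup>2" using mu(1)[of k] w2 by (intro mult_left_mono) auto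
    qed (use mu(1)[of k] g0 L0 nrm_nonneg[of w] in auto)
    \<comment> \<open>The localised dissipation has the good sign and is dropped; the gradient is
      controlled globally by \<open>energy_delta\<close>.\<close>
    have ds: "0 \<le> cutoff.diss \<phi> (\<delta> k) w"
      unfolding cutoff.diss_def[OF CU] by (intro sum_nonneg) simp
    have "cutoff.rate_bound \<phi> L (\<delta> k) \<epsilon> (\<mu> k) w
      = - 2 * cutoff.diss \<phi> (\<delta> k) w + 2 * L * nrm w * g + 5 * L * nrm w * conv_norm \<epsilon> w + L * K * (nrm w)\<^sup>2 * d'
        + 6 * \<mu> k * (nrm w)\<^sup>2 * (g + L * nrm w)"
      unfolding cutoff.rate_bound_def[OF CU] by (simp add: g_def G_def d'_def e_def K_def w_def)
    also have "\<dots> \<le> (L * p\<^sup>2 * g\<^sup>2 + L * A\<^sup>2 / p\<^sup>2) + 5 * L * A * (2 * (p * g\<^sup>2 + A\<^sup>2 / p ^ 3) + K * (1 + 2 * A) * d')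
        + L * K * A\<^sup>2 * d' + 6 * \<mu> k * A\<^sup>2 * (g\<^sup>2 + 1 + L * A)"
      using t1 t2 t3 t4 ds by linarith
    also have "\<dots> = c1 k * g\<^sup>2 + c2 k + c3 * d'"
    proof -
      have "5 * L * A * (2 * (A\<^sup>2 / p ^ 3)) = 10 * L * A ^ 3 / p ^ 3"
        by (simp add: power2_eq_square power3_eq_cube)
      then show ?thesis by (simp add: c1_def c2_def c3_def algebra_simps)
    qed
    finally show ?thesis by (simp add: w_def g_def d'_def)
  qed
  have Gc: "continuous_on {0..T} (G k)" for k
    unfolding G_def[abs_def] by (rule continuous_on_subset[OF nrm_gn_mol_continuous[OF d(1)]]) auto
  have ec: "continuous_on {0..T} (e k)" for k
    unfolding e_def[abs_def] by (rule continuous_on_subset[OF mol_error_continuous[OF d(1)]]) auto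
  have G2i: "(\<lambda>t. (G k t)\<^sup>2) integrable_on {0..T}" for k
    by (intro integrable_continuous_real continuous_intros Gc)
  have ei: "e k integrable_on {0..T}" for k by (intro integrable_continuous_real ec)
  have c10: "c1 k \<ge> 0" for k using L0 p A mu(1)[of k] by (simp add: c1_def)
  have G2: "integral {0..T} (\<lambda>t. (G k t)\<^sup>2) \<le> A\<^sup>2 + 9 * (\<mu> k)\<^sup>2 * A ^ 4 * T" for k
    using energy_delta[OF d(1)[of k] mu(2)[of k] mu(1)[of k] T(2) uA] zero_le_power2[of "nrm (mol (\<delta> k) (u T))"]
    unfolding G_def A(1) by linarith
  have step: "(\<integral>x. \<phi> x * (norm (mol (\<delta> k) (u T) x))\<^sup>2 \<partial>lborel) - (\<integral>x. \<phi> x * (norm (mol (\<delta> k) (u 0) x))\<^sup>2 \<partial>lborel)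
     \<le> c1 k * (A\<^sup>2 + 9 * (\<mu> k)\<^sup>2 * A ^ 4 * T) + c2 k * T + c3 * integral {0..T} (e k)" for k
  proof -
    have "integral {0..T} (\<lambda>t. cutoff.rate_bound \<phi> L (\<delta> k) \<epsilon> (\<mu> k) (u t)) \<le> c1 k * integral {0..T} (\<lambda>t. (G k t)\<^sup>2) + c2 k * T + c3 * integral {0..T} (e k)"
    proof (rule has_integral_le)
      have "(\<lambda>t. cutoff.rate_bound \<phi> L (\<delta> k) \<epsilon> (\<mu> k) (u t)) integrable_on {0..T}"
        by (intro integrable_continuous_real continuous_on_subset[OF flow_cutoff.rate_bound_continuous[OF FC]]) auto
      then show "((\<lambda>t. cutoff.rate_bound \<phi> L (\<delta> k) \<epsilon> (\<mu> k) (u t)) has_integral integral {0..T} (\<lambda>t. cutoff.rate_bound \<phi> L (\<delta> k) \<epsilon> (\<mu> k) (u t))) {0..T}"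
        by (rule integrable_integral)
      show "((\<lambda>t. c1 k * (G k t)\<^sup>2 + c2 k + c3 * e k t) has_integral c1 k * integral {0..T} (\<lambda>t. (G k t)\<^sup>2) + c2 k * T + c3 * integral {0..T} (e k)) {0..T}"
        using has_integral_const_real[of "c2 k" 0 T] T
        by (intro has_integral_add has_integral_mult_right integrable_integral G2i ei) (simp add: mult.commute)
    qed (use rate in auto)
    also have "\<dots> \<le> c1 k * (A\<^sup>2 + 9 * (\<mu> k)\<^sup>2 * A ^ 4 * T) + c2 k * T + c3 * integral {0..T} (e k)"
      using mult_left_mono[OF G2 c10] by simp
    finally show ?thesis
      using flow_cutoff.local_energy[OF FC T(2) mu(2,1), of k] by linarith
  qed
  \<comment> \<open>At each time the error tends to 0, without a rate; the energy inequality
    supplies the dominating constant.\<close>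
  have elim: "(\<lambda>k. integral {0..T} (e k)) \<longlonglongrightarrow> integral {0..T} (\<lambda>t. 0)"
  proof (rule dominated_convergence(2)[OF ei, of "\<lambda>_. 2 * A"])
    show "(\<lambda>_. 2 * A) integrable_on {0..T}" by (rule integrable_const_ivl)
    show "norm (e k t) \<le> 2 * A" if "t \<in> {0..T}" for k t
    proof -
      have t0: "t \<ge> 0" using that by simp
      have "e k t \<le> nrm (mol (\<delta> k) (u t)) + nrm (u t)"
        unfolding e_def by (rule sqint_diff(2)[OF sqint_mol(1)[OF d(1) usq[OF t0]] usq[OF t0]])
      also have "\<dots> \<le> 2 * A"
        using sqint_mol(2)[OF d(1) usq[OF t0], of k] uA[OF t0] by linarith
      finally show ?thesis using pos(2)[of k t] by simp
    qed
    show "(\<lambda>k. e k t) \<longlonglongrightarrow> 0" if "t \<in> {0..T}" for t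
      unfolding e_def \<delta>_def by (rule mol_tendsto[OF usq]) (use that in simp)
  qed
  have wl: "(\<lambda>k. \<integral>x. \<phi> x * (norm (mol (\<delta> k) (u t) x))\<^sup>2 \<partial>lborel) \<longlonglongrightarrow> (\<integral>x. \<phi> x * (norm (u t x))\<^sup>2 \<partial>lborel)" if t: "t \<ge> 0" for t
  proof -
    have sm: "(\<lambda>x. sqrt (\<phi> x)) \<in> borel_measurable borel" "\<And>x. \<bar>sqrt (\<phi> x)\<bar> \<le> 1"
      using test_measurable[OF phi(1)] phi(2,3) by auto
    have "(\<lambda>k. nrm (\<lambda>x. sqrt (\<phi> x) *\<^sub>R mol (\<delta> k) (u t) x) - nrm (\<lambda>x. sqrt (\<phi> x) *\<^sub>R u t x)) \<longlonglongrightarrow> 0"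
    proof (rule Lim_null_comparison)
      show "\<forall>\<^sub>F k in sequentially. norm (nrm (\<lambda>x. sqrt (\<phi> x) *\<^sub>R mol (\<delta> k) (u t) x) - nrm (\<lambda>x. sqrt (\<phi> x) *\<^sub>R u t x)) \<le> nrm (\<lambda>x. mol (\<delta> k) (u t) x - u t x)"
        unfolding real_norm_def by (intro always_eventually allI nrm_weighted_diff sm sqint_mol d usq t)
      show "(\<lambda>k. nrm (\<lambda>x. mol (\<delta> k) (u t) x - u t x)) \<longlonglongrightarrow> 0"
        unfolding \<delta>_def by (rule mol_tendsto[OF usq[OF t]])
    qed
    then have "(\<lambda>k. (nrm (\<lambda>x. sqrt (\<phi> x) *\<^sub>R mol (\<delta> k) (u t) x))\<^sup>2) \<longlonglongrightarrow> (nrm (\<lambda>x. sqrt (\<phi> x) *\<^sub>R u t x))\<^sup>2"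
      by (intro tendsto_power) (simp add: LIM_zero_iff)
    then show ?thesis unfolding nrm_sqrt_weight[OF phi(2)] .
  qed
  have rl: "(\<lambda>k. c1 k * (A\<^sup>2 + 9 * (\<mu> k)\<^sup>2 * A ^ 4 * T) + c2 k * T + c3 * integral {0..T} (e k))
    \<longlonglongrightarrow> (L * p\<^sup>2 + 10 * L * A * p + 6 * 0 * A\<^sup>2) * (A\<^sup>2 + 9 * 0\<^sup>2 * A ^ 4 * T)
      + (L * A\<^sup>2 / p\<^sup>2 + 10 * L * A ^ 3 / p ^ 3 + 6 * 0 * A\<^sup>2 * (1 + L * A)) * T + c3 * integral {0..T} (\<lambda>t. 0)"
    unfolding c1_def c2_def by (intro tendsto_intros ml elim)
  have "(\<integral>x. \<phi> x * (norm (u T x))\<^sup>2 \<partial>lborel) - (\<integral>x. \<phi> x * (norm (u 0 x))\<^sup>2 \<partial>lborel)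
    \<le> (L * p\<^sup>2 + 10 * L * A * p + 6 * 0 * A\<^sup>2) * (A\<^sup>2 + 9 * 0\<^sup>2 * A ^ 4 * T)
      + (L * A\<^sup>2 / p\<^sup>2 + 10 * L * A ^ 3 / p ^ 3 + 6 * 0 * A\<^sup>2 * (1 + L * A)) * T + c3 * integral {0..T} (\<lambda>t. 0)"
    by (rule LIMSEQ_le[OF tendsto_diff[OF wl[OF T(2)] wl[OF order_refl]] rl]) (intro exI[of _ 0] allI impI step)
  also have "\<dots> = 2 * L * A\<^sup>2 * p\<^sup>2 + 20 * L * A ^ 3 * p"
  proof -
    have "L * A\<^sup>2 / p\<^sup>2 * T = L * A\<^sup>2 * p\<^sup>2" "10 * L * A ^ 3 / p ^ 3 * T = 10 * L * A ^ 3 * p"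
      using p by (auto simp: T_def power2_eq_square power3_eq_cube power4_eq_xxxx)
    moreover have "A * A\<^sup>2 = A ^ 3" by (simp add: power2_eq_square power3_eq_cube)
    ultimately show ?thesis by (simp add: algebra_simps)
  qed
  finally show ?thesis by (simp add: T_def)
qed

text \<open>The slope \<open>4 / (R2 - R1)\<close> turns the coefficients 2 and 20 of
  \<open>limit_local_energy\<close> into 8 and 80; the smaller one is raised so that a single
  constant serves both terms.\<close>

lemma exterior_energy:
  assumes R: "R1 < R2" and t: "t \<ge> 0"
  shows "(\<integral>x. indicat_real {x. norm x > R2} x * (norm (u t x))\<^sup>2 \<partial>lborel)
    \<le> (\<integral>x. indicat_real {x. norm x > R1} x * (norm (u 0 x))\<^sup>2 \<partial>lborel)
      + (80 * (nrm (u 0))\<^sup>2 * sqrt t + 80 * (nrm (u 0)) ^ 3 * t powr (1/4)) / (R2 - R1)"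
proof -
  define A where "A = nrm (u 0)"
  have A0: "A \<ge> 0" by (simp add: A_def nrm_nonneg)
  have im: "indicat_real {x::R3. norm x > r} \<in> borel_measurable borel" for r
    by (intro borel_measurable_indicator borel_open open_Collect_less continuous_intros)
  have ii: "integrable lborel (\<lambda>x. indicat_real {x. norm x > r} x * (norm (u s x))\<^sup>2)" if "s \<ge> 0" for r s
    by (rule weighted_integrable[OF im _ _ usq[OF that]]) (auto simp: indicator_def)
  show ?thesis
  proof (cases "A = 0 \<or> t = 0")
    \<comment> \<open>The Young weights degenerate here, but either no time has passed or the energy
      inequality forces \<open>u t\<close> to vanish almost everywhere.\<close>
    case True
    have "(\<integral>x. indicat_real {x. norm x > R2} x * (norm (u t x))\<^sup>2 \<partial>lborel) \<le> (\<integral>x. indicat_real {x. norm x > R1} x * (norm (u 0 x))\<^sup>2 \<partial>lborel)"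
    proof (cases "t = 0")
      case True
      then show ?thesis
        using R by (intro integral_mono ii) (auto simp: indicator_def)
    next
      case False
      then have "nrm (u t) = 0"
        using \<open>A = 0 \<or> t = 0\<close> energy_inequality[OF t] nrm_nonneg[of "u t"] by (simp add: A_def)
      have "(\<integral>x. indicat_real {x. norm x > R2} x * (norm (u t x))\<^sup>2 \<partial>lborel) \<le> (\<integral>x. (norm (u t x))\<^sup>2 \<partial>lborel)"
        by (intro integral_mono ii t sqint_integrable usq) (auto simp: indicator_def)
      also have "\<dots> = 0" using \<open>nrm (u t) = 0\<close> nrm_sq[of "u t"] by simp
      also have "0 \<le> (\<integral>x. indicat_real {x. norm x > R1} x * (norm (u 0 x))\<^sup>2 \<partial>lborel)"
        by (rule Bochner_Integration.integral_nonneg) simp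
      finally show ?thesis .
    qed
    moreover have "0 \<le> (80 * A\<^sup>2 * sqrt t + 80 * A ^ 3 * t powr (1/4)) / (R2 - R1)"
      using A0 R t by simp
    ultimately show ?thesis by (simp add: A_def)
  next
    case False
    then have Ap: "A > 0" and tp: "t > 0" using A0 t by auto
    define p where "p = t powr (1/4)"
    have p: "p > 0" "p ^ 4 = t" "p\<^sup>2 = sqrt t"
      using tp by (auto simp: p_def powr_power powr_half_sqrt)
    define L where "L = 4 / (R2 - R1)"
    define B where "B = 2 * L * A\<^sup>2 * p\<^sup>2 + 20 * L * A ^ 3 * p"
    \<comment> \<open>The outer radius \<open>real n + (R2 - R1)\<close> meets the conditions of
      \<open>outer_cutoff\<close> already for \<open>n = 0\<close>.\<close>
    have "\<exists>\<phi>::R3 \<Rightarrow> real. test_function \<phi> \<and> (\<forall>x. 0 \<le> \<phi> x) \<and> (\<forall>x. \<phi> x \<le> 1) \<and> (\<forall>x. gn \<phi> x \<le> L) \<and>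
      (\<forall>x. R2 \<le> norm x \<and> norm x \<le> real n + (R2 - R1) \<longrightarrow> \<phi> x = 1) \<and> (\<forall>x. norm x \<le> R1 \<longrightarrow> \<phi> x = 0)" for n
      unfolding L_def using R by (intro outer_cutoff) auto
    then obtain X :: "nat \<Rightarrow> R3 \<Rightarrow> real" where X: "\<And>n. test_function (X n)" "\<And>n x. 0 \<le> X n x" "\<And>n x. X n x \<le> 1"
      "\<And>n x. gn (X n) x \<le> L" "\<And>n x. R2 \<le> norm x \<Longrightarrow> norm x \<le> real n + (R2 - R1) \<Longrightarrow> X n x = 1"
      "\<And>n x. norm x \<le> R1 \<Longrightarrow> X n x = 0"
      by metis
    \<comment> \<open>The sharp indicator of the part of the exterior where \<open>X n\<close> is
      known to be 1. It lies below \<open>X n\<close> and, unlike \<open>X n\<close>, has an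
      explicit pointwise limit.\<close>
    define I where "I n x = indicat_real ({x. norm x > R2} \<inter> cball 0 (real n + (R2 - R1))) x" for n and x :: R3
    have Im: "I n \<in> borel_measurable borel" for n
      unfolding I_def[abs_def]
      by (intro borel_measurable_indicator sets.Int borel_open[OF open_Collect_less] borel_closed[OF closed_cball] continuous_intros)
    have I01: "0 \<le> I n x" "I n x \<le> 1" for n x by (auto simp: I_def indicator_def)
    have le: "(\<integral>x. I n x * (norm (u t x))\<^sup>2 \<partial>lborel) \<le> (\<integral>x. indicat_real {x. norm x > R1} x * (norm (u 0 x))\<^sup>2 \<partial>lborel) + B" for n
    proof -
      have Xm: "X n \<in> borel_measurable borel" by (rule test_measurable[OF X(1)])
      have "(\<integral>x. I n x * (norm (u t x))\<^sup>2 \<partial>lborel) \<le> (\<integral>x. X n x * (norm (u t x))\<^sup>2 \<partial>lborel)"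
      proof (intro integral_mono weighted_integrable Im I01 Xm X usq t)
        show "I n x * (norm (u t x))\<^sup>2 \<le> X n x * (norm (u t x))\<^sup>2" for x
          using X(5)[of x n] X(2)[of n x] by (intro mult_right_mono) (auto simp: I_def indicator_def)
      qed
      also have "\<dots> \<le> (\<integral>x. X n x * (norm (u 0 x))\<^sup>2 \<partial>lborel) + B"
        using limit_local_energy[OF X(1-4)[where n=n] p(1) A_def[symmetric] Ap] by (simp add: p B_def)
      also have "(\<integral>x. X n x * (norm (u 0 x))\<^sup>2 \<partial>lborel) \<le> (\<integral>x. indicat_real {x. norm x > R1} x * (norm (u 0 x))\<^sup>2 \<partial>lborel)"
      proof (intro integral_mono weighted_integrable Xm X usq ii)
        show "X n x * (norm (u 0 x))\<^sup>2 \<le> indicat_real {x. norm x > R1} x * (norm (u 0 x))\<^sup>2" for x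
          using X(6)[of x n] X(3)[of n x] by (intro mult_right_mono) (auto simp: indicator_def)
      qed auto
      finally show ?thesis by simp
    qed
    have "(\<lambda>n. I n x) \<longlonglongrightarrow> indicat_real {x. norm x > R2} x" for x
    proof (rule tendsto_eventually)
      obtain N where N: "norm x \<le> real N" using real_arch_simple by blast
      show "\<forall>\<^sub>F n in sequentially. I n x = indicat_real {x. norm x > R2} x"
        using eventually_ge_at_top[of N] by eventually_elim (use N R in \<open>auto simp: I_def indicator_def\<close>)
    qed
    from weighted_sq_tendsto[OF Im I01 this usq[OF t]]
    have "(\<integral>x. indicat_real {x. norm x > R2} x * (norm (u t x))\<^sup>2 \<partial>lborel) \<le> (\<integral>x. indicat_real {x. norm x > R1} x * (norm (u 0 x))\<^sup>2 \<partial>lborel) + B"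
      by (rule LIMSEQ_le_const2) (intro exI[of _ 0] allI impI le)
    also have "B = (8 * A\<^sup>2 * sqrt t + 80 * A ^ 3 * p) / (R2 - R1)"
      by (simp add: B_def L_def p add_divide_distrib)
    also have "\<dots> \<le> (80 * A\<^sup>2 * sqrt t + 80 * A ^ 3 * p) / (R2 - R1)"
      using R t A0 by (intro divide_right_mono) auto
    finally show ?thesis by (simp add: A_def p_def)
  qed
qed

end

section \<open>From strong solutions to flows\<close>

definition dfun :: "(real \<Rightarrow> real) \<Rightarrow> real \<Rightarrow> real" where
  "dfun \<theta> t = frechet_derivative \<theta> (at t) 1"

lemma smooth_has_real_derivative:
  assumes "smooth \<theta>"
  shows "(\<theta> has_real_derivative dfun \<theta> t) (at t)"
proof -
  have "frechet_derivative \<theta> (at t) = (\<lambda>h. dfun \<theta> t * h)"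
  proof
    fix h
    have "frechet_derivative \<theta> (at t) (h *\<^sub>R 1) = h *\<^sub>R frechet_derivative \<theta> (at t) 1"
      by (rule linear_scale[OF has_derivative_linear[OF smooth_has_derivative[OF assms]]])
    then show "frechet_derivative \<theta> (at t) h = dfun \<theta> t * h" by (simp add: dfun_def)
  qed
  then show ?thesis
    using smooth_has_derivative[OF assms, of t] by (simp add: has_field_derivative_def)
qed

lemma test_dfun: "test_function \<theta> \<Longrightarrow> test_function (dfun \<theta>)"
  unfolding dfun_def[abs_def] test_function_iff by (simp add: smooth_frechet cpt_supp_frechet)

text \<open>\<open>N\<close> is extended by zero to negative times, continuously because
  \<open>N 0 = 0\<close>. The convolution of \<open>\<psi>\<close> with the extension has zero
  derivative, since the reflected \<open>\<psi>\<close> is an admissible \<open>\<theta>\<close>; so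
  it is constant, and it vanishes far to the left. As \<open>\<psi>\<close> is arbitrary, the
  extension itself is zero. The integrals up to all large \<open>R\<close> stand for the integral
  over all positive times.\<close>

lemma du_bois_reymond:
  fixes N :: "real \<Rightarrow> real"
  assumes N: "continuous_on {0..} N" "N 0 = 0"
    and W: "\<And>\<theta>. test_function \<theta> \<Longrightarrow> \<exists>R0. \<forall>R\<ge>R0. integral {0..R} (\<lambda>t. dfun \<theta> t * N t) = 0"
    and t: "t \<ge> 0"
  shows "N t = 0"
proof -
  define G where "G s = N (max s 0)" for s
  have G: "continuous_on UNIV G"
    unfolding G_def by (intro continuous_on_compose2[OF N(1)] continuous_intros) auto
  have G0: "G s = 0" if "s \<le> 0" for s using that N(2) by (simp add: G_def)
  have lG: "loc_int G" by (rule loc_int_continuous[OF G])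
  have z: "gcv times (dfun \<psi>) G x = 0" if psi: "test_function \<psi>" for \<psi> x
  proof -
    define \<theta> where "\<theta> y = \<psi> (x - y)" for y
    have t\<theta>: "test_function \<theta>" unfolding \<theta>_def by (rule test_reflect[OF psi])
    have d\<theta>: "dfun \<theta> y = - dfun \<psi> (x - y)" for y
      unfolding dfun_def \<theta>_def[abs_def] by (rule smooth_reflect(2)[OF test_smooth[OF psi]])
    obtain R0 where R0: "\<And>R. R \<ge> R0 \<Longrightarrow> integral {0..R} (\<lambda>t. dfun \<theta> t * N t) = 0" using W[OF t\<theta>] by blast
    obtain r where r: "\<And>y. dfun \<theta> y \<noteq> 0 \<Longrightarrow> norm y \<le> r" using test_cpt_supp[OF test_dfun[OF t\<theta>]] by (auto simp: cpt_supp_def)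
    define R where "R = max R0 r"
    have i: "integrable lborel (\<lambda>y. dfun \<theta> y * G y)"
      by (intro integrable_cpt_supp continuous_intros smooth_continuous test_smooth test_dfun t\<theta> G)
         (rule cpt_supp_mono[OF test_cpt_supp[OF test_dfun[OF t\<theta>]]], simp)
    have "dfun \<theta> y * G y = (if y \<in> {0..R} then dfun \<theta> y * N y else 0)" for y
    proof (cases "y \<in> {0..R}")
      case True
      then show ?thesis by (simp add: G_def)
    next
      case False
      then have "y < 0 \<or> y > r" by (auto simp: R_def)
      then show ?thesis using r[of y] G0[of y] False by (cases "dfun \<theta> y = 0") auto
    qed
    then have "(\<integral>y. dfun \<theta> y * G y \<partial>lborel) = integral {0..R} (\<lambda>t. dfun \<theta> t * N t)"
      using integral_lborel[OF i] integral_restrict_UNIV[of "{0..R}" "\<lambda>t. dfun \<theta> t * N t"] by simp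
    also have "\<dots> = 0" by (rule R0) (simp add: R_def)
    finally show ?thesis by (simp add: gcv_def d\<theta>)
  qed
  have "gcv times G \<psi> t = 0" if psi: "test_function \<psi>" for \<psi>
  proof -
    note bm = bounded_bilinear_mult[where 'a=real]
    have c: "gcv times G \<psi> x = gcv times \<psi> G x" for x
      using gcv_commute[OF bm loc_int_measurable[OF lG] test_measurable[OF psi], of x] by (simp only: gcv_def mult.commute)
    have D: "(gcv times \<psi> G has_derivative (\<lambda>h. 0)) (at x)" for x
    proof -
      have "frechet_derivative \<psi> (at z) h = h * dfun \<psi> z" for z h
        using linear_scale[OF has_derivative_linear[OF smooth_has_derivative[OF test_smooth[OF psi]]], of z h 1] by (simp add: dfun_def)
      then have "gcv times (\<lambda>z. frechet_derivative \<psi> (at z) h) G x = h * gcv times (dfun \<psi>) G x" for h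
        by (simp add: gcv_def mult.assoc)
      then show ?thesis
        using gcv_has_derivative[OF bm test_Ck[OF psi] test_cpt_supp[OF psi] lG, of x] z[OF psi] by simp
    qed
    obtain r where r: "\<And>y. \<psi> y \<noteq> 0 \<Longrightarrow> norm y \<le> r" using test_cpt_supp[OF psi] by (auto simp: cpt_supp_def)
    \<comment> \<open>For \<open>y > 0\<close> the point \<open>a - y\<close> lies left of the
      support of \<open>\<psi>\<close>, and for \<open>y \<le> 0\<close> the extension is
      zero.\<close>
    define a where "a = - \<bar>r\<bar> - 1"
    have "\<psi> (a - y) * G y = 0" for y
    proof (cases "y \<le> 0")
      case False
      then have "\<not> norm (a - y) \<le> r" by (simp add: a_def)
      then show ?thesis using r[of "a - y"] by auto
    qed (simp add: G0)
    then have "(\<lambda>y. \<psi> (a - y) * G y) = (\<lambda>y. 0)" by (rule ext)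
    then have "gcv times \<psi> G a = 0" unfolding gcv_def by (simp only: integral_zero)
    moreover have "gcv times \<psi> G t = gcv times \<psi> G a"
      using has_derivative_zero_unique[of UNIV "gcv times \<psi> G"] D by (metis UNIV_I convex_UNIV has_derivative_at_withinI)
    ultimately show ?thesis by (simp add: c)
  qed
  then have "G t = 0" by (rule continuous_eq_0_if_gcv[OF G])
  then show ?thesis using t by (simp add: G_def)
qed

section \<open>Passage from Lebesgue to Borel representatives\<close>

lemma borel_representative:
  fixes f :: "R3 \<Rightarrow> R3"
  assumes "f \<in> borel_measurable lebesgue"
  shows "\<exists>g. g \<in> borel_measurable borel \<and> (AE x in lborel. f x = g x)"
proof -
  have "\<exists>g\<in>borel_measurable lborel. AE x in lborel. f x $ i = g x" for i
  proof (rule completion_ex_borel_measurable_real)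
    have "(\<lambda>x. f x \<bullet> axis i 1) \<in> borel_measurable lebesgue"
      using assms by (intro borel_measurable_inner) auto
    then show "(\<lambda>x. f x $ i) \<in> borel_measurable lebesgue" by (simp add: inner_axis)
  qed
  then obtain g where g: "\<And>i. g i \<in> borel_measurable lborel" "\<And>i. AE x in lborel. f x $ i = g i x" by metis
  define h :: "R3 \<Rightarrow> R3" where "h x = (\<Sum>i\<in>UNIV. g i x *\<^sub>R axis i 1)" for x
  have hi: "h x $ i = g i x" for x i
    by (simp add: h_def axis_def if_distrib cong: if_cong)
  have "h \<in> borel_measurable borel" using g(1) unfolding h_def[abs_def] by measurable
  moreover have "AE x in lborel. \<forall>i. f x $ i = g i x"
    using g(2) by (simp add: AE_all_countable)
  then have "AE x in lborel. f x = h x"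
    by eventually_elim (simp add: vec_eq_iff hi)
  ultimately show ?thesis by blast
qed

lemma integral_lebesgue_lborel:
  fixes f h :: "R3 \<Rightarrow> 'b::euclidean_space"
  assumes "f \<in> borel_measurable lebesgue" "h \<in> borel_measurable borel" "AE x in lborel. f x = h x"
  shows "(LINT x|lebesgue. f x) = (\<integral>x. h x \<partial>lborel)" "integrable lebesgue f \<longleftrightarrow> integrable lborel h"
proof -
  have hb: "h \<in> borel_measurable lborel" and hl: "h \<in> borel_measurable lebesgue"
    using assms(2) by (auto intro: measurable_completion)
  have ae: "AE x in lebesgue. f x = h x" by (rule AE_completion[OF assms(3)])
  show "(LINT x|lebesgue. f x) = (\<integral>x. h x \<partial>lborel)"
    using integral_cong_AE[OF assms(1) hl ae] integral_completion[OF hb] by simp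
  show "integrable lebesgue f \<longleftrightarrow> integrable lborel h"
    using integrable_cong_AE[OF assms(1) hl ae] integrable_completion[OF hb] by simp
qed

text \<open>Separated fields suffice because their time factor is an arbitrary test function, from
  which \<open>du_bois_reymond\<close> recovers the identity at every single time.\<close>

lemma spacetime_product:
  fixes g :: "R3 \<Rightarrow> R3"
  assumes th: "test_function \<theta>" and g: "test_function g"
  shows "spacetime_test_function (\<lambda>t x. \<theta> t *\<^sub>R g x)"
proof -
  have s1: "smooth (\<lambda>z::real \<times> R3. \<theta> (fst z))"
    using test_Ck[OF th] unfolding smooth_def
    by (intro allI Ck_compose_linear[OF bounded_linear_fst]) (auto simp: Basis_prod_def)
  have s2: "smooth (\<lambda>z::real \<times> R3. g (snd z))"
    using test_Ck[OF g] unfolding smooth_def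
    by (intro allI Ck_compose_linear[OF bounded_linear_snd]) (auto simp: Basis_prod_def)
  obtain r s where r: "\<And>x. \<theta> x \<noteq> 0 \<Longrightarrow> norm x \<le> r" and s: "\<And>x. g x \<noteq> 0 \<Longrightarrow> norm x \<le> s"
    using test_cpt_supp[OF th] test_cpt_supp[OF g] by (auto simp: cpt_supp_def)
  have "norm z \<le> r + s" if "\<theta> (fst z) *\<^sub>R g (snd z) \<noteq> 0" for z
  proof -
    have "norm (fst z, snd z) \<le> norm (fst z) + norm (snd z)" by (rule norm_Pair_le)
    then show ?thesis using r[of "fst z"] s[of "snd z"] that by auto
  qed
  then have "cpt_supp (\<lambda>z. \<theta> (fst z) *\<^sub>R g (snd z))" unfolding cpt_supp_def by blast
  then show ?thesis
    unfolding spacetime_test_function_def test_function_iff case_prod_beta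
    using smooth_scaleR[OF s1 s2] by simp
qed

lemma set_integral_eq_HK:
  fixes F :: "real \<Rightarrow> real"
  assumes F: "continuous_on {0..} F" "\<And>t. t > R \<Longrightarrow> F t = 0"
  shows "(LINT t:{0..}|lebesgue. F t) = integral {0..R} F"
proof -
  have "set_integrable lebesgue {0..R} F"
    by (intro absolutely_integrable_continuous_real continuous_on_subset[OF F(1)]) auto
  moreover have "(LINT t:{0..}|lebesgue. F t) = (LINT t:{0..R}|lebesgue. F t)"
    unfolding set_lebesgue_integral_def
    by (rule Bochner_Integration.integral_cong) (use F(2) in \<open>auto simp: indicator_def not_le\<close>)
  ultimately show ?thesis by (simp add: set_lebesgue_integral_eq_integral(2))
qed

lemma ip_lipschitz:
  assumes "sqint w" "sqint w'" "sqint g"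
  shows "\<bar>ip w g - ip w' g\<bar> \<le> nrm g * nrm (\<lambda>x. w x - w' x)"
  using ip_le[OF sqint_diff(1)[OF assms(1,2)] assms(3)] ip_diff_left[OF assms] by (simp add: mult.commute)

lemma continuous_on_Ici:
  fixes f :: "real \<Rightarrow> real"
  assumes "\<And>b. continuous_on {0..b} f"
  shows "continuous_on {0..} f"
  unfolding continuous_on_iff
proof (intro ballI allI impI)
  fix x e :: real assume x: "x \<in> {0..}" and e: "e > 0"
  obtain d where d: "d > 0" "\<And>y. y \<in> {0..x + 1} \<Longrightarrow> dist y x < d \<Longrightarrow> dist (f y) (f x) < e"
    using assms[of "x + 1"] x e unfolding continuous_on_iff by (metis atLeastAtMost_iff atLeast_iff le_add_same_cancel1 zero_le_one)
  show "\<exists>d>0. \<forall>x'\<in>{0..}. dist x' x < d \<longrightarrow> dist (f x') (f x) < e"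
    using d by (intro exI[of _ "min d 1"]) (auto simp: dist_real_def)
qed

lemma scaleR_has_vector_derivative:
  assumes "(\<theta> has_real_derivative d) (at s)"
  shows "((\<lambda>\<sigma>. \<theta> \<sigma> *\<^sub>R c) has_vector_derivative d *\<^sub>R c) (at s)"
proof -
  have "((\<lambda>\<sigma>. \<theta> \<sigma> *\<^sub>R c) has_derivative (\<lambda>h. (d * h) *\<^sub>R c)) (at s)"
    using has_derivative_scaleR_left[of \<theta> "\<lambda>h. d * h" "at s" c] assms by (simp add: has_field_derivative_def)
  then show ?thesis by (simp add: has_vector_derivative_def mult.commute)
qed

text \<open>The term with \<open>\<theta> t * r t\<close> is integrated by parts against the
  primitive of \<open>r\<close>, and the initial term equals minus \<open>m 0\<close> times the
  integral of \<open>dfun \<theta>\<close>, since \<open>\<theta> R = 0\<close>. Everything then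
  stands against \<open>dfun \<theta>\<close>.\<close>

lemma integral_theta_parts:
  fixes \<theta> r m :: "real \<Rightarrow> real"
  assumes th: "test_function \<theta>" and r: "continuous_on {0..} r" and m: "continuous_on {0..} m"
    and R: "R \<ge> 0" "\<theta> R = 0"
    and W: "\<theta> 0 * m 0 + integral {0..R} (\<lambda>t. dfun \<theta> t * m t + \<theta> t * r t) = 0"
  shows "integral {0..R} (\<lambda>t. dfun \<theta> t * (m t - m 0 - integral {0..t} r)) = 0"
proof -
  have cr: "continuous_on {0..R} r" and cm: "continuous_on {0..R} m"
    by (auto intro: continuous_on_subset[OF r] continuous_on_subset[OF m])
  have c\<theta>: "continuous_on {0..R} \<theta>" "continuous_on {0..R} (dfun \<theta>)"
    by (intro smooth_continuous test_smooth test_dfun th)+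
  define P where "P t = integral {0..t} r" for t
  have DP: "(P has_vector_derivative r t) (at t within {0..R})" if "t \<in> {0..R}" for t
    unfolding P_def using integral_has_vector_derivative[OF cr that] .
  have D\<theta>: "(\<theta> has_vector_derivative dfun \<theta> t) (at t within {0..R})" for t
    using has_vector_derivative_at_within[OF smooth_has_real_derivative[OF test_smooth[OF th], unfolded has_real_derivative_iff_has_vector_derivative]] .
  have I1: "(dfun \<theta> has_integral \<theta> R - \<theta> 0) {0..R}"
    by (rule fundamental_theorem_of_calculus[OF R(1)]) (rule D\<theta>)
  have I2: "((\<lambda>t. \<theta> t * r t + dfun \<theta> t * P t) has_integral \<theta> R * P R - \<theta> 0 * P 0) {0..R}"
    by (rule fundamental_theorem_of_calculus[OF R(1)]) (rule has_vector_derivative_mult[OF D\<theta> DP])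
  have "(\<lambda>t. dfun \<theta> t * m t + \<theta> t * r t) integrable_on {0..R}"
    by (intro integrable_continuous_real continuous_intros c\<theta> cm cr)
  then have I3: "((\<lambda>t. dfun \<theta> t * m t + \<theta> t * r t) has_integral - (\<theta> 0 * m 0)) {0..R}"
    using integrable_integral[of "\<lambda>t. dfun \<theta> t * m t + \<theta> t * r t" "{0..R}"] minus_unique[OF W] by simp
  have "((\<lambda>t. (dfun \<theta> t * m t + \<theta> t * r t) - m 0 * dfun \<theta> t - (\<theta> t * r t + dfun \<theta> t * P t))
     has_integral (- (\<theta> 0 * m 0) - m 0 * (\<theta> R - \<theta> 0) - (\<theta> R * P R - \<theta> 0 * P 0))) {0..R}"
    by (rule has_integral_diff[OF has_integral_diff[OF I3 has_integral_mult_right[OF I1]] I2])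
  moreover have "P 0 = 0" by (simp add: P_def)
  ultimately have "((\<lambda>t. (dfun \<theta> t * m t + \<theta> t * r t) - m 0 * dfun \<theta> t - (\<theta> t * r t + dfun \<theta> t * P t)) has_integral 0) {0..R}"
    using R(2) by (simp add: mult.commute)
  moreover have "(\<lambda>t. (dfun \<theta> t * m t + \<theta> t * r t) - m 0 * dfun \<theta> t - (\<theta> t * r t + dfun \<theta> t * P t)) = (\<lambda>t. dfun \<theta> t * (m t - m 0 - integral {0..t} r))"
    by (simp add: fun_eq_iff P_def algebra_simps)
  ultimately show ?thesis by (simp add: integral_unique)
qed

text \<open>The convolution integral does not see null sets, so the mollifications agree at every
  point and not just almost everywhere.\<close>

lemma mollify_eq_mol:
  assumes e: "\<epsilon> > 0" and f: "f \<in> borel_measurable lebesgue" and g: "sqint g" and ae: "AE x in lborel. f x = g x"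
  shows "mollify \<epsilon> f = mol \<epsilon> g"
proof
  fix x
  have [measurable]: "mollifier_eps \<epsilon> \<in> borel_measurable borel" by (rule test_measurable[OF test_mollifier_eps[OF e]])
  have km: "(\<lambda>y. mollifier_eps \<epsilon> (x - y)) \<in> borel_measurable borel" by (rule borel_measurable_compose_diff) measurable
  then have km': "(\<lambda>y. mollifier_eps \<epsilon> (x - y)) \<in> borel_measurable lebesgue"
    by (simp add: measurable_completion)
  have "mollify \<epsilon> f x = (\<integral>y. mollifier_eps \<epsilon> (x - y) *\<^sub>R g y \<partial>lborel)"
    unfolding mollify_def
  proof (rule integral_lebesgue_lborel(1))
    show "(\<lambda>y. mollifier_eps \<epsilon> (x - y) *\<^sub>R f y) \<in> borel_measurable lebesgue"
      by (intro borel_measurable_scaleR km' f)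
    show "(\<lambda>y. mollifier_eps \<epsilon> (x - y) *\<^sub>R g y) \<in> borel_measurable borel"
      by (intro borel_measurable_scaleR km sqint_measurable[OF g])
    show "AE y in lborel. mollifier_eps \<epsilon> (x - y) *\<^sub>R f y = mollifier_eps \<epsilon> (x - y) *\<^sub>R g y"
      using ae by eventually_elim simp
  qed
  then show "mollify \<epsilon> f x = mol \<epsilon> g x" by (simp add: mol_def gcv_def)
qed

lemma inner_integral_eq:
  assumes f: "f \<in> borel_measurable lebesgue" and g: "g \<in> borel_measurable borel" and ae: "AE x in lborel. f x = g x"
    and h: "h \<in> borel_measurable borel"
  shows "(LINT x|lebesgue. (f x :: R3) \<bullet> h x) = ip g h"
  unfolding ip_def
proof (rule integral_lebesgue_lborel(1))
  have "h \<in> borel_measurable lebesgue" using h by (simp add: measurable_completion)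
  then show "(\<lambda>x. f x \<bullet> h x) \<in> borel_measurable lebesgue" by (intro borel_measurable_inner f)
  show "(\<lambda>x. g x \<bullet> h x) \<in> borel_measurable borel" by (intro borel_measurable_inner g h)
  show "AE x in lborel. f x \<bullet> h x = g x \<bullet> h x" using ae by eventually_elim simp
qed

text \<open>A Borel representative is chosen for each time separately. Joint measurability in time
  and space does not come into play, because the velocity enters through inner integrals that are
  continuous in time.\<close>

lemma strong_solution_flow:
  assumes e: "\<epsilon> > 0" and sol: "strong_solution \<epsilon> u"
    and u0: "in_L2 u0" "weakly_div_free u0" "AE x in lebesgue. u 0 x = u0 x"
  shows "\<exists>v. flow v \<epsilon> \<and> (\<forall>t\<ge>0. AE x in lborel. u t x = v t x)"
proof -
  obtain p where W: "\<And>f. spacetime_test_function f \<Longrightarrow> weak_equation \<epsilon> u p f"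
    using sol unfolding strong_solution_def by blast
  have div: "\<And>t. t > 0 \<Longrightarrow> weakly_div_free (u t)" and cont: "continuous_L2 u"
    using sol unfolding strong_solution_def by auto
  have um: "u t \<in> borel_measurable lebesgue" and ui: "integrable lebesgue (\<lambda>x. (norm (u t x))\<^sup>2)" if "t \<ge> 0" for t
    using cont that unfolding continuous_L2_def in_L2_def by auto
  have "\<forall>t. \<exists>g. t \<ge> 0 \<longrightarrow> g \<in> borel_measurable borel \<and> (AE x in lborel. u t x = g x)"
    using borel_representative[OF um] by blast
  then obtain v where v: "\<And>t. t \<ge> 0 \<Longrightarrow> v t \<in> borel_measurable borel" "\<And>t. t \<ge> 0 \<Longrightarrow> AE x in lborel. u t x = v t x"
    by metis
  have sq: "sqint (v t)" if t: "t \<ge> 0" for t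
  proof -
    have "integrable lebesgue (\<lambda>x. (norm (u t x))\<^sup>2) \<longleftrightarrow> integrable lborel (\<lambda>x. (norm (v t x))\<^sup>2)"
    proof (rule integral_lebesgue_lborel(2))
      show "(\<lambda>x. (norm (u t x))\<^sup>2) \<in> borel_measurable lebesgue" using um[OF t] by measurable
      show "(\<lambda>x. (norm (v t x))\<^sup>2) \<in> borel_measurable borel" using v(1)[OF t] by measurable
      show "AE x in lborel. (norm (u t x))\<^sup>2 = (norm (v t x))\<^sup>2" using v(2)[OF t] by eventually_elim simp
    qed
    then show ?thesis using ui[OF t] v(1)[OF t] by (simp add: sqint_def)
  qed
  have nd: "L2_norm (\<lambda>x. u s x - u t x) = nrm (\<lambda>x. v s x - v t x)" if st: "s \<ge> 0" "t \<ge> 0" for s t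
  proof -
    have "(LINT x|lebesgue. (norm (u s x - u t x))\<^sup>2) = (\<integral>x. (norm (v s x - v t x))\<^sup>2 \<partial>lborel)"
    proof (rule integral_lebesgue_lborel(1))
      show "(\<lambda>x. (norm (u s x - u t x))\<^sup>2) \<in> borel_measurable lebesgue" using um[OF st(1)] um[OF st(2)] by measurable
      show "(\<lambda>x. (norm (v s x - v t x))\<^sup>2) \<in> borel_measurable borel" using v(1)[OF st(1)] v(1)[OF st(2)] by measurable
      show "AE x in lborel. (norm (u s x - u t x))\<^sup>2 = (norm (v s x - v t x))\<^sup>2"
        using v(2)[OF st(1)] v(2)[OF st(2)] by eventually_elim simp
    qed
    then show ?thesis by (simp add: L2_norm_def nrm_def)
  qed
  interpret l2_curve v \<epsilon>
  proof
    show "\<epsilon> > 0" by (rule e)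
    show "sqint (v t)" if "t \<ge> 0" for t by (rule sq[OF that])
    fix t :: real assume t: "t \<ge> 0"
    have "((\<lambda>s. L2_norm (\<lambda>x. u s x - u t x)) \<longlongrightarrow> 0) (at t within {0..})"
      using cont t unfolding continuous_L2_def by auto
    then show "((\<lambda>s. nrm (\<lambda>x. v s x - v t x)) \<longlongrightarrow> 0) (at t within {0..})"
      by (rule Lim_transform_eventually) (auto simp: eventually_at_filter nd t)
  qed
  have u0m: "u0 \<in> borel_measurable lebesgue" using u0(1) by (simp add: in_L2_def)
  have u0v: "AE x in lborel. u0 x = v 0 x"
  proof -
    have "AE x in lborel. u 0 x = u0 x" using u0(3) by (simp add: AE_completion_iff)
    with v(2)[of 0] show ?thesis by (auto elim: eventually_elim2)
  qed
  \<comment> \<open>Incompressibility at time 0 is inherited from \<open>u0\<close>; the notion of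
    solution grants it for positive times.\<close>
  have vdiv: "ip (v t) (grad g) = 0" if t: "t \<ge> 0" and g: "test_function g" for t g
  proof (cases "t = 0")
    case True
    then show ?thesis
      using u0(2) g inner_integral_eq[OF u0m v(1)[of 0] u0v test_measurable[OF test_grad[OF g]]]
      by (simp add: weakly_div_free_def)
  next
    case False
    then show ?thesis
      using div[of t] t g inner_integral_eq[OF um[OF t] v(1)[OF t] v(2)[OF t] test_measurable[OF test_grad[OF g]]]
      by (simp add: weakly_div_free_def)
  qed
  have vweak: "ip (v T) g = ip (v 0) g + integral {0..T} (\<lambda>\<tau>. rhs \<epsilon> (v \<tau>) g)"
    if T: "T \<ge> 0" and g: "test_function g" and dg: "\<And>x. divergence g x = 0" for T g
  proof -
    have sg: "smooth g" by (rule test_smooth[OF g])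
    define m where "m t = ip (v t) g" for t
    define a where "a t = ip (v t) (laplacian g)" for t
    \<comment> \<open>\<open>r t - a t\<close> is the convective part, which the weak equation has
      on its right-hand side.\<close>
    define r where "r t = rhs \<epsilon> (v t) g" for t
    have ipc: "continuous_on {0..} (\<lambda>t. ip (v t) h)" if h: "sqint h" for h
    proof (rule functional_continuous)
      fix w w' :: "R3 \<Rightarrow> R3" assume w: "sqint w" "sqint w'"
      have "nrm h * nrm (\<lambda>x. w x - w' x) \<le> nrm h * (1 + nrm w + nrm w') * nrm (\<lambda>x. w x - w' x)"
        using mult_left_mono[of 1 "1 + nrm w + nrm w'" "nrm h"] nrm_nonneg[of h] nrm_nonneg[of w] nrm_nonneg[of w']
        by (intro mult_right_mono nrm_nonneg) simp
      then show "\<bar>ip w h - ip w' h\<bar> \<le> nrm h * (1 + nrm w + nrm w') * nrm (\<lambda>x. w x - w' x)"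
        using ip_lipschitz[OF w h] by linarith
    qed
    have mc: "continuous_on {0..} m" and ac: "continuous_on {0..} a" and rc: "continuous_on {0..} r"
      unfolding m_def a_def r_def by (intro ipc test_sqint test_laplacian g rhs_continuous)+
    define N where "N t = m t - m 0 - integral {0..t} r" for t
    have "continuous_on {0..} (\<lambda>t. integral {0..t} r)"
      by (intro continuous_on_Ici indefinite_integral_continuous_1 integrable_continuous_real continuous_on_subset[OF rc]) auto
    then have Nc: "continuous_on {0..} N"
      unfolding N_def by (intro continuous_intros mc)
    have "N T = 0"
    proof (rule du_bois_reymond[OF Nc _ _ T])
      show "N 0 = 0" by (simp add: N_def)
      fix \<theta> :: "real \<Rightarrow> real" assume th: "test_function \<theta>"
      have sth: "smooth \<theta>" by (rule test_smooth[OF th])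
      have \<theta>c: "continuous_on {0..} \<theta>" "continuous_on {0..} (dfun \<theta>)"
        by (intro smooth_continuous sth test_smooth test_dfun th)+
      obtain r1 r2 where r12: "\<And>x. \<theta> x \<noteq> 0 \<Longrightarrow> norm x \<le> r1" "\<And>x. dfun \<theta> x \<noteq> 0 \<Longrightarrow> norm x \<le> r2"
        using test_cpt_supp[OF th] test_cpt_supp[OF test_dfun[OF th]] by (auto simp: cpt_supp_def)
      \<comment> \<open>From \<open>R0\<close> on both \<open>\<theta>\<close> and its derivative
        are zero, so integrals over \<open>{0..}\<close> reduce to \<open>{0..R}\<close>.\<close>
      define R0 where "R0 = max (max r1 r2) 0 + 1"
      have z: "\<theta> t = 0" "dfun \<theta> t = 0" if "t \<ge> R0" for t
        using r12[of t] that unfolding R0_def by fastforce+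
      have "integral {0..R} (\<lambda>t. dfun \<theta> t * N t) = 0" if R: "R \<ge> R0" for R
        unfolding N_def
      proof (rule integral_theta_parts[OF th rc mc])
        show "R \<ge> 0" using R by (simp add: R0_def)
        show "\<theta> R = 0" by (rule z(1)[OF R])
        define f where "f t x = \<theta> t *\<^sub>R g x" for t x
        have "weak_equation \<epsilon> u p f"
          unfolding f_def[abs_def] by (rule W[OF spacetime_product[OF th g]])
        moreover have "(LINT x|lebesgue. u 0 x \<bullet> f 0 x) = \<theta> 0 * m 0"
          using inner_integral_eq[OF um[of 0] v(1)[of 0] v(2)[of 0] test_measurable[OF g]]
          by (simp add: f_def m_def)
        moreover have "(LINT t:{0..}|lebesgue. LINT x|lebesgue.
            u t x \<bullet> (vector_derivative (\<lambda>s. f s x) (at t) + laplacian (f t) x) + p t x * divergence (f t) x)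
          = (LINT t:{0..}|lebesgue. dfun \<theta> t * m t + \<theta> t * a t)"
        proof (rule set_lebesgue_integral_cong, simp, intro allI impI)
          fix t :: real assume "t \<in> {0..}"
          then have t: "t \<ge> 0" by simp
          have 1: "vector_derivative (\<lambda>s. f s x) (at t) = dfun \<theta> t *\<^sub>R g x" for x
            unfolding f_def by (rule vector_derivative_at[OF scaleR_has_vector_derivative[OF smooth_has_real_derivative[OF sth]]])
          have 2: "laplacian (f t) x = \<theta> t *\<^sub>R laplacian g x" for x
            unfolding f_def[abs_def] by (simp add: laplacian_scaleR[OF sg])
          \<comment> \<open>This multiplies the pressure by zero at every point, whatever its values
            are.\<close>
          have 3: "divergence (f t) x = 0" for x
            using dg[of x] unfolding f_def[abs_def] divergence_def by (simp add: partial_scaleR[OF sg] flip: sum_distrib_left)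
          have hm: "(\<lambda>x. dfun \<theta> t *\<^sub>R g x + \<theta> t *\<^sub>R laplacian g x) \<in> borel_measurable borel"
            using test_measurable[OF g] test_measurable[OF test_laplacian[OF g]] by measurable
          have "(LINT x|lebesgue. u t x \<bullet> (vector_derivative (\<lambda>s. f s x) (at t) + laplacian (f t) x) + p t x * divergence (f t) x)
            = ip (v t) (\<lambda>x. dfun \<theta> t *\<^sub>R g x + \<theta> t *\<^sub>R laplacian g x)"
            unfolding 1 2 3 using inner_integral_eq[OF um[OF t] v(1)[OF t] v(2)[OF t] hm] by simp
          also have "\<dots> = dfun \<theta> t * m t + \<theta> t * a t"
            using ip_add_right[OF sq[OF t], of "\<lambda>x. dfun \<theta> t *\<^sub>R g x" "\<lambda>x. \<theta> t *\<^sub>R laplacian g x"]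
            by (simp add: ip_scaleR_right m_def a_def sqint_scaleR(1) test_sqint test_laplacian g)
          finally show "(LINT x|lebesgue. u t x \<bullet> (vector_derivative (\<lambda>s. f s x) (at t) + laplacian (f t) x) + p t x * divergence (f t) x)
            = dfun \<theta> t * m t + \<theta> t * a t" .
        qed
        moreover have "(LINT t:{0..}|lebesgue. LINT x|lebesgue. u t x \<bullet> advect (mollify \<epsilon> (u t)) (f t) x)
          = (LINT t:{0..}|lebesgue. \<theta> t * (r t - a t))"
        proof (rule set_lebesgue_integral_cong, simp, intro allI impI)
          fix t :: real assume "t \<in> {0..}"
          then have t: "t \<ge> 0" by simp
          have am: "advect (mol \<epsilon> (v t)) g \<in> borel_measurable borel"
            by (rule advect_measurable[OF mol_measurable[OF e sq[OF t]] sg])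
          have "advect (mollify \<epsilon> (u t)) (f t) = (\<lambda>x. \<theta> t *\<^sub>R advect (mol \<epsilon> (v t)) g x)"
            unfolding mollify_eq_mol[OF e um[OF t] sq[OF t] v(2)[OF t]] f_def[abs_def] by (rule advect_scaleR[OF sg])
          then show "(LINT x|lebesgue. u t x \<bullet> advect (mollify \<epsilon> (u t)) (f t) x) = \<theta> t * (r t - a t)"
            using inner_integral_eq[OF um[OF t] v(1)[OF t] v(2)[OF t] am]
            by (simp add: r_def rhs_def a_def)
        qed
        ultimately have eq: "\<theta> 0 * m 0 + (LINT t:{0..}|lebesgue. dfun \<theta> t * m t + \<theta> t * a t) = - (LINT t:{0..}|lebesgue. \<theta> t * (r t - a t))"
          unfolding weak_equation_def by simp
        have "(LINT t:{0..}|lebesgue. dfun \<theta> t * m t + \<theta> t * a t) = integral {0..R} (\<lambda>t. dfun \<theta> t * m t + \<theta> t * a t)"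
          using z R by (intro set_integral_eq_HK continuous_intros \<theta>c mc ac) auto
        moreover have "(LINT t:{0..}|lebesgue. \<theta> t * (r t - a t)) = integral {0..R} (\<lambda>t. \<theta> t * (r t - a t))"
          using z R by (intro set_integral_eq_HK continuous_intros \<theta>c rc ac) auto
        moreover have "integral {0..R} (\<lambda>t. dfun \<theta> t * m t + \<theta> t * a t) + integral {0..R} (\<lambda>t. \<theta> t * (r t - a t))
          = integral {0..R} (\<lambda>t. dfun \<theta> t * m t + \<theta> t * r t)"
        proof (subst Henstock_Kurzweil_Integration.integral_add[symmetric])
          show "(\<lambda>t. dfun \<theta> t * m t + \<theta> t * a t) integrable_on {0..R}" "(\<lambda>t. \<theta> t * (r t - a t)) integrable_on {0..R}"
            by (intro integrable_continuous_real continuous_intros continuous_on_subset[OF \<theta>c(1)] continuous_on_subset[OF \<theta>c(2)]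
                continuous_on_subset[OF mc] continuous_on_subset[OF ac] continuous_on_subset[OF rc]; auto)+
        qed (simp add: algebra_simps)
        ultimately show "\<theta> 0 * m 0 + integral {0..R} (\<lambda>t. dfun \<theta> t * m t + \<theta> t * r t) = 0"
          using eq by linarith
      qed
      then show "\<exists>R0. \<forall>R\<ge>R0. integral {0..R} (\<lambda>t. dfun \<theta> t * N t) = 0" by blast
    qed
    then show ?thesis by (simp add: N_def m_def r_def[abs_def])
  qed
  have "flow v \<epsilon>"
  proof
    show "ip (v t) (grad g) = 0" if "t \<ge> 0" "test_function g" for t and g :: "R3 \<Rightarrow> real"
      by (rule vdiv[OF that])
    show "ip (v t) g = ip (v 0) g + integral {0..t} (\<lambda>s. rhs \<epsilon> (v s) g)"
      if "t \<ge> 0" "test_function g" "\<And>x. divergence g x = 0" for t g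
      by (rule vweak[OF that])
  qed
  then show ?thesis using v(2) by blast
qed

theorem lemma4p3:
  shows "\<exists>C::real. C > 0 \<and>
    (\<forall>(u0 :: R3 \<Rightarrow> R3) (\<epsilon>::real) (R1::real) (R2::real) (u :: real \<Rightarrow> R3 \<Rightarrow> R3) (t::real).
       in_H1 u0 \<and> in_Linf u0 \<and> weakly_div_free u0 \<and>
       \<epsilon> > 0 \<and> 0 < R1 \<and> R1 < R2 \<and>
       strong_solution \<epsilon> u \<and> (AE x in lebesgue. u 0 x = u0 x) \<and> t \<ge> 0 \<longrightarrow>
       (LINT x:{x. norm x > R2}|lebesgue. (norm (u t x))\<^sup>2)
       \<le> (LINT x:{x. norm x > R1}|lebesgue. (norm (u0 x))\<^sup>2)
         + (C * (L2_norm u0)\<^sup>2 * sqrt t + C * (L2_norm u0) ^ 3 * t powr (1/4)) / (R2 - R1))"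
proof (intro exI[of _ 80] conjI allI impI)
  fix u0 :: "R3 \<Rightarrow> R3" and \<epsilon> R1 R2 t :: real and u :: "real \<Rightarrow> R3 \<Rightarrow> R3"
  assume H: "in_H1 u0 \<and> in_Linf u0 \<and> weakly_div_free u0 \<and> \<epsilon> > 0 \<and> 0 < R1 \<and> R1 < R2 \<and>
       strong_solution \<epsilon> u \<and> (AE x in lebesgue. u 0 x = u0 x) \<and> t \<ge> 0"
  then have u0: "in_L2 u0" and t: "t \<ge> 0" and R: "R1 < R2" by (auto simp: in_H1_def)
  obtain v where v: "flow v \<epsilon>" "\<And>t. t \<ge> 0 \<Longrightarrow> AE x in lborel. u t x = v t x"
    using strong_solution_flow[of \<epsilon> u u0] H u0 by blast
  have sq: "sqint (v t)" if "t \<ge> 0" for t using flow.axioms(1)[OF v(1)] l2_curve.usq that by blast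
  have um: "u t \<in> borel_measurable lebesgue" if "t \<ge> 0" for t
    using H that unfolding strong_solution_def continuous_L2_def in_L2_def by blast
  have u0m: "u0 \<in> borel_measurable lebesgue" using u0 by (simp add: in_L2_def)
  have "AE x in lborel. u 0 x = u0 x" using H by (simp add: AE_completion_iff)
  then have u0v: "AE x in lborel. u0 x = v 0 x"
    using v(2)[of 0] by (auto elim: eventually_elim2)
  \<comment> \<open>Carries the exterior integrals of the given representatives over to the Borel
    setting in which \<open>exterior_energy\<close> holds.\<close>
  have ext: "(LINT x:{x. norm x > r}|lebesgue. (norm (f x))\<^sup>2) = (\<integral>x. indicat_real {x. norm x > r} x * (norm (g x))\<^sup>2 \<partial>lborel)"
    if f: "f \<in> borel_measurable lebesgue" and g: "sqint g" and ae: "AE x in lborel. f x = g x" for r and f g :: "R3 \<Rightarrow> R3"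
    unfolding set_lebesgue_integral_def real_scaleR_def
  proof (rule integral_lebesgue_lborel(1))
    have o: "{x::R3. norm x > r} \<in> sets borel" by (intro borel_open open_Collect_less continuous_intros)
    then have "{x::R3. norm x > r} \<in> sets lebesgue" by simp
    then show "(\<lambda>x. indicat_real {x. norm x > r} x * (norm (f x))\<^sup>2) \<in> borel_measurable lebesgue"
      using measurable_compose[OF f borel_measurable_norm] by (intro borel_measurable_times borel_measurable_indicator borel_measurable_power)
    show "(\<lambda>x. indicat_real {x. norm x > r} x * (norm (g x))\<^sup>2) \<in> borel_measurable borel"
      using measurable_compose[OF sqint_measurable[OF g] borel_measurable_norm] o
      by (intro borel_measurable_times borel_measurable_indicator borel_measurable_power)
    show "AE x in lborel. indicat_real {x. norm x > r} x * (norm (f x))\<^sup>2 = indicat_real {x. norm x > r} x * (norm (g x))\<^sup>2"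
      using ae by eventually_elim simp
  qed
  have "L2_norm u0 = nrm (v 0)"
  proof -
    have "(LINT x|lebesgue. (norm (u0 x))\<^sup>2) = (\<integral>x. (norm (v 0 x))\<^sup>2 \<partial>lborel)"
    proof (rule integral_lebesgue_lborel(1))
      show "(\<lambda>x. (norm (u0 x))\<^sup>2) \<in> borel_measurable lebesgue" using u0m by measurable
      show "(\<lambda>x. (norm (v 0 x))\<^sup>2) \<in> borel_measurable borel" using sqint_measurable[OF sq[of 0]] by measurable
      show "AE x in lborel. (norm (u0 x))\<^sup>2 = (norm (v 0 x))\<^sup>2" using u0v by eventually_elim simp
    qed
    then show ?thesis by (simp add: L2_norm_def nrm_def)
  qed
  then show "(LINT x:{x. norm x > R2}|lebesgue. (norm (u t x))\<^sup>2)
       \<le> (LINT x:{x. norm x > R1}|lebesgue. (norm (u0 x))\<^sup>2)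
         + (80 * (L2_norm u0)\<^sup>2 * sqrt t + 80 * (L2_norm u0) ^ 3 * t powr (1/4)) / (R2 - R1)"
    using flow.exterior_energy[OF v(1) R t]
    unfolding ext[OF um[OF t] sq[OF t] v(2)[OF t]] ext[OF u0m sq[OF order_refl] u0v] by simp
qed simp

end
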